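(* Let $\Sigma\subset \mathbb{CH}^{n+1}$ be an $m$-dimensional submanifold that is minimal with respect to $g_{\mathbb{CH}}$. If $\Sigma$ is weakly $C^2$-asymptotically regular and weakly asymptotically horizontal, then $\Sigma$ is $C^1$-asymptotically regular and strongly asymptotically horizontal.
   Context: Identify $\mathbb R^{2n+2}$ with $\mathbb C^{n+1}$ via $z_j=x_j+iy_j$. Let $g_{\mathbb R}$ be the Euclidean metric, $J_{\mathbb R}$ the complex structure with $J_{\mathbb R}(\partial_{x_j})=-\partial_{y_j}$, $J_{\mathbb R}(\partial_{y_j})=\partial_{x_j}$, $r=|z|$, $\mathbf X=\sum_j(x_j\partial_{x_j}+y_j\partial_{y_j})$ the position vector field and $\mathbf T=-J_{\mathbb R}(\mathbf X)=\sum_j(x_j\partial_{y_j}-y_j\partial_{x_j})$. On $\mathbb R^{2n+2}\setminus\{0\}$ let $\theta=r^{-2}\sum_j(x_j\,dy_j-y_j\,dx_j)$ (so $\theta(V)=r^{-2}g_{\mathbb R}(V,\mathbf T)$). Let $\mathbb B^{2n+2}$ be the open unit ball, $\mathbb S^{2n+1}$ its boundary, $\hat\theta$ the pullback of $\theta$ to $\mathbb S^{2n+1}$, and $\mathcal H_q=\ker\hat\theta_q\subset T_q\mathbb S^{2n+1}$. A submanifold $\Gamma\subset\mathbb S^{2n+1}$ is horizontal if $T_q\Gamma\subset\mathcal H_q$ for all $q\in\Gamma$. $\mathbb{CH}^{n+1}$ is complex hyperbolic space: the complete simply connected Kähler manifold of real dimension $2n+2$ with constant holomorphic sectional curvature,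 normalized so that its sectional curvatures lie in $[-4,-1]$; its metric is $g_{\mathbb{CH}}$. The Bergman model is $\mathbb B^{2n+2}$ with metric $g_B=\frac{1}{1-r^2}\sum_j dz_j d\bar z_j+\frac{1}{(1-r^2)^2}\sum_{j,k}z_j\bar z_k\,dz_k d\bar z_j$ and complex structure $J_{\mathbb R}$. For $p\in\mathbb{CH}^{n+1}$, a Bergman compactification is an isometric biholomorphism $\Upsilon_p:(\mathbb{CH}^{n+1},g_{\mathbb{CH}})\to(\mathbb B^{2n+2},g_B)$ with $\Upsilon_p(p)=\mathbf 0$. For a submanifold $\Sigma$, set $\Sigma_p=\overline{\Upsilon_p(\Sigma)}\subset\bar{\mathbb B}^{2n+2}$. Let $\mathcal S:\mathbb B^{2n+2}\to\mathbb B^{2n+2}$, $\mathcal S(z)=z/(1+\sqrt{1-|z|^2})$; it extends to a homeomorphism $\bar{\mathcal S}$ of $\bar{\mathbb B}^{2n+2}$ that is the identity on $\mathbb S^{2n+1}$. Set $\tilde\Sigma_p=\bar{\mathcal S}(\Sigma_p)$ (modified Bergman compactification). Definitions (for $l\ge1$; these are independent of the choice of $p$ and $\Upsilon_p$): $\Sigma$ is $C^l$-asymptotically regular if $\Sigma_p$ is a $C^l$ submanifold with boundary of $\bar{\mathbb B}^{2n+2}$ meeting $\partial\mathbb B^{2n+2}$ transversally; it is strongly asymptotically horizontal if moreover $\partial\Sigma_p$ is horizontal and $T_q\Sigma_p\subset\ker\theta_q$ (i.e. $T_q\Sigma_p$ is $g_{\mathbb R}$-orthogonal to $\mathbf T$)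 for all $q\in\partial\Sigma_p$. $\Sigma$ is weakly $C^l$-asymptotically regular if $\tilde\Sigma_p$ is a $C^l$ submanifold with boundary meeting $\partial\mathbb B^{2n+2}$ transversally; it is weakly asymptotically horizontal if moreover $\partial\tilde\Sigma_p$ is a horizontal submanifold of $\mathbb S^{2n+1}$. *)

theory Defs
  imports "HOL-Analysis.Analysis" "HOL-Library.Extended_Nat"
begin

text \<open>Ambient space: the Bergman ball model inside complex^'n, with CARD('n) = n+1.
  The Euclidean inner product on complex^'n is the real inner product g_R.\<close>

definition dirderiv :: "('a::real_normed_vector \<Rightarrow> 'b::real_normed_vector) \<Rightarrow> 'a \<Rightarrow> 'a \<Rightarrow> 'b" where
  "dirderiv f v x = vector_derivative (\<lambda>t::real. f (x + t *\<^sub>R v)) (at 0)"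

fun iderivs :: "'a::real_normed_vector list \<Rightarrow> ('a \<Rightarrow> 'b::real_normed_vector) \<Rightarrow> 'a \<Rightarrow> 'b" where
  "iderivs [] f = f"
| "iderivs (v # vs) f = dirderiv (iderivs vs f) v"

definition Ck_on :: "nat \<Rightarrow> ('a::euclidean_space \<Rightarrow> 'b::real_normed_vector) \<Rightarrow> 'a set \<Rightarrow> bool" where
  "Ck_on k f S \<longleftrightarrow> open S \<and>
     (\<forall>vs. set vs \<subseteq> Basis \<and> length vs \<le> k \<longrightarrow>
        continuous_on S (iderivs vs f) \<and>
        (length vs < k \<longrightarrow> (\<forall>x\<in>S. \<forall>v\<in>Basis.
            ((\<lambda>t. iderivs vs f (x + t *\<^sub>R v)) has_vector_derivative iderivs (v # vs) f x) (at 0))))"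

definition Cl_on :: "enat \<Rightarrow> ('a::euclidean_space \<Rightarrow> 'b::real_normed_vector) \<Rightarrow> 'a set \<Rightarrow> bool" where
  "Cl_on l f S \<longleftrightarrow> open S \<and> (\<forall>k. enat k \<le> l \<longrightarrow> Ck_on k f S)"

text \<open>A C^l adapted chart for S at q: a C^l diffeomorphism \<Phi> of an open U \<ni> q onto an open set,
  straightening S \<inter> U to a piece of the half space {y \<in> L. e \<bullet> y \<ge> 0} of an m-dimensional
  linear subspace L (e = 0 gives an interior chart).\<close>
definition adapted_chart :: "enat \<Rightarrow> nat \<Rightarrow> 'v::euclidean_space set \<Rightarrow> 'v \<Rightarrow> 'v set \<Rightarrow> ('v \<Rightarrow> 'v)
     \<Rightarrow> 'v set \<Rightarrow> 'v \<Rightarrow> bool" where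
  "adapted_chart l m S q U \<Phi> L e \<longleftrightarrow>
     open U \<and> q \<in> U \<and> inj_on \<Phi> U \<and> open (\<Phi> ` U) \<and>
     Cl_on l \<Phi> U \<and> Cl_on l (inv_into U \<Phi>) (\<Phi> ` U) \<and>
     subspace L \<and> dim L = m \<and> e \<in> L \<and>
     \<Phi> ` (S \<inter> U) = \<Phi> ` U \<inter> {y \<in> L. e \<bullet> y \<ge> 0}"

definition submfd_wb :: "enat \<Rightarrow> nat \<Rightarrow> 'v::euclidean_space set \<Rightarrow> bool" where
  "submfd_wb l m S \<longleftrightarrow> (\<forall>q\<in>S. \<exists>U \<Phi> L e. adapted_chart l m S q U \<Phi> L e)"

definition submfd :: "enat \<Rightarrow> nat \<Rightarrow> 'v::euclidean_space set \<Rightarrow> bool" where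
  "submfd l m S \<longleftrightarrow> (\<forall>q\<in>S. \<exists>U \<Phi> L. adapted_chart l m S q U \<Phi> L 0)"

definition mbdry :: "enat \<Rightarrow> nat \<Rightarrow> 'v::euclidean_space set \<Rightarrow> 'v set" where
  "mbdry l m S = {q\<in>S. \<exists>U \<Phi> L e. adapted_chart l m S q U \<Phi> L e \<and> e \<noteq> 0 \<and> e \<bullet> \<Phi> q = 0}"

definition tspace :: "enat \<Rightarrow> nat \<Rightarrow> 'v::euclidean_space set \<Rightarrow> 'v \<Rightarrow> 'v set" where
  "tspace l m S q = {v. \<exists>U \<Phi> L e. adapted_chart l m S q U \<Phi> L e \<and> frechet_derivative \<Phi> (at q) v \<in> L}"

definition bdry_tspace :: "enat \<Rightarrow> nat \<Rightarrow> 'v::euclidean_space set \<Rightarrow> 'v \<Rightarrow> 'v set" where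
  "bdry_tspace l m S q = {v. \<exists>U \<Phi> L e. adapted_chart l m S q U \<Phi> L e \<and> e \<noteq> 0 \<and> e \<bullet> \<Phi> q = 0 \<and>
       frechet_derivative \<Phi> (at q) v \<in> L \<and> e \<bullet> frechet_derivative \<Phi> (at q) v = 0}"

text \<open>T = -J_R(X) = i z.\<close>
definition Tfield :: "complex^'n \<Rightarrow> complex^'n" where
  "Tfield z = (\<chi> j. \<i> * z $ j)"

text \<open>H_q = ker of the pulled back theta in T_q S^{2n+1}.\<close>
definition Hdist :: "complex^'n \<Rightarrow> (complex^'n) set" where
  "Hdist q = {v. v \<bullet> q = 0 \<and> v \<bullet> Tfield q = 0}"

section \<open>Asymptotic regularity notions (Bergman model, p = 0, Upsilon = id)\<close>

definition regular_in_ball :: "enat \<Rightarrow> nat \<Rightarrow> (complex^'n) set \<Rightarrow> bool" where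
  "regular_in_ball l m S \<longleftrightarrow> S \<subseteq> cball 0 1 \<and> submfd_wb l m S \<and>
     mbdry l m S = S \<inter> sphere 0 1 \<and>
     (\<forall>q \<in> S \<inter> sphere 0 1. \<exists>v \<in> tspace l m S q. v \<bullet> q \<noteq> 0)"

definition horizontal_bdry :: "enat \<Rightarrow> nat \<Rightarrow> (complex^'n) set \<Rightarrow> bool" where
  "horizontal_bdry l m S \<longleftrightarrow> (\<forall>q \<in> mbdry l m S. bdry_tspace l m S q \<subseteq> Hdist q)"

definition Smod :: "complex^'n \<Rightarrow> complex^'n" where
  "Smod z = (1 / (1 + sqrt (1 - (norm z)\<^sup>2))) *\<^sub>R z"

definition asym_regular :: "enat \<Rightarrow> nat \<Rightarrow> (complex^'n) set \<Rightarrow> bool" where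
  "asym_regular l m \<Sigma> \<longleftrightarrow> regular_in_ball l m (closure \<Sigma>)"

definition strongly_asym_horizontal :: "enat \<Rightarrow> nat \<Rightarrow> (complex^'n) set \<Rightarrow> bool" where
  "strongly_asym_horizontal l m \<Sigma> \<longleftrightarrow> asym_regular l m \<Sigma> \<and>
     horizontal_bdry l m (closure \<Sigma>) \<and>
     (\<forall>q \<in> mbdry l m (closure \<Sigma>). \<forall>v \<in> tspace l m (closure \<Sigma>) q. v \<bullet> Tfield q = 0)"

definition weakly_asym_regular :: "enat \<Rightarrow> nat \<Rightarrow> (complex^'n) set \<Rightarrow> bool" where
  "weakly_asym_regular l m \<Sigma> \<longleftrightarrow> regular_in_ball l m (Smod ` closure \<Sigma>)"

definition weakly_asym_horizontal :: "enat \<Rightarrow> nat \<Rightarrow> (complex^'n) set \<Rightarrow> bool" where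
  "weakly_asym_horizontal l m \<Sigma> \<longleftrightarrow> weakly_asym_regular l m \<Sigma> \<and>
     horizontal_bdry l m (Smod ` closure \<Sigma>)"

definition cinner :: "complex^'n \<Rightarrow> complex^'n \<Rightarrow> complex" where
  "cinner u v = (\<Sum>j\<in>UNIV. u $ j * cnj (v $ j))"

text \<open>g_B at z, as a real bilinear form: the real part of the hermitian form
  h(u,v) = <u,v>/(1-r^2) + <u,z><z,v>/(1-r^2)^2.\<close>
definition gB :: "complex^'n \<Rightarrow> complex^'n \<Rightarrow> complex^'n \<Rightarrow> real" where
  "gB z u v = Re (cinner u v) / (1 - (norm z)\<^sup>2) + Re (cinner u z * cinner z v) / (1 - (norm z)\<^sup>2)\<^sup>2"

text \<open>Minimality w.r.t. g_B (stationarity of the g_B-area): for every smooth embedded local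
  parametrization F : W \<subseteq> R^m \<rightarrow> \<Sigma> and every smooth ambient vector field V with V \<circ> F
  supported in a compact K \<subseteq> W, the first variation of the g_B-area of F(K) vanishes.\<close>
definition bergman_minimal :: "'m::finite itself \<Rightarrow> (complex^'n) set \<Rightarrow> bool" where
  "bergman_minimal TYPE('m) \<Sigma> \<longleftrightarrow>
    (\<forall>(F :: real^'m \<Rightarrow> complex^'n) W K (V :: complex^'n \<Rightarrow> complex^'n).
       Cl_on \<infinity> F W \<and> inj_on F W \<and> F ` W \<subseteq> \<Sigma> \<and>
       (\<forall>w\<in>W. inj (frechet_derivative F (at w))) \<and>
       compact K \<and> K \<subseteq> W \<and> Cl_on \<infinity> V UNIV \<and> (\<forall>w\<in>W - K. V (F w) = 0)
       \<longrightarrow> ((\<lambda>t. integral K (\<lambda>w. sqrt (det (\<chi> i j.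
              gB (F w + t *\<^sub>R V (F w))
                 (dirderiv (\<lambda>x. F x + t *\<^sub>R V (F x)) (axis i 1) w)
                 (dirderiv (\<lambda>x. F x + t *\<^sub>R V (F x)) (axis j 1) w)))))
            has_real_derivative 0) (at 0))"

end

theory Submission
  imports Defs
begin

text \<open>Write \<open>z = proj w\<close> with \<open>w = Smod z\<close>; then \<open>rho w = sqrt (1 - |z|\<^sup>2)\<close> is a boundary defining function. Near
  a boundary point the modified compactification has a \<open>C\<^sup>2\<close> parametrization \<open>F\<close> whose coordinate \<open>y\<^sub>\<nu>\<close> is
  \<open>rho\<close>, and \<open>Z = proj \<circ> F\<close> parametrizes the closure of \<open>\<Sigma>\<close>. Minimality, tested against \<open>f K\<close> for a Killing
  field \<open>K\<close>, says that the tangential part of \<open>K\<close> is divergence free. Moreover a field \<open>A\<close> with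
  \<open>div A = u / y\<^sub>\<nu>\<close> such that \<open>A\<close> and \<open>u\<close> have limits at a boundary point has \<open>u \<rightarrow> 0\<close> there. Applied to the
  rotation \<open>K = iz\<close> this gives first \<open>Z\<^sub>\<nu> \<bottom> iz\<close> and then \<open>Z\<^sub>\<nu>\<^sub>\<nu> \<bottom> iz\<close> on the boundary; applied to the
  transvections \<open>K = b - \<langle>z, b\<rangle> z\<close> it gives \<open>Z\<^sub>\<nu> = 0\<close>. Hence \<open>Z\<close> is a \<open>C\<^sup>1\<close> function of \<open>y\<^sub>\<nu>\<^sup>2\<close> and the other
  coordinates, which provides \<open>C\<^sup>1\<close> charts of the closure of \<open>\<Sigma>\<close>; its tangent space at the boundary is spanned by
  the horizontal boundary directions and by \<open>Z\<^sub>\<nu>\<^sub>\<nu>\<close>.\<close>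

section \<open>Functions of class \<open>C\<^sup>k\<close>\<close>

text \<open>The obstacle is regularity: \<open>Z\<close> is only C^2 up to the boundary while the
  metric blows up there, so the minimal surface equation has no boundary values. The divergence
  identities involve the field and the metric only through first derivatives of \<open>Z\<close>,
  and these do have limits. The order of the conclusions is forced. The Gram matrix contains the
  products of the derivatives of \<open>Z\<close> with \<open>iz\<close>, divided by the boundary
  coordinate; only after the first conclusion is known at all nearby boundary points does the
  rescaled matrix converge, and only then can transvections be used. Among these, the direction
  \<open>b\<close> equal to the normal derivative itself turns the limit identity into a sum of two
  nonnegative terms. Geometrically the vanishing of the normal derivative says that the modified
  compactification meets the sphere orthogonally, since on the sphere \<open>proj\<close> kills
  exactly the radial direction to first order. The coordinate frame is orthonormal only at the
  centre of a parametrization, so everything is proved at centres and carried to other boundary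
  points by recentring.\<close>

text \<open>Stands in for \<open>Ck_on\<close>, whose lists of iterated partials are awkward for
  chain and product rules. Only the values of the derivative in fixed directions are required to be
  C^k, so no operator norm enters and the induction stays within functions of the same type.
  Derivatives are taken in the full space even if \<open>S\<close> is not open.\<close>

primrec cdiff :: "nat \<Rightarrow> ('a::real_normed_vector \<Rightarrow> 'b::real_normed_vector) \<Rightarrow> 'a set \<Rightarrow> bool" where
  "cdiff 0 = (\<lambda>f S. continuous_on S f)"
| "cdiff (Suc k) = (\<lambda>f S. \<exists>f'. (\<forall>x\<in>S. (f has_derivative f' x) (at x)) \<and> (\<forall>v. cdiff k (\<lambda>x. f' x v) S))"

lemma cdiff_SucI:
  assumes "\<And>x. x \<in> S \<Longrightarrow> (f has_derivative f' x) (at x)" "\<And>v. cdiff k (\<lambda>x. f' x v) S"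
  shows "cdiff (Suc k) f S"
  using assms by auto

lemma cdiff_cong:
  assumes "open S" "\<And>x. x \<in> S \<Longrightarrow> f x = g x" "cdiff k f S"
  shows "cdiff k g S"
  using assms
proof (cases k)
  case 0
  with assms show ?thesis by (simp cong: continuous_on_cong)
next
  case (Suc j)
  with assms obtain f' where f': "\<forall>x\<in>S. (f has_derivative f' x) (at x)" "\<forall>v. cdiff j (\<lambda>x. f' x v) S"
    by auto
  have "\<forall>x\<in>S. (g has_derivative f' x) (at x)"
    using f'(1) assms(1,2) by (metis has_derivative_transform_within_open)
  with f'(2) Suc show ?thesis by auto
qed

lemma cdiff_SucD:
  assumes "cdiff (Suc k) f S" "open S" "\<And>x. x \<in> S \<Longrightarrow> (f has_derivative f' x) (at x)"
  shows "cdiff k (\<lambda>x. f' x v) S"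
proof -
  obtain g' where g': "\<forall>x\<in>S. (f has_derivative g' x) (at x)" "\<forall>v. cdiff k (\<lambda>x. g' x v) S"
    using assms(1) by auto
  have "\<And>x. x \<in> S \<Longrightarrow> g' x v = f' x v"
    using has_derivative_unique[OF bspec[OF g'(1)] assms(3)] by simp
  then show ?thesis by (rule cdiff_cong[OF assms(2) _ spec[OF g'(2)]])
qed

lemma cdiff_imp_frechet:
  assumes "cdiff (Suc k) f S" "x \<in> S"
  shows "(f has_derivative frechet_derivative f (at x)) (at x)"
  using assms by (auto simp: frechet_derivative_works[symmetric] differentiable_def)

lemma cdiff_frechet:
  assumes "cdiff (Suc k) f S" "open S"
  shows "cdiff k (\<lambda>x. frechet_derivative f (at x) v) S"
  using cdiff_SucD[OF assms cdiff_imp_frechet[OF assms(1)]] by blast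

lemma cdiff_lower: "cdiff (Suc k) f S \<Longrightarrow> cdiff k f S"
proof (induction k arbitrary: f)
  case 0
  then show ?case
    by (metis cdiff.simps(1) cdiff_imp_frechet continuous_at_imp_continuous_on has_derivative_continuous)
next
  case (Suc k)
  then obtain f' where "\<forall>x\<in>S. (f has_derivative f' x) (at x)" "\<forall>v. cdiff (Suc k) (\<lambda>x. f' x v) S"
    by auto
  with Suc.IH show ?case by (intro cdiff_SucI[where f'=f']) blast+
qed

lemma cdiff_mono: "cdiff k f S \<Longrightarrow> j \<le> k \<Longrightarrow> cdiff j f S"
  by (induction k) (auto simp del: cdiff.simps(2) simp: le_Suc_eq dest: cdiff_lower)

lemma cdiff_continuous: "cdiff k f S \<Longrightarrow> continuous_on S f"
  using cdiff_mono[of k f S 0] by simp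

lemma cdiff_subset: "cdiff k f S \<Longrightarrow> T \<subseteq> S \<Longrightarrow> cdiff k f T"
proof (induction k arbitrary: f)
  case 0 then show ?case by (auto intro: continuous_on_subset)
next
  case (Suc k)
  then obtain f' where "\<forall>x\<in>S. (f has_derivative f' x) (at x)" "\<forall>v. cdiff k (\<lambda>x. f' x v) S"
    by auto
  with Suc show ?case by (intro cdiff_SucI[where f'=f']) (blast intro: subsetD)+
qed

text \<open>Derivatives provided by different neighbourhoods have to be glued;
  \<open>frechet_derivative\<close> is a canonical choice on which all of them agree.\<close>

lemma cdiff_local:
  assumes "\<And>x. x \<in> S \<Longrightarrow> \<exists>U. open U \<and> x \<in> U \<and> cdiff k f U"
  shows "cdiff k f S"
  using assms
proof (induction k arbitrary: f)
  case 0
  have "isCont f x" if "x \<in> S" for x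
    using 0[OF that] by (auto simp: continuous_on_eq_continuous_at)
  then show ?case by (simp add: continuous_at_imp_continuous_on)
next
  case (Suc k)
  show ?case
  proof (rule cdiff_SucI[where f'="\<lambda>x. frechet_derivative f (at x)"])
    show "(f has_derivative frechet_derivative f (at x)) (at x)" if "x \<in> S" for x
      using Suc.prems[OF that] by (meson cdiff_imp_frechet)
    show "cdiff k (\<lambda>x. frechet_derivative f (at x) v) S" for v
    proof (rule Suc.IH)
      fix x assume "x \<in> S"
      from Suc.prems[OF this] obtain U where "open U" "x \<in> U" "cdiff (Suc k) f U" by blast
      then show "\<exists>U. open U \<and> x \<in> U \<and> cdiff k (\<lambda>x. frechet_derivative f (at x) v) U"
        by (intro exI[of _ U]) (simp add: cdiff_frechet del: cdiff.simps)
    qed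
  qed
qed

lemma cdiff_const [simp]: "cdiff k (\<lambda>x. c) S"
proof (induction k arbitrary: c)
  case (Suc k)
  show ?case by (rule cdiff_SucI[where f'="\<lambda>x v. 0"]) (auto simp: Suc)
qed simp

lemma cdiff_linear: "bounded_linear f \<Longrightarrow> cdiff k f S"
  by (cases k)
    (auto simp: linear_continuous_on intro!: exI[of _ "\<lambda>x. f"] bounded_linear_imp_has_derivative)

lemma cdiff_id [simp]: "cdiff k (\<lambda>x. x) S"
  by (rule cdiff_linear) (rule bounded_linear_ident)

lemma cdiff_add: "cdiff k f S \<Longrightarrow> cdiff k g S \<Longrightarrow> cdiff k (\<lambda>x. f x + g x) S"
proof (induction k arbitrary: f g)
  case 0 then show ?case by (auto intro: continuous_on_add)
next
  case (Suc k)
  then obtain f' g' where "\<forall>x\<in>S. (f has_derivative f' x) (at x)" "\<forall>v. cdiff k (\<lambda>x. f' x v) S"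
    "\<forall>x\<in>S. (g has_derivative g' x) (at x)" "\<forall>v. cdiff k (\<lambda>x. g' x v) S" by auto
  then show ?case
    by (intro cdiff_SucI[where f'="\<lambda>x v. f' x v + g' x v"] Suc.IH)
       (auto intro: has_derivative_add)
qed

lemma cdiff_bilinear:
  assumes "bounded_bilinear pr"
  shows "cdiff k f S \<Longrightarrow> cdiff k g S \<Longrightarrow> cdiff k (\<lambda>x. pr (f x) (g x)) S"
proof (induction k arbitrary: f g)
  case 0 then show ?case by (auto intro: bounded_bilinear.continuous_on[OF assms])
next
  case (Suc k)
  then obtain f' g' where *: "\<forall>x\<in>S. (f has_derivative f' x) (at x)" "\<forall>v. cdiff k (\<lambda>x. f' x v) S"
    "\<forall>x\<in>S. (g has_derivative g' x) (at x)" "\<forall>v. cdiff k (\<lambda>x. g' x v) S" by auto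
  moreover have "cdiff k f S" "cdiff k g S" using Suc.prems by (auto simp del: cdiff.simps intro: cdiff_lower)
  ultimately show ?case
    by (intro cdiff_SucI[where f'="\<lambda>x v. pr (f x) (g' x v) + pr (f' x v) (g x)"])
       (auto intro!: bounded_bilinear.FDERIV[OF assms] cdiff_add Suc.IH)
qed

lemmas cdiff_mult = cdiff_bilinear[OF bounded_bilinear_mult]
lemmas cdiff_scaleR = cdiff_bilinear[OF bounded_bilinear_scaleR]
lemmas cdiff_inner = cdiff_bilinear[OF bounded_bilinear_inner]

lemma cdiff_sum:
  "(\<And>i. i \<in> I \<Longrightarrow> cdiff k (f i) S) \<Longrightarrow> cdiff k (\<lambda>x. \<Sum>i\<in>I. f i x) S"
  by (induction I rule: infinite_finite_induct) (auto intro: cdiff_add)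

lemma cdiff_prod:
  fixes f :: "'i \<Rightarrow> 'a::real_normed_vector \<Rightarrow> real"
  shows "(\<And>i. i \<in> I \<Longrightarrow> cdiff k (f i) S) \<Longrightarrow> cdiff k (\<lambda>x. \<Prod>i\<in>I. f i x) S"
  by (induction I rule: infinite_finite_induct) (auto intro: cdiff_mult)

lemma cdiff_compose_linear:
  assumes "bounded_linear h" "cdiff k f S"
  shows "cdiff k (\<lambda>x. h (f x)) S"
  using assms(2)
proof (induction k arbitrary: f)
  case 0 then show ?case by (auto intro: bounded_linear.continuous_on[OF assms(1)])
next
  case (Suc k)
  then obtain f' where *: "\<forall>x\<in>S. (f has_derivative f' x) (at x)" "\<forall>v. cdiff k (\<lambda>x. f' x v) S"
    by auto
  then show ?case
    by (intro cdiff_SucI[where f'="\<lambda>x v. h (f' x v)"])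
       (auto intro!: bounded_linear.has_derivative[OF assms(1)] Suc.IH)
qed

lemma cdiff_minus: "cdiff k f S \<Longrightarrow> cdiff k (\<lambda>x. - f x) S"
  by (rule cdiff_compose_linear[OF bounded_linear_minus[OF bounded_linear_ident]])

lemma cdiff_diff: "cdiff k f S \<Longrightarrow> cdiff k g S \<Longrightarrow> cdiff k (\<lambda>x. f x - g x) S"
  using cdiff_add[OF _ cdiff_minus, of k f S g] by simp

lemma cdiff_power:
  fixes f :: "'a::real_normed_vector \<Rightarrow> real"
  shows "cdiff k f S \<Longrightarrow> cdiff k (\<lambda>x. f x ^ n) S"
  by (induction n) (auto intro: cdiff_mult)

lemma cdiff_norm_power2:
  fixes f :: "'a::real_normed_vector \<Rightarrow> 'b::real_inner"
  shows "cdiff k f S \<Longrightarrow> cdiff k (\<lambda>x. (norm (f x))\<^sup>2) S"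
  by (simp add: power2_norm_eq_inner cdiff_inner)

text \<open>The chain rule yields \<open>g' (f x) (f' x v)\<close>, whose direction moves with
  \<open>x\<close>, while \<open>cdiff\<close> controls \<open>g'\<close> in fixed directions only.
  Expanding \<open>f' x v\<close> in \<open>Basis\<close> turns this into a sum of products to which
  the induction hypothesis applies.\<close>

lemma cdiff_compose:
  fixes f :: "'a::real_normed_vector \<Rightarrow> 'b::euclidean_space" and g :: "'b \<Rightarrow> 'c::real_normed_vector"
  assumes "cdiff k f S" "cdiff k g T" "f ` S \<subseteq> T"
  shows "cdiff k (\<lambda>x. g (f x)) S"
  using assms
proof (induction k arbitrary: f g)
  case 0 then show ?case by (auto intro: continuous_on_compose2)
next
  case (Suc k)
  then obtain f' g' where *: "\<forall>x\<in>S. (f has_derivative f' x) (at x)" "\<forall>v. cdiff k (\<lambda>x. f' x v) S"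
    "\<forall>x\<in>T. (g has_derivative g' x) (at x)" "\<forall>v. cdiff k (\<lambda>x. g' x v) T" by auto
  have f: "cdiff k f S" using Suc.prems(1) by (rule cdiff_lower)
  show ?case
  proof (rule cdiff_SucI[where f'="\<lambda>x v. \<Sum>b\<in>Basis. (f' x v \<bullet> b) *\<^sub>R g' (f x) b"])
    fix x assume x: "x \<in> S"
    have "((\<lambda>x. g (f x)) has_derivative (\<lambda>v. g' (f x) (f' x v))) (at x)"
      using has_derivative_compose[of f "f' x" x UNIV g "g' (f x)"] * x Suc.prems(3) by auto
    moreover have "g' (f x) (f' x v) = (\<Sum>b\<in>Basis. (f' x v \<bullet> b) *\<^sub>R g' (f x) b)" for v
    proof -
      have l: "linear (g' (f x))" using * x Suc.prems(3)
        by (meson bounded_linear.linear has_derivative_bounded_linear image_subset_iff)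
      have "g' (f x) (f' x v) = g' (f x) (\<Sum>b\<in>Basis. (f' x v \<bullet> b) *\<^sub>R b)"
        by (simp add: euclidean_representation)
      also have "\<dots> = (\<Sum>b\<in>Basis. (f' x v \<bullet> b) *\<^sub>R g' (f x) b)"
        by (simp add: linear_sum[OF l] linear_scale[OF l])
      finally show ?thesis .
    qed
    ultimately show "((\<lambda>x. g (f x)) has_derivative (\<lambda>v. \<Sum>b\<in>Basis. (f' x v \<bullet> b) *\<^sub>R g' (f x) b)) (at x)"
      by simp
  next
    fix v
    show "cdiff k (\<lambda>x. \<Sum>b\<in>Basis. (f' x v \<bullet> b) *\<^sub>R g' (f x) b) S"
    proof (intro cdiff_sum cdiff_scaleR)
      fix b :: 'b
      show "cdiff k (\<lambda>x. f' x v \<bullet> b) S"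
        by (rule cdiff_compose_linear[OF bounded_linear_inner_left]) (use * in auto)
      show "cdiff k (\<lambda>x. g' (f x) b) S"
        by (rule Suc.IH[OF f spec[OF *(4)] Suc.prems(3)])
    qed
  qed
qed

lemma cdiff_inverse: "cdiff k (inverse :: real \<Rightarrow> real) (-{0})"
proof (induction k)
  case 0 show ?case by (auto intro: continuous_intros)
next
  case (Suc k)
  show ?case
  proof (rule cdiff_SucI[where f'="\<lambda>x v. - (inverse x * v * inverse x)"])
    show "(inverse has_derivative (\<lambda>v. - (inverse x * v * inverse x))) (at x)" if "x \<in> -{0}" for x::real
      using that by (intro has_derivative_inverse') auto
    show "cdiff k (\<lambda>x. - (inverse x * v * inverse x)) (- {0})" for v :: real
      by (intro cdiff_minus cdiff_mult Suc cdiff_const)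
  qed
qed

lemma cdiff_inverse_compose:
  fixes f :: "'a::real_normed_vector \<Rightarrow> real"
  assumes "cdiff k f S" "\<And>x. x \<in> S \<Longrightarrow> f x \<noteq> 0"
  shows "cdiff k (\<lambda>x. inverse (f x)) S"
  by (rule cdiff_compose[OF assms(1) cdiff_inverse]) (use assms(2) in auto)

lemma cdiff_divide:
  fixes f g :: "'a::real_normed_vector \<Rightarrow> real"
  assumes "cdiff k g S" "cdiff k f S" "\<And>x. x \<in> S \<Longrightarrow> f x \<noteq> 0"
  shows "cdiff k (\<lambda>x. g x / f x) S"
  unfolding divide_inverse by (intro cdiff_mult assms(1) cdiff_inverse_compose assms)

lemma cdiff_sqrt: "cdiff k sqrt {0<..}"
proof (induction k)
  case 0 show ?case by (auto intro: continuous_intros)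
next
  case (Suc k)
  show ?case
  proof (rule cdiff_SucI[where f'="\<lambda>x v. v * (inverse (sqrt x) / 2)"])
    show "(sqrt has_derivative (\<lambda>v. v * (inverse (sqrt x) / 2))) (at x)" if "x \<in> {0<..}" for x::real
      using that DERIV_real_sqrt[of x]
      by (metis (no_types, lifting) ext greaterThan_iff has_field_derivative_def mult.commute)
    have "cdiff k (\<lambda>x. inverse (sqrt x)) {0<..}"
      by (rule cdiff_inverse_compose[OF Suc]) auto
    then show "cdiff k (\<lambda>x. v * (inverse (sqrt x) / 2)) {0<..}" for v :: real
      unfolding divide_inverse by (intro cdiff_mult cdiff_const)
  qed
qed

lemma cdiff_sqrt_compose:
  fixes f :: "'a::real_normed_vector \<Rightarrow> real"
  assumes "cdiff k f S" "\<And>x. x \<in> S \<Longrightarrow> f x > 0"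
  shows "cdiff k (\<lambda>x. sqrt (f x)) S"
  by (rule cdiff_compose[OF assms(1) cdiff_sqrt]) (use assms(2) in auto)

lemma cdiff_componentwise:
  fixes f :: "'a::real_normed_vector \<Rightarrow> 'b::euclidean_space"
  assumes "\<And>b. b \<in> Basis \<Longrightarrow> cdiff k (\<lambda>x. f x \<bullet> b) S"
  shows "cdiff k f S"
proof -
  have "cdiff k (\<lambda>x. \<Sum>b\<in>Basis. (f x \<bullet> b) *\<^sub>R b) S"
    by (intro cdiff_sum cdiff_scaleR cdiff_const assms)
  then show ?thesis by (simp add: euclidean_representation)
qed

lemma cdiff_vec_lambda:
  fixes f :: "'a::real_normed_vector \<Rightarrow> real^'n"
  assumes "\<And>i. cdiff k (\<lambda>x. f x $ i) S"
  shows "cdiff k f S"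
  by (rule cdiff_componentwise) (auto simp: Basis_vec_def inner_axis assms)

lemma cdiff_nth: "cdiff k f S \<Longrightarrow> cdiff k (\<lambda>x. f x $ i) S"
  by (rule cdiff_compose_linear[OF bounded_linear_vec_nth])

section \<open>Equivalence with iterated partial derivatives\<close>

text \<open>The increment is split along the coordinate directions; each piece is compared with its
  partial at \<open>x\<close> by the mean value inequality, using continuity of the partials near
  \<open>x\<close>.\<close>

lemma has_derivative_partials:
  fixes f :: "'a::euclidean_space \<Rightarrow> 'b::real_normed_vector"
  assumes "open S" "x \<in> S"
    and D: "\<And>y b. y \<in> S \<Longrightarrow> b \<in> Basis \<Longrightarrow> ((\<lambda>t. f (y + t *\<^sub>R b)) has_vector_derivative D b y) (at 0)"
    and C: "\<And>b. b \<in> Basis \<Longrightarrow> continuous_on S (D b)"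
  shows "(f has_derivative (\<lambda>v. \<Sum>b\<in>Basis. (v \<bullet> b) *\<^sub>R D b x)) (at x)"
proof (rule has_derivativeI)
  show "bounded_linear (\<lambda>v. \<Sum>b\<in>Basis. (v \<bullet> b) *\<^sub>R D b x)"
    by (intro bounded_linear_sum bounded_linear_scaleR_const bounded_linear_inner_left)
  show "((\<lambda>y. (f y - f x - (\<Sum>b\<in>Basis. ((y - x) \<bullet> b) *\<^sub>R D b x)) /\<^sub>R norm (y - x)) \<longlongrightarrow> 0) (at x)"
  proof (rule tendstoI)
    fix e :: real assume "e > 0"
    \<comment> \<open>One share per coordinate: the total error is at most \<open>e / 2\<close>
      times the length of the increment, hence strictly below \<open>e\<close> times it.\<close>
    define e' where "e' = e / (2 * DIM('a))"
    have "e' > 0" using \<open>e>0\<close> by (simp add: e'_def)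
    have "\<forall>\<^sub>F y in nhds x. \<forall>b\<in>Basis. dist (D b y) (D b x) < e'"
    proof (subst eventually_ball_finite_distrib, simp, rule ballI)
      fix b :: 'a assume "b \<in> Basis"
      have "isCont (D b) x" using C[OF \<open>b\<in>Basis\<close>] assms(1,2) by (simp add: continuous_on_eq_continuous_at)
      then have "(D b \<longlongrightarrow> D b x) (nhds x)" by (simp add: continuous_at tendsto_at_iff_tendsto_nhds)
      then show "\<forall>\<^sub>F y in nhds x. dist (D b y) (D b x) < e'" using \<open>e'>0\<close> by (rule tendstoD)
    qed
    moreover have "\<forall>\<^sub>F y in nhds x. y \<in> S" using assms(1,2) by (simp add: eventually_nhds_in_open)
    ultimately have "\<forall>\<^sub>F y in nhds x. y \<in> S \<and> (\<forall>b\<in>Basis. dist (D b y) (D b x) < e')"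
      by eventually_elim auto
    then obtain d where "d > 0" and d: "\<And>y. dist y x < d \<Longrightarrow> y \<in> S \<and> (\<forall>b\<in>Basis. dist (D b y) (D b x) < e')"
      by (auto simp: eventually_nhds_metric)
    have key: "norm (f (x + (\<Sum>b\<in>B. (v \<bullet> b) *\<^sub>R b)) - f x - (\<Sum>b\<in>B. (v \<bullet> b) *\<^sub>R D b x)) \<le> card B * e' * norm v"
      if "norm v < d" "finite B" "B \<subseteq> Basis" for B :: "'a set" and v
      using that(2,3)
    proof (induction B rule: finite_induct)
      case (insert b B)
      define w where "w = x + (\<Sum>b\<in>B. (v \<bullet> b) *\<^sub>R b)"
      have bB: "b \<in> Basis" "B \<subseteq> Basis" using insert.prems by auto
      define g where "g = (\<lambda>t. f (w + t *\<^sub>R b) - t *\<^sub>R D b x)"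
      have near: "dist (w + t *\<^sub>R b) x < d" if t: "t \<in> closed_segment 0 (v \<bullet> b)" for t
      proof -
        have at: "\<bar>t\<bar> \<le> \<bar>v \<bullet> b\<bar>" using t by (auto simp: closed_segment_eq_real_ivl split: if_splits)
        have "norm ((\<Sum>b\<in>B. (v \<bullet> b) *\<^sub>R b) + t *\<^sub>R b) \<le> norm v"
        proof (rule norm_le_componentwise)
          fix c :: 'a assume c: "c \<in> Basis"
          have "((\<Sum>b\<in>B. (v \<bullet> b) *\<^sub>R b) + t *\<^sub>R b) \<bullet> c = (\<Sum>b\<in>B. if b = c then v \<bullet> b else 0) + (if b = c then t else 0)"
            using bB c by (auto simp: inner_add_left inner_sum_left inner_Basis intro!: sum.cong)
          also have "\<dots> = (if c \<in> B then v \<bullet> c else if b = c then t else 0)"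
            using insert.hyps by (auto simp: sum.delta)
          finally show "\<bar>((\<Sum>b\<in>B. (v \<bullet> b) *\<^sub>R b) + t *\<^sub>R b) \<bullet> c\<bar> \<le> \<bar>v \<bullet> c\<bar>" using at by auto
        qed
        with that show ?thesis using \<open>norm v < d\<close> by (simp add: w_def dist_norm)
      qed
      have "norm (g (v \<bullet> b) - g 0) \<le> e' * norm (v \<bullet> b - 0)"
      proof (rule differentiable_bound[where S="closed_segment 0 (v \<bullet> b)" and f'="\<lambda>t h. h *\<^sub>R (D b (w + t *\<^sub>R b) - D b x)"])
        show "convex (closed_segment 0 (v \<bullet> b))" by simp
        show "0 \<in> closed_segment 0 (v \<bullet> b)" "v \<bullet> b \<in> closed_segment 0 (v \<bullet> b)" by auto
        fix t assume t: "t \<in> closed_segment 0 (v \<bullet> b)"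
        have wS: "w + t *\<^sub>R b \<in> S" and ne: "dist (D b (w + t *\<^sub>R b)) (D b x) < e'" using d[OF near[OF t]] bB by auto
        have "((\<lambda>s. s - t) has_vector_derivative 1) (at t)"
          by (auto intro!: derivative_eq_intros simp: has_vector_derivative_def)
        then have "((\<lambda>s. f ((w + t *\<^sub>R b) + (s - t) *\<^sub>R b)) has_vector_derivative D b (w + t *\<^sub>R b)) (at t)"
          using vector_diff_chain_at[of "\<lambda>s. s - t" 1 t "\<lambda>s. f ((w + t *\<^sub>R b) + s *\<^sub>R b)" "D b (w + t *\<^sub>R b)"] D[OF wS bB(1)]
          by (auto simp: o_def)
        then have "((\<lambda>s. f (w + s *\<^sub>R b)) has_vector_derivative D b (w + t *\<^sub>R b)) (at t)"
          by (simp add: algebra_simps)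
        then have "(g has_vector_derivative (D b (w + t *\<^sub>R b) - D b x)) (at t)"
          unfolding g_def by (auto intro!: derivative_eq_intros)
        then show "(g has_derivative (\<lambda>h. h *\<^sub>R (D b (w + t *\<^sub>R b) - D b x))) (at t within closed_segment 0 (v \<bullet> b))"
          by (simp add: has_vector_derivative_def has_derivative_at_withinI)
        show "onorm (\<lambda>h. h *\<^sub>R (D b (w + t *\<^sub>R b) - D b x)) \<le> e'"
          using ne \<open>e' > 0\<close> by (intro onorm_le) (auto simp: dist_norm mult.commute[of e'] intro: mult_left_mono)
      qed
      then have 1: "norm (f (w + (v \<bullet> b) *\<^sub>R b) - f w - (v \<bullet> b) *\<^sub>R D b x) \<le> e' * \<bar>v \<bullet> b\<bar>"
        by (simp add: g_def algebra_simps)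
      have 2: "norm (f w - f x - (\<Sum>b\<in>B. (v \<bullet> b) *\<^sub>R D b x)) \<le> card B * e' * norm v"
        using insert bB by (simp add: w_def)
      have 3: "e' * \<bar>v \<bullet> b\<bar> \<le> e' * norm v" using \<open>e'>0\<close> bB by (simp add: Basis_le_norm)
      have "f (x + (\<Sum>b\<in>insert b B. (v \<bullet> b) *\<^sub>R b)) - f x - (\<Sum>b\<in>insert b B. (v \<bullet> b) *\<^sub>R D b x)
         = (f (w + (v \<bullet> b) *\<^sub>R b) - f w - (v \<bullet> b) *\<^sub>R D b x) + (f w - f x - (\<Sum>b\<in>B. (v \<bullet> b) *\<^sub>R D b x))"
        using insert.hyps by (simp add: w_def algebra_simps)
      also have "norm \<dots> \<le> e' * norm v + card B * e' * norm v"
        by (rule norm_triangle_mono) (use 1 2 3 in linarith)+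
      finally show ?case using insert.hyps by (simp add: algebra_simps)
    qed simp
    have "norm ((f y - f x - (\<Sum>b\<in>Basis. ((y - x) \<bullet> b) *\<^sub>R D b x)) /\<^sub>R norm (y - x)) < e" if "dist y x < d" "y \<noteq> x" for y
    proof -
      have "norm (f y - f x - (\<Sum>b\<in>Basis. ((y - x) \<bullet> b) *\<^sub>R D b x)) \<le> e/2 * norm (y - x)"
        using key[of "y - x" Basis] that by (simp add: dist_norm euclidean_representation e'_def)
      also have "\<dots> < e * norm (y - x)" using that \<open>e>0\<close> by simp
      finally show ?thesis using that by (simp add: norm_divide divide_less_eq inverse_eq_divide)
    qed
    with \<open>d>0\<close> show "\<forall>\<^sub>F y in at x. dist ((f y - f x - (\<Sum>b\<in>Basis. ((y - x) \<bullet> b) *\<^sub>R D b x)) /\<^sub>R norm (y - x)) 0 < e"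
      unfolding eventually_at by (intro exI[of _ d]) (simp add: dist_norm)
  qed
qed

text \<open>The last entry of the list is differentiated first. This form lets the induction on the
  order replace \<open>f\<close> by one of its partials.\<close>

lemma iderivs_append: "iderivs (vs @ [b]) f = iderivs vs (dirderiv f b)"
  by (induction vs) auto

lemma has_derivative_dirderiv:
  assumes "(f has_derivative f') (at x)"
  shows "((\<lambda>t. f (x + t *\<^sub>R v)) has_vector_derivative f' v) (at 0)" "dirderiv f v x = f' v"
proof -
  have "((\<lambda>t. x + t *\<^sub>R v) has_vector_derivative v) (at 0)"
    by (auto intro!: derivative_eq_intros)
  then show 1: "((\<lambda>t. f (x + t *\<^sub>R v)) has_vector_derivative f' v) (at 0)"
    using vector_derivative_diff_chain_within[of "\<lambda>t. x + t *\<^sub>R v" v 0 UNIV f f'] assms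
    by (simp add: o_def has_derivative_at_withinI)
  show "dirderiv f v x = f' v"
    unfolding dirderiv_def using 1 by (rule vector_derivative_at)
qed

lemma cdiff_dirderiv:
  assumes "cdiff (Suc k) f S" "open S"
  shows "cdiff k (dirderiv f v) S"
  using cdiff_cong[OF assms(2) _ cdiff_frechet[OF assms, of v]]
    has_derivative_dirderiv(2)[OF cdiff_imp_frechet[OF assms(1)]] by metis

lemma cdiff_imp_Ck_on:
  assumes "cdiff k f S" "open S"
  shows "Ck_on k f S"
proof -
  have main: "cdiff (k - length vs) (iderivs vs f) S" if "length vs \<le> k" for vs
    using that
  proof (induction vs)
    case (Cons v vs)
    then have "cdiff (Suc (k - length (v # vs))) (iderivs vs f) S"
      by (simp add: Suc_diff_Suc Suc_le_eq del: cdiff.simps)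
    from cdiff_dirderiv[OF this assms(2)] show ?case by simp
  qed (use assms in simp)
  show ?thesis
    unfolding Ck_on_def
  proof (intro conjI allI impI ballI assms(2))
    fix vs :: "'a list" assume vs: "set vs \<subseteq> Basis \<and> length vs \<le> k"
    then show "continuous_on S (iderivs vs f)" using main cdiff_continuous by blast
    fix x v assume "length vs < k" "x \<in> S"
    then obtain j where "k - length vs = Suc j" by (metis Suc_diff_Suc)
    with main[of vs] vs have "cdiff (Suc j) (iderivs vs f) S" by (simp del: cdiff.simps)
    from has_derivative_dirderiv[OF cdiff_imp_frechet[OF this \<open>x \<in> S\<close>]]
    show "((\<lambda>t. iderivs vs f (x + t *\<^sub>R v)) has_vector_derivative iderivs (v # vs) f x) (at 0)"
      by simp
  qed
qed

lemma Ck_on_imp_cdiff: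
  "Ck_on k f S \<Longrightarrow> cdiff k f S"
proof (induction k arbitrary: f)
  case 0
  then show ?case by (auto simp: Ck_on_def dest: spec[of _ "[]"])
next
  case (Suc k)
  have S: "open S" and C: "\<And>vs. set vs \<subseteq> Basis \<Longrightarrow> length vs \<le> Suc k \<Longrightarrow> continuous_on S (iderivs vs f)"
    and D: "\<And>vs x v. set vs \<subseteq> Basis \<Longrightarrow> length vs < Suc k \<Longrightarrow> x\<in>S \<Longrightarrow> v\<in>Basis \<Longrightarrow>
            ((\<lambda>t. iderivs vs f (x + t *\<^sub>R v)) has_vector_derivative iderivs (v # vs) f x) (at 0)"
    using Suc.prems unfolding Ck_on_def by auto
  show ?case
  proof (rule cdiff_SucI[where f'="\<lambda>x v. \<Sum>b\<in>Basis. (v \<bullet> b) *\<^sub>R dirderiv f b x"])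
    fix x assume "x \<in> S"
    then show "(f has_derivative (\<lambda>v. \<Sum>b\<in>Basis. (v \<bullet> b) *\<^sub>R dirderiv f b x)) (at x)"
      using D[of "[]"] C[of "[_]"] by (intro has_derivative_partials[OF S]) auto
  next
    fix v
    have "cdiff k (dirderiv f b) S" if b: "b \<in> Basis" for b
    proof (rule Suc.IH)
      show "Ck_on k (dirderiv f b) S"
        unfolding Ck_on_def
      proof (intro conjI allI impI ballI S)
        fix vs :: "'a list" assume vs: "set vs \<subseteq> Basis \<and> length vs \<le> k"
        show "continuous_on S (iderivs vs (dirderiv f b))"
          using C[of "vs @ [b]"] vs b by (simp add: iderivs_append)
        fix x v :: 'a assume "length vs < k" "x \<in> S" "v \<in> Basis"
        then show "((\<lambda>t. iderivs vs (dirderiv f b) (x + t *\<^sub>R v)) has_vector_derivative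
                iderivs (v # vs) (dirderiv f b) x) (at 0)"
          using D[of "vs @ [b]" x v] vs b by (simp add: iderivs_append)
      qed
    qed
    then show "cdiff k (\<lambda>x. \<Sum>b\<in>Basis. (v \<bullet> b) *\<^sub>R dirderiv f b x) S"
      by (intro cdiff_sum cdiff_scaleR cdiff_const)
  qed
qed

lemma Ck_on_iff_cdiff: "Ck_on k f S \<longleftrightarrow> open S \<and> cdiff k f S"
  using Ck_on_imp_cdiff cdiff_imp_Ck_on Ck_on_def by blast

lemma Cl_on_enat_iff: "Cl_on (enat k) f S \<longleftrightarrow> open S \<and> cdiff k f S"
  unfolding Cl_on_def Ck_on_iff_cdiff using cdiff_mono by auto

lemma Cl_on_infty_iff: "Cl_on \<infinity> f S \<longleftrightarrow> open S \<and> (\<forall>k. cdiff k f S)"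
  unfolding Cl_on_def Ck_on_iff_cdiff by auto

lemma Cl_on_numeral_iff: "Cl_on (numeral n) f S \<longleftrightarrow> open S \<and> cdiff (numeral n) f S"
  using Cl_on_enat_iff[of "numeral n"] by (simp only: numeral_eq_enat)

lemma Cl_on_1_iff: "Cl_on 1 f S \<longleftrightarrow> open S \<and> cdiff 1 f S"
  using Cl_on_enat_iff[of 1] by (simp only: one_enat_def)

section \<open>Inverses of linear maps depending on a parameter, and inverse functions\<close>

text \<open>The product rule survives with one factor merely continuous if the other vanishes at the
  point: the derivative of \<open>c\<close> would be multiplied by zero.\<close>

lemma has_derivative_mult_vanishing:
  fixes h :: "'a::real_normed_vector \<Rightarrow> real" and c :: "'a \<Rightarrow> 'b::real_normed_vector"
  assumes h: "(h has_derivative h') (at x)" and "h x = 0" and c: "isCont c x"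
  shows "((\<lambda>y. h y *\<^sub>R c y) has_derivative (\<lambda>u. h' u *\<^sub>R c x)) (at x)"
proof (rule has_derivativeI)
  interpret bounded_linear h' using h by (rule has_derivative_bounded_linear)
  show "bounded_linear (\<lambda>u. h' u *\<^sub>R c x)"
    by (rule bounded_linear_compose[OF bounded_linear_scaleR_left]) (rule has_derivative_bounded_linear[OF h])
  obtain K where K: "\<And>u. norm (h' u) \<le> norm u * K" "K > 0" using pos_bounded by blast
  have 1: "((\<lambda>y. (h y - h x - h' (y - x)) /\<^sub>R norm (y - x)) \<longlongrightarrow> 0) (at x)"
    using h by (simp add: has_derivative_at_within)
  have c1: "(c \<longlongrightarrow> c x) (at x)" using c by (simp add: continuous_at)
  have 2: "((\<lambda>y. ((h y - h x - h' (y - x)) /\<^sub>R norm (y - x)) *\<^sub>R c y) \<longlongrightarrow> 0 *\<^sub>R c x) (at x)"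
    by (rule tendsto_scaleR[OF 1 c1])
  have 3: "((\<lambda>y. (h' (y - x) / norm (y - x)) *\<^sub>R (c y - c x)) \<longlongrightarrow> 0) (at x)"
  proof (rule Lim_null_comparison[where g="\<lambda>y. K * norm (c y - c x)"])
    show "\<forall>\<^sub>F y in at x. norm ((h' (y - x) / norm (y - x)) *\<^sub>R (c y - c x)) \<le> K * norm (c y - c x)"
    proof (rule always_eventually, rule allI)
      fix y
      have "\<bar>h' (y - x)\<bar> / norm (y - x) \<le> K"
        using K(1)[of "y - x"] K(2) by (cases "y = x") (auto simp: divide_le_eq mult.commute)
      then show "norm ((h' (y - x) / norm (y - x)) *\<^sub>R (c y - c x)) \<le> K * norm (c y - c x)"
        using mult_right_mono[of "\<bar>h' (y - x)\<bar> / norm (y - x)" K "norm (c y - c x)"] by simp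
    qed
    have "((\<lambda>y. K * norm (c y - c x)) \<longlongrightarrow> K * norm (c x - c x)) (at x)"
      by (intro tendsto_intros c1)
    then show "((\<lambda>y. K * norm (c y - c x)) \<longlongrightarrow> 0) (at x)" by simp
  qed
  have "((\<lambda>y. ((h y - h x - h' (y - x)) /\<^sub>R norm (y - x)) *\<^sub>R c y + (h' (y - x) / norm (y - x)) *\<^sub>R (c y - c x)) \<longlongrightarrow> 0) (at x)"
    using tendsto_add[OF 2 3] by simp
  then show "((\<lambda>y. (h y *\<^sub>R c y - h x *\<^sub>R c x - h' (y - x) *\<^sub>R c x) /\<^sub>R norm (y - x)) \<longlongrightarrow> 0) (at x)"
  proof (rule Lim_transform_eventually[OF _ always_eventually], intro allI)
    fix y
    have "h' (y - x) / norm (y - x) = inverse (norm (y - x)) * h' (y - x)" by (simp add: divide_inverse)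
    then show "((h y - h x - h' (y - x)) /\<^sub>R norm (y - x)) *\<^sub>R c y + (h' (y - x) / norm (y - x)) *\<^sub>R (c y - c x)
      = (h y *\<^sub>R c y - h x *\<^sub>R c x - h' (y - x) *\<^sub>R c x) /\<^sub>R norm (y - x)"
      by (simp only: \<open>h x = 0\<close>) (simp add: scaleR_diff_right scaleR_diff_left right_diff_distrib)
  qed
qed

text \<open>\<open>A0\<close> is bounded below by \<open>1 / K\<close>; once \<open>A y\<close> is
  close to it on \<open>Basis\<close>, \<open>A y\<close> is bounded below by
  \<open>1 / (2 K)\<close>. So the difference of the preimages is controlled by its image under
  \<open>A y\<close>, which tends to zero.\<close>

lemma inv_linear_tendsto:
  fixes A :: "'i \<Rightarrow> 'a::euclidean_space \<Rightarrow> 'a"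
  assumes lim: "\<And>v. ((\<lambda>y. A y v) \<longlongrightarrow> A0 v) F"
    and lin: "\<forall>\<^sub>F y in F. linear (A y) \<and> inj (A y)" "linear A0" "inj A0"
    and w: "(w \<longlongrightarrow> w0) F"
  shows "((\<lambda>y. inv (A y) (w y)) \<longlongrightarrow> inv A0 w0) F"
proof -
  obtain g where g: "linear g" "\<And>x. g (A0 x) = x" "\<And>x. A0 (g x) = x"
    using linear_injective_isomorphism[OF lin(2,3)] by metis
  have invA0: "inv A0 = g" using g by (metis ext lin(3) inv_f_f)
  obtain K where K: "K > 0" "\<And>x. norm (g x) \<le> K * norm x"
    using linear_bounded_pos[OF g(1)] by blast
  have lb: "norm u / K \<le> norm (A0 u)" for u
    using K(2)[of "A0 u"] K(1) g(2) by (simp add: divide_le_eq mult.commute)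
  have "\<forall>\<^sub>F y in F. \<forall>b\<in>Basis. dist (A y b) (A0 b) < 1 / (2 * K * DIM('a))"
  proof (subst eventually_ball_finite_distrib, simp, rule ballI)
    fix b :: 'a assume "b \<in> Basis"
    show "\<forall>\<^sub>F y in F. dist (A y b) (A0 b) < 1 / (2 * K * DIM('a))"
      by (rule tendstoD[OF lim]) (use K in simp)
  qed
  with lin(1) have ev: "\<forall>\<^sub>F y in F. linear (A y) \<and> inj (A y) \<and> (\<forall>u. norm u / (2*K) \<le> norm (A y u))"
  proof eventually_elim
    case (elim y)
    have "norm u / (2*K) \<le> norm (A y u)" for u
    proof -
      have l: "linear (\<lambda>u. A y u - A0 u)" using elim lin(2) by (simp add: linear_compose_sub)
      have "A y u - A0 u = (\<Sum>b\<in>Basis. (u \<bullet> b) *\<^sub>R (A y b - A0 b))"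
        using linear_sum[OF l, of "\<lambda>b. (u \<bullet> b) *\<^sub>R b" Basis] linear_scale[OF l] by (simp add: euclidean_representation)
      also have "norm \<dots> \<le> (\<Sum>b\<in>(Basis::'a set). norm u * (1 / (2 * K * DIM('a))))"
      proof (rule sum_norm_le)
        fix b :: 'a assume b: "b \<in> Basis"
        have "\<bar>u \<bullet> b\<bar> * norm (A y b - A0 b) \<le> norm u * (1 / (2 * K * DIM('a)))"
          using elim b by (intro mult_mono Basis_le_norm) (auto simp: dist_norm intro: less_imp_le)
        then show "norm ((u \<bullet> b) *\<^sub>R (A y b - A0 b)) \<le> norm u * (1 / (2 * K * DIM('a)))" by simp
      qed
      also have "\<dots> = norm u / (2*K)" using K by simp
      finally have "norm (A0 u) - norm u / (2*K) \<le> norm (A y u)"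
        using norm_triangle_ineq2[of "A0 u" "A y u"] norm_minus_commute[of "A y u" "A0 u"] by linarith
      with lb[of u] show ?thesis using K by (simp add: field_simps)
    qed
    with elim show ?case by blast
  qed
  have lim0: "((\<lambda>y. 2 * K * (norm (w y - w0) + norm (A0 (g w0) - A y (g w0)))) \<longlongrightarrow> 0) F"
  proof -
    have "((\<lambda>y. 2 * K * (norm (w y - w0) + norm (A0 (g w0) - A y (g w0)))) \<longlongrightarrow>
        2 * K * (norm (w0 - w0) + norm (A0 (g w0) - A0 (g w0)))) F"
      by (intro tendsto_intros lim w)
    then show ?thesis by simp
  qed
  have "((\<lambda>y. inv (A y) (w y) - g w0) \<longlongrightarrow> 0) F"
  proof (rule Lim_null_comparison[OF _ lim0])
    from ev show "\<forall>\<^sub>F y in F. norm (inv (A y) (w y) - g w0) \<le> 2 * K * (norm (w y - w0) + norm (A0 (g w0) - A y (g w0)))"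
    proof eventually_elim
      case (elim y)
      then have "surj (A y)" by (simp add: linear_injective_imp_surjective)
      then have "A y (inv (A y) (w y)) = w y" by (simp add: surj_f_inv_f)
      then have "A y (inv (A y) (w y) - g w0) = (w y - w0) + (A0 (g w0) - A y (g w0))"
        using elim by (simp add: linear_diff g)
      then have "norm (inv (A y) (w y) - g w0) / (2*K) \<le> norm (w y - w0) + norm (A0 (g w0) - A y (g w0))"
        using elim by (metis norm_triangle_ineq order_trans)
      then show ?case using K by (simp add: field_simps)
    qed
  qed
  then show ?thesis by (simp add: invA0 LIM_zero_iff)
qed

text \<open>Differentiability comes from the exact identity
  \<open>inv (A y) v = w + inv (A y) (A x w - A y w)\<close> with \<open>w = inv (A x) v\<close>:
  the argument vanishes at \<open>y = x\<close>, so continuity of the inverse suffices. The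
  resulting derivative contains only inverses and derivatives of \<open>A\<close>, which drives the
  induction.\<close>

lemma cdiff_inv_linear:
  fixes A :: "'s::real_normed_vector \<Rightarrow> 'a::euclidean_space \<Rightarrow> 'a"
  assumes "open V" "\<And>v. cdiff k (\<lambda>y. A y v) V" "\<And>y. y \<in> V \<Longrightarrow> linear (A y)" "\<And>y. y \<in> V \<Longrightarrow> inj (A y)"
  shows "cdiff k (\<lambda>y. inv (A y) v) V"
  using assms(2)
proof (induction k arbitrary: v)
  case 0
  have "isCont (\<lambda>y. inv (A y) v) x" if "x \<in> V" for x
    unfolding continuous_at
  proof (rule inv_linear_tendsto)
    show "((\<lambda>y. A y v) \<longlongrightarrow> A x v) (at x)" for v
      using 0 that assms(1) by (simp add: continuous_on_eq_continuous_at continuous_at)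
    have "\<forall>\<^sub>F y in at x. y \<in> V" using that assms(1) by (simp add: eventually_at_in_open')
    then show "\<forall>\<^sub>F y in at x. linear (A y) \<and> inj (A y)"
      by eventually_elim (use assms in blast)
  qed (use that assms in auto)
  then show ?case by (simp add: continuous_at_imp_continuous_on)
next
  case (Suc k)
  have low: "cdiff k (\<lambda>y. A y v) V" for v using Suc.prems cdiff_lower by blast
  have IH: "cdiff k (\<lambda>y. inv (A y) v) V" for v using Suc.IH low by blast
  define A' where "A' = (\<lambda>w x. frechet_derivative (\<lambda>y. A y w) (at x))"
  have A': "((\<lambda>y. A y w) has_derivative A' w x) (at x)" if "x \<in> V" for w x
    unfolding A'_def by (rule cdiff_imp_frechet[OF Suc.prems that])
  have A'k: "cdiff k (\<lambda>x. A' w x u) V" for w u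
    unfolding A'_def by (rule cdiff_frechet[OF Suc.prems assms(1)])
  have AA: "A x (inv (A x) w) = w" if "x \<in> V" for x w
    using assms(3,4)[OF that] by (simp add: linear_injective_imp_surjective surj_f_inv_f)
  have lininv: "linear (inv (A x))" if "x \<in> V" for x
    using inj_linear_imp_inv_linear[OF assms(3,4)[OF that]] .
  show ?case
  proof (rule cdiff_SucI[where f'="\<lambda>x u. - (\<Sum>b\<in>Basis. (A' (inv (A x) v) x u \<bullet> b) *\<^sub>R inv (A x) b)"])
    fix x assume x: "x \<in> V"
    define w where "w = inv (A x) v"
    have cont: "isCont (\<lambda>y. inv (A y) b) x" for b
      using cdiff_continuous[OF IH] assms(1) x by (simp add: continuous_on_eq_continuous_at)
    have "((\<lambda>y. \<Sum>b\<in>Basis. ((A x w - A y w) \<bullet> b) *\<^sub>R inv (A y) b) has_derivative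
       (\<lambda>u. \<Sum>b\<in>Basis. ((0 - A' w x u) \<bullet> b) *\<^sub>R inv (A x) b)) (at x)"
      by (intro has_derivative_sum has_derivative_mult_vanishing cont has_derivative_inner_left has_derivative_diff
          has_derivative_const A' x) auto
    then have "((\<lambda>y. w + (\<Sum>b\<in>Basis. ((A x w - A y w) \<bullet> b) *\<^sub>R inv (A y) b)) has_derivative
       (\<lambda>u. - (\<Sum>b\<in>Basis. (A' w x u \<bullet> b) *\<^sub>R inv (A x) b))) (at x)"
      using has_derivative_add[OF has_derivative_const[of w]] by (fastforce simp: sum_negf)
    then show "((\<lambda>y. inv (A y) v) has_derivative (\<lambda>u. - (\<Sum>b\<in>Basis. (A' (inv (A x) v) x u \<bullet> b) *\<^sub>R inv (A x) b))) (at x)"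
      unfolding w_def[symmetric]
    proof (rule has_derivative_transform_within_open[OF _ assms(1) x])
      fix y assume y: "y \<in> V"
      have "(\<Sum>b\<in>Basis. ((A x w - A y w) \<bullet> b) *\<^sub>R inv (A y) b) = inv (A y) (\<Sum>b\<in>Basis. ((A x w - A y w) \<bullet> b) *\<^sub>R b)"
        using lininv[OF y] by (simp add: linear_sum linear_scale)
      also have "\<dots> = inv (A y) (v - A y w)" using AA[OF x] by (simp add: euclidean_representation w_def)
      also have "\<dots> = inv (A y) v - w"
        using lininv[OF y] assms(4)[OF y] by (simp add: linear_diff)
      finally show "w + (\<Sum>b\<in>Basis. ((A x w - A y w) \<bullet> b) *\<^sub>R inv (A y) b) = inv (A y) v" by simp
    qed
  next
    fix u
    have "cdiff k (\<lambda>x. A' (inv (A x) v) x u) V"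
    proof -
      \<comment> \<open>The vector fed to \<open>A\<close> moves with \<open>x\<close>, so this slot
        is expanded in \<open>Basis\<close> as well.\<close>
      have *: "A' (inv (A x) v) x u = (\<Sum>c\<in>Basis. (inv (A x) v \<bullet> c) *\<^sub>R A' c x u)" if x: "x \<in> V" for x
      proof -
        have "((\<lambda>y. \<Sum>c\<in>Basis. (inv (A x) v \<bullet> c) *\<^sub>R A y c) has_derivative (\<lambda>u. \<Sum>c\<in>Basis. (inv (A x) v \<bullet> c) *\<^sub>R A' c x u)) (at x)"
          by (intro has_derivative_sum has_derivative_scaleR_right A' x)
        then have "((\<lambda>y. A y (inv (A x) v)) has_derivative (\<lambda>u. \<Sum>c\<in>Basis. (inv (A x) v \<bullet> c) *\<^sub>R A' c x u)) (at x)"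
        proof (rule has_derivative_transform_within_open[OF _ assms(1) x])
          fix y assume y: "y \<in> V"
          show "(\<Sum>c\<in>Basis. (inv (A x) v \<bullet> c) *\<^sub>R A y c) = A y (inv (A x) v)"
            using linear_sum[OF assms(3)[OF y], of "\<lambda>c. (inv (A x) v \<bullet> c) *\<^sub>R c" Basis]
            by (simp add: euclidean_representation linear_scale[OF assms(3)[OF y]])
        qed
        from has_derivative_unique[OF A'[OF x] this] show ?thesis by metis
      qed
      have "cdiff k (\<lambda>x. \<Sum>c\<in>Basis. (inv (A x) v \<bullet> c) *\<^sub>R A' c x u) V"
        by (intro cdiff_sum cdiff_scaleR cdiff_inner IH cdiff_const A'k)
      then show ?thesis by (rule cdiff_cong[OF assms(1), rotated]) (simp add: *)
    qed
    then show "cdiff k (\<lambda>x. - (\<Sum>b\<in>Basis. (A' (inv (A x) v) x u \<bullet> b) *\<^sub>R inv (A x) b)) V"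
      by (intro cdiff_minus cdiff_sum cdiff_scaleR cdiff_inner IH cdiff_const)
  qed
qed

text \<open>The C^1 inverse has derivative \<open>inv (f' (g y))\<close>, which is C^j if
  \<open>g\<close> is C^j and \<open>f\<close> is C^(j+1); so regularity bootstraps, with one
  \<open>g\<close> and one \<open>V\<close> for all orders.\<close>

lemma cdiff_inverse_function:
  fixes f :: "'a::euclidean_space \<Rightarrow> 'a"
  assumes "open S" "x0 \<in> S" "cdiff 1 f S" "inj (frechet_derivative f (at x0))"
  obtains U V g where "open U" "x0 \<in> U" "U \<subseteq> S" "open V" "f x0 \<in> V" "homeomorphism U V f g"
    "\<And>k. cdiff (Suc k) f S \<Longrightarrow> cdiff (Suc k) g V"
    "\<And>x. x \<in> U \<Longrightarrow> inj (frechet_derivative f (at x))"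
proof -
  define f' where "f' = (\<lambda>x. frechet_derivative f (at x))"
  have f1: "cdiff (Suc 0) f S" using assms(3) by simp
  have der: "(f has_derivative f' x) (at x)" if "x \<in> S" for x
    unfolding f'_def by (rule cdiff_imp_frechet[OF f1 that])
  define F where "F = (\<lambda>x. Blinfun (f' x))"
  have F: "blinfun_apply (F x) = f' x" if "x \<in> S" for x
    unfolding F_def by (rule bounded_linear_Blinfun_apply[OF has_derivative_bounded_linear[OF der[OF that]]])
  obtain h where h: "linear h" "h \<circ> f' x0 = id"
    using linear_injective_left_inverse[of "f' x0"] assms(4) has_derivative_linear[OF der[OF assms(2)]]
    unfolding f'_def by blast
  have contF: "continuous_on S F"
  proof (rule continuous_on_blinfun_componentwise)
    fix i :: 'a
    have "continuous_on S (\<lambda>x. f' x i)"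
      using cdiff_frechet[OF f1 assms(1)] by (simp add: f'_def)
    then show "continuous_on S (\<lambda>x. blinfun_apply (F x) i)"
      by (simp add: F cong: continuous_on_cong)
  qed
  have invf: "Blinfun h o\<^sub>L F x0 = id_blinfun"
    using h by (intro blinfun_eqI)
      (simp add: F[OF assms(2)] bounded_linear_Blinfun_apply linear_conv_bounded_linear o_def id_def fun_eq_iff)
  obtain U V g g' where U: "open U" "U \<subseteq> S" "x0 \<in> U" "open V" "f x0 \<in> V" "homeomorphism U V f g"
    and g: "\<And>y. y \<in> V \<Longrightarrow> (g has_derivative (g' y)) (at y)"
      "\<And>y. y \<in> V \<Longrightarrow> g' y = inv (blinfun_apply (F (g y)))"
      "\<And>y. y \<in> V \<Longrightarrow> bij (blinfun_apply (F (g y)))"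
    using inverse_function_theorem[OF assms(1) _ contF assms(2) invf] der F by metis
  have gV: "g y \<in> S" "g y \<in> U" if "y \<in> V" for y
    using that U by (auto simp: homeomorphism_def)
  have g1: "(g has_derivative inv (f' (g y))) (at y)" "bij (f' (g y))" if "y \<in> V" for y
    using g(1)[OF that] g(2)[OF that] g(3)[OF that] F[OF gV(1)[OF that]] by simp_all
  have inj: "inj (f' x)" if "x \<in> U" for x
    using g1(2)[of "f x"] that U by (auto simp: homeomorphism_def bij_def)
  have "cdiff j g V \<Longrightarrow> cdiff (Suc j) f S \<Longrightarrow> cdiff (Suc j) g V" for j
  proof (rule cdiff_SucI[where f'="\<lambda>y. inv (f' (g y))"])
    assume j: "cdiff j g V" "cdiff (Suc j) f S"
    show "cdiff j (\<lambda>y. inv (f' (g y)) v) V" for v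
    proof (rule cdiff_inv_linear[OF U(4)])
      show "cdiff j (\<lambda>y. f' (g y) v) V" for v
        unfolding f'_def
        by (rule cdiff_compose[OF j(1) cdiff_frechet[OF j(2) assms(1)]]) (use gV in auto)
      show "linear (f' (g y))" "inj (f' (g y))" if "y \<in> V" for y
        using has_derivative_linear[OF der] g1(2) gV that by (auto simp: bij_def)
    qed
  qed (use g1 in auto)
  note step = this
  have "cdiff (Suc k) f S \<Longrightarrow> cdiff (Suc k) g V" for k
  proof (induction k)
    case 0
    have "cdiff 0 g V" using U by (simp add: homeomorphism_def)
    from step[OF this 0] show ?case .
  next
    case (Suc k)
    from Suc.IH[OF cdiff_lower[OF Suc.prems]] Suc.prems show ?case by (rule step)
  qed
  with U inj show ?thesis
    by (intro that[of U V g]) (auto simp: f'_def simp del: cdiff.simps)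
qed

section \<open>Bump functions and divergences\<close>

text \<open>The classical \<open>exp (- 1 / x)\<close> extended by zero, with inverse powers of
  \<open>x\<close> attached: this family is closed under differentiation up to linear
  combinations.\<close>

definition flat :: "nat \<Rightarrow> real \<Rightarrow> real" where
  "flat n x = (if x > 0 then exp (- inverse x) * inverse x ^ n else 0)"

lemma flat_div_tendsto: "((\<lambda>x. flat n x / x) \<longlongrightarrow> 0) (at 0)"
proof -
  have "filterlim inverse at_top (at_right (0::real))" by (rule filterlim_inverse_at_top_right)
  with tendsto_power_div_exp_0[of "Suc n"]
  have "((\<lambda>x::real. inverse x ^ Suc n / exp (inverse x)) \<longlongrightarrow> 0) (at_right 0)"
    by (rule filterlim_compose)
  then have r: "((\<lambda>x. flat n x / x) \<longlongrightarrow> 0) (at_right 0)"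
    by (rule Lim_transform_eventually)
       (auto simp: flat_def eventually_at_filter exp_minus field_simps intro!: always_eventually)
  have l: "((\<lambda>x. flat n x / x) \<longlongrightarrow> 0) (at_left 0)"
    by (rule Lim_transform_eventually[OF tendsto_const])
       (auto simp: flat_def eventually_at_filter)
  show ?thesis using l r by (simp add: filterlim_split_at)
qed

lemma flat_has_derivative:
  "(flat n has_field_derivative (flat (n + 2) x - real n * flat (n + 1) x)) (at x)"
proof (cases x "0::real" rule: linorder_cases)
  case less
  have "((\<lambda>x. 0) has_field_derivative 0) (at x)" by simp
  then have "(flat n has_field_derivative 0) (at x)"
    by (rule has_field_derivative_transform_within_open[where S="{..<0}"]) (use less in \<open>auto simp: flat_def\<close>)
  then show ?thesis using less by (simp add: flat_def)
next
  case equal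
  have "((\<lambda>y. (flat n y - flat n 0) / (y - 0)) \<longlongrightarrow> 0) (at 0)"
    using flat_div_tendsto by (simp add: flat_def[of n 0])
  then show ?thesis using equal by (simp add: has_field_derivative_iff flat_def[of _ 0])
next
  case greater
  have "((\<lambda>x. exp (- inverse x) * inverse x ^ n) has_field_derivative
     exp (- inverse x) * (inverse x * inverse x) * inverse x ^ n
     + exp (- inverse x) * (real n * inverse x ^ (n - 1) * - (inverse x * inverse x))) (at x)"
    using greater by (auto intro!: derivative_eq_intros)
  then have "((\<lambda>x. exp (- inverse x) * inverse x ^ n) has_field_derivative
     exp (- inverse x) * inverse x ^ (n+2) - real n * (exp (- inverse x) * inverse x ^ (n+1))) (at x)"
    by (rule DERIV_cong) (cases n; simp add: algebra_simps)
  then have "(flat n has_field_derivative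
     exp (- inverse x) * inverse x ^ (n+2) - real n * (exp (- inverse x) * inverse x ^ (n+1))) (at x)"
    by (rule has_field_derivative_transform_within_open[where S="{0<..}"]) (use greater in \<open>auto simp: flat_def\<close>)
  then show ?thesis using greater by (simp add: flat_def)
qed

lemma cdiff_flat: "cdiff k (flat n) UNIV"
proof (induction k arbitrary: n)
  case 0
  show ?case using DERIV_isCont[OF flat_has_derivative] by (simp add: continuous_at_imp_continuous_on)
next
  case (Suc k)
  show ?case
  proof (rule cdiff_SucI[where f'="\<lambda>x v. (flat (n + 2) x - real n * flat (n + 1) x) * v"])
    show "(flat n has_derivative (\<lambda>v. (flat (n + 2) x - real n * flat (n + 1) x) * v)) (at x)" for x
      using flat_has_derivative[of n x] unfolding has_field_derivative_def by simp
  qed (intro cdiff_mult cdiff_diff Suc.IH cdiff_const)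
qed

text \<open>A product over coordinates instead of a radial function: it is positive exactly inside a
  coordinate cube, so its support is a \<open>cbox\<close>, the shape of the domains of
  integration.\<close>

definition bump :: "real^'m \<Rightarrow> real \<Rightarrow> real^'m \<Rightarrow> real" where
  "bump c d x = (\<Prod>i\<in>UNIV. flat 0 (d + (x $ i - c $ i)) * flat 0 (d - (x $ i - c $ i)))"

lemma cdiff_bump: "cdiff k (bump c d) S"
proof -
  have "cdiff k (\<lambda>x. flat 0 (d + (x $ i - c $ i))) S" "cdiff k (\<lambda>x. flat 0 (d - (x $ i - c $ i))) S" for i
    by (rule cdiff_compose[OF _ cdiff_flat]; (intro cdiff_add cdiff_diff cdiff_nth cdiff_const cdiff_id)?; simp)+
  then show ?thesis unfolding bump_def by (intro cdiff_prod cdiff_mult)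
qed

lemma flat_nonneg: "flat n x \<ge> 0" by (simp add: flat_def)
lemma flat_pos: "x > 0 \<Longrightarrow> flat n x > 0" by (simp add: flat_def)
lemma flat_zero: "x \<le> 0 \<Longrightarrow> flat n x = 0" by (simp add: flat_def)

lemma bump_nonneg: "bump c d x \<ge> 0"
  unfolding bump_def by (intro prod_nonneg) (simp add: flat_nonneg)

lemma bump_pos: "d > 0 \<Longrightarrow> bump c d c > 0"
  unfolding bump_def by (intro prod_pos) (simp add: flat_pos)

lemma bump_zero: "x \<notin> cbox (c - (\<chi> i. d)) (c + (\<chi> i. d)) \<Longrightarrow> bump c d x = 0"
proof -
  assume "x \<notin> cbox (c - (\<chi> i. d)) (c + (\<chi> i. d))"
  then obtain i where "\<not> ((c - (\<chi> i. d)) $ i \<le> x $ i \<and> x $ i \<le> (c + (\<chi> i. d)) $ i)"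
    unfolding mem_box_cart by blast
  then have "d + (x $ i - c $ i) \<le> 0 \<or> d - (x $ i - c $ i) \<le> 0" by auto
  then have "flat 0 (d + (x $ i - c $ i)) * flat 0 (d - (x $ i - c $ i)) = 0"
    using flat_zero by auto
  then show ?thesis unfolding bump_def by (intro prod_zero) auto
qed

section \<open>Integration by parts and the divergence\<close>

text \<open>Translation invariance: the integral of the translate by \<open>t\<close> times
  \<open>e\<close> over a large box does not depend on \<open>t\<close>; differentiating under the
  integral at \<open>t = 0\<close> gives the claim.\<close>

lemma integral_derivative_compact_support:
  fixes g :: "'a::euclidean_space \<Rightarrow> real"
  assumes g: "cdiff 1 g UNIV" and supp: "\<And>x. x \<notin> cbox a b \<Longrightarrow> g x = 0"
    and "cbox a b \<noteq> {}"
  shows "((\<lambda>x. frechet_derivative g (at x) e) has_integral 0) (cbox a b)"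
proof -
  have g1: "cdiff (Suc 0) g UNIV" using g by simp
  define Dg where "Dg = (\<lambda>x. frechet_derivative g (at x) e)"
  have der: "(g has_derivative frechet_derivative g (at x)) (at x)" for x
    by (rule cdiff_imp_frechet[OF g1]) simp
  have contg: "continuous_on UNIV g" by (rule cdiff_continuous[OF g1])
  have contD: "continuous_on UNIV Dg" using cdiff_frechet[OF g1, of e] by (simp add: Dg_def)
  define N where "N = (\<Sum>i\<in>Basis. (norm e) *\<^sub>R i :: 'a)"
  have N: "N \<bullet> i = norm e" if "i \<in> Basis" for i using that by (simp add: N_def)
  \<comment> \<open>Enlarging the box by \<open>norm e\<close> in every coordinate makes it contain
    all translates with \<open>t\<close> in \<open>{-1..1}\<close>.\<close>
  define A B where "A = a - N" and "B = b + N"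
  obtain i where i: "(g has_integral i) (cbox a b)"
    using integrable_continuous[OF continuous_on_subset[OF contg subset_UNIV]] by blast
  have shift: "((\<lambda>x. g (x + t *\<^sub>R e)) has_integral i) (cbox A B)" if t: "t \<in> {-1..1}" for t
  proof -
    have "((\<lambda>x. g (x + t *\<^sub>R e)) has_integral i) (cbox (a - t *\<^sub>R e) (b - t *\<^sub>R e))"
      using has_integral_affinity'[OF i, of 1 "t *\<^sub>R e"] by simp
    then show ?thesis
    proof (rule has_integral_on_superset)
      have "\<bar>t * (e \<bullet> i)\<bar> \<le> norm e" if "i \<in> Basis" for i
      proof -
        have "\<bar>t\<bar> * \<bar>e \<bullet> i\<bar> \<le> 1 * norm e" using t Basis_le_norm[OF that] by (intro mult_mono) auto
        then show ?thesis by (simp add: abs_mult)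
      qed
      then show "cbox (a - t *\<^sub>R e) (b - t *\<^sub>R e) \<subseteq> cbox A B"
        by (intro subset_box_imp) (fastforce simp: A_def B_def inner_diff_left inner_add_left N abs_le_iff)
      show "g (x + t *\<^sub>R e) = 0" if "x \<notin> cbox (a - t *\<^sub>R e) (b - t *\<^sub>R e)" for x
        using that by (intro supp) (auto simp: mem_box inner_add_left inner_diff_left algebra_simps)
    qed
  qed
  have "((\<lambda>t. integral (cbox A B) (\<lambda>x. g (x + t *\<^sub>R e))) has_vector_derivative
      integral (cbox A B) (\<lambda>x. Dg (x + 0 *\<^sub>R e))) (at 0 within {-1..1})"
  proof (rule leibniz_rule_vector_derivative)
    fix t :: real and x assume "t \<in> {-1..1}" "x \<in> cbox A B"
    have "((\<lambda>t. g (x + t *\<^sub>R e)) has_derivative (\<lambda>h. frechet_derivative g (at (x + t *\<^sub>R e)) (h *\<^sub>R e))) (at t)"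
      by (rule has_derivative_compose[OF _ der]) (auto intro!: derivative_eq_intros)
    then show "((\<lambda>t. g (x + t *\<^sub>R e)) has_vector_derivative Dg (x + t *\<^sub>R e)) (at t within {-1..1})"
      unfolding has_vector_derivative_def Dg_def linear_scale[OF has_derivative_linear[OF der]]
      by (rule has_derivative_at_withinI)
  next
    show "(\<lambda>x. g (x + t *\<^sub>R e)) integrable_on cbox A B" if "t \<in> {-1..1}" for t
      using shift[OF that] by blast
    show "continuous_on ({-1..1} \<times> cbox A B) (\<lambda>(t, x). Dg (x + t *\<^sub>R e))"
      unfolding split_beta by (rule continuous_on_compose2[OF contD]) (auto intro!: continuous_intros)
  qed auto
  moreover have "((\<lambda>t. integral (cbox A B) (\<lambda>x. g (x + t *\<^sub>R e))) has_vector_derivative 0) (at 0 within {-1..1})"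
    by (rule has_vector_derivative_transform[where f="\<lambda>t. i"]) (use shift in \<open>auto simp: integral_unique\<close>)
  ultimately have "integral (cbox A B) (\<lambda>x. Dg (x + 0 *\<^sub>R e)) = 0"
    using vector_derivative_unique_within_closed_interval[of "-1" 1 0] by (simp add: box_real)
  then have "integral (cbox A B) Dg = 0" by simp
  then have "(Dg has_integral 0) (cbox A B)"
    using integrable_continuous[OF continuous_on_subset[OF contD subset_UNIV]] by (metis integrable_integral)
  moreover have "Dg x = 0" if "x \<notin> cbox a b" for x
  proof -
    have "(g has_derivative (\<lambda>v. 0)) (at x)"
      by (rule has_derivative_transform_within_open[OF has_derivative_const open_Compl[OF closed_cbox]])
        (use that supp in auto)
    from has_derivative_unique[OF der this] show ?thesis by (simp add: Dg_def)
  qed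
  moreover have "cbox a b \<subseteq> cbox A B"
    by (intro subset_box_imp) (auto simp: A_def B_def inner_diff_left inner_add_left N)
  ultimately have D: "(Dg has_integral 0) (cbox A B)" "\<And>x. x \<notin> cbox a b \<Longrightarrow> Dg x = 0" and sub: "cbox a b \<subseteq> cbox A B"
    by blast+
  have "((\<lambda>x. if x \<in> cbox a b then Dg x else 0) has_integral 0) (cbox A B)"
    by (rule has_integral_eq[OF _ D(1)]) (simp add: D(2))
  then have "(Dg has_integral 0) (cbox a b)" using has_integral_restrict[OF sub] by blast
  then show ?thesis unfolding Dg_def .
qed

definition dvg :: "(real^'m \<Rightarrow> real^'m) \<Rightarrow> real^'m \<Rightarrow> real" where
  "dvg B x = (\<Sum>i\<in>UNIV. frechet_derivative B (at x) (axis i 1) $ i)"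

text \<open>\<open>B\<close> is controlled on \<open>S\<close> only, so the product is extended by
  zero; it is C^1 everywhere because \<open>\<phi>\<close> vanishes off the box and the closed box
  lies in the open set \<open>S\<close>.\<close>

lemma integration_by_parts:
  fixes B :: "real^'m \<Rightarrow> real^'m"
  assumes phi: "cdiff 1 \<phi> UNIV" and supp: "\<And>x. x \<notin> cbox a b \<Longrightarrow> \<phi> x = 0"
    and S: "open S" "cbox a b \<subseteq> S" "cdiff 1 B S" and "cbox a b \<noteq> {}"
  shows "((\<lambda>x. (\<Sum>i\<in>UNIV. frechet_derivative \<phi> (at x) (axis i 1) * B x $ i) + \<phi> x * dvg B x) has_integral 0) (cbox a b)"
proof -
  have phi1: "cdiff (Suc 0) \<phi> UNIV" and B1: "cdiff (Suc 0) B S" using phi S by simp_all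
  have dphi: "(\<phi> has_derivative frechet_derivative \<phi> (at x)) (at x)" for x
    by (rule cdiff_imp_frechet[OF phi1]) simp
  have dB: "(B has_derivative frechet_derivative B (at x)) (at x)" if "x \<in> S" for x
    by (rule cdiff_imp_frechet[OF B1 that])
  define g where "g = (\<lambda>i x. if x \<in> cbox a b then \<phi> x * B x $ i else 0)"
  have gS: "g i x = \<phi> x * B x $ i" for i x by (simp add: g_def supp)
  have "cdiff 1 (g i) UNIV" for i
  proof (rule cdiff_local)
    fix x :: "real^'m"
    show "\<exists>U. open U \<and> x \<in> U \<and> cdiff 1 (g i) U"
    proof (cases "x \<in> S")
      case True
      have "cdiff 1 (\<lambda>x. \<phi> x * B x $ i) S"
        by (intro cdiff_mult cdiff_nth S) (rule cdiff_subset[OF phi], simp)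
      then have "cdiff 1 (g i) S" by (rule cdiff_cong[OF S(1), rotated]) (simp add: gS)
      with True S show ?thesis by blast
    next
      case False
      have "cdiff 1 (g i) (- cbox a b)"
        by (rule cdiff_cong[OF _ _ cdiff_const[of 1 0]]) (auto simp: g_def)
      moreover have "open (- cbox a b)" by auto
      ultimately show ?thesis using False S(2) by blast
    qed
  qed
  then have "((\<lambda>x. frechet_derivative (g i) (at x) (axis i 1)) has_integral 0) (cbox a b)" for i
    by (rule integral_derivative_compact_support[OF _ _ assms(6)]) (simp add: g_def)
  then have "((\<lambda>x. \<Sum>i\<in>UNIV. frechet_derivative (g i) (at x) (axis i 1)) has_integral (\<Sum>i\<in>(UNIV::'m set). 0)) (cbox a b)"
    by (intro has_integral_sum) auto
  then have "((\<lambda>x. \<Sum>i\<in>UNIV. frechet_derivative (g i) (at x) (axis i 1)) has_integral 0) (cbox a b)"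
    by simp
  then show ?thesis
  proof (rule has_integral_eq[rotated])
    fix x assume "x \<in> cbox a b"
    then have x: "x \<in> S" using S by auto
    have "frechet_derivative (g i) (at x) = (\<lambda>v. \<phi> x * frechet_derivative B (at x) v $ i + frechet_derivative \<phi> (at x) v * B x $ i)" for i
    proof (rule frechet_derivative_at[symmetric])
      show "(g i has_derivative (\<lambda>v. \<phi> x * frechet_derivative B (at x) v $ i + frechet_derivative \<phi> (at x) v * B x $ i)) (at x)"
        unfolding gS[abs_def]
        by (intro has_derivative_mult dphi bounded_linear.has_derivative[OF bounded_linear_vec_nth] dB x)
    qed
    then show "(\<Sum>i\<in>UNIV. frechet_derivative (g i) (at x) (axis i 1)) =
       (\<Sum>i\<in>UNIV. frechet_derivative \<phi> (at x) (axis i 1) * B x $ i) + \<phi> x * dvg B x"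
      by (simp add: dvg_def sum.distrib sum_distrib_left add.commute)
  qed
qed

lemma cdiff_dvg: "cdiff (Suc k) B S \<Longrightarrow> open S \<Longrightarrow> cdiff k (dvg B) S"
  unfolding dvg_def[abs_def] by (intro cdiff_sum cdiff_nth cdiff_frechet)

lemma cbox_cart_shrink:
  fixes c :: "real^'m"
  assumes "open S" "c \<in> S"
  obtains d where "d > 0" "cbox (c - (\<chi> i. d)) (c + (\<chi> i. d)) \<subseteq> S"
proof -
  obtain e where e: "e > 0" "ball c e \<subseteq> S" using openE[OF assms] by metis
  define d where "d = e / (2 * CARD('m))"
  have "cbox (c - (\<chi> i. d)) (c + (\<chi> i. d)) \<subseteq> ball c e"
  proof
    fix x assume x: "x \<in> cbox (c - (\<chi> i. d)) (c + (\<chi> i. d))"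
    have "norm (x - c) \<le> (\<Sum>i\<in>UNIV. \<bar>(x - c) $ i\<bar>)" by (rule norm_le_l1_cart)
    also have "\<dots> \<le> (\<Sum>i\<in>(UNIV::'m set). d)"
      using x by (intro sum_mono) (auto simp: mem_box_cart abs_le_iff algebra_simps)
    also have "\<dots> < e" using e by (simp add: d_def)
    finally show "x \<in> ball c e" by (simp add: dist_norm norm_minus_commute)
  qed
  with e show ?thesis by (intro that[of d]) (auto simp: d_def)
qed

text \<open>The fundamental lemma of the calculus of variations, tested only with bumps centred at
  \<open>c\<close>: a positive divergence at \<open>c\<close> would be positive on a small box and
  be detected by the bump there. The opposite inequality comes from \<open>- B\<close>.\<close>

lemma dvg_eq_0_if_weak_le:
  fixes B :: "real^'m \<Rightarrow> real^'m"
  assumes S: "open S" "cdiff 1 B S" "c \<in> S"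
    and weak: "\<And>d. d > 0 \<Longrightarrow> cbox (c - (\<chi> i. d)) (c + (\<chi> i. d)) \<subseteq> S \<Longrightarrow>
      ((\<lambda>x. \<Sum>i\<in>UNIV. frechet_derivative (bump c d) (at x) (axis i 1) * B x $ i) has_integral 0)
        (cbox (c - (\<chi> i. d)) (c + (\<chi> i. d)))"
  shows "dvg B c \<le> 0"
proof (rule ccontr)
  assume "\<not> ?thesis"
  then have pos: "dvg B c > 0" by simp
  have cont: "continuous_on S (dvg B)" using cdiff_dvg[of 0 B S] S by simp
  have "open {x \<in> S. dvg B x > 0}"
    using continuous_on_open_vimage[OF S(1), THEN iffD1, OF cont, rule_format, of "{0<..}"]
    by (simp add: vimage_def Collect_conj_eq Int_commute inf_set_def)
  then obtain d where d: "d > 0" "cbox (c - (\<chi> i. d)) (c + (\<chi> i. d)) \<subseteq> {x \<in> S. dvg B x > 0}"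
    using cbox_cart_shrink[of "{x \<in> S. dvg B x > 0}" c] S(3) pos by auto
  let ?K = "cbox (c - (\<chi> i. d)) (c + (\<chi> i. d))"
  have cK: "c \<in> box (c - (\<chi> i. d)) (c + (\<chi> i. d))" using d by (auto simp: mem_box_cart)
  then have cK': "c \<in> ?K" using box_subset_cbox by blast
  have KS: "?K \<subseteq> S" using d by auto
  have "((\<lambda>x. (\<Sum>i\<in>UNIV. frechet_derivative (bump c d) (at x) (axis i 1) * B x $ i) + bump c d x * dvg B x) has_integral 0) ?K"
    by (rule integration_by_parts[OF cdiff_bump bump_zero S(1) KS S(2)]) (use cK' in auto)
  from has_integral_diff[OF this weak[OF d(1) KS]]
  have int: "((\<lambda>x. bump c d x * dvg B x) has_integral 0) ?K" by simp
  have "bump c d c * dvg B c = 0"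
  proof (rule has_integral_0_cbox_imp_0[OF _ _ int _ cK'])
    show "continuous_on ?K (\<lambda>x. bump c d x * dvg B x)"
      by (intro continuous_on_mult cdiff_continuous[OF cdiff_bump] continuous_on_subset[OF cont KS])
    show "0 \<le> bump c d x * dvg B x" if "x \<in> box (c - (\<chi> i. d)) (c + (\<chi> i. d))" for x
      using subsetD[OF d(2) subsetD[OF box_subset_cbox that]] by (intro mult_nonneg_nonneg bump_nonneg) auto
    show "box (c - (\<chi> i. d)) (c + (\<chi> i. d)) \<noteq> {}" using cK by blast
  qed
  with bump_pos[OF d(1), of c] pos show False by simp
qed

lemma dvg_minus: "B differentiable (at x) \<Longrightarrow> dvg (\<lambda>x. - B x) x = - dvg B x"
proof -
  assume "B differentiable (at x)"
  then have "(B has_derivative frechet_derivative B (at x)) (at x)" by (simp add: frechet_derivative_works)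
  then have "((\<lambda>x. - B x) has_derivative (\<lambda>v. - frechet_derivative B (at x) v)) (at x)"
    by (rule has_derivative_minus)
  from frechet_derivative_at[OF this, symmetric] show ?thesis by (simp add: dvg_def sum_negf)
qed

lemma dvg_eq_0_if_weak:
  fixes B :: "real^'m \<Rightarrow> real^'m"
  assumes S: "open S" "cdiff 1 B S" "c \<in> S"
    and weak: "\<And>d. d > 0 \<Longrightarrow> cbox (c - (\<chi> i. d)) (c + (\<chi> i. d)) \<subseteq> S \<Longrightarrow>
      ((\<lambda>x. \<Sum>i\<in>UNIV. frechet_derivative (bump c d) (at x) (axis i 1) * B x $ i) has_integral 0)
        (cbox (c - (\<chi> i. d)) (c + (\<chi> i. d)))"
  shows "dvg B c = 0"
proof (rule antisym)
  show "dvg B c \<le> 0" by (rule dvg_eq_0_if_weak_le[OF S weak])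
  have "dvg (\<lambda>x. - B x) c \<le> 0"
  proof (rule dvg_eq_0_if_weak_le[OF S(1) cdiff_minus[OF S(2)] S(3)])
    fix d :: real assume d: "d > 0" "cbox (c - (\<chi> i. d)) (c + (\<chi> i. d)) \<subseteq> S"
    show "((\<lambda>x. \<Sum>i\<in>UNIV. frechet_derivative (bump c d) (at x) (axis i 1) * (- B x) $ i) has_integral 0)
        (cbox (c - (\<chi> i. d)) (c + (\<chi> i. d)))"
      using has_integral_neg[OF weak[OF d]] by (simp add: sum_negf)
  qed
  moreover have "B differentiable (at c)" using S by (auto simp: differentiable_def)
  ultimately show "0 \<le> dvg B c" by (simp add: dvg_minus)
qed

declare cdiff.simps(2) [simp del]

lemma cdiff_1_has_derivative:
  assumes "cdiff 1 f S" "x \<in> S"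
  shows "(f has_derivative frechet_derivative f (at x)) (at x)"
  using cdiff_imp_frechet[of 0 f S x] assms by simp

lemma cdiff_1_differentiable: "cdiff 1 f S \<Longrightarrow> x \<in> S \<Longrightarrow> f differentiable (at x)"
  using cdiff_1_has_derivative differentiable_def by blast

lemma dvg_scale:
  fixes A :: "real^'m \<Rightarrow> real^'m"
  assumes "A differentiable (at (e *\<^sub>R x))"
  shows "dvg (\<lambda>x. A (e *\<^sub>R x)) x = e * dvg A (e *\<^sub>R x)"
proof -
  have A: "(A has_derivative frechet_derivative A (at (e *\<^sub>R x))) (at (e *\<^sub>R x))"
    using assms by (simp add: frechet_derivative_works)
  have "((\<lambda>x. A (e *\<^sub>R x)) has_derivative (\<lambda>v. frechet_derivative A (at (e *\<^sub>R x)) (e *\<^sub>R v))) (at x)"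
    by (rule has_derivative_compose[where f="\<lambda>x. e *\<^sub>R x" and g=A, OF _ A]) (auto intro!: derivative_eq_intros)
  from frechet_derivative_at[OF this, symmetric] show ?thesis
    by (simp add: dvg_def sum_distrib_left linear_scale[OF has_derivative_linear[OF A]])
qed

section \<open>Half cubes and limits at the face\<close>

text \<open>Balls of the maximum norm: making one coordinate smaller in absolute value never leaves
  them, so a point can be moved to a face independently of its other coordinates.\<close>

definition cube :: "real \<Rightarrow> (real^'m) set" where
  "cube d = {y. \<forall>i. \<bar>y $ i\<bar> < d}"

definition hcube :: "'m \<Rightarrow> real \<Rightarrow> (real^'m) set" where
  "hcube \<nu> d = {y \<in> cube d. 0 < y $ \<nu>}"

lemma open_cube: "open (cube d)"
proof -
  have "cube d = (\<Inter>i\<in>UNIV. {y::real^'a. \<bar>y $ i\<bar> < d})" by (auto simp: cube_def)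
  moreover have "open {y::real^'a. \<bar>y $ i\<bar> < d}" for i
    by (intro open_Collect_less continuous_intros)
  ultimately show ?thesis by (simp add: open_INT)
qed

lemma open_hcube: "open (hcube \<nu> d)"
  unfolding hcube_def Collect_conj_eq Collect_mem_eq
  by (intro open_Int open_cube open_Collect_less continuous_intros)

lemma convex_cube: "convex (cube d :: (real^'m) set)"
proof -
  have "cube d = box (- (\<chi> i. d)) (\<chi> i. d :: real^'m)"
    by (auto simp: cube_def mem_box_cart abs_less_iff minus_less_iff)
  then show ?thesis by simp
qed

text \<open>Testing \<open>div A = u / y\<^sub>\<nu>\<close> against a bump function rescaled to size \<open>\<epsilon>\<close> inside the half cube, both sides scale
  alike; in the limit \<open>\<epsilon> \<rightarrow> 0\<close> the constant \<open>A0\<close> drops out and \<open>u0\<close> times a positive integral remains.\<close>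
lemma boundary_limit_zero:
  fixes A :: "real^'m \<Rightarrow> real^'m" and \<nu> :: 'm
  assumes "d > 0" and A: "cdiff 1 A (hcube \<nu> d)" and div: "\<And>y. y \<in> hcube \<nu> d \<Longrightarrow> dvg A y = u y / y $ \<nu>"
    and limA: "(A \<longlongrightarrow> A0) (at 0 within hcube \<nu> d)" and limu: "(u \<longlongrightarrow> u0) (at 0 within hcube \<nu> d)"
  shows "u0 = 0"
proof -
  \<comment> \<open>The cube of half side 1 around this point keeps away from the face: there the
    \<nu>-coordinate is at least 2, and all coordinates are at most 4 in absolute value.\<close>
  define c :: "real^'m" where "c = axis \<nu> 3"
  let ?K = "cbox (c - (\<chi> i. 1)) (c + (\<chi> i. 1))"
  define \<phi> where "\<phi> = bump c 1"
  have cK: "c \<in> box (c - (\<chi> i. 1)) (c + (\<chi> i. 1))" by (auto simp: mem_box_cart)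
  then have cK': "c \<in> ?K" using box_subset_cbox by blast
  have K1: "x $ \<nu> \<ge> 2" "\<bar>x $ i\<bar> \<le> 4" if "x \<in> ?K" for x i
  proof -
    have "c $ i - 1 \<le> x $ i \<and> x $ i \<le> c $ i + 1" for i using that by (simp add: mem_box_cart)
    from this[of \<nu>] this[of i] show "x $ \<nu> \<ge> 2" "\<bar>x $ i\<bar> \<le> 4" by (auto simp: c_def axis_def split: if_splits)
  qed
  define D where "D = (\<lambda>i x. frechet_derivative \<phi> (at x) (axis i 1))"
  have contD: "continuous_on ?K (D i)" for i
    unfolding D_def \<phi>_def using cdiff_frechet[OF cdiff_bump[of "Suc 0"] open_UNIV]
    by (auto intro: continuous_on_subset)
  have cont\<phi>: "continuous_on ?K \<phi>" unfolding \<phi>_def using cdiff_continuous[OF cdiff_bump] .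
  have contq: "continuous_on ?K (\<lambda>x. \<phi> x / x $ \<nu>)"
    using K1(1) by (intro continuous_intros cont\<phi>) force
  define w where "w = (\<lambda>e x. (\<Sum>i\<in>UNIV. D i x * A (e *\<^sub>R x) $ i) + \<phi> x / x $ \<nu> * u (e *\<^sub>R x))"
  \<comment> \<open>Since coordinates on the box are at most 4, \<open>e < d / 5\<close> keeps the
    scaled box inside the cube. The factor \<open>e\<close> of the chain rule cancels against the
    \<open>e\<close> in the denominator of \<open>u / y $ \<nu>\<close>.\<close>
  have w: "(w e has_integral 0) ?K" if e: "0 < e" "e < d / 5" for e
  proof -
    define H where "H = {x. e *\<^sub>R x \<in> hcube \<nu> d}"
    have KH: "?K \<subseteq> H"
    proof
      fix x assume x: "x \<in> ?K"
      have "e * \<bar>x $ i\<bar> < d" for i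
      proof -
        have "e * \<bar>x $ i\<bar> \<le> e * 4" using K1(2)[OF x] e by (intro mult_left_mono) auto
        with e show ?thesis by linarith
      qed
      moreover have "0 < e * x $ \<nu>" using K1(1)[OF x] e by simp
      ultimately show "x \<in> H" using e by (simp add: H_def hcube_def cube_def abs_mult)
    qed
    have "open ((\<lambda>x. e *\<^sub>R x) -` hcube \<nu> d)"
      by (intro continuous_open_vimage open_hcube continuous_intros)
    then have oH: "open H" by (simp add: H_def vimage_def)
    have AH: "cdiff 1 (\<lambda>x. A (e *\<^sub>R x)) H"
      by (rule cdiff_compose[OF _ A]) (simp only: cdiff_linear bounded_linear_scaleR_right, auto simp: H_def)
    have "((\<lambda>x. (\<Sum>i\<in>UNIV. D i x * A (e *\<^sub>R x) $ i) + \<phi> x * dvg (\<lambda>x. A (e *\<^sub>R x)) x) has_integral 0) ?K"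
      unfolding D_def \<phi>_def
      by (rule integration_by_parts[OF cdiff_bump bump_zero oH KH AH]) (use cK' in auto)
    then show ?thesis
    proof (rule has_integral_eq[rotated])
      fix x assume x: "x \<in> ?K"
      then have h: "e *\<^sub>R x \<in> hcube \<nu> d" using KH by (auto simp: H_def)
      have "A differentiable (at (e *\<^sub>R x))" by (rule cdiff_1_differentiable[OF A h])
      then have "dvg (\<lambda>x. A (e *\<^sub>R x)) x = u (e *\<^sub>R x) / x $ \<nu>"
        using e by (simp add: dvg_scale div[OF h])
      then show "(\<Sum>i\<in>UNIV. D i x * A (e *\<^sub>R x) $ i) + \<phi> x * dvg (\<lambda>x. A (e *\<^sub>R x)) x = w e x"
        by (simp add: w_def)
    qed
  qed
  define w0 where "w0 = (\<lambda>x. (\<Sum>i\<in>UNIV. D i x * A0 $ i) + \<phi> x / x $ \<nu> * u0)"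
  have "continuous_on ?K w0" unfolding w0_def by (intro continuous_intros contD contq)
  then have w0i: "w0 integrable_on ?K" by (rule integrable_continuous)
  have "compact ?K" by simp
  have bdd: "\<exists>M>0. \<forall>x\<in>?K. \<bar>f x\<bar> \<le> M" if "continuous_on ?K f" for f :: "real^'m \<Rightarrow> real"
    using compact_imp_bounded[OF compact_continuous_image[OF that compact_cbox]]
    by (auto simp: bounded_pos)
  have "\<exists>M. \<forall>i. 0 < M i \<and> (\<forall>x\<in>?K. \<bar>D i x\<bar> \<le> M i)" using bdd[OF contD] by (intro choice) blast
  then obtain M where M: "\<And>i. 0 < M i" "\<And>i x. x \<in> ?K \<Longrightarrow> \<bar>D i x\<bar> \<le> M i" by blast
  obtain N where N: "0 < N" "\<And>x. x \<in> ?K \<Longrightarrow> \<bar>\<phi> x / x $ \<nu>\<bar> \<le> N" using bdd[OF contq] by blast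
  define C where "C = (\<Sum>i\<in>UNIV. M i) + N"
  have "C > 0" unfolding C_def using M(1) N(1) by (simp add: add_nonneg_pos sum_nonneg less_imp_le)
  have I0: "integral ?K w0 = 0"
  proof (rule ccontr)
    assume ne: "integral ?K w0 \<noteq> 0"
    define V where "V = measure lborel ?K"
    have "V \<ge> 0" by (simp add: V_def)
    \<comment> \<open>Chosen so that an error of \<open>C * r\<close> over volume \<open>V\<close>
      integrates to less than the supposedly nonzero integral; \<open>V + 1\<close> avoids dividing
      by a volume not yet known to be positive.\<close>
    define r where "r = \<bar>integral ?K w0\<bar> / (2 * C * (V + 1))"
    have "r > 0" using ne \<open>C > 0\<close> \<open>V \<ge> 0\<close> by (simp add: r_def)
    have "\<forall>\<^sub>F y in at 0 within hcube \<nu> d. dist (A y) A0 < r \<and> dist (u y) u0 < r"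
      using tendstoD[OF limA \<open>r>0\<close>] tendstoD[OF limu \<open>r>0\<close>] by (rule eventually_conj)
    then obtain s where s: "s > 0" "\<And>y. y \<in> hcube \<nu> d \<Longrightarrow> y \<noteq> 0 \<Longrightarrow> norm y < s \<Longrightarrow> norm (A y - A0) < r \<and> \<bar>u y - u0\<bar> < r"
      unfolding eventually_at by (auto simp: dist_norm)
    obtain R where R: "R > 0" "\<And>x. x \<in> ?K \<Longrightarrow> norm x \<le> R"
      using bounded_cbox by (metis bounded_pos)
    define e where "e = min (d / 6) (s / (2 * R))"
    have e: "0 < e" "e < d / 5" "e * R < s"
      using \<open>d>0\<close> s R by (auto simp: e_def min_def field_simps)
    have diff: "norm (w0 x - w e x) \<le> C * r" if x: "x \<in> ?K" for x
    proof -
      have "norm x \<le> R" using R x by blast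
      have ex: "e *\<^sub>R x \<in> hcube \<nu> d"
      proof -
        have "e * \<bar>x $ i\<bar> < d" for i
        proof -
          have "e * \<bar>x $ i\<bar> \<le> e * 4" using K1(2)[OF x] e by (intro mult_left_mono) auto
          with e show ?thesis by linarith
        qed
        moreover have "0 < e * x $ \<nu>" using K1(1)[OF x] e by simp
        ultimately show ?thesis using e by (simp add: hcube_def cube_def abs_mult)
      qed
      then have "e *\<^sub>R x \<noteq> 0" by (auto simp: hcube_def)
      moreover have "norm (e *\<^sub>R x) < s"
      proof -
        have "e * norm x \<le> e * R" using \<open>norm x \<le> R\<close> e by (intro mult_left_mono) auto
        also have "\<dots> < s" by (rule e(3))
        finally show ?thesis using e by simp
      qed
      ultimately have n: "norm (A (e *\<^sub>R x) - A0) < r" "\<bar>u (e *\<^sub>R x) - u0\<bar> < r" using s ex by auto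
      have n': "\<bar>A0 $ i - A (e *\<^sub>R x) $ i\<bar> \<le> r" for i
        using component_le_norm_cart[of "A (e *\<^sub>R x) - A0" i] n by auto
      have "w0 x - w e x = (\<Sum>i\<in>UNIV. D i x * (A0 $ i - A (e *\<^sub>R x) $ i)) + \<phi> x / x $ \<nu> * (u0 - u (e *\<^sub>R x))"
        by (simp add: w0_def w_def sum_subtractf right_diff_distrib)
      also have "\<bar>\<dots>\<bar> \<le> (\<Sum>i\<in>UNIV. M i * r) + N * r"
      proof (rule order_trans[OF abs_triangle_ineq add_mono])
        show "\<bar>\<Sum>i\<in>UNIV. D i x * (A0 $ i - A (e *\<^sub>R x) $ i)\<bar> \<le> (\<Sum>i\<in>UNIV. M i * r)"
        proof (rule order_trans[OF sum_abs sum_mono])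
          fix i show "\<bar>D i x * (A0 $ i - A (e *\<^sub>R x) $ i)\<bar> \<le> M i * r"
            unfolding abs_mult using M(2)[OF x] n' M(1)[of i] by (intro mult_mono) (auto intro: less_imp_le)
        qed
        have "\<bar>\<phi> x / x $ \<nu>\<bar> * \<bar>u0 - u (e *\<^sub>R x)\<bar> \<le> N * r"
          using N(2)[OF x] n N(1) by (intro mult_mono) (auto intro: less_imp_le)
        then show "\<bar>\<phi> x / x $ \<nu> * (u0 - u (e *\<^sub>R x))\<bar> \<le> N * r" by (simp only: abs_mult)
      qed
      finally show ?thesis by (simp add: C_def sum_distrib_right distrib_right)
    qed
    have "((\<lambda>x. w0 x - w e x) has_integral (integral ?K w0 - 0)) ?K"
      by (intro has_integral_diff w e integrable_integral w0i)
    from has_integral_bound[OF _ this diff] have "\<bar>integral ?K w0\<bar> \<le> C * r * V"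
      using \<open>C>0\<close> \<open>r>0\<close> by (simp add: V_def)
    also have "\<dots> = \<bar>integral ?K w0\<bar> * (V / (2 * (V + 1)))"
      using \<open>C > 0\<close> \<open>V \<ge> 0\<close> by (simp add: r_def)
    also have "\<dots> < \<bar>integral ?K w0\<bar> * 1"
      using ne \<open>V \<ge> 0\<close> by (intro mult_strict_left_mono) auto
    finally show False by simp
  qed
  \<comment> \<open>The constant field \<open>A0\<close> is divergence free, so its pairing with the
    gradient of the bump integrates to zero.\<close>
  have "((\<lambda>x. (\<Sum>i\<in>UNIV. D i x * A0 $ i) + \<phi> x * dvg (\<lambda>x. A0) x) has_integral 0) ?K"
    unfolding D_def \<phi>_def
    by (rule integration_by_parts[OF cdiff_bump bump_zero open_UNIV _ cdiff_const]) (use cK' in auto)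
  moreover have "dvg (\<lambda>x. A0) x = 0" for x by (simp add: dvg_def frechet_derivative_const)
  moreover have "(w0 has_integral 0) ?K" using w0i I0 by (metis integrable_integral)
  ultimately have "((\<lambda>x. w0 x - (\<Sum>i\<in>UNIV. D i x * A0 $ i)) has_integral 0 - 0) ?K"
    by (intro has_integral_diff) auto
  then have Z: "((\<lambda>x. u0 * (\<phi> x / x $ \<nu>)) has_integral 0) ?K" by (simp add: w0_def mult.commute)
  show ?thesis
  proof (rule ccontr)
    assume "u0 \<noteq> 0"
    with has_integral_mult_right[OF Z, of "inverse u0"]
    have "((\<lambda>x. \<phi> x / x $ \<nu>) has_integral 0) ?K" by (simp add: mult.assoc[symmetric] del: times_divide_eq_right)
    moreover have "0 \<le> \<phi> x / x $ \<nu>" if "x \<in> box (c - (\<chi> i. 1)) (c + (\<chi> i. 1))" for x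
      using K1(1)[OF subsetD[OF box_subset_cbox that]] bump_nonneg[of c 1 x] by (auto simp: \<phi>_def)
    moreover have "box (c - (\<chi> i. 1)) (c + (\<chi> i. 1)) \<noteq> {}" using cK by blast
    ultimately have "\<phi> c / c $ \<nu> = 0" by (intro has_integral_0_cbox_imp_0[OF contq _ _ _ cK'])
    then show False using bump_pos[of 1 c] by (simp add: \<phi>_def c_def axis_def)
  qed
qed

section \<open>Second derivatives and quotients by a coordinate\<close>

text \<open>The mean value theorem twice, in direction \<open>u\<close> for the increment along
  \<open>v\<close> and then in direction \<open>v\<close>. The second difference on the left is
  symmetric in \<open>u\<close> and \<open>v\<close>, from which the symmetry of second derivatives
  follows.\<close>

lemma second_difference:
  fixes g :: "'a::euclidean_space \<Rightarrow> real"
  assumes g: "cdiff 2 g S" and S: "open S" and h: "h > 0"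
    and sub: "\<And>s r. \<lbrakk>0 \<le> s; s \<le> h; 0 \<le> r; r \<le> h\<rbrakk> \<Longrightarrow> x + s *\<^sub>R u + r *\<^sub>R v \<in> S"
  shows "\<exists>s r. 0 \<le> s \<and> s \<le> h \<and> 0 \<le> r \<and> r \<le> h \<and>
    g (x + h *\<^sub>R u + h *\<^sub>R v) - g (x + h *\<^sub>R u) - g (x + h *\<^sub>R v) + g x =
    h^2 * frechet_derivative (\<lambda>y. frechet_derivative g (at y) u) (at (x + s *\<^sub>R u + r *\<^sub>R v)) v"
proof -
  have g2: "cdiff (Suc (Suc 0)) g S" using g by (simp only: numeral_2_eq_2)
  have dg: "(g has_derivative frechet_derivative g (at y)) (at y)" if "y \<in> S" for y
    by (rule cdiff_imp_frechet[OF g2 that])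
  define Dg where "Dg = (\<lambda>y. frechet_derivative g (at y) u)"
  have Dg1: "cdiff (Suc 0) Dg S" unfolding Dg_def by (rule cdiff_frechet[OF g2 S])
  have dDg: "(Dg has_derivative frechet_derivative Dg (at y)) (at y)" if "y \<in> S" for y
    by (rule cdiff_imp_frechet[OF Dg1 that])
  have line: "((\<lambda>s. f (a + s *\<^sub>R w)) has_field_derivative f' w) (at s)"
    if "(f has_derivative f') (at (a + s *\<^sub>R w))" for f :: "'a \<Rightarrow> real" and f' a w s
  proof -
    have "((\<lambda>s. f (a + s *\<^sub>R w)) has_derivative (\<lambda>t. f' (t *\<^sub>R w))) (at s)"
      by (rule has_derivative_compose[where f="\<lambda>s. a + s *\<^sub>R w" and g=f, OF _ that]) (auto intro!: derivative_eq_intros)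
    moreover have "(\<lambda>t. f' (t *\<^sub>R w)) = (*) (f' w)"
      by (rule ext) (simp add: linear_scale[OF has_derivative_linear[OF that]])
    ultimately show ?thesis by (simp add: has_field_derivative_def)
  qed
  define p where "p = (\<lambda>s. g (x + h *\<^sub>R v + s *\<^sub>R u) - g (x + s *\<^sub>R u))"
  have "\<exists>s. s > 0 \<and> s < h \<and> p h - p 0 = (h - 0) * (Dg (x + h *\<^sub>R v + s *\<^sub>R u) - Dg (x + s *\<^sub>R u))"
  proof (rule MVT2[OF h])
    fix s assume s: "0 \<le> s" "s \<le> h"
    have "x + h *\<^sub>R v + s *\<^sub>R u \<in> S" "x + s *\<^sub>R u \<in> S" using sub[OF s, of h] sub[OF s, of 0] h by (auto simp: algebra_simps)
    then show "(p has_real_derivative Dg (x + h *\<^sub>R v + s *\<^sub>R u) - Dg (x + s *\<^sub>R u)) (at s)"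
      unfolding p_def Dg_def by (intro DERIV_diff line dg)
  qed
  then obtain s where s: "0 < s" "s < h" "p h - p 0 = h * (Dg (x + h *\<^sub>R v + s *\<^sub>R u) - Dg (x + s *\<^sub>R u))" by auto
  have "\<exists>r. r > 0 \<and> r < h \<and> Dg (x + s *\<^sub>R u + h *\<^sub>R v) - Dg (x + s *\<^sub>R u + 0 *\<^sub>R v) =
      (h - 0) * frechet_derivative Dg (at (x + s *\<^sub>R u + r *\<^sub>R v)) v"
    by (rule MVT2[OF h], rule line, rule dDg) (use sub s in auto)
  then obtain r where r: "0 < r" "r < h" "Dg (x + s *\<^sub>R u + h *\<^sub>R v) - Dg (x + s *\<^sub>R u) =
      h * frechet_derivative Dg (at (x + s *\<^sub>R u + r *\<^sub>R v)) v" by auto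
  have "g (x + h *\<^sub>R u + h *\<^sub>R v) - g (x + h *\<^sub>R u) - g (x + h *\<^sub>R v) + g x = p h - p 0"
    by (simp add: p_def add.commute add.left_commute)
  also have "\<dots> = h^2 * frechet_derivative Dg (at (x + s *\<^sub>R u + r *\<^sub>R v)) v"
    using s(3) r(3) by (simp add: power2_eq_square add.commute add.left_commute)
  finally show ?thesis unfolding Dg_def using s r by (intro exI[of _ s] exI[of _ r]) auto
qed

lemma second_derivative_symmetric:
  fixes g :: "'a::euclidean_space \<Rightarrow> real"
  assumes g: "cdiff 2 g S" and S: "open S" "x \<in> S"
  shows "frechet_derivative (\<lambda>y. frechet_derivative g (at y) u) (at x) v =
         frechet_derivative (\<lambda>y. frechet_derivative g (at y) v) (at x) u"
proof -
  define D where "D = (\<lambda>u v x. frechet_derivative (\<lambda>y. frechet_derivative g (at y) u) (at x) v)"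
  have g2: "cdiff (Suc (Suc 0)) g S" using g by (simp only: numeral_2_eq_2)
  have contD: "continuous_on S (D u v)" for u v
    unfolding D_def using cdiff_frechet[OF cdiff_frechet[OF g2 S(1)] S(1)] by simp
  have "\<bar>D u v x - D v u x\<bar> \<le> 2 * e" if "e > 0" for e
  proof -
    have "\<forall>\<^sub>F y in nhds x. y \<in> S \<and> dist (D u v y) (D u v x) < e \<and> dist (D v u y) (D v u x) < e"
    proof (intro eventually_conj)
      show "\<forall>\<^sub>F y in nhds x. y \<in> S" using S by (simp add: eventually_nhds_in_open)
      have "(D a b \<longlongrightarrow> D a b x) (nhds x)" for a b
        using contD[of a b] S by (simp add: continuous_on_eq_continuous_at continuous_at tendsto_at_iff_tendsto_nhds)
      from tendstoD[OF this \<open>e>0\<close>]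
      show "\<forall>\<^sub>F y in nhds x. dist (D u v y) (D u v x) < e" "\<forall>\<^sub>F y in nhds x. dist (D v u y) (D v u x) < e"
        by this+
    qed
    then obtain d where d: "d > 0" "\<And>y. dist y x < d \<Longrightarrow> y \<in> S \<and> dist (D u v y) (D u v x) < e \<and> dist (D v u y) (D v u x) < e"
      unfolding eventually_nhds_metric by blast
    define N where "N = norm u + norm v + 1"
    have N: "N > 0" unfolding N_def using norm_ge_zero[of u] norm_ge_zero[of v] by linarith
    define h where "h = d / 2 / N"
    have h: "h > 0" "h * (norm u + norm v) < d"
    proof -
      show "h > 0" using d N by (simp add: h_def)
      have "h * (norm u + norm v) \<le> h * N" using \<open>h > 0\<close> by (intro mult_left_mono) (auto simp: N_def)
      also have "h * N = d / 2" using N by (simp add: h_def)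
      also have "\<dots> < d" using d by simp
      finally show "h * (norm u + norm v) < d" .
    qed
    have near: "dist (x + s *\<^sub>R u + r *\<^sub>R v) x < d" if "0 \<le> s" "s \<le> h" "0 \<le> r" "r \<le> h" for s r
    proof -
      have "norm (s *\<^sub>R u + r *\<^sub>R v) \<le> s * norm u + r * norm v"
        using norm_triangle_ineq[of "s *\<^sub>R u" "r *\<^sub>R v"] that by simp
      also have "\<dots> \<le> h * norm u + h * norm v" using that by (intro add_mono mult_right_mono) auto
      finally show ?thesis using h by (simp add: dist_norm distrib_left add.assoc)
    qed
    obtain s r where 1: "0 \<le> s" "s \<le> h" "0 \<le> r" "r \<le> h"
      "g (x + h *\<^sub>R u + h *\<^sub>R v) - g (x + h *\<^sub>R u) - g (x + h *\<^sub>R v) + g x = h^2 * D u v (x + s *\<^sub>R u + r *\<^sub>R v)"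
      using second_difference[OF g S(1) h(1), of x u v] near d unfolding D_def by blast
    have near': "dist (x + r *\<^sub>R v + s *\<^sub>R u) x < d" if "0 \<le> s" "s \<le> h" "0 \<le> r" "r \<le> h" for s r
      using near[OF that] by (simp add: add.commute add.left_commute)
    obtain s' r' where 2: "0 \<le> s'" "s' \<le> h" "0 \<le> r'" "r' \<le> h"
      "g (x + h *\<^sub>R v + h *\<^sub>R u) - g (x + h *\<^sub>R v) - g (x + h *\<^sub>R u) + g x = h^2 * D v u (x + s' *\<^sub>R v + r' *\<^sub>R u)"
      using second_difference[OF g S(1) h(1), of x v u] near' d unfolding D_def by blast
    have "h^2 * D u v (x + s *\<^sub>R u + r *\<^sub>R v) = h^2 * D v u (x + s' *\<^sub>R v + r' *\<^sub>R u)"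
    proof -
      have "x + h *\<^sub>R v + h *\<^sub>R u = x + h *\<^sub>R u + h *\<^sub>R v" by simp
      from 1(5) 2(5)[unfolded this] show ?thesis by linarith
    qed
    then have "D u v (x + s *\<^sub>R u + r *\<^sub>R v) = D v u (x + s' *\<^sub>R v + r' *\<^sub>R u)" using h by simp
    moreover have "dist (D u v (x + s *\<^sub>R u + r *\<^sub>R v)) (D u v x) < e" using d near 1 by blast
    moreover have "dist (D v u (x + s' *\<^sub>R v + r' *\<^sub>R u)) (D v u x) < e" using d near' 2 by blast
    ultimately show ?thesis by (simp add: dist_real_def)
  qed
  from this[of "\<bar>D u v x - D v u x\<bar> / 3"] have "D u v x = D v u x" by (cases "D u v x = D v u x") auto
  then show ?thesis by (simp add: D_def)
qed

text \<open>The approach to \<open>c\<close> is arbitrary, not only along the normal. Each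
  \<open>y\<close> is joined to its foot on the face, where \<open>h\<close> vanishes, and the mean
  value inequality on that segment compares \<open>h y\<close> with \<open>y $ \<nu>\<close> times
  the derivative at \<open>c\<close>.\<close>

lemma quotient_tendsto_derivative:
  fixes h :: "real^'m \<Rightarrow> 'b::real_normed_vector"
  assumes h: "cdiff 1 h (cube d)" and zero: "\<And>y. y \<in> cube d \<Longrightarrow> y $ \<nu> = 0 \<Longrightarrow> h y = 0"
    and c: "c \<in> cube d" "c $ \<nu> = 0"
  shows "((\<lambda>y. h y /\<^sub>R y $ \<nu>) \<longlongrightarrow> frechet_derivative h (at c) (axis \<nu> 1)) (at c within {y. y $ \<nu> \<noteq> 0})"
proof (rule tendstoI)
  fix e :: real assume "e > 0"
  have h1: "cdiff (Suc 0) h (cube d)" using h by simp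
  define D where "D = (\<lambda>y. frechet_derivative h (at y) (axis \<nu> 1))"
  have "continuous_on (cube d) D" unfolding D_def using cdiff_frechet[OF h1 open_cube] by simp
  then have "(D \<longlongrightarrow> D c) (nhds c)"
    using c open_cube by (metis continuous_on_eq_continuous_at continuous_at tendsto_at_iff_tendsto_nhds)
  then have "\<forall>\<^sub>F y in nhds c. dist (D y) (D c) < e / 2" using \<open>e>0\<close> by (intro tendstoD) auto
  moreover have "\<forall>\<^sub>F y in nhds c. y \<in> cube d" by (rule eventually_nhds_in_open[OF open_cube c(1)])
  ultimately have "\<forall>\<^sub>F y in nhds c. y \<in> cube d \<and> dist (D y) (D c) < e / 2" by eventually_elim auto
  then obtain r where r: "r > 0" "\<And>y. dist y c < r \<Longrightarrow> y \<in> cube d \<and> dist (D y) (D c) < e / 2"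
    unfolding eventually_nhds_metric by blast
  have "dist (h y /\<^sub>R y $ \<nu>) (D c) < e" if y: "y $ \<nu> \<noteq> 0" "dist y c < r" for y
  proof -
    define y0 where "y0 = (\<lambda>t. y + (t - y $ \<nu>) *\<^sub>R axis \<nu> 1)"
    have y0o: "y0 t $ \<nu> = t" for t by (simp add: y0_def axis_def)
    have y0': "y0 t $ i = y $ i" if "i \<noteq> \<nu>" for t i using that by (simp add: y0_def axis_def)
    have y0y: "y0 (y $ \<nu>) = y" by (simp add: y0_def)
    have near: "dist (y0 t) c < r" if t: "t \<in> closed_segment 0 (y $ \<nu>)" for t
    proof -
      have at: "\<bar>t\<bar> \<le> \<bar>y $ \<nu>\<bar>" using t by (auto simp: closed_segment_eq_real_ivl split: if_splits)
      have "norm (y0 t - c) \<le> norm (y - c)"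
      proof (rule norm_le_componentwise_cart)
        show "norm ((y0 t - c) $ i) \<le> norm ((y - c) $ i)" for i
          using at y0o y0' c(2) by (cases "i = \<nu>") auto
      qed
      with y show ?thesis by (simp add: dist_norm)
    qed
    have der: "((\<lambda>t. h (y0 t)) has_vector_derivative D (y0 t)) (at t within closed_segment 0 (y $ \<nu>))"
      if t: "t \<in> closed_segment 0 (y $ \<nu>)" for t
    proof -
      have *: "(h has_derivative frechet_derivative h (at (y0 t))) (at (y0 t))"
        using cdiff_imp_frechet[OF h1] r near[OF t] by blast
      have "((\<lambda>t. h (y0 t)) has_derivative (\<lambda>s. frechet_derivative h (at (y0 t)) (s *\<^sub>R axis \<nu> 1))) (at t)"
        by (rule has_derivative_compose[where f=y0 and g=h, OF _ *]) (auto simp: y0_def intro!: derivative_eq_intros)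
      then show ?thesis
        unfolding has_vector_derivative_def D_def linear_scale[OF has_derivative_linear[OF *]]
        by (rule has_derivative_at_withinI)
    qed
    define G where "G = (\<lambda>t. h (y0 t) - t *\<^sub>R D c)"
    have "norm (G (y $ \<nu>) - G 0) \<le> e / 2 * norm (y $ \<nu> - 0)"
    proof (rule differentiable_bound[where S="closed_segment 0 (y $ \<nu>)" and f'="\<lambda>t s. s *\<^sub>R (D (y0 t) - D c)"])
      fix t assume t: "t \<in> closed_segment 0 (y $ \<nu>)"
      have "(G has_vector_derivative (D (y0 t) - D c)) (at t within closed_segment 0 (y $ \<nu>))"
        unfolding G_def using der[OF t] by (auto intro!: derivative_eq_intros)
      then show "(G has_derivative (\<lambda>s. s *\<^sub>R (D (y0 t) - D c))) (at t within closed_segment 0 (y $ \<nu>))"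
        by (simp add: has_vector_derivative_def)
      have "norm (D (y0 t) - D c) \<le> e / 2" using r(2)[OF near[OF t]] by (simp add: dist_norm)
      then show "onorm (\<lambda>s. s *\<^sub>R (D (y0 t) - D c)) \<le> e / 2"
        using \<open>e>0\<close> by (intro onorm_le) (metis mult.commute mult_left_mono norm_ge_zero norm_scaleR real_norm_def)
    qed auto
    moreover have "h (y0 0) = 0"
      using r(2)[OF near[of 0]] by (intro zero) (auto simp: y0o)
    ultimately have "norm (h y - (y $ \<nu>) *\<^sub>R D c) \<le> e / 2 * \<bar>y $ \<nu>\<bar>" by (simp add: G_def y0y)
    moreover have "h y - (y $ \<nu>) *\<^sub>R D c = (y $ \<nu>) *\<^sub>R (h y /\<^sub>R y $ \<nu> - D c)"
      using y by (simp add: scaleR_diff_right)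
    ultimately have "\<bar>y $ \<nu>\<bar> * norm (h y /\<^sub>R y $ \<nu> - D c) \<le> \<bar>y $ \<nu>\<bar> * (e / 2)" by (simp add: mult.commute)
    then have "norm (h y /\<^sub>R y $ \<nu> - D c) \<le> e / 2" using y by simp
    with \<open>e>0\<close> show ?thesis by (simp add: dist_norm)
  qed
  with r(1) show "\<forall>\<^sub>F y in at c within {y. y $ \<nu> \<noteq> 0}. dist (h y /\<^sub>R y $ \<nu>) (frechet_derivative h (at c) (axis \<nu> 1)) < e"
    unfolding eventually_at by (intro exI[of _ r]) (auto simp: D_def)
qed

section \<open>Determinants and positive definite matrices\<close>

lemma det_has_real_derivative:
  fixes M :: "real \<Rightarrow> real^'n^'n"
  assumes "\<And>i j. ((\<lambda>t. M t $ i $ j) has_real_derivative M' $ i $ j) (at t0)"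
  shows "((\<lambda>t. det (M t)) has_real_derivative
    (\<Sum>k\<in>UNIV. det (\<chi> i j. if i = k then M' $ i $ j else M t0 $ i $ j))) (at t0)"
proof -
  have P: "((\<lambda>t. \<Prod>i\<in>UNIV. M t $ i $ p i) has_real_derivative
     (\<Sum>k\<in>UNIV. \<Prod>i\<in>UNIV. (if i = k then M' $ i $ p i else M t0 $ i $ p i))) (at t0)" for p :: "'n \<Rightarrow> 'n"
  proof -
    have "((\<lambda>t. \<Prod>i\<in>UNIV. M t $ i $ p i) has_derivative
       (\<lambda>y. \<Sum>i\<in>UNIV. (M' $ i $ p i * y) * (\<Prod>j\<in>UNIV - {i}. M t0 $ j $ p j))) (at t0)"
      using assms unfolding has_field_derivative_def by (intro has_derivative_prod)
    moreover have "(\<Prod>i\<in>UNIV. (if i = k then M' $ i $ p i else M t0 $ i $ p i))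
        = M' $ k $ p k * (\<Prod>j\<in>UNIV - {k}. M t0 $ j $ p j)" for k
      by (subst prod.remove[of _ k]) (auto intro!: arg_cong2[where f="(*)"] prod.cong)
    moreover have "(\<lambda>y. \<Sum>i\<in>UNIV. (M' $ i $ p i * y) * (\<Prod>j\<in>UNIV - {i}. M t0 $ j $ p j))
        = (*) (\<Sum>k\<in>UNIV. M' $ k $ p k * (\<Prod>j\<in>UNIV - {k}. M t0 $ j $ p j))"
      by (rule ext) (simp add: sum_distrib_left mult_ac)
    ultimately show ?thesis
      unfolding has_field_derivative_def by simp
  qed
  have "((\<lambda>t. \<Sum>p\<in>{p. p permutes UNIV}. of_int (sign p) * (\<Prod>i\<in>UNIV. M t $ i $ p i)) has_real_derivative
     (\<Sum>p\<in>{p. p permutes UNIV}. of_int (sign p) *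
        (\<Sum>k\<in>UNIV. \<Prod>i\<in>UNIV. (if i = k then M' $ i $ p i else M t0 $ i $ p i)))) (at t0)"
    by (intro DERIV_sum DERIV_cmult P)
  moreover have "(\<Sum>p\<in>{p. p permutes UNIV}. of_int (sign p) *
        (\<Sum>k\<in>UNIV. \<Prod>i\<in>UNIV. (if i = k then M' $ i $ p i else M t0 $ i $ p i)))
    = (\<Sum>k\<in>UNIV. det (\<chi> i j. if i = k then M' $ i $ j else M t0 $ i $ j))"
    unfolding det_def sum_distrib_left by (subst sum.swap) (simp cong: if_cong)
  ultimately show ?thesis unfolding det_def by simp
qed

lemma inner_matrix_symmetric:
  fixes M :: "real^'n^'n"
  assumes "transpose M = M"
  shows "x \<bullet> (M *v y) = (M *v x) \<bullet> y"
  using dot_lmul_matrix[of x M y] assms by (metis inner_commute transpose_matrix_vector)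

text \<open>Jacobi's formula for the derivative \<open>u p^T + p u^T\<close>: the trace against the
  inverse matrix is twice \<open>u \<bullet> x\<close>. The Gram matrix varies in exactly this way
  along a function multiple of a Killing field.\<close>

lemma det_derivative_rank_two:
  fixes M :: "real \<Rightarrow> real^'n^'n"
  assumes der: "\<And>i j. ((\<lambda>t. M t $ i $ j) has_real_derivative u $ i * p $ j + p $ i * u $ j) (at t0)"
    and sym: "transpose (M t0) = M t0" and inj: "inj ((*v) (M t0))" and x: "M t0 *v x = p"
  shows "((\<lambda>t. det (M t)) has_real_derivative 2 * det (M t0) * (u \<bullet> x)) (at t0)"
proof -
  define A where "A = M t0"
  have Asym: "A $ i $ j = A $ j $ i" for i j
    using arg_cong[OF sym, of "\<lambda>B. B $ j $ i"] by (simp add: transpose_def A_def)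
  have "surj ((*v) A)" using inj by (simp add: A_def linear_injective_imp_surjective)
  then obtain x' where x': "A *v x' = u" by (metis surjD)
  have px: "x' \<bullet> p = u \<bullet> x"
    using inner_matrix_symmetric[OF sym, of x' x] x x' by (simp add: A_def)
  have k: "det (\<chi> i j. if i = k then (u $ i * p $ j + p $ i * u $ j) else A $ i $ j)
      = (p $ k * x' $ k + u $ k * x $ k) * det A" for k
  proof -
    have "det (\<chi> i j. if i = k then (u $ i * p $ j + p $ i * u $ j) else A $ i $ j)
       = det (transpose (\<chi> i j. if i = k then (u $ i * p $ j + p $ i * u $ j) else A $ i $ j))"
      by (simp only: det_transpose)
    \<comment> \<open>Row \<open>k\<close> of the derivative is the matrix applied to a combination
      of the two preimages \<open>x\<close> and \<open>x'\<close>; transposed it is a column, and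
      Cramer's rule evaluates the determinant.\<close>
    also have "transpose (\<chi> i j. if i = k then (u $ i * p $ j + p $ i * u $ j) else A $ i $ j)
      = (\<chi> i j. if j = k then (A *v (p $ k *\<^sub>R x' + u $ k *\<^sub>R x)) $ i else A $ i $ j)"
      using x x' Asym by (auto simp: transpose_def vec_eq_iff A_def matrix_vector_right_distrib matrix_vector_mult_scaleR algebra_simps)
    also have "det \<dots> = (p $ k *\<^sub>R x' + u $ k *\<^sub>R x) $ k * det A" by (rule cramer_lemma)
    finally show ?thesis by simp
  qed
  have "((\<lambda>t. det (M t)) has_real_derivative
    (\<Sum>k\<in>UNIV. det (\<chi> i j. if i = k then (\<chi> i j. u $ i * p $ j + p $ i * u $ j) $ i $ j else M t0 $ i $ j))) (at t0)"
    by (rule det_has_real_derivative) (simp add: der)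
  also have "(\<Sum>k\<in>UNIV. det (\<chi> i j. if i = k then (\<chi> i j. u $ i * p $ j + p $ i * u $ j) $ i $ j else M t0 $ i $ j))
      = (\<Sum>k\<in>UNIV. (p $ k * x' $ k + u $ k * x $ k) * det A)"
    using k by (simp add: A_def cong: if_cong)
  also have "\<dots> = (x' \<bullet> p + u \<bullet> x) * det A"
    by (simp add: sum_distrib_right[symmetric] sum.distrib inner_vec_def mult.commute[of "p $ _"])
  finally show ?thesis using px by (simp add: A_def mult_ac)
qed

definition posdef :: "real^'n^'n \<Rightarrow> bool" where
  "posdef M \<longleftrightarrow> transpose M = M \<and> (\<forall>v. v \<noteq> 0 \<longrightarrow> v \<bullet> (M *v v) > 0)"

lemma posdef_inj: "posdef M \<Longrightarrow> inj ((*v) M)"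
  using linear_injective_0[of "(*v) M"] unfolding posdef_def
  by (metis inner_zero_right less_irrefl matrix_vector_mul_linear)

lemma posdef_surj: "posdef M \<Longrightarrow> M *v inv ((*v) M) p = p"
  using posdef_inj[of M] by (metis linear_injective_imp_surjective matrix_vector_mul_linear surj_f_inv_f)

lemma posdef_inv_eq: "posdef M \<Longrightarrow> M *v x = p \<Longrightarrow> inv ((*v) M) p = x"
  using posdef_inj[of M] by (metis inv_f_f)

text \<open>The segment from the identity to \<open>M\<close> consists of positive definite
  matrices, so the determinant has no zero along it and keeps its sign.\<close>

lemma posdef_det_pos:
  fixes M :: "real^'n^'n"
  assumes "posdef M"
  shows "det M > 0"
proof (rule ccontr)
  assume neg: "\<not> det M > 0"
  define N where "N = (\<lambda>t::real. (1 - t) *\<^sub>R mat 1 + t *\<^sub>R M)"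
  have ne: "det (N t) \<noteq> 0" if "0 \<le> t" "t \<le> 1" for t
  proof -
    have "inj ((*v) (N t))"
    proof (subst linear_injective_0, simp, intro allI impI)
      fix v assume v: "N t *v v = 0"
      have "v \<bullet> (N t *v v) = (1 - t) * (v \<bullet> v) + t * (v \<bullet> (M *v v))"
        by (simp add: N_def matrix_vector_mult_add_rdistrib scaleR_matrix_vector_assoc[symmetric] inner_add_right)
      with v have 0: "(1 - t) * (v \<bullet> v) + t * (v \<bullet> (M *v v)) = 0" by simp
      show "v = 0"
      proof (rule ccontr)
        assume "v \<noteq> 0"
        then have "v \<bullet> v > 0" "v \<bullet> (M *v v) > 0" using assms by (auto simp: posdef_def)
        then have "(1 - t) * (v \<bullet> v) + t * (v \<bullet> (M *v v)) > 0"
          using that by (cases "t = 0") (auto intro: add_nonneg_pos)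
        with 0 show False by simp
      qed
    qed
    then show ?thesis using invertible_det_nz invertible_left_inverse matrix_left_invertible_injective by blast
  qed
  have "continuous_on {0..1} (\<lambda>t. det (N t))"
    unfolding det_def N_def by (intro continuous_intros)
  moreover have "det (N 0) = 1" "det (N 1) = det M" by (simp_all add: N_def det_I)
  ultimately obtain t where "0 \<le> t" "t \<le> 1" "det (N t) = 0"
    using IVT2'[of "\<lambda>t. det (N t)" 1 0 0] neg by auto
  with ne show False by blast
qed

lemma posdef_rank_one:
  fixes G :: "real^'n^'n"
  assumes "posdef G"
  shows "posdef (G + (\<chi> i j. e $ i * e $ j))"
proof -
  have "(\<chi> i j. e $ i * e $ j) *v v = (e \<bullet> v) *\<^sub>R e" for v :: "real^'n"
    by (simp add: matrix_vector_mult_def vec_eq_iff inner_vec_def sum_distrib_right sum_distrib_left mult_ac)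
  moreover have "transpose (G + (\<chi> i j. e $ i * e $ j)) = G + (\<chi> i j. e $ i * e $ j)"
    using assms by (auto simp: posdef_def transpose_def vec_eq_iff mult.commute)
  ultimately show ?thesis
    using assms by (auto simp: posdef_def matrix_vector_mult_add_rdistrib inner_add_right inner_commute add_pos_nonneg)
qed

lemma rank_one_mult: "(G + (\<chi> i j. e $ i * e $ j)) *v v = G *v v + (e \<bullet> v) *\<^sub>R (e :: real^'n)"
  by (simp add: matrix_vector_mult_def vec_eq_iff inner_vec_def sum_distrib_right sum_distrib_left mult_ac distrib_left sum.distrib)

text \<open>The matrix determinant lemma, obtained by integrating the derivative of the determinant along
  the segment from \<open>G\<close> to its rank one perturbation.\<close>
lemma det_rank_one:
  fixes G :: "real^'n^'n"
  assumes G: "posdef G" and w: "G *v w = e"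
  shows "det (G + (\<chi> i j. e $ i * e $ j)) = det G * (1 + e \<bullet> w)"
proof -
  define s where "s = e \<bullet> w"
  have s: "s \<ge> 0" using G w by (cases "w = 0") (auto simp: s_def posdef_def inner_commute intro: less_imp_le)
  \<comment> \<open>\<open>M\<close> and \<open>N\<close> agree for \<open>t \<ge> 0\<close>: the
    square roots match the form of \<open>posdef_rank_one\<close>, whereas \<open>N\<close> is
    differentiable also at \<open>t = 0\<close>.\<close>
  define M where "M = (\<lambda>t. G + (\<chi> i j. (sqrt t *\<^sub>R e) $ i * (sqrt t *\<^sub>R e) $ j))"
  define N where "N = (\<lambda>t. G + t *\<^sub>R (\<chi> i j. e $ i * e $ j))"
  have MN: "M t = N t" if "t \<ge> 0" for t
    using that by (simp add: M_def N_def vec_eq_iff mult_ac)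
  have pd: "posdef (N t)" if "t \<ge> 0" for t
    using posdef_rank_one[OF G, of "sqrt t *\<^sub>R e"] MN[OF that] by (simp add: M_def)
  have x: "N t *v ((1 / (1 + t * s)) *\<^sub>R w) = e" if "t \<ge> 0" for t
  proof -
    have "1 + t * s > 0" using s that by (simp add: add_pos_nonneg)
    then have "N t *v w = (1 + t * s) *\<^sub>R e"
      using rank_one_mult[of G "sqrt t *\<^sub>R e" w] MN[OF that] that w
      by (simp add: M_def s_def scaleR_add_left)
    with \<open>1 + t * s > 0\<close> show ?thesis by (simp add: matrix_vector_mult_scaleR)
  qed
  have D: "((\<lambda>t. det (N t) / (1 + t * s)) has_real_derivative 0) (at t)" if t: "t \<ge> 0" for t
  proof -
    have pos: "1 + t * s > 0" using s t by (simp add: add_pos_nonneg)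
    \<comment> \<open>The rank one derivative \<open>e e^T\<close> is split as
      \<open>(e/2) e^T + e (e/2)^T\<close> to fit the symmetric form.\<close>
    have "((\<lambda>t. det (N t)) has_real_derivative 2 * det (N t) * (((1/2) *\<^sub>R e) \<bullet> ((1 / (1 + t * s)) *\<^sub>R w))) (at t)"
    proof (rule det_derivative_rank_two)
      show "((\<lambda>t. N t $ i $ j) has_real_derivative ((1/2) *\<^sub>R e) $ i * e $ j + e $ i * ((1/2) *\<^sub>R e) $ j) (at t)" for i j
        unfolding N_def by (auto intro!: derivative_eq_intros)
    qed (use pd[OF t] x[OF t] posdef_inj in \<open>auto simp: posdef_def\<close>)
    then have "((\<lambda>t. det (N t)) has_real_derivative det (N t) * s / (1 + t * s)) (at t)"
      by (rule DERIV_cong) (use pos in \<open>simp add: s_def[symmetric] field_simps\<close>)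
    then have "((\<lambda>t. det (N t) / (1 + t * s)) has_real_derivative
      (det (N t) * s / (1 + t * s) * (1 + t * s) - det (N t) * s) / ((1 + t * s) * (1 + t * s))) (at t)"
      using pos by (auto intro!: derivative_eq_intros)
    then show ?thesis using pos by simp
  qed
  have "det (N 1) / (1 + 1 * s) = det (N 0) / (1 + 0 * s)"
    by (rule DERIV_isconst_end[of 0 1 "\<lambda>t. det (N t) / (1 + t * s)"])
       (use D in \<open>auto intro!: continuous_at_imp_continuous_on DERIV_isCont\<close>)
  then show ?thesis using s by (simp add: N_def s_def divide_eq_eq)
qed

section \<open>The Bergman metric and its Killing fields\<close>

lemma Tfield_inner: "Tfield a \<bullet> b = - (a \<bullet> Tfield b)" "Tfield a \<bullet> Tfield b = a \<bullet> b"
  by (auto simp: Tfield_def inner_vec_def inner_complex_def sum_negf[symmetric] algebra_simps intro!: sum.cong)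

lemma Tfield_Tfield: "Tfield (Tfield a) = - a"
  by (simp add: Tfield_def vec_eq_iff)

lemma inner_Tfield_self [simp]: "a \<bullet> Tfield a = 0"
  using Tfield_inner(1)[of a a] by (simp add: inner_commute)

lemma linear_Tfield: "linear Tfield"
  by (rule linearI) (auto simp: Tfield_def vec_eq_iff algebra_simps)

lemma bounded_linear_Tfield: "bounded_linear Tfield"
  using linear_Tfield by (simp add: linear_conv_bounded_linear)

lemmas Tfield_add = linear_add[OF linear_Tfield] and Tfield_scale = linear_scale[OF linear_Tfield]
  and Tfield_diff = linear_diff[OF linear_Tfield] and Tfield_neg = linear_neg[OF linear_Tfield]

lemma Re_cinner: "Re (cinner u v) = u \<bullet> v"
  by (simp add: cinner_def inner_vec_def inner_complex_def)

lemma Im_cinner: "Im (cinner u v) = u \<bullet> Tfield v"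
  by (simp add: cinner_def inner_vec_def inner_complex_def Tfield_def algebra_simps)

lemma cinner_cnj: "cinner u v = cnj (cinner v u)"
  by (simp add: cinner_def mult.commute)

text \<open>The complex products split into the real part \<open>u \<bullet> z\<close> and the
  imaginary part \<open>u \<bullet> Tfield z\<close>. The directions \<open>z\<close> and
  \<open>Tfield z\<close> are thus the ones with the stronger singularity at the sphere.\<close>

lemma gB_real:
  "gB z u v = (u \<bullet> v) / (1 - (norm z)\<^sup>2) +
    ((u \<bullet> z) * (v \<bullet> z) + (u \<bullet> Tfield z) * (v \<bullet> Tfield z)) / (1 - (norm z)\<^sup>2)\<^sup>2"
proof -
  have "Re (cinner u z * cinner z v) = (u \<bullet> z) * (v \<bullet> z) + (u \<bullet> Tfield z) * (v \<bullet> Tfield z)"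
    by (subst cinner_cnj[of z v]) (simp add: Re_cinner Im_cinner)
  then show ?thesis by (simp add: gB_def Re_cinner)
qed

lemma gB_sym: "gB z u v = gB z v u"
  by (simp add: gB_real inner_commute mult.commute)

lemma gB_add: "gB z (u + u') v = gB z u v + gB z u' v" "gB z v (u + u') = gB z v u + gB z v u'"
  by (simp_all add: gB_real inner_add_left inner_add_right add_divide_distrib distrib_left distrib_right)

lemma gB_scale: "gB z (c *\<^sub>R u) v = c * gB z u v" "gB z v (c *\<^sub>R u) = c * gB z v u"
  by (simp_all add: gB_real distrib_left mult.left_commute mult.assoc)

lemma gB_zero [simp]: "gB z 0 v = 0" "gB z v 0 = 0"
  by (simp_all add: gB_real)

lemma gB_pos: "norm z < 1 \<Longrightarrow> u \<noteq> 0 \<Longrightarrow> gB z u u > 0"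
  unfolding gB_real by (intro add_pos_nonneg divide_pos_pos divide_nonneg_nonneg) (auto simp: power_less_one_iff abs_square_less_1)

lemma gB_sum: "gB z (\<Sum>i\<in>I. u i) v = (\<Sum>i\<in>I. gB z (u i) v)" "gB z v (\<Sum>i\<in>I. u i) = (\<Sum>i\<in>I. gB z v (u i))"
  by (induction I rule: infinite_finite_induct; simp add: gB_add)+

text \<open>The derivative of \<open>gB z a c\<close> in the base point \<open>z\<close> along
  \<open>V\<close>, with \<open>a\<close> and \<open>c\<close> held fixed.\<close>

definition dgB :: "complex^'n \<Rightarrow> complex^'n \<Rightarrow> complex^'n \<Rightarrow> complex^'n \<Rightarrow> real" where
  "dgB z V a c = (2 * (z \<bullet> V) * (a \<bullet> c)
     + (a \<bullet> V) * (c \<bullet> z) + (a \<bullet> z) * (c \<bullet> V) + (a \<bullet> Tfield V) * (c \<bullet> Tfield z) + (a \<bullet> Tfield z) * (c \<bullet> Tfield V))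
       / (1 - (norm z)\<^sup>2)\<^sup>2
     + 4 * (z \<bullet> V) * ((a \<bullet> z) * (c \<bullet> z) + (a \<bullet> Tfield z) * (c \<bullet> Tfield z)) / (1 - (norm z)\<^sup>2) ^ 3"

lemma dgB_scale: "dgB z (f *\<^sub>R V) a c = f * dgB z V a c"
  by (simp add: dgB_def Tfield_scale algebra_simps add_divide_distrib)

lemma inner_line_derivative:
  "((\<lambda>t. (a + t *\<^sub>R A) \<bullet> (c + t *\<^sub>R C)) has_real_derivative A \<bullet> c + a \<bullet> C) (at 0)"
proof -
  have "((\<lambda>t. a \<bullet> c + t * (A \<bullet> c + a \<bullet> C) + t * t * (A \<bullet> C)) has_real_derivative A \<bullet> c + a \<bullet> C) (at 0)"
    by (auto intro!: derivative_eq_intros)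
  then show ?thesis by (simp add: inner_add_left inner_add_right algebra_simps)
qed

lemma gB_has_derivative:
  assumes "norm z < 1"
  shows "((\<lambda>t. gB (z + t *\<^sub>R V) (a + t *\<^sub>R A) (c + t *\<^sub>R C)) has_real_derivative
    gB z A c + gB z a C + dgB z V a c) (at 0)"
proof -
  have "1 - (norm z)\<^sup>2 \<noteq> 0" using assms abs_square_less_1[of "norm z"] by auto
  then have nz: "1 - z \<bullet> z \<noteq> 0" by (simp add: power2_norm_eq_inner)
  define S where "S = (\<lambda>t. 1 - (z + t *\<^sub>R V) \<bullet> (z + t *\<^sub>R V))"
  define s where "s = 1 - z \<bullet> z"
  define P where "P = (\<lambda>t. (a + t *\<^sub>R A) \<bullet> (c + t *\<^sub>R C))"
  define Q where "Q = (\<lambda>t. ((a + t *\<^sub>R A) \<bullet> (z + t *\<^sub>R V)) * ((c + t *\<^sub>R C) \<bullet> (z + t *\<^sub>R V))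
     + ((a + t *\<^sub>R A) \<bullet> (Tfield z + t *\<^sub>R Tfield V)) * ((c + t *\<^sub>R C) \<bullet> (Tfield z + t *\<^sub>R Tfield V)))"
  have S0: "S 0 = s" by (simp add: S_def s_def)
  have S: "(S has_real_derivative 0 - (V \<bullet> z + z \<bullet> V)) (at 0)"
    unfolding S_def by (intro DERIV_diff DERIV_const inner_line_derivative)
  have P: "(P has_real_derivative A \<bullet> c + a \<bullet> C) (at 0)"
    unfolding P_def by (rule inner_line_derivative)
  have Q: "(Q has_real_derivative
      ((A \<bullet> z + a \<bullet> V) * (c \<bullet> z) + (C \<bullet> z + c \<bullet> V) * (a \<bullet> z))
    + ((A \<bullet> Tfield z + a \<bullet> Tfield V) * (c \<bullet> Tfield z) + (C \<bullet> Tfield z + c \<bullet> Tfield V) * (a \<bullet> Tfield z))) (at 0)"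
    unfolding Q_def
    using DERIV_add[OF DERIV_mult[OF inner_line_derivative[of a A z V] inner_line_derivative[of c C z V]]
       DERIV_mult[OF inner_line_derivative[of a A "Tfield z" "Tfield V"] inner_line_derivative[of c C "Tfield z" "Tfield V"]]]
    by simp
  have "((\<lambda>t. P t / S t + Q t / (S t)\<^sup>2) has_real_derivative
     ((A \<bullet> c + a \<bullet> C) * s - P 0 * (0 - (V \<bullet> z + z \<bullet> V))) / (s * s)
     + ((((A \<bullet> z + a \<bullet> V) * (c \<bullet> z) + (C \<bullet> z + c \<bullet> V) * (a \<bullet> z))
    + ((A \<bullet> Tfield z + a \<bullet> Tfield V) * (c \<bullet> Tfield z) + (C \<bullet> Tfield z + c \<bullet> Tfield V) * (a \<bullet> Tfield z))) * s\<^sup>2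
        - Q 0 * (2 * (0 - (V \<bullet> z + z \<bullet> V)) * s)) / (s\<^sup>2 * s\<^sup>2)) (at 0)"
    using nz DERIV_add[OF DERIV_divide[OF P S] DERIV_divide[OF Q DERIV_power[OF S, of 2]]]
    by (simp add: S0 s_def[symmetric] mult_ac)
  then show ?thesis
  proof (rule DERIV_cong[THEN back_subst[where P="\<lambda>f. (f has_real_derivative _) _"]])
    show "(\<lambda>t. P t / S t + Q t / (S t)\<^sup>2) = (\<lambda>t. gB (z + t *\<^sub>R V) (a + t *\<^sub>R A) (c + t *\<^sub>R C))"
      by (simp add: gB_real P_def Q_def S_def power2_norm_eq_inner Tfield_add Tfield_scale fun_eq_iff)
    have P0: "P 0 = a \<bullet> c" and Q0: "Q 0 = (a \<bullet> z) * (c \<bullet> z) + (a \<bullet> Tfield z) * (c \<bullet> Tfield z)"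
      by (simp_all add: P_def Q_def)
    have "s \<noteq> 0" using nz by (simp add: s_def)
    then show "((A \<bullet> c + a \<bullet> C) * s - P 0 * (0 - (V \<bullet> z + z \<bullet> V))) / (s * s)
     + ((((A \<bullet> z + a \<bullet> V) * (c \<bullet> z) + (C \<bullet> z + c \<bullet> V) * (a \<bullet> z))
    + ((A \<bullet> Tfield z + a \<bullet> Tfield V) * (c \<bullet> Tfield z) + (C \<bullet> Tfield z + c \<bullet> Tfield V) * (a \<bullet> Tfield z))) * s\<^sup>2
        - Q 0 * (2 * (0 - (V \<bullet> z + z \<bullet> V)) * s)) / (s\<^sup>2 * s\<^sup>2) = gB z A c + gB z a C + dgB z V a c"
      unfolding gB_real dgB_def power2_norm_eq_inner s_def[symmetric] P0 Q0 inner_commute[of V z]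
      by (simp add: field_simps power2_eq_square power3_eq_cube)
  qed
qed

text \<open>The last clause is the vanishing of the Lie derivative of the Bergman metric along
  \<open>K\<close>, with \<open>K'\<close> the derivative of \<open>K\<close>. Smoothness on the
  whole space makes smooth multiples of \<open>K\<close> admissible variation fields.\<close>

definition killing :: "(complex^'n \<Rightarrow> complex^'n) \<Rightarrow> (complex^'n \<Rightarrow> complex^'n \<Rightarrow> complex^'n) \<Rightarrow> bool" where
  "killing K K' \<longleftrightarrow> (\<forall>z. (K has_derivative K' z) (at z)) \<and> (\<forall>k. cdiff k K UNIV) \<and>
     (\<forall>z a c. norm z < 1 \<longrightarrow> gB z (K' z a) c + gB z a (K' z c) + dgB z (K z) a c = 0)"

lemma killing_Tfield: "killing Tfield (\<lambda>z. Tfield)"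
  unfolding killing_def
proof (intro conjI allI impI)
  show "(Tfield has_derivative Tfield) (at z)" for z :: "complex^'n"
    by (rule bounded_linear_imp_has_derivative[OF bounded_linear_Tfield])
  show "cdiff k Tfield UNIV" for k by (rule cdiff_linear[OF bounded_linear_Tfield])
  fix z a c :: "complex^'n" assume z: "norm z < 1"
  show "gB z (Tfield a) c + gB z a (Tfield c) + dgB z (Tfield z) a c = 0"
    by (simp add: gB_real dgB_def Tfield_inner Tfield_Tfield add_divide_distrib diff_divide_distrib)
qed

text \<open>The field \<open>b - <z,b> z\<close> in real notation, with the real and imaginary parts
  of \<open>cinner z b\<close>: the generator of the automorphisms of the ball that move the origin
  in direction \<open>b\<close>.\<close>

definition transl :: "complex^'n \<Rightarrow> complex^'n \<Rightarrow> complex^'n" where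
  "transl b z = b - (z \<bullet> b) *\<^sub>R z - (z \<bullet> Tfield b) *\<^sub>R Tfield z"

definition transl' :: "complex^'n \<Rightarrow> complex^'n \<Rightarrow> complex^'n \<Rightarrow> complex^'n" where
  "transl' b z a = - (a \<bullet> b) *\<^sub>R z - (z \<bullet> b) *\<^sub>R a - (a \<bullet> Tfield b) *\<^sub>R Tfield z - (z \<bullet> Tfield b) *\<^sub>R Tfield a"

lemma killing_transl:
  fixes b :: "complex^'n"
  shows "killing (transl b) (transl' b)"
  unfolding killing_def
proof (intro conjI allI impI)
  show "(transl b has_derivative transl' b z) (at z)" for z :: "complex^'n"
    unfolding transl_def[abs_def] transl'_def[abs_def]
    by (auto intro!: derivative_eq_intros bounded_linear_imp_has_derivative[OF bounded_linear_Tfield] simp: algebra_simps)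
  show "cdiff k (transl b) UNIV" for k
    unfolding transl_def[abs_def]
    by (intro cdiff_diff cdiff_scaleR cdiff_inner cdiff_const cdiff_id cdiff_linear[OF bounded_linear_Tfield])
  fix z a c :: "complex^'n" assume z: "norm z < 1"
  define s where "s = 1 - (norm z)\<^sup>2"
  have s: "s \<noteq> 0" using z abs_square_less_1[of "norm z"] by (auto simp: s_def)
  have n: "z \<bullet> z = 1 - s" by (simp add: s_def power2_norm_eq_inner)
  \<comment> \<open>All inner products are brought into one orientation; the Killing equation is
    then a rational identity in \<open>s\<close> and finitely many real numbers.\<close>
  have com: "b \<bullet> x = x \<bullet> b" "b \<bullet> Tfield x = - (x \<bullet> Tfield b)" "z \<bullet> a = a \<bullet> z" "z \<bullet> c = c \<bullet> z" "c \<bullet> a = a \<bullet> c"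
     "z \<bullet> Tfield a = - (a \<bullet> Tfield z)"  "z \<bullet> Tfield c = - (c \<bullet> Tfield z)" "c \<bullet> Tfield a = - (a \<bullet> Tfield c)" for x
    using Tfield_inner(1)[of x b] Tfield_inner(1)[of a z] Tfield_inner(1)[of c z] Tfield_inner(1)[of a c]
    by (simp_all add: inner_commute)
  show "gB z (transl' b z a) c + gB z a (transl' b z c) + dgB z (transl b z) a c = 0"
    using s unfolding gB_real dgB_def transl_def transl'_def s_def[symmetric]
    apply (simp add: inner_diff_left inner_diff_right inner_add_left inner_add_right Tfield_diff Tfield_scale Tfield_inner Tfield_Tfield Tfield_neg com n)
    apply (simp add: field_simps power2_eq_square power3_eq_cube)
    done
qed

text \<open>Relative to the Euclidean product \<open>Tfield z\<close> is an eigenvector of the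
  metric, with eigenvalue \<open>1 / s + |z|^2 / s^2 = 1 / s^2\<close> for
  \<open>s = 1 - |z|^2\<close>.\<close>

lemma gB_Tfield:
  assumes "norm z < 1"
  shows "gB z (Tfield z) v = (v \<bullet> Tfield z) / (1 - (norm z)\<^sup>2)\<^sup>2"
proof -
  define s where "s = 1 - (norm z)\<^sup>2"
  have s: "s \<noteq> 0" using assms abs_square_less_1[of "norm z"] by (auto simp: s_def)
  have n: "z \<bullet> z = 1 - s" by (simp add: s_def power2_norm_eq_inner)
  have "Tfield z \<bullet> z = 0" "Tfield z \<bullet> v = v \<bullet> Tfield z" by (simp_all add: inner_commute)
  with s show ?thesis unfolding gB_real s_def[symmetric]
    by (simp add: Tfield_inner(2) n field_simps power2_eq_square)
qed

text \<open>The last term is a multiple of \<open>gB z (Tfield z) v\<close>. Adding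
  \<open>2 (z \<bullet> Tfield b)\<close> times the rotation therefore leaves only the less singular
  first term; this is the origin of the correction in \<open>flux_transl\<close>.\<close>

lemma gB_transl:
  assumes "norm z < 1"
  shows "gB z (transl b z) v = (b \<bullet> v) / (1 - (norm z)\<^sup>2)
     - 2 * (z \<bullet> Tfield b) * (v \<bullet> Tfield z) / (1 - (norm z)\<^sup>2)\<^sup>2"
proof -
  define s where "s = 1 - (norm z)\<^sup>2"
  have s: "s \<noteq> 0" using assms abs_square_less_1[of "norm z"] by (auto simp: s_def)
  have n: "z \<bullet> z = 1 - s" by (simp add: s_def power2_norm_eq_inner)
  have com: "b \<bullet> Tfield z = - (z \<bullet> Tfield b)" "b \<bullet> z = z \<bullet> b" "z \<bullet> v = v \<bullet> z" "Tfield z \<bullet> v = v \<bullet> Tfield z"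
    using Tfield_inner(1)[of z b] by (simp_all add: inner_commute)
  show ?thesis using s unfolding gB_real s_def[symmetric] transl_def
    by (simp add: inner_diff_left inner_add_left Tfield_inner(2) inner_commute[of "Tfield z" z] n com field_simps power2_eq_square)
qed

section \<open>First variation along Killing fields\<close>

definition gram :: "(real^'m \<Rightarrow> complex^'n) \<Rightarrow> real^'m \<Rightarrow> real^'m^'m" where
  "gram Z w = (\<chi> i j. gB (Z w) (frechet_derivative Z (at w) (axis i 1)) (frechet_derivative Z (at w) (axis j 1)))"

text \<open>The coordinates of the tangential part of \<open>K\<close> along \<open>Z\<close>, times
  the area density; \<open>dvg\<close> of this is the intrinsic divergence times the
  density.\<close>

definition flux :: "(complex^'n \<Rightarrow> complex^'n) \<Rightarrow> (real^'m \<Rightarrow> complex^'n) \<Rightarrow> real^'m \<Rightarrow> real^'m" where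
  "flux K Z w = sqrt (det (gram Z w)) *\<^sub>R
     inv ((*v) (gram Z w)) (\<chi> j. gB (Z w) (K (Z w)) (frechet_derivative Z (at w) (axis j 1)))"

lemma linear_axis_sum:
  fixes v :: "real^'m"
  assumes "linear D"
  shows "D v = (\<Sum>i\<in>UNIV. v $ i *\<^sub>R D (axis i 1))"
proof -
  have "v = (\<Sum>i\<in>UNIV. v $ i *\<^sub>R axis i 1)" by (simp add: vec_eq_iff axis_def if_distrib[of "(*) _"] cong: if_cong)
  then have "D v = D (\<Sum>i\<in>UNIV. v $ i *\<^sub>R axis i 1)" by simp
  also have "\<dots> = (\<Sum>i\<in>UNIV. v $ i *\<^sub>R D (axis i 1))" by (simp add: linear_sum[OF assms] linear_scale[OF assms])
  finally show ?thesis .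
qed

lemma gram_posdef:
  assumes Z: "(Z has_derivative D) (at w)" and "norm (Z w) < 1" and inj: "\<And>v. D v = 0 \<Longrightarrow> v = 0"
  shows "posdef (gram Z w)"
  unfolding posdef_def
proof (intro conjI allI impI)
  have D: "frechet_derivative Z (at w) = D" using frechet_derivative_at[OF Z] by simp
  show "transpose (gram Z w) = gram Z w" by (simp add: gram_def transpose_def vec_eq_iff gB_sym)
  fix v :: "real^'a" assume "v \<noteq> 0"
  have "v \<bullet> (gram Z w *v v) = gB (Z w) (\<Sum>i\<in>UNIV. v $ i *\<^sub>R D (axis i 1)) (\<Sum>j\<in>UNIV. v $ j *\<^sub>R D (axis j 1))"
    unfolding gB_sum(1) gB_scale(1) unfolding gB_sum(2) gB_scale(2)
    by (simp add: gram_def D inner_vec_def matrix_vector_mult_def mult_ac)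
  also have "\<dots> = gB (Z w) (D v) (D v)"
    by (simp only: linear_axis_sum[OF has_derivative_linear[OF Z], of v])
  also have "\<dots> > 0" using assms(2) inj \<open>v \<noteq> 0\<close> by (intro gB_pos) auto
  finally show "v \<bullet> (gram Z w *v v) > 0" .
qed

lemma norm_lt_1_nz: "norm (z::'a::real_normed_vector) < 1 \<Longrightarrow> 1 - (norm z)\<^sup>2 > 0"
  by (simp add: abs_square_less_1)

lemma cdiff_Tfield: "cdiff k f S \<Longrightarrow> cdiff k (\<lambda>x. Tfield (f x)) S"
  by (rule cdiff_compose_linear[OF bounded_linear_Tfield])

lemma cdiff_gB:
  assumes "cdiff k z S" "cdiff k u S" "cdiff k v S" "\<And>x. x \<in> S \<Longrightarrow> norm (z x) < 1"
  shows "cdiff k (\<lambda>x. gB (z x) (u x) (v x)) S"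
  unfolding gB_real
  by (intro cdiff_add cdiff_divide cdiff_mult cdiff_inner cdiff_power cdiff_diff cdiff_const cdiff_norm_power2 cdiff_Tfield assms)
     (use norm_lt_1_nz[OF assms(4)] in force)+

lemma cdiff_det:
  fixes M :: "'a::real_normed_vector \<Rightarrow> real^'n^'n"
  assumes "\<And>i j. cdiff k (\<lambda>x. M x $ i $ j) S"
  shows "cdiff k (\<lambda>x. det (M x)) S"
  unfolding det_def by (intro cdiff_sum cdiff_mult cdiff_const cdiff_prod assms)

lemma cdiff_flux:
  assumes S: "open S" and Z: "cdiff (Suc k) Z S" and K: "cdiff k K UNIV"
    and lt: "\<And>w. w \<in> S \<Longrightarrow> norm (Z w) < 1" and pd: "\<And>w. w \<in> S \<Longrightarrow> posdef (gram Z w)"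
  shows "cdiff k (flux K Z) S"
proof -
  have Zk: "cdiff k Z S" by (rule cdiff_lower[OF Z])
  have KZ: "cdiff k (\<lambda>w. K (Z w)) S" by (rule cdiff_compose[OF Zk K]) auto
  have g: "cdiff k (\<lambda>w. gram Z w $ i $ j) S" for i j
    using lt by (simp add: gram_def) (intro cdiff_gB Zk cdiff_frechet Z S)
  have p: "cdiff k (\<lambda>w. gB (Z w) (K (Z w)) (frechet_derivative Z (at w) (axis j 1))) S" for j
    using lt by (intro cdiff_gB Zk cdiff_frechet Z S KZ)
  have inv: "cdiff k (\<lambda>w. inv ((*v) (gram Z w)) v) S" for v
  proof (rule cdiff_inv_linear[OF S])
    show "cdiff k (\<lambda>w. gram Z w *v v) S" for v
      by (rule cdiff_vec_lambda) (simp add: matrix_vector_mult_def, intro cdiff_sum cdiff_mult g cdiff_const)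
  qed (use pd posdef_inj in auto)
  \<comment> \<open>\<open>cdiff_inv_linear\<close> treats a fixed right-hand side, so the moving
    one is expanded into unit vectors.\<close>
  have "cdiff k (\<lambda>w. \<Sum>j\<in>UNIV. gB (Z w) (K (Z w)) (frechet_derivative Z (at w) (axis j 1)) *\<^sub>R inv ((*v) (gram Z w)) (axis j 1)) S"
    by (intro cdiff_sum cdiff_scaleR p inv)
  then have I: "cdiff k (\<lambda>w. inv ((*v) (gram Z w)) (\<chi> j. gB (Z w) (K (Z w)) (frechet_derivative Z (at w) (axis j 1)))) S"
  proof (rule cdiff_cong[OF S, rotated])
    fix w assume "w \<in> S"
    then have "linear (inv ((*v) (gram Z w)))"
      by (intro inj_linear_imp_inv_linear posdef_inj pd) auto
    from linear_axis_sum[OF this, of "\<chi> j. gB (Z w) (K (Z w)) (frechet_derivative Z (at w) (axis j 1))"] show "(\<Sum>j\<in>UNIV. gB (Z w) (K (Z w)) (frechet_derivative Z (at w) (axis j 1)) *\<^sub>R inv ((*v) (gram Z w)) (axis j 1))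
       = inv ((*v) (gram Z w)) (\<chi> j. gB (Z w) (K (Z w)) (frechet_derivative Z (at w) (axis j 1)))"
      by simp
  qed
  have D: "cdiff k (\<lambda>w. sqrt (det (gram Z w))) S"
    by (rule cdiff_sqrt_compose[OF cdiff_det[OF g] posdef_det_pos[OF pd]])
  from cdiff_scaleR[OF D I] show ?thesis unfolding flux_def .
qed

text \<open>Vary along \<open>V = f K\<close>. In the derivative of the Gram matrix the terms with
  \<open>f\<close> undifferentiated form \<open>f\<close> times the Lie derivative of the metric and
  vanish; the terms with derivatives of \<open>f\<close> have the form treated by
  \<open>det_derivative_rank_two\<close>. What remains is the gradient of \<open>\<phi>\<close>
  paired with the flux. \<open>f\<close> lives on the ambient space because minimality is tested
  with ambient fields.\<close>

lemma first_variation: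
  fixes Z :: "real^'m \<Rightarrow> complex^'n"
  assumes min: "bergman_minimal TYPE('m) \<Sigma>" and ball: "\<Sigma> \<subseteq> ball 0 1"
    and W: "open W" "\<And>k. cdiff k Z W" "inj_on Z W" "Z ` W \<subseteq> \<Sigma>"
    and imm: "\<And>w v. w \<in> W \<Longrightarrow> frechet_derivative Z (at w) v = 0 \<Longrightarrow> v = 0"
    and K: "killing K K'" and f: "\<And>k. cdiff k f UNIV"
    and \<phi>: "cdiff 1 \<phi> W" "\<And>w. w \<in> W \<Longrightarrow> f (Z w) = \<phi> w"
    and box: "cbox a b \<subseteq> W" "\<And>w. w \<in> W - cbox a b \<Longrightarrow> \<phi> w = 0"
  shows "((\<lambda>w. \<Sum>i\<in>UNIV. frechet_derivative \<phi> (at w) (axis i 1) * flux K Z w $ i) has_integral 0) (cbox a b)"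
proof -
  define V where "V = (\<lambda>z. f z *\<^sub>R K z)"
  define v where "v = (\<lambda>w. V (Z w))"
  have Kd: "(K has_derivative K' z) (at z)" "\<And>k. cdiff k K UNIV"
    "\<And>z a c. norm z < 1 \<Longrightarrow> gB z (K' z a) c + gB z a (K' z c) + dgB z (K z) a c = 0" for z
    using K by (auto simp: killing_def)
  have Vk: "cdiff k V UNIV" for k unfolding V_def by (intro cdiff_scaleR f Kd)
  have vk: "cdiff k v W" for k unfolding v_def by (rule cdiff_compose[OF W(2) Vk]) auto
  have Zd: "(Z has_derivative frechet_derivative Z (at w)) (at w)" if "w \<in> W" for w
    by (rule cdiff_imp_frechet[OF W(2) that])
  have vd: "(v has_derivative frechet_derivative v (at w)) (at w)" if "w \<in> W" for w
    by (rule cdiff_imp_frechet[OF vk that])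
  have lt: "norm (Z w) < 1" if "w \<in> W" for w
  proof -
    have "Z w \<in> ball 0 1" using that W(4) ball by blast
    then show ?thesis by simp
  qed
  define a' where "a' = (\<lambda>i w. frechet_derivative Z (at w) (axis i 1))"
  define A' where "A' = (\<lambda>i w. frechet_derivative v (at w) (axis i 1))"
  \<comment> \<open>The varied surface and its tangent vectors as functions of time and parameter
    jointly, so that joint regularity of the integrand follows from the rules for
    \<open>cdiff\<close>.\<close>
  define X where "X = (\<lambda>x::real \<times> (real^'m). Z (snd x) + fst x *\<^sub>R v (snd x))"
  define E where "E = (\<lambda>i. \<lambda>x::real \<times> (real^'m). a' i (snd x) + fst x *\<^sub>R A' i (snd x))"
  define \<Gamma> where "\<Gamma> = (\<lambda>x. (\<chi> i j. gB (X x) (E i x) (E j x)) :: real^'m^'m)"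
  define O1 where "O1 = (UNIV :: real set) \<times> W"
  have O1: "open O1" unfolding O1_def by (intro open_Times W) simp
  have snd: "cdiff k (\<lambda>x. g (snd x)) O1" if "cdiff k g W" for k and g :: "real^'m \<Rightarrow> complex^'n"
    by (rule cdiff_compose[OF cdiff_linear[OF bounded_linear_snd] that]) (auto simp: O1_def)
  have fst: "cdiff k (\<lambda>x. fst x) O1" for k by (rule cdiff_linear[OF bounded_linear_fst])
  have X: "cdiff k X O1" for k
    unfolding X_def by (intro cdiff_add cdiff_scaleR snd fst W vk)
  have E: "cdiff k (E i) O1" for k i
    unfolding E_def a'_def A'_def by (intro cdiff_add cdiff_scaleR snd fst cdiff_frechet[OF W(2)] cdiff_frechet[OF vk] W)
  define O2 where "O2 = O1 \<inter> X -` ball 0 1"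
  have O2: "open O2" unfolding O2_def
    by (rule continuous_open_preimage[OF cdiff_continuous[OF X] O1 open_ball])
  have G: "cdiff k (\<lambda>x. det (\<Gamma> x)) O2" for k
  proof (rule cdiff_det)
    show "cdiff k (\<lambda>x. \<Gamma> x $ i $ j) O2" for i j
      unfolding \<Gamma>_def by simp (intro cdiff_gB cdiff_subset[OF X] cdiff_subset[OF E], auto simp: O2_def)
  qed
  define O3 where "O3 = O2 \<inter> (\<lambda>x. det (\<Gamma> x)) -` {0<..}"
  have O3: "open O3" unfolding O3_def
    by (rule continuous_open_preimage[OF cdiff_continuous[OF G] O2 open_greaterThan])
  define I where "I = (\<lambda>x. sqrt (det (\<Gamma> x)))"
  have I: "cdiff (Suc k) I O3" for k unfolding I_def
    by (rule cdiff_sqrt_compose[OF cdiff_subset[OF G]]) (auto simp: O3_def)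
  have \<Gamma>0: "\<Gamma> (0, w) = gram Z w" for w
    by (simp add: \<Gamma>_def gram_def X_def E_def a'_def)
  have pd: "posdef (gram Z w)" if "w \<in> W" for w
    using gram_posdef[OF Zd[OF that] lt[OF that]] imm[OF that] by blast
  have "{0} \<times> cbox a b \<subseteq> O3"
    using box(1) posdef_det_pos[OF pd] lt by (auto simp: O3_def O2_def O1_def \<Gamma>0 X_def)
  \<comment> \<open>Compactness of the box gives one time interval on which the surface stays in the
    ball and the Gram determinants stay positive, as needed to differentiate under the
    integral.\<close>
  have "\<exists>\<tau>>0. {-\<tau>..\<tau>} \<times> cbox a b \<subseteq> O3"
  proof (cases "cbox a b = {}")
    case False
    have cpt: "compact ({0::real} \<times> cbox a b)" by (intro compact_Times) auto
    obtain e where e: "e > 0" "\<And>x y. x \<in> {0} \<times> cbox a b \<Longrightarrow> dist y x < e \<Longrightarrow> y \<in> O3"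
    proof -
      from compact_subset_open_imp_ball_epsilon_subset[OF cpt O3 \<open>{0} \<times> cbox a b \<subseteq> O3\<close>]
      obtain e where "e > 0" "(\<Union>x\<in>{0} \<times> cbox a b. ball x e) \<subseteq> O3" by metis
      show ?thesis
      proof (rule that[OF \<open>e > 0\<close>])
        fix x y :: "real \<times> (real^'m)" assume "x \<in> {0} \<times> cbox a b" "dist y x < e"
        then have "y \<in> (\<Union>x\<in>{0} \<times> cbox a b. ball x e)" by (intro UN_I) (auto simp: dist_commute)
        then show "y \<in> O3" using \<open>(\<Union>x\<in>{0} \<times> cbox a b. ball x e) \<subseteq> O3\<close> by blast
      qed
    qed
    have "{-(e/2)..e/2} \<times> cbox a b \<subseteq> O3"
    proof
      fix y assume "y \<in> {-(e/2)..e/2} \<times> cbox a b"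
      then obtain t w where y: "y = (t, w)" "\<bar>t\<bar> \<le> e/2" "w \<in> cbox a b" by auto
      have "dist y (0, w) < e" using y e(1) by (simp add: dist_Pair_Pair)
      with e(2)[of "(0,w)" y] y show "y \<in> O3" by auto
    qed
    with e(1) show ?thesis by (intro exI[of _ "e/2"]) auto
  qed (auto intro: exI[of _ 1])
  then obtain \<tau> where \<tau>: "\<tau> > 0" "{-\<tau>..\<tau>} \<times> cbox a b \<subseteq> O3" by blast
  define It where "It = (\<lambda>t w. frechet_derivative I (at (t, w)) (1, 0))"
  have Id: "((\<lambda>t. I (t, w)) has_real_derivative It t w) (at t)" if "(t, w) \<in> O3" for t w
  proof -
    have *: "(I has_derivative frechet_derivative I (at (t, w))) (at (t, w))" by (rule cdiff_imp_frechet[OF I that])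
    have "((\<lambda>t. I (t, w)) has_derivative (\<lambda>s. frechet_derivative I (at (t, w)) (s, 0))) (at t)"
      by (rule has_derivative_compose[where f="\<lambda>t. (t, w)" and g=I, OF _ *]) (auto intro!: derivative_eq_intros)
    moreover have "frechet_derivative I (at (t, w)) (s, 0) = It t w * s" for s
      using linear_scale[OF has_derivative_linear[OF *], of s "(1, 0)"] by (simp add: It_def mult.commute)
    ultimately show ?thesis unfolding has_field_derivative_def by simp
  qed
  have cI: "continuous_on O3 I" by (rule cdiff_continuous[OF I])
  have cIt: "continuous_on O3 (\<lambda>x. frechet_derivative I (at x) (1, 0))"
    using cdiff_frechet[OF I[of 0] O3] by simp
  have "((\<lambda>t. integral (cbox a b) (\<lambda>w. I (t, w))) has_field_derivative integral (cbox a b) (It 0)) (at 0 within {-\<tau>..\<tau>})"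
  proof (rule leibniz_rule_field_derivative)
    show "((\<lambda>t. I (t, w)) has_real_derivative It t w) (at t within {-\<tau>..\<tau>})" if "t \<in> {-\<tau>..\<tau>}" "w \<in> cbox a b" for t w
    proof (rule has_field_derivative_at_within[OF Id])
      show "(t, w) \<in> O3" using \<tau>(2) that by blast
    qed
    show "(\<lambda>w. I (t, w)) integrable_on cbox a b" if "t \<in> {-\<tau>..\<tau>}" for t
    proof (rule integrable_continuous, rule continuous_on_compose2[OF cI])
      show "continuous_on (cbox a b) (Pair t)" by (intro continuous_intros)
      show "Pair t ` cbox a b \<subseteq> O3" using \<tau>(2) that by blast
    qed
    show "continuous_on ({-\<tau>..\<tau>} \<times> cbox a b) (\<lambda>(t, w). It t w)"
      using continuous_on_subset[OF cIt \<tau>(2)] by (simp only: It_def split_beta' prod.collapse)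
  qed (use \<tau> in auto)
  then have L: "((\<lambda>t. integral (cbox a b) (\<lambda>w. I (t, w))) has_real_derivative integral (cbox a b) (It 0)) (at 0)"
    using at_within_Icc_at[of "-\<tau>" 0 \<tau>] \<tau>(1) by simp
  have "((\<lambda>t. integral (cbox a b) (\<lambda>w. sqrt (det (\<chi> i j.
              gB (Z w + t *\<^sub>R V (Z w))
                 (dirderiv (\<lambda>x. Z x + t *\<^sub>R V (Z x)) (axis i 1) w)
                 (dirderiv (\<lambda>x. Z x + t *\<^sub>R V (Z x)) (axis j 1) w)))))
            has_real_derivative 0) (at 0)"
  proof (rule min[unfolded bergman_minimal_def, rule_format], intro conjI ballI)
    show "Cl_on \<infinity> Z W" "Cl_on \<infinity> V UNIV" unfolding Cl_on_infty_iff using W Vk by auto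
    show "inj (frechet_derivative Z (at w))" if "w \<in> W" for w
      using linear_injective_0[OF has_derivative_linear[OF Zd[OF that]]] imm[OF that] by blast
    show "V (Z w) = 0" if "w \<in> W - cbox a b" for w
      using that box(2)[OF that] \<phi>(2) by (simp add: V_def)
  qed (use W box in auto)
  moreover have "integral (cbox a b) (\<lambda>w. sqrt (det (\<chi> i j.
              gB (Z w + t *\<^sub>R V (Z w))
                 (dirderiv (\<lambda>x. Z x + t *\<^sub>R V (Z x)) (axis i 1) w)
                 (dirderiv (\<lambda>x. Z x + t *\<^sub>R V (Z x)) (axis j 1) w))))
       = integral (cbox a b) (\<lambda>w. I (t, w))" for t
  proof (rule integral_cong)
    fix w assume "w \<in> cbox a b"
    then have w: "w \<in> W" using box by auto
    have "((\<lambda>x. Z x + t *\<^sub>R V (Z x)) has_derivative (\<lambda>h. frechet_derivative Z (at w) h + t *\<^sub>R frechet_derivative v (at w) h)) (at w)"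
      using Zd[OF w] vd[OF w] unfolding v_def by (intro has_derivative_add has_derivative_scaleR_right)
    from has_derivative_dirderiv(2)[OF this]
    have "dirderiv (\<lambda>x. Z x + t *\<^sub>R V (Z x)) (axis i 1) w = E i (t, w)" for i
      by (simp add: E_def a'_def A'_def)
    then show "sqrt (det (\<chi> i j. gB (Z w + t *\<^sub>R V (Z w))
                 (dirderiv (\<lambda>x. Z x + t *\<^sub>R V (Z x)) (axis i 1) w)
                 (dirderiv (\<lambda>x. Z x + t *\<^sub>R V (Z x)) (axis j 1) w))) = I (t, w)"
      by (simp add: I_def \<Gamma>_def X_def v_def)
  qed
  ultimately have "integral (cbox a b) (It 0) = 0"
    using DERIV_unique[OF L] by simp
  moreover have "continuous_on (cbox a b) (It 0)"
    unfolding It_def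
  proof (rule continuous_on_compose2[OF cIt])
    show "continuous_on (cbox a b) (Pair 0)" by (intro continuous_intros)
    have "(0::real) \<in> {-\<tau>..\<tau>}" using \<tau>(1) by simp
    then show "Pair 0 ` cbox a b \<subseteq> O3" using \<tau>(2) by blast
  qed
  ultimately have "(It 0 has_integral 0) (cbox a b)"
    using integrable_continuous integrable_integral by metis
  then show ?thesis
  proof (rule has_integral_eq[rotated])
    fix w assume wbox: "w \<in> cbox a b"
    then have w: "w \<in> W" using box by auto
    define u where "u = (\<chi> i. frechet_derivative \<phi> (at w) (axis i 1))"
    define p where "p = (\<chi> j. gB (Z w) (K (Z w)) (a' j w))"
    define x where "x = inv ((*v) (gram Z w)) p"
    have x: "gram Z w *v x = p" unfolding x_def by (rule posdef_surj[OF pd[OF w]])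
    have vd': "(v has_derivative (\<lambda>h. \<phi> w *\<^sub>R K' (Z w) (frechet_derivative Z (at w) h) + frechet_derivative \<phi> (at w) h *\<^sub>R K (Z w))) (at w)"
    proof -
      have "((\<lambda>x. K (Z x)) has_derivative (\<lambda>h. K' (Z w) (frechet_derivative Z (at w) h))) (at w)"
        by (rule has_derivative_compose[OF Zd[OF w] Kd(1)])
      from has_derivative_scaleR[OF cdiff_1_has_derivative[OF \<phi>(1) w] this]
      show ?thesis
      proof (rule has_derivative_transform_within_open[OF _ W(1) w])
        show "\<phi> x *\<^sub>R K (Z x) = v x" if "x \<in> W" for x using \<phi>(2)[OF that] by (simp add: v_def V_def)
      qed
    qed
    have A: "A' i w = u $ i *\<^sub>R K (Z w) + \<phi> w *\<^sub>R K' (Z w) (a' i w)" for i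
      using has_derivative_unique[OF vd[OF w] vd'] by (simp add: A'_def a'_def u_def)
    have der: "((\<lambda>t. \<Gamma> (t, w) $ i $ j) has_real_derivative u $ i * p $ j + p $ i * u $ j) (at 0)" for i j
    proof -
      have "((\<lambda>t. gB (Z w + t *\<^sub>R v w) (a' i w + t *\<^sub>R A' i w) (a' j w + t *\<^sub>R A' j w)) has_real_derivative
        gB (Z w) (A' i w) (a' j w) + gB (Z w) (a' i w) (A' j w) + dgB (Z w) (v w) (a' i w) (a' j w)) (at 0)"
        by (rule gB_has_derivative[OF lt[OF w]])
      \<comment> \<open>The bracket multiplied by \<open>\<phi> w\<close> is the left-hand side of
        the Killing equation.\<close>
      moreover have "gB (Z w) (A' i w) (a' j w) + gB (Z w) (a' i w) (A' j w) + dgB (Z w) (v w) (a' i w) (a' j w)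
        = u $ i * p $ j + p $ i * u $ j + \<phi> w * (gB (Z w) (K' (Z w) (a' i w)) (a' j w)
           + gB (Z w) (a' i w) (K' (Z w) (a' j w)) + dgB (Z w) (K (Z w)) (a' i w) (a' j w))"
        using \<phi>(2)[OF w] gB_sym[of "Z w" "a' i w" "K (Z w)"]
        by (simp add: A p_def gB_add gB_scale v_def V_def dgB_scale algebra_simps)
      ultimately show ?thesis
        using Kd(3)[OF lt[OF w], of "a' i w" "a' j w"] by (simp add: \<Gamma>_def X_def E_def)
    qed
    have "((\<lambda>t. det (\<Gamma> (t, w))) has_real_derivative 2 * det (gram Z w) * (u \<bullet> x)) (at 0)"
      using det_derivative_rank_two[of "\<lambda>t. \<Gamma> (t, w)" u p 0 x] der pd[OF w] posdef_inj[OF pd[OF w]] x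
      by (simp add: \<Gamma>0 posdef_def)
    from DERIV_chain2[OF DERIV_real_sqrt this] posdef_det_pos[OF pd[OF w]]
    have "((\<lambda>t. I (t, w)) has_real_derivative inverse (sqrt (det (gram Z w))) / 2 * (2 * det (gram Z w) * (u \<bullet> x))) (at 0)"
      by (simp add: I_def \<Gamma>0)
    moreover have "((\<lambda>t. I (t, w)) has_real_derivative It 0 w) (at 0)"
    proof (rule Id)
      have "(0::real) \<in> {-\<tau>..\<tau>}" using \<tau>(1) by simp
      then show "(0, w) \<in> O3" using \<tau>(2) wbox by blast
    qed
    ultimately have "It 0 w = inverse (sqrt (det (gram Z w))) * det (gram Z w) * (u \<bullet> x)"
      using DERIV_unique by fastforce
    also have "\<dots> = sqrt (det (gram Z w)) * (u \<bullet> x)"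
      using posdef_det_pos[OF pd[OF w]] by (simp add: divide_inverse[symmetric] mult.commute[of "inverse _"] real_div_sqrt)
    also have "\<dots> = (\<Sum>i\<in>UNIV. frechet_derivative \<phi> (at w) (axis i 1) * flux K Z w $ i)"
      by (simp add: flux_def x_def p_def a'_def u_def inner_vec_def sum_distrib_left mult_ac)
    finally show "It 0 w = (\<Sum>i\<in>UNIV. frechet_derivative \<phi> (at w) (axis i 1) * flux K Z w $ i)" .
  qed
qed

text \<open>The parametrization is pinned down by functions on the target: the boundary coordinate
  by the norm, the others by linear functionals. This gives an explicit left inverse where the
  boundary coordinate is positive, and immersivity off the face.\<close>

definition normalized :: "'m \<Rightarrow> ('m \<Rightarrow> complex^'n) \<Rightarrow> (real^'m \<Rightarrow> complex^'n) \<Rightarrow> (real^'m) set \<Rightarrow> bool" where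
  "normalized \<nu> e Z Q \<longleftrightarrow> (\<forall>y\<in>Q. (norm (Z y))\<^sup>2 = 1 - (y $ \<nu>)\<^sup>2 \<and> (\<forall>i. i \<noteq> \<nu> \<longrightarrow> e i \<bullet> Z y = y $ i))"

lemma normalized_derivative:
  assumes N: "normalized \<nu> e Z Q" and Q: "open Q" "y \<in> Q" and Z: "(Z has_derivative D) (at y)"
  shows "Z y \<bullet> D v = - (y $ \<nu>) * v $ \<nu>" "i \<noteq> \<nu> \<Longrightarrow> e i \<bullet> D v = v $ i"
proof -
  have "((\<lambda>y. Z y \<bullet> Z y) has_derivative (\<lambda>v. Z y \<bullet> D v + D v \<bullet> Z y)) (at y)"
    by (rule has_derivative_inner[OF Z Z])
  moreover have "((\<lambda>y. 1 - y $ \<nu> * y $ \<nu>) has_derivative (\<lambda>v. 0 - (y $ \<nu> * v $ \<nu> + v $ \<nu> * y $ \<nu>))) (at y)"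
    by (intro has_derivative_diff has_derivative_const has_derivative_mult bounded_linear_imp_has_derivative bounded_linear_vec_nth)
  then have "((\<lambda>y. Z y \<bullet> Z y) has_derivative (\<lambda>v. 0 - (y $ \<nu> * v $ \<nu> + v $ \<nu> * y $ \<nu>))) (at y)"
  proof (rule has_derivative_transform_within_open[OF _ Q])
    show "1 - x $ \<nu> * x $ \<nu> = Z x \<bullet> Z x" if "x \<in> Q" for x
      using N that unfolding normalized_def power2_norm_eq_inner by (simp add: power2_eq_square)
  qed
  ultimately have "Z y \<bullet> D v + D v \<bullet> Z y = 0 - (y $ \<nu> * v $ \<nu> + v $ \<nu> * y $ \<nu>)"
    by (rule fun_cong[OF has_derivative_unique])
  then show "Z y \<bullet> D v = - (y $ \<nu>) * v $ \<nu>" by (simp add: inner_commute)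
  assume i: "i \<noteq> \<nu>"
  have "((\<lambda>y. e i \<bullet> Z y) has_derivative (\<lambda>v. e i \<bullet> D v)) (at y)"
    by (rule has_derivative_inner_right[OF Z])
  moreover have "((\<lambda>y. y $ i) has_derivative (\<lambda>v. v $ i)) (at y)"
    by (intro bounded_linear_imp_has_derivative bounded_linear_vec_nth)
  then have "((\<lambda>y. e i \<bullet> Z y) has_derivative (\<lambda>v. v $ i)) (at y)"
    by (rule has_derivative_transform_within_open[OF _ Q]) (use N i in \<open>auto simp: normalized_def\<close>)
  ultimately show "e i \<bullet> D v = v $ i" by (rule fun_cong[OF has_derivative_unique])
qed

lemma normalized_immersion:
  assumes "normalized \<nu> e Z Q" "open Q" "y \<in> Q" "(Z has_derivative D) (at y)" "y $ \<nu> \<noteq> 0" "D v = 0"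
  shows "v = 0"
proof -
  have "v $ i = 0" for i
    using normalized_derivative[OF assms(1-4), where v=v] assms(5,6) by (cases "i = \<nu>") auto
  then show ?thesis by (simp add: vec_eq_iff)
qed

lemma normalized_norm_less:
  assumes "normalized \<nu> e Z Q" "y \<in> Q" "y $ \<nu> \<noteq> 0"
  shows "norm (Z y) < 1"
proof -
  have "(norm (Z y))\<^sup>2 < 1" using assms by (simp add: normalized_def)
  then show ?thesis by (simp add: abs_square_less_1)
qed

lemma normalized_gram_posdef:
  assumes N: "normalized \<nu> e Z Q" "open Q" "y \<in> Q" "cdiff 1 Z Q" "y $ \<nu> \<noteq> 0"
  shows "posdef (gram Z y)"
  using cdiff_1_has_derivative[OF N(4,3)] normalized_immersion[OF N(1-3)] normalized_norm_less[OF N(1,3)] N(5)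
  by (intro gram_posdef) auto

text \<open>The bump in the parameters has to be the restriction of an ambient function; composing
  it with the explicit left inverse \<open>\<Psi>\<close> of the normalized \<open>Z\<close>
  provides one.\<close>

lemma flux_divergence_free:
  fixes Z :: "real^'m \<Rightarrow> complex^'n"
  assumes min: "bergman_minimal TYPE('m) \<Sigma>" and ball: "\<Sigma> \<subseteq> ball 0 1"
    and W: "open W" "\<And>k. cdiff k Z W" "Z ` W \<subseteq> \<Sigma>" "\<And>w. w \<in> W \<Longrightarrow> w $ \<nu> > 0"
    and N: "normalized \<nu> e Z W" and K: "killing K K'" and c: "c \<in> W"
  shows "dvg (flux K Z) c = 0"
proof (rule dvg_eq_0_if_weak[OF W(1) _ c])
  have Z1: "cdiff 1 Z W" by (rule W(2))
  have Zd: "(Z has_derivative frechet_derivative Z (at w)) (at w)" if "w \<in> W" for w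
    by (rule cdiff_1_has_derivative[OF Z1 that])
  have nz: "w $ \<nu> \<noteq> 0" if "w \<in> W" for w using W(4)[OF that] by simp
  show "cdiff 1 (flux K Z) W"
    using K nz by (intro cdiff_flux W normalized_norm_less[OF N] normalized_gram_posdef[OF N W(1) _ Z1])
      (auto simp: killing_def)
  fix d :: real assume d: "d > 0" and box: "cbox (c - (\<chi> i. d)) (c + (\<chi> i. d)) \<subseteq> W"
  define \<Psi> where "\<Psi> = (\<lambda>z. (\<chi> i. if i = \<nu> then sqrt (1 - (norm z)\<^sup>2) else e i \<bullet> z) :: real^'m)"
  have \<Psi>: "\<Psi> (Z w) = w" if "w \<in> W" for w
    using N W(4)[OF that] that by (auto simp: \<Psi>_def normalized_def vec_eq_iff)
  \<comment> \<open>The smallest \<nu>-coordinate on the box. Where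
    \<open>sqrt (1 - |z|^2) < r\<close> the composed bump vanishes, so it extends smoothly by zero
    past the sphere, at which \<open>\<Psi>\<close> has a square root singularity.\<close>
  define r where "r = c $ \<nu> - d"
  have "c - (\<chi> i. d) \<in> cbox (c - (\<chi> i. d)) (c + (\<chi> i. d))" using d by (auto simp: mem_box_cart)
  then have "c - (\<chi> i. d) \<in> W" using box by blast
  from W(4)[OF this] have r: "r > 0" by (simp add: r_def)
  define f where "f = (\<lambda>z. if norm z < 1 then bump c d (\<Psi> z) else 0)"
  have "cdiff k f UNIV" for k
  proof (rule cdiff_local)
    fix z :: "complex^'n"
    show "\<exists>U. open U \<and> z \<in> U \<and> cdiff k f U"
    proof (cases "norm z < 1")
      case True
      have P: "cdiff k \<Psi> (ball 0 1)"
      proof (rule cdiff_vec_lambda)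
        fix i
        have "cdiff k (\<lambda>z. sqrt (1 - (norm z)\<^sup>2)) (ball 0 (1::real) :: (complex^'n) set)"
          by (intro cdiff_sqrt_compose cdiff_diff cdiff_const cdiff_norm_power2 cdiff_id) (use norm_lt_1_nz in auto)
        moreover have "cdiff k (\<lambda>z. e i \<bullet> z) (ball 0 1)"
          by (intro cdiff_inner cdiff_const cdiff_id)
        ultimately show "cdiff k (\<lambda>z. \<Psi> z $ i) (ball 0 1)" by (cases "i = \<nu>") (simp_all add: \<Psi>_def)
      qed
      have "cdiff k (\<lambda>z. bump c d (\<Psi> z)) (ball 0 1)"
        by (rule cdiff_compose[OF P cdiff_bump[where S=UNIV]]) auto
      then have "cdiff k f (ball 0 1)"
        by (rule cdiff_cong[OF open_ball, rotated]) (auto simp: f_def)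
      with True show ?thesis by (intro exI[of _ "ball 0 1"]) auto
    next
      case False
      define U where "U = {z :: complex^'n. 1 - (norm z)\<^sup>2 < r\<^sup>2}"
      have "open U" unfolding U_def by (intro open_Collect_less continuous_intros)
      moreover have "z \<in> U"
      proof -
        have "1 \<le> (norm z)\<^sup>2" using False by simp
        moreover have "r\<^sup>2 > 0" using r by simp
        ultimately show ?thesis unfolding U_def mem_Collect_eq by linarith
      qed
      moreover have "cdiff k f U"
      proof (rule cdiff_cong[OF \<open>open U\<close> _ cdiff_const[of k 0]])
        fix x assume x: "x \<in> U"
        show "0 = f x"
        proof (cases "norm x < 1")
          case True
          have "sqrt (1 - (norm x)\<^sup>2) < r"
            using x r real_sqrt_less_mono[of "1 - (norm x)\<^sup>2" "r\<^sup>2"] by (simp add: U_def)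
          then have "\<Psi> x \<notin> cbox (c - (\<chi> i. d)) (c + (\<chi> i. d))"
            by (auto simp: mem_box_cart \<Psi>_def r_def not_le intro!: exI[of _ \<nu>])
          then show ?thesis by (simp add: f_def bump_zero)
        qed (simp add: f_def)
      qed
      ultimately show ?thesis by blast
    qed
  qed
  note fk = this
  show "((\<lambda>x. \<Sum>i\<in>UNIV. frechet_derivative (bump c d) (at x) (axis i 1) * flux K Z x $ i) has_integral 0)
        (cbox (c - (\<chi> i. d)) (c + (\<chi> i. d)))"
  proof (rule first_variation[OF min ball W(1,2) _ W(3) _ K fk cdiff_bump])
    show "inj_on Z W" by (rule inj_on_inverseI[where g=\<Psi>]) (rule \<Psi>)
    show "v = 0" if "w \<in> W" "frechet_derivative Z (at w) v = 0" for w v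
      by (rule normalized_immersion[OF N W(1) that(1) Zd[OF that(1)] nz[OF that(1)] that(2)])
    show "f (Z w) = bump c d w" if "w \<in> W" for w
      using normalized_norm_less[OF N that nz[OF that]] \<Psi>[OF that] by (simp add: f_def)
    show "bump c d w = 0" if "w \<in> W - cbox (c - (\<chi> i. d)) (c + (\<chi> i. d))" for w
      using that by (intro bump_zero) auto
  qed (rule box)
qed

section \<open>Boundary behaviour of the normal derivative\<close>

lemma dvg_scaleR:
  fixes B :: "real^'m \<Rightarrow> real^'m"
  assumes f: "(f has_derivative f') (at x)" and B: "B differentiable (at x)"
  shows "dvg (\<lambda>x. f x *\<^sub>R B x) x = f x * dvg B x + (\<Sum>i\<in>UNIV. f' (axis i 1) * B x $ i)"
proof -
  have "(B has_derivative frechet_derivative B (at x)) (at x)" using B by (simp add: frechet_derivative_works)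
  from frechet_derivative_at[OF has_derivative_scaleR[OF f this], symmetric]
  show ?thesis by (simp add: dvg_def sum.distrib sum_distrib_left)
qed

lemma dvg_add:
  fixes A B :: "real^'m \<Rightarrow> real^'m"
  assumes A: "A differentiable (at x)" and B: "B differentiable (at x)"
  shows "dvg (\<lambda>x. A x + B x) x = dvg A x + dvg B x"
proof -
  have "(A has_derivative frechet_derivative A (at x)) (at x)" "(B has_derivative frechet_derivative B (at x)) (at x)"
    using A B by (simp_all add: frechet_derivative_works)
  from frechet_derivative_at[OF has_derivative_add[OF this], symmetric]
  show ?thesis by (simp add: dvg_def sum.distrib)
qed

lemma dvg_cong:
  assumes "open S" "x \<in> S" "\<And>y. y \<in> S \<Longrightarrow> A y = B y" "A differentiable (at x)"
  shows "dvg A x = dvg B x"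
proof -
  have "(A has_derivative frechet_derivative A (at x)) (at x)" using assms(4) by (simp add: frechet_derivative_works)
  then have "(B has_derivative frechet_derivative A (at x)) (at x)"
    by (rule has_derivative_transform_within_open[OF _ assms(1,2)]) (rule assms(3))
  from frechet_derivative_at[OF this] show ?thesis by (simp add: dvg_def)
qed

lemma det_scaleR:
  fixes A :: "real^'n^'n"
  shows "det (c *\<^sub>R A) = c ^ CARD('n) * det A"
proof -
  have "c *\<^sub>R A = (\<chi> i. c *s A $ i)" by (simp add: vec_eq_iff)
  then show ?thesis by (simp add: det_rows_mul[of "\<lambda>_. c" "\<lambda>i. A $ i"])
qed

lemma posdef_scaleR: "c > 0 \<Longrightarrow> posdef A \<Longrightarrow> posdef (c *\<^sub>R A)"
  by (auto simp: posdef_def transpose_def vec_eq_iff scaleR_matrix_vector_assoc[symmetric])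

lemma inv_scaleR_matrix:
  assumes "posdef A" "c > 0"
  shows "inv ((*v) (c *\<^sub>R A)) (d *\<^sub>R p) = (d / c) *\<^sub>R inv ((*v) A) p"
  by (rule posdef_inv_eq[OF posdef_scaleR[OF assms(2,1)]])
     (use assms in \<open>simp add: scaleR_matrix_vector_assoc[symmetric] matrix_vector_mult_scaleR posdef_surj\<close>)

lemma tendsto_sqrt_det_inv:
  fixes G :: "'i \<Rightarrow> real^'n^'n"
  assumes G: "\<And>i j. ((\<lambda>y. G y $ i $ j) \<longlongrightarrow> G1 $ i $ j) F" and p: "\<And>j. ((\<lambda>y. p y $ j) \<longlongrightarrow> p1 $ j) F"
    and pd: "\<forall>\<^sub>F y in F. posdef (G y)" "posdef G1"
  shows "((\<lambda>y. sqrt (det (G y)) *\<^sub>R inv ((*v) (G y)) (p y)) \<longlongrightarrow> sqrt (det G1) *\<^sub>R inv ((*v) G1) p1) F"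
    "((\<lambda>y. inv ((*v) (G y)) (p y)) \<longlongrightarrow> inv ((*v) G1) p1) F" "((\<lambda>y. det (G y)) \<longlongrightarrow> det G1) F"
proof -
  show 1: "((\<lambda>y. inv ((*v) (G y)) (p y)) \<longlongrightarrow> inv ((*v) G1) p1) F"
  proof (rule inv_linear_tendsto)
    show "((\<lambda>y. G y *v v) \<longlongrightarrow> G1 *v v) F" for v
      by (rule vec_tendstoI) (simp add: matrix_vector_mult_def, intro tendsto_intros G)
    show "\<forall>\<^sub>F y in F. linear ((*v) (G y)) \<and> inj ((*v) (G y))"
      using pd(1) by eventually_elim (simp add: posdef_inj)
    show "(p \<longlongrightarrow> p1) F" by (rule vec_tendstoI) (rule p)
  qed (use pd(2) posdef_inj in auto)
  show 2: "((\<lambda>y. det (G y)) \<longlongrightarrow> det G1) F"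
    unfolding det_def by (intro tendsto_intros G)
  show "((\<lambda>y. sqrt (det (G y)) *\<^sub>R inv ((*v) (G y)) (p y)) \<longlongrightarrow> sqrt (det G1) *\<^sub>R inv ((*v) G1) p1) F"
    by (intro tendsto_intros 1 2)
qed

text \<open>The Sherman-Morrison formula on the perturbing vector itself, where it is a mere
  rescaling.\<close>

lemma rank_one_inv:
  fixes G :: "real^'n^'n"
  assumes G: "posdef G" and w: "G *v w = e"
  shows "inv ((*v) (G + (\<chi> i j. e $ i * e $ j))) e = (1 / (1 + e \<bullet> w)) *\<^sub>R w" and "1 + e \<bullet> w > 0"
proof -
  show pos: "1 + e \<bullet> w > 0"
    using G w by (cases "w = 0") (auto simp: posdef_def inner_commute add_pos_pos)
  show "inv ((*v) (G + (\<chi> i j. e $ i * e $ j))) e = (1 / (1 + e \<bullet> w)) *\<^sub>R w"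
  proof (rule posdef_inv_eq[OF posdef_rank_one[OF G]])
    have "(G + (\<chi> i j. e $ i * e $ j)) *v w = (1 + e \<bullet> w) *\<^sub>R e"
      by (simp add: rank_one_mult w scaleR_add_left)
    with pos show "(G + (\<chi> i j. e $ i * e $ j)) *v ((1 / (1 + e \<bullet> w)) *\<^sub>R w) = e"
      by (simp add: matrix_vector_mult_scaleR)
  qed
qed

lemma quadratic_form:
  fixes M :: "real^'n^'n"
  shows "v \<bullet> (M *v v) = (\<Sum>i\<in>UNIV. \<Sum>j\<in>UNIV. v $ i * (v $ j * M $ i $ j))"
  by (simp add: inner_vec_def matrix_vector_mult_def sum_distrib_left mult.commute)

text \<open>The domain is the full cube across the face \<open>y $ \<nu> = 0\<close>, so derivatives
  at face points are ordinary ones. \<open>dense\<close> is a substitute for smoothness: minimality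
  speaks only about smooth parametrizations into \<Sigma>, whereas the \<open>Z\<close> of the
  application is merely C^2 with values in the closure; identities on small smooth patches extend by
  continuity. \<open>axes\<close> and \<open>ortho\<close> make the tangential derivatives
  orthonormal at the origin only.\<close>

locale boundary_chart =
  fixes \<Sigma> :: "(complex^'n) set" and Z :: "real^'m \<Rightarrow> complex^'n" and \<nu> :: 'm and e :: "'m \<Rightarrow> complex^'n" and \<delta> :: real
  assumes delta: "\<delta> > 0" and Z2: "cdiff 2 Z (cube \<delta>)" and N: "normalized \<nu> e Z (cube \<delta>)"
    and min: "bergman_minimal TYPE('m) \<Sigma>" and ball: "\<Sigma> \<subseteq> ball 0 1"
    and dense: "\<And>y U. y \<in> hcube \<nu> \<delta> \<Longrightarrow> open U \<Longrightarrow> y \<in> U \<Longrightarrow>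
        \<exists>W. open W \<and> W \<noteq> {} \<and> W \<subseteq> U \<inter> hcube \<nu> \<delta> \<and> (\<forall>k. cdiff k Z W) \<and> Z ` W \<subseteq> \<Sigma>"
    and axes: "\<And>i. i \<noteq> \<nu> \<Longrightarrow> frechet_derivative Z (at 0) (axis i 1) = e i"
    and ortho: "\<And>i j. i \<noteq> \<nu> \<Longrightarrow> j \<noteq> \<nu> \<Longrightarrow> e i \<bullet> e j = (if i = j then 1 else 0)"
    and hor: "\<And>y i. y \<in> cube \<delta> \<Longrightarrow> y $ \<nu> = 0 \<Longrightarrow> i \<noteq> \<nu> \<Longrightarrow>
        frechet_derivative Z (at y) (axis i 1) \<bullet> Tfield (Z y) = 0"
begin

abbreviation "Q \<equiv> cube \<delta> :: (real^'m) set"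
abbreviation "H \<equiv> hcube \<nu> \<delta>"
abbreviation "at0 \<equiv> at 0 within H"

definition "D i y = frechet_derivative Z (at y) (axis i 1)"
text \<open>The Bergman Gram matrix of \<open>Z\<close> is \<open>G / y\<^sub>\<nu>\<^sup>2\<close>. Up to powers of \<open>y\<^sub>\<nu>\<close>, \<open>J\<close> is the flux of the rotation and \<open>A b\<close>
  the flux of the transvection \<open>transl b\<close> corrected by a multiple of the flux of the rotation.\<close>
definition "\<theta> y = (\<chi> i. D i y \<bullet> Tfield (Z y))"
definition "G0 y = (\<chi> i j. D i y \<bullet> D j y + (if i = \<nu> \<and> j = \<nu> then 1 else 0))"
definition "\<eta> y = (1 / y $ \<nu>) *\<^sub>R \<theta> y"
definition "G y = G0 y + (\<chi> i j. \<eta> y $ i * \<eta> y $ j)"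
definition "J y = sqrt (det (G y)) *\<^sub>R inv ((*v) (G y)) (\<eta> y)"
definition "A b y = sqrt (det (G y)) *\<^sub>R inv ((*v) (G y)) (\<chi> j. b \<bullet> D j y)"

lemma HQ: "y \<in> H \<Longrightarrow> y \<in> Q" and Hpos: "y \<in> H \<Longrightarrow> y $ \<nu> > 0" and Hnz: "y \<in> H \<Longrightarrow> y $ \<nu> \<noteq> 0" and zeroQ: "0 \<in> Q"
  using delta by (auto simp: hcube_def cube_def)

lemma Z2': "cdiff (Suc 1) Z Q" using Z2 by (simp add: numeral_2_eq_2)

lemma Z1: "cdiff 1 Z Q" by (rule cdiff_lower[OF Z2'])

lemma Zd: "y \<in> Q \<Longrightarrow> (Z has_derivative frechet_derivative Z (at y)) (at y)"
  by (rule cdiff_1_has_derivative[OF Z1])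

lemma D1: "cdiff 1 (D i) Q"
  unfolding D_def by (rule cdiff_frechet[OF Z2' open_cube])

lemma D_norm: "y \<in> Q \<Longrightarrow> Z y \<bullet> D i y = (if i = \<nu> then - (y $ \<nu>) else 0)"
  using normalized_derivative(1)[OF N open_cube _ Zd, of y "axis i 1"] by (auto simp: D_def axis_def)

lemma D_e: "y \<in> Q \<Longrightarrow> i \<noteq> \<nu> \<Longrightarrow> e i \<bullet> D j y = (if j = i then 1 else 0)"
  using normalized_derivative(2)[OF N open_cube _ Zd, of y i "axis j 1"] by (auto simp: D_def axis_def)

lemma norm_Z: "y \<in> Q \<Longrightarrow> 1 - (norm (Z y))\<^sup>2 = (y $ \<nu>)\<^sup>2"
  using N by (simp add: normalized_def)

lemma norm_Z_lt: "y \<in> H \<Longrightarrow> norm (Z y) < 1"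
  using normalized_norm_less[OF N HQ] Hpos by force

text \<open>The normal derivative of \<open>Z\<close> may vanish on the face; the added 1 in the
  (\<nu>,\<nu>) entry contributes the square of \<open>v $ \<nu>\<close> and keeps the form definite
  there.\<close>

lemma G0_posdef: "y \<in> Q \<Longrightarrow> posdef (G0 y)"
  unfolding posdef_def
proof (intro conjI allI impI)
  assume y: "y \<in> Q"
  show "transpose (G0 y) = G0 y" by (auto simp: G0_def transpose_def vec_eq_iff inner_commute)
  fix v :: "real^'m" assume v: "v \<noteq> 0"
  let ?D = "frechet_derivative Z (at y)"
  have "v \<bullet> (G0 y *v v) = (\<Sum>i\<in>UNIV. v $ i *\<^sub>R D i y) \<bullet> (\<Sum>j\<in>UNIV. v $ j *\<^sub>R D j y)
     + (\<Sum>i\<in>UNIV. \<Sum>j\<in>UNIV. if i = \<nu> \<and> j = \<nu> then v $ i * v $ j else 0)"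
  proof -
    have "(\<Sum>i\<in>UNIV. v $ i *\<^sub>R D i y) \<bullet> (\<Sum>j\<in>UNIV. v $ j *\<^sub>R D j y)
      = (\<Sum>i\<in>UNIV. \<Sum>j\<in>UNIV. v $ i * (v $ j * (D i y \<bullet> D j y)))"
      unfolding inner_sum_left inner_scaleR_left unfolding inner_sum_right inner_scaleR_right sum_distrib_left ..
    moreover have "v $ i * (v $ j * G0 y $ i $ j) = v $ i * (v $ j * (D i y \<bullet> D j y)) + (if i = \<nu> \<and> j = \<nu> then v $ i * v $ j else 0)" for i j
      by (simp add: G0_def algebra_simps)
    ultimately show ?thesis unfolding quadratic_form by (simp add: sum.distrib)
  qed
  also have "(\<Sum>i\<in>UNIV. v $ i *\<^sub>R D i y) = ?D v"
    unfolding D_def by (rule linear_axis_sum[OF has_derivative_linear[OF Zd[OF y]], symmetric])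
  also have "(\<Sum>i\<in>UNIV. \<Sum>j\<in>UNIV. if i = \<nu> \<and> j = \<nu> then v $ i * v $ j else 0) = v $ \<nu> * v $ \<nu>"
  proof -
    have "(\<Sum>j\<in>UNIV. if i = \<nu> \<and> j = \<nu> then v $ i * v $ j else 0) = (if i = \<nu> then v $ \<nu> * v $ \<nu> else 0)" for i
      by (cases "i = \<nu>") auto
    then show ?thesis by simp
  qed
  finally have eq: "v \<bullet> (G0 y *v v) = ?D v \<bullet> ?D v + v $ \<nu> * v $ \<nu>" .
  have "?D v \<noteq> 0 \<or> v $ \<nu> \<noteq> 0"
  proof (rule ccontr)
    assume c: "\<not> ?thesis"
    have "v $ i = 0" for i
      using normalized_derivative(2)[OF N open_cube y Zd[OF y], of i v] c by (cases "i = \<nu>") auto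
    with v show False by (simp add: vec_eq_iff)
  qed
  then show "v \<bullet> (G0 y *v v) > 0" unfolding eq
    by (metis add_nonneg_pos add_pos_nonneg inner_ge_zero inner_gt_zero_iff not_real_square_gt_zero zero_le_square)
qed

lemma G_posdef: "y \<in> Q \<Longrightarrow> posdef (G y)"
  unfolding G_def by (rule posdef_rank_one[OF G0_posdef])

text \<open>Among the radial products only \<open>Z \<bullet> D \<nu> = - y $ \<nu>\<close> is
  nonzero. Its square over the fourth power of \<open>y $ \<nu>\<close>, with the common factor
  taken out, is the 1 in \<open>G0\<close>; the products with \<open>Tfield Z\<close> give the rank
  one part.\<close>

lemma gram_eq: "y \<in> H \<Longrightarrow> gram Z y = (1 / (y $ \<nu>)\<^sup>2) *\<^sub>R G y"
proof -
  assume y: "y \<in> H"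
  have "gB (Z y) (D i y) (D j y) = (1 / (y $ \<nu>)\<^sup>2) * G y $ i $ j" for i j
    using Hpos[OF y] D_norm[OF HQ[OF y], of i] D_norm[OF HQ[OF y], of j]
    unfolding gB_real norm_Z[OF HQ[OF y]]
    by (auto simp: inner_commute[of _ "Z y"] G_def G0_def \<eta>_def \<theta>_def field_simps power2_eq_square)
  then show ?thesis by (simp add: gram_def D_def vec_eq_iff)
qed

lemma sqrt_det_gram: "y \<in> H \<Longrightarrow> sqrt (det (gram Z y)) = (1 / y $ \<nu>) ^ CARD('m) * sqrt (det (G y))"
proof -
  assume y: "y \<in> H"
  have "sqrt ((1 / (y $ \<nu>)\<^sup>2) ^ CARD('m)) = (1 / y $ \<nu>) ^ CARD('m)"
    using Hpos[OF y] by (simp add: real_sqrt_power real_sqrt_divide power_one_over)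
  then show ?thesis by (simp add: gram_eq[OF y] det_scaleR real_sqrt_mult)
qed

lemma inv_gram: "y \<in> H \<Longrightarrow> inv ((*v) (gram Z y)) (c *\<^sub>R p) = (c * (y $ \<nu>)\<^sup>2) *\<^sub>R inv ((*v) (G y)) p"
  using inv_scaleR_matrix[OF G_posdef[OF HQ], of y "1 / (y $ \<nu>)\<^sup>2" c p] Hpos[of y] by (simp add: gram_eq)

lemma inv_gram_linear: "y \<in> H \<Longrightarrow> linear (inv ((*v) (gram Z y)))"
  using gram_eq posdef_scaleR[OF _ G_posdef[OF HQ], of "1 / (y $ \<nu>)\<^sup>2" y] Hpos[of y]
  by (intro inj_linear_imp_inv_linear posdef_inj) auto

text \<open>Powers of \<open>y $ \<nu>\<close>, with \<open>m = CARD('m)\<close>: the area density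
  has \<open>-m\<close>, the inverse Gram matrix \<open>2\<close>, the dual of the rotation
  \<open>-3\<close>; altogether \<open>-(m + 1)\<close>.\<close>

lemma flux_T: "y \<in> H \<Longrightarrow> (y $ \<nu>) ^ (CARD('m) + 1) *\<^sub>R flux Tfield Z y = J y"
proof -
  assume y: "y \<in> H"
  have "(\<chi> j. gB (Z y) (Tfield (Z y)) (frechet_derivative Z (at y) (axis j 1))) = (1 / (y $ \<nu>) ^ 3) *\<^sub>R \<eta> y"
    using Hpos[OF y] unfolding gB_Tfield[OF norm_Z_lt[OF y]] norm_Z[OF HQ[OF y]]
    by (simp add: vec_eq_iff \<eta>_def \<theta>_def D_def field_simps power2_eq_square power3_eq_cube)
  then show ?thesis using Hpos[OF y]
    by (simp add: flux_def J_def inv_gram[OF y] sqrt_det_gram[OF y] power_one_over)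
      (simp add: field_simps power2_eq_square power3_eq_cube)
qed

text \<open>With the multiple of the rotation added, the dual of the field is
  \<open>b \<bullet> D j y\<close> over the square of \<open>y $ \<nu>\<close>, so the powers add up
  to \<open>-m + 2 - 2\<close>.\<close>

lemma flux_transl:
  assumes y: "y \<in> H"
  shows "(y $ \<nu>) ^ CARD('m) *\<^sub>R (flux (transl b) Z y + (2 * (Z y \<bullet> Tfield b)) *\<^sub>R flux Tfield Z y) = A b y"
proof -
  let ?I = "inv ((*v) (gram Z y))"
  define \<beta> where "\<beta> = (\<chi> j. b \<bullet> D j y)"
  define t where "t = (\<chi> j. gB (Z y) (Tfield (Z y)) (frechet_derivative Z (at y) (axis j 1)))"
  have "(\<chi> j. gB (Z y) (transl b (Z y)) (frechet_derivative Z (at y) (axis j 1)))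
     = (1 / (y $ \<nu>)\<^sup>2) *\<^sub>R \<beta> - (2 * (Z y \<bullet> Tfield b)) *\<^sub>R t"
    by (simp add: vec_eq_iff gB_transl[OF norm_Z_lt[OF y]] gB_Tfield[OF norm_Z_lt[OF y]] norm_Z[OF HQ[OF y]] \<beta>_def t_def D_def)
  then have "?I (\<chi> j. gB (Z y) (transl b (Z y)) (frechet_derivative Z (at y) (axis j 1)))
     = inv ((*v) (G y)) \<beta> - (2 * (Z y \<bullet> Tfield b)) *\<^sub>R ?I t"
  proof -
    have "?I ((1 / (y $ \<nu>)\<^sup>2) *\<^sub>R \<beta>) = inv ((*v) (G y)) \<beta>"
      using Hpos[OF y] by (simp add: inv_gram[OF y])
    then show ?thesis
      using \<open>(\<chi> j. gB (Z y) (transl b (Z y)) (frechet_derivative Z (at y) (axis j 1))) = _\<close>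
      by (simp only: linear_diff[OF inv_gram_linear[OF y]] linear_scale[OF inv_gram_linear[OF y]])
  qed
  then have "flux (transl b) Z y + (2 * (Z y \<bullet> Tfield b)) *\<^sub>R flux Tfield Z y = sqrt (det (gram Z y)) *\<^sub>R inv ((*v) (G y)) \<beta>"
    by (simp add: flux_def t_def scaleR_diff_right mult.commute)
  then show ?thesis using Hpos[OF y]
    by (simp add: A_def \<beta>_def sqrt_det_gram[OF y] power_one_over)
qed

lemma flux_cdiff: "killing K K' \<Longrightarrow> cdiff 1 (flux K Z) H"
  by (rule cdiff_flux[OF open_hcube cdiff_subset[OF Z2']])
    (auto simp: killing_def intro: HQ norm_Z_lt normalized_gram_posdef[OF N open_cube HQ Z1 Hnz])

text \<open>The flux is C^1, hence its divergence continuous; if nonzero at \<open>y\<close> it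
  would be nonzero on a neighbourhood, and that contains a smooth patch where
  \<open>flux_divergence_free\<close> applies.\<close>

lemma divergence_free:
  assumes K: "killing K K'" and y: "y \<in> H"
  shows "dvg (flux K Z) y = 0"
proof (rule ccontr)
  assume ne: "dvg (flux K Z) y \<noteq> 0"
  have "continuous_on H (dvg (flux K Z))"
    using cdiff_dvg[of 0 "flux K Z" H] flux_cdiff[OF K] by (simp add: open_hcube)
  from continuous_open_preimage[OF this open_hcube, of "-{0}"]
  have U: "open (H \<inter> dvg (flux K Z) -` (-{0}))" by auto
  have "y \<in> H \<inter> dvg (flux K Z) -` (-{0})" using ne y by auto
  from dense[OF y U this] obtain W where W: "open W" "W \<noteq> {}" "W \<subseteq> H \<inter> dvg (flux K Z) -` (-{0}) \<inter> H"
      "\<And>k. cdiff k Z W" "Z ` W \<subseteq> \<Sigma>"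
    by metis
  then obtain c where c: "c \<in> W" by blast
  have "dvg (flux K Z) c = 0"
  proof (rule flux_divergence_free[OF min ball W(1,4,5) _ _ K c])
    show "normalized \<nu> e Z W" using N W(3) HQ unfolding normalized_def by blast
    show "w $ \<nu> > 0" if "w \<in> W" for w using W(3) Hpos that by blast
  qed
  with W(3) c show False by auto
qed

lemma power_coordinate_derivative:
  "((\<lambda>y. (y $ \<nu>) ^ n) has_derivative (\<lambda>v. real n * (y $ \<nu>) ^ (n - 1) * v $ \<nu>)) (at (y :: real^'m))"
  using has_derivative_power[OF bounded_linear_imp_has_derivative[OF bounded_linear_vec_nth[of \<nu>]], of n y UNIV]
  by (simp add: mult_ac)

lemma axis_sum: "(\<Sum>i\<in>UNIV. c * (axis i 1 :: real^'m) $ \<nu> * B $ i) = c * (B::real^'m) $ \<nu>"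
  by (simp add: axis_def if_distrib[of "(*) _"] if_distrib[of "\<lambda>x. x * _"] cong: if_cong)

text \<open>A power of \<open>y $ \<nu>\<close> times a divergence free field: only the derivative
  of the power survives, and it sees only the \<nu>-component. This is the form required by
  \<open>boundary_limit_zero\<close>.\<close>

lemma J_cdiff: "cdiff 1 J H" and J_div: "y \<in> H \<Longrightarrow> dvg J y = real (CARD('m) + 1) * J y $ \<nu> / y $ \<nu>"
proof -
  let ?n = "CARD('m) + 1"
  define B where "B = flux Tfield Z"
  have B: "cdiff 1 B H" unfolding B_def by (rule flux_cdiff[OF killing_Tfield])
  have "cdiff 1 (\<lambda>y. (y $ \<nu>) ^ ?n *\<^sub>R B y) H"
    by (intro cdiff_scaleR cdiff_power cdiff_nth cdiff_id B)
  then show J: "cdiff 1 J H"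
    by (rule cdiff_cong[OF open_hcube, rotated]) (simp add: flux_T[symmetric] B_def)
  assume y: "y \<in> H"
  have "dvg J y = dvg (\<lambda>y. (y $ \<nu>) ^ ?n *\<^sub>R B y) y"
    by (rule dvg_cong[OF open_hcube y _ cdiff_1_differentiable[OF J y]]) (simp add: flux_T[symmetric] B_def)
  also have "\<dots> = (y $ \<nu>) ^ ?n * dvg B y + (\<Sum>i\<in>UNIV. real ?n * (y $ \<nu>) ^ (?n - 1) * (axis i 1 :: real^'m) $ \<nu> * B y $ i)"
    by (rule dvg_scaleR[OF power_coordinate_derivative cdiff_1_differentiable[OF B y]])
  also have "\<dots> = real ?n * (y $ \<nu>) ^ (?n - 1) * B y $ \<nu>"
    unfolding axis_sum using divergence_free[OF killing_Tfield y] by (simp add: B_def)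
  also have "\<dots> = real ?n * J y $ \<nu> / y $ \<nu>"
    using Hpos[OF y] flux_T[OF y, symmetric] by (simp add: B_def)
  finally show "dvg J y = real ?n * J y $ \<nu> / y $ \<nu>" .
qed

text \<open>Besides the power, the coefficient \<open>2 (Z \<bullet> Tfield b)\<close> of the
  rotation is differentiated, which couples the identity to \<open>J\<close>. The power here is one
  less than the one in \<open>J\<close>, whence the common denominator
  \<open>y $ \<nu>\<close>.\<close>

lemma A_cdiff: "cdiff 1 (A b) H"
  and A_div: "y \<in> H \<Longrightarrow> dvg (A b) y = (real CARD('m) * A b y $ \<nu> + 2 * (\<Sum>i\<in>UNIV. (D i y \<bullet> Tfield b) * J y $ i)) / y $ \<nu>"
proof -
  let ?n = "CARD('m)"
  define B where "B = flux Tfield Z"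
  define C where "C = flux (transl b) Z"
  define f where "f = (\<lambda>y. 2 * (Z y \<bullet> Tfield b))"
  define E where "E = (\<lambda>y. C y + f y *\<^sub>R B y)"
  have B: "cdiff 1 B H" unfolding B_def by (rule flux_cdiff[OF killing_Tfield])
  have C: "cdiff 1 C H" unfolding C_def by (rule flux_cdiff[OF killing_transl])
  have ZH: "cdiff 1 Z H" by (rule cdiff_subset[OF Z1]) (auto simp: HQ)
  have fB: "cdiff 1 (\<lambda>y. f y *\<^sub>R B y) H"
    unfolding f_def by (intro cdiff_scaleR cdiff_mult cdiff_const cdiff_inner ZH B)
  have E: "cdiff 1 E H" unfolding E_def by (intro cdiff_add C fB)
  have AE: "A b y = (y $ \<nu>) ^ ?n *\<^sub>R E y" if "y \<in> H" for y
    using flux_transl[OF that] by (simp add: E_def f_def C_def B_def)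
  have "cdiff 1 (\<lambda>y. (y $ \<nu>) ^ ?n *\<^sub>R E y) H"
    by (intro cdiff_scaleR cdiff_power cdiff_nth cdiff_id E)
  then show Ac: "cdiff 1 (A b) H"
    by (rule cdiff_cong[OF open_hcube, rotated]) (simp add: AE)
  assume y: "y \<in> H"
  have fd: "(f has_derivative (\<lambda>v. 2 * (frechet_derivative Z (at y) v \<bullet> Tfield b))) (at y)"
    unfolding f_def by (intro has_derivative_mult_right has_derivative_inner_left Zd HQ y)
  have "dvg E y = dvg C y + (f y * dvg B y + (\<Sum>i\<in>UNIV. 2 * (frechet_derivative Z (at y) (axis i 1) \<bullet> Tfield b) * B y $ i))"
    unfolding E_def dvg_add[OF cdiff_1_differentiable[OF C y] cdiff_1_differentiable[OF fB y]]
      dvg_scaleR[OF fd cdiff_1_differentiable[OF B y]] ..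
  also have "\<dots> = 2 * (\<Sum>i\<in>UNIV. (D i y \<bullet> Tfield b) * B y $ i)"
    using divergence_free[OF killing_Tfield y] divergence_free[OF killing_transl y]
    by (simp add: B_def C_def D_def sum_distrib_left mult.assoc)
  finally have dE: "dvg E y = 2 * (\<Sum>i\<in>UNIV. (D i y \<bullet> Tfield b) * B y $ i)" .
  have "dvg (A b) y = dvg (\<lambda>y. (y $ \<nu>) ^ ?n *\<^sub>R E y) y"
    by (rule dvg_cong[OF open_hcube y AE cdiff_1_differentiable[OF Ac y]])
  also have "\<dots> = (y $ \<nu>) ^ ?n * dvg E y + (\<Sum>i\<in>UNIV. real ?n * (y $ \<nu>) ^ (?n - 1) * (axis i 1 :: real^'m) $ \<nu> * E y $ i)"
    by (rule dvg_scaleR[OF power_coordinate_derivative cdiff_1_differentiable[OF E y]])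
  also have "\<dots> = 2 * (\<Sum>i\<in>UNIV. (D i y \<bullet> Tfield b) * ((y $ \<nu>) ^ ?n * B y $ i)) + real ?n * (y $ \<nu>) ^ (?n - 1) * E y $ \<nu>"
    unfolding axis_sum dE by (simp add: sum_distrib_left mult_ac)
  also have "\<dots> = (real ?n * A b y $ \<nu> + 2 * (\<Sum>i\<in>UNIV. (D i y \<bullet> Tfield b) * J y $ i)) / y $ \<nu>"
  proof -
    have "(y $ \<nu>) ^ ?n * B y $ i = J y $ i / y $ \<nu>" for i
      using flux_T[OF y, symmetric] Hpos[OF y] by (simp add: B_def)
    moreover have "(y $ \<nu>) ^ (?n - 1) * E y $ \<nu> = A b y $ \<nu> / y $ \<nu>"
    proof -
      have "(y $ \<nu>) ^ ?n = y $ \<nu> * (y $ \<nu>) ^ (?n - 1)" by (simp add: power_eq_if)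
      then show ?thesis using AE[OF y] Hpos[OF y] by simp
    qed
    ultimately show ?thesis
      by (simp add: add_divide_distrib mult.assoc sum_divide_distrib[symmetric])
  qed
  finally show "dvg (A b) y = (real ?n * A b y $ \<nu> + 2 * (\<Sum>i\<in>UNIV. (D i y \<bullet> Tfield b) * J y $ i)) / y $ \<nu>" .
qed

lemma tendsto_at0:
  assumes "continuous_on Q f" shows "(f \<longlongrightarrow> f 0) at0"
proof -
  have "isCont f 0" using assms zeroQ by (simp add: continuous_on_eq_continuous_at[OF open_cube])
  then have "(f \<longlongrightarrow> f 0) (at 0)" by (simp add: continuous_at)
  then show ?thesis by (rule tendsto_within_subset[OF _ subset_UNIV])
qed

lemma in_H_at0: "\<forall>\<^sub>F y in at0. y \<in> H"
  by (simp add: eventually_at_filter)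

lemma D_lim: "(D i \<longlongrightarrow> D i 0) at0" by (rule tendsto_at0[OF cdiff_continuous[OF D1]])

lemma nu_lim: "((\<lambda>y. y $ \<nu>) \<longlongrightarrow> 0) at0"
  using tendsto_at0[of "\<lambda>y. y $ \<nu>"] by (simp add: continuous_intros)

definition "g = D \<nu> 0 \<bullet> D \<nu> 0 + 1"

lemma g_pos: "g > 0" by (simp add: g_def add_nonneg_pos)

text \<open>At the origin the tangential derivatives are the orthonormal \<open>e i\<close>, and
  normalization makes \<open>D \<nu> 0\<close> orthogonal to them.\<close>

lemma G0_0: "G0 0 $ i $ j = (if i = j then (if i = \<nu> then g else 1) else 0)"
proof -
  have D: "i \<noteq> \<nu> \<Longrightarrow> D i 0 = e i" for i using axes by (simp add: D_def)
  have "i \<noteq> \<nu> \<Longrightarrow> e i \<bullet> D \<nu> 0 = 0" for i using D_e[OF zeroQ, of i \<nu>] by auto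
  then show ?thesis
    by (cases "i = \<nu>"; cases "j = \<nu>") (auto simp: G0_def g_def D ortho inner_commute)
qed

lemma G0_0_mult: "(G0 0 *v v) $ i = (if i = \<nu> then g * v $ \<nu> else v $ i)"
  by (simp add: matrix_vector_mult_def G0_0 if_distrib[of "\<lambda>x. x * _"] cong: if_cong)

lemma theta_1: "cdiff 1 \<theta> Q"
  by (rule cdiff_vec_lambda) (simp only: \<theta>_def vec_lambda_beta, intro cdiff_inner D1 cdiff_Tfield Z1)

text \<open>If the product were nonzero, \<open>\<eta>\<close> and with it \<open>G\<close> would
  blow up; but \<open>J\<close> still converges, because the growth of the determinant and the decay
  of the inverse nearly compensate. Its limit has a nonzero \<nu>-component, against
  \<open>boundary_limit_zero\<close>.\<close>

lemma conormal_vanishes: "D \<nu> 0 \<bullet> Tfield (Z 0) = 0"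
proof (rule ccontr)
  define a where "a = D \<nu> 0 \<bullet> Tfield (Z 0)"
  assume "\<not> ?thesis"
  then have a: "a \<noteq> 0" by (simp add: a_def)
  have \<theta>0: "\<theta> 0 = a *\<^sub>R axis \<nu> 1"
    using hor[OF zeroQ] by (simp add: vec_eq_iff \<theta>_def a_def D_def axis_def)
  define w where "w = (\<lambda>y. inv ((*v) (G0 y)) (\<theta> y))"
  have w: "G0 y *v w y = \<theta> y" if "y \<in> Q" for y
    unfolding w_def by (rule posdef_surj[OF G0_posdef[OF that]])
  have w0: "w 0 = (a / g) *\<^sub>R axis \<nu> 1"
    unfolding w_def
    by (rule posdef_inv_eq[OF G0_posdef[OF zeroQ]]) (use g_pos in \<open>simp add: vec_eq_iff G0_0_mult \<theta>0 axis_def\<close>)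
  \<comment> \<open>By \<open>det_rank_one\<close> and \<open>rank_one_inv\<close> the determinant
    gains a factor \<open>s\<close> and the solution a factor \<open>1 / s\<close>, leaving
    \<open>1 / sqrt s\<close>. Together with the \<open>1 / y $ \<nu>\<close> in \<open>w'\<close>
    this is regular: \<open>(y $ \<nu>)^2 s\<close> tends to \<open>\<theta> \<bullet> w\<close> at
    the origin, which is positive here.\<close>
  have J: "J y = (1 / sqrt ((y $ \<nu>)\<^sup>2 + \<theta> y \<bullet> w y)) *\<^sub>R (sqrt (det (G0 y)) *\<^sub>R w y)" if y: "y \<in> H" for y
  proof -
    have pos: "y $ \<nu> > 0" by (rule Hpos[OF y])
    define w' where "w' = (1 / y $ \<nu>) *\<^sub>R w y"
    have w': "G0 y *v w' = \<eta> y" by (simp add: w'_def \<eta>_def matrix_vector_mult_scaleR w[OF HQ[OF y]])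
    define s where "s = 1 + \<eta> y \<bullet> w'"
    have s: "s > 0" unfolding s_def by (rule rank_one_inv(2)[OF G0_posdef[OF HQ[OF y]] w'])
    have "det (G y) = det (G0 y) * s"
      unfolding G_def s_def by (rule det_rank_one[OF G0_posdef[OF HQ[OF y]] w'])
    moreover have "inv ((*v) (G y)) (\<eta> y) = (1 / s) *\<^sub>R w'"
      unfolding G_def s_def by (rule rank_one_inv(1)[OF G0_posdef[OF HQ[OF y]] w'])
    ultimately have "J y = (sqrt (det (G0 y)) * (sqrt s / s)) *\<^sub>R w'"
      by (simp add: J_def real_sqrt_mult)
    also have "sqrt s / s = 1 / sqrt s" using s by (simp add: field_simps)
    also have "(sqrt (det (G0 y)) * (1 / sqrt s)) *\<^sub>R w' = (1 / (y $ \<nu> * sqrt s)) *\<^sub>R (sqrt (det (G0 y)) *\<^sub>R w y)"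
      by (simp add: w'_def mult_ac)
    also have "y $ \<nu> * sqrt s = sqrt ((y $ \<nu>)\<^sup>2 * s)" using pos by (simp add: real_sqrt_mult)
    also have "(y $ \<nu>)\<^sup>2 * s = (y $ \<nu>)\<^sup>2 + \<theta> y \<bullet> w y"
      using pos by (simp add: s_def w'_def \<eta>_def field_simps power2_eq_square)
    finally show ?thesis .
  qed
  have G0_lim: "((\<lambda>y. G0 y $ i $ j) \<longlongrightarrow> G0 0 $ i $ j) at0" for i j
    unfolding G0_def vec_lambda_beta by (intro tendsto_intros D_lim)
  have \<theta>_lim: "((\<lambda>y. \<theta> y $ j) \<longlongrightarrow> \<theta> 0 $ j) at0" for j
    by (intro tendsto_intros tendsto_at0[OF cdiff_continuous[OF theta_1]])
  have ev: "\<forall>\<^sub>F y in at0. posdef (G0 y)"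
    using in_H_at0 by eventually_elim (simp add: G0_posdef HQ)
  note lims = tendsto_sqrt_det_inv[OF G0_lim \<theta>_lim ev G0_posdef[OF zeroQ]]
  have wlim: "(w \<longlongrightarrow> w 0) at0" using lims(2) by (simp add: w_def)
  have \<theta>w: "\<theta> 0 \<bullet> w 0 = a\<^sup>2 / g" by (simp add: \<theta>0 w0 power2_eq_square inner_axis_axis)
  define J0 where "J0 = (1 / sqrt (a\<^sup>2 / g)) *\<^sub>R (sqrt (det (G0 0)) *\<^sub>R w 0)"
  have "((\<lambda>y. (1 / sqrt ((y $ \<nu>)\<^sup>2 + \<theta> y \<bullet> w y)) *\<^sub>R (sqrt (det (G0 y)) *\<^sub>R w y)) \<longlongrightarrow>
      (1 / sqrt (0\<^sup>2 + \<theta> 0 \<bullet> w 0)) *\<^sub>R (sqrt (det (G0 0)) *\<^sub>R w 0)) at0"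
    using a g_pos \<theta>w
    by (intro tendsto_intros nu_lim tendsto_at0[OF cdiff_continuous[OF theta_1]] wlim lims(3)) auto
  then have "((\<lambda>y. (1 / sqrt ((y $ \<nu>)\<^sup>2 + \<theta> y \<bullet> w y)) *\<^sub>R (sqrt (det (G0 y)) *\<^sub>R w y)) \<longlongrightarrow> J0) at0"
    by (simp add: J0_def \<theta>w)
  then have Jlim: "(J \<longlongrightarrow> J0) at0"
    by (rule Lim_transform_eventually) (use in_H_at0 in \<open>eventually_elim, simp add: J\<close>)
  have "real (CARD('m) + 1) * J0 $ \<nu> = 0"
  proof (rule boundary_limit_zero[OF delta J_cdiff J_div Jlim])
    show "((\<lambda>y. real (CARD('m) + 1) * J y $ \<nu>) \<longlongrightarrow> real (CARD('m) + 1) * J0 $ \<nu>) at0"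
      by (intro tendsto_intros Jlim)
  qed
  then have "J0 $ \<nu> = 0" by simp
  moreover have "J0 $ \<nu> \<noteq> 0"
    using a g_pos posdef_det_pos[OF G0_posdef[OF zeroQ]] by (simp add: J0_def w0 axis_def)
  ultimately show False by simp
qed

text \<open>The vanishing is now assumed along the whole face, because the limit of
  \<open>\<eta>\<close> is taken over all approaches and the numerator \<open>\<theta>\<close> must
  vanish at every foot point. Points other than the origin are supplied later by recentred
  parametrizations.\<close>

context
  assumes conormal: "\<And>y. y \<in> Q \<Longrightarrow> y $ \<nu> = 0 \<Longrightarrow> D \<nu> y \<bullet> Tfield (Z y) = 0"
begin

definition "\<kappa> = (\<chi> i. frechet_derivative (\<lambda>y. \<theta> y $ i) (at 0) (axis \<nu> 1))"

lemma theta_boundary: "y \<in> Q \<Longrightarrow> y $ \<nu> = 0 \<Longrightarrow> \<theta> y $ i = 0"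
  using conormal hor by (cases "i = \<nu>") (auto simp: \<theta>_def D_def)

lemma eta_lim: "((\<lambda>y. \<eta> y $ i) \<longlongrightarrow> \<kappa> $ i) at0"
proof -
  have "((\<lambda>y. \<theta> y $ i /\<^sub>R y $ \<nu>) \<longlongrightarrow> \<kappa> $ i) (at 0 within {y. y $ \<nu> \<noteq> 0})"
    unfolding \<kappa>_def vec_lambda_beta
    by (rule quotient_tendsto_derivative[OF cdiff_nth[OF theta_1] theta_boundary zeroQ]) auto
  then have "((\<lambda>y. \<theta> y $ i /\<^sub>R y $ \<nu>) \<longlongrightarrow> \<kappa> $ i) at0"
    by (rule tendsto_within_subset) (use Hpos in force)
  then show ?thesis by (simp add: \<eta>_def divide_inverse)
qed

definition "G1 = G0 0 + (\<chi> i j. \<kappa> $ i * \<kappa> $ j)"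

lemma G1_posdef: "posdef G1" unfolding G1_def by (rule posdef_rank_one[OF G0_posdef[OF zeroQ]])

lemma G_lim: "((\<lambda>y. G y $ i $ j) \<longlongrightarrow> G1 $ i $ j) at0"
  unfolding G_def G1_def G0_def vector_add_component vec_lambda_beta by (intro tendsto_intros D_lim eta_lim)

lemma G_ev: "\<forall>\<^sub>F y in at0. posdef (G y)"
  using in_H_at0 by eventually_elim (simp add: G_posdef HQ)

definition "J1 = sqrt (det G1) *\<^sub>R inv ((*v) G1) \<kappa>"

lemma J_lim: "(J \<longlongrightarrow> J1) at0"
  unfolding J_def[abs_def] J1_def by (rule tendsto_sqrt_det_inv(1)[OF G_lim eta_lim G_ev G1_posdef])

lemma det_G1: "sqrt (det G1) > 0" using posdef_det_pos[OF G1_posdef] by simp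

text \<open>\<open>boundary_limit_zero\<close> gives \<open>J1 $ \<nu> = 0\<close>. Since
  \<open>G1\<close> perturbs \<open>G0 0\<close> by \<open>\<kappa>\<close> itself,
  \<open>J1\<close> is a multiple of the solution \<open>w\<close> of
  \<open>G0 0 w = \<kappa>\<close>, so \<open>w $ \<nu> = 0\<close>. As \<open>G0 0\<close> is the
  identity apart from its (\<nu>,\<nu>) entry, \<open>w\<close> equals
  \<open>\<kappa>\<close>.\<close>

lemma kappa_nu: "\<kappa> $ \<nu> = 0" and J1_eq: "J1 = (sqrt (det G1) / (1 + \<kappa> \<bullet> \<kappa>)) *\<^sub>R \<kappa>"
proof -
  have "real (CARD('m) + 1) * J1 $ \<nu> = 0"
    by (rule boundary_limit_zero[OF delta J_cdiff J_div J_lim], assumption) (intro tendsto_intros J_lim)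
  then have J1: "J1 $ \<nu> = 0" by simp
  define w where "w = inv ((*v) (G0 0)) \<kappa>"
  have w: "G0 0 *v w = \<kappa>" unfolding w_def by (rule posdef_surj[OF G0_posdef[OF zeroQ]])
  have inv: "inv ((*v) G1) \<kappa> = (1 / (1 + \<kappa> \<bullet> w)) *\<^sub>R w" and pos: "1 + \<kappa> \<bullet> w > 0"
    using rank_one_inv[OF G0_posdef[OF zeroQ] w] by (simp_all add: G1_def)
  have "w $ \<nu> = 0" using J1 inv pos det_G1 by (simp add: J1_def)
  then have "w $ i = \<kappa> $ i" for i using arg_cong[OF w, of "\<lambda>v. v $ i"] by (auto simp: G0_0_mult split: if_splits)
  then have wk: "w = \<kappa>" by (simp add: vec_eq_iff)
  with \<open>w $ \<nu> = 0\<close> show "\<kappa> $ \<nu> = 0" by simp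
  show "J1 = (sqrt (det G1) / (1 + \<kappa> \<bullet> \<kappa>)) *\<^sub>R \<kappa>" by (simp add: J1_def inv wk)
qed

lemma theta_derivative:
  "frechet_derivative (\<lambda>y. \<theta> y $ i) (at 0) v =
     frechet_derivative (D i) (at 0) v \<bullet> Tfield (Z 0) + D i 0 \<bullet> Tfield (frechet_derivative Z (at 0) v)"
proof -
  have "((\<lambda>y. D i y \<bullet> Tfield (Z y)) has_derivative
     (\<lambda>v. D i 0 \<bullet> Tfield (frechet_derivative Z (at 0) v) + frechet_derivative (D i) (at 0) v \<bullet> Tfield (Z 0))) (at 0)"
    by (intro has_derivative_inner cdiff_1_has_derivative[OF D1 zeroQ] bounded_linear.has_derivative[OF bounded_linear_Tfield] Zd zeroQ)
  from frechet_derivative_at[OF this, symmetric] show ?thesis by (simp add: \<theta>_def)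
qed

text \<open>Pairing with a fixed vector reduces the vector-valued case to real functions.\<close>

lemma mixed_symmetric:
  "frechet_derivative (D i) (at 0) (axis j 1) \<bullet> c = frechet_derivative (D j) (at 0) (axis i 1) \<bullet> c"
proof -
  define h where "h = (\<lambda>y. Z y \<bullet> c)"
  have h: "cdiff 2 h Q" unfolding h_def by (intro cdiff_inner Z2 cdiff_const)
  have h1: "frechet_derivative h (at y) v = frechet_derivative Z (at y) v \<bullet> c" if "y \<in> Q" for y v
    using frechet_derivative_at[OF has_derivative_inner_left[OF Zd[OF that], of c], symmetric] by (simp add: h_def)
  have "frechet_derivative (\<lambda>y. frechet_derivative h (at y) (axis i 1)) (at 0) v = frechet_derivative (D i) (at 0) v \<bullet> c" for i v
  proof -
    have "((\<lambda>y. D i y \<bullet> c) has_derivative (\<lambda>v. frechet_derivative (D i) (at 0) v \<bullet> c)) (at 0)"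
      by (intro has_derivative_inner_left cdiff_1_has_derivative[OF D1 zeroQ])
    then have "((\<lambda>y. frechet_derivative h (at y) (axis i 1)) has_derivative (\<lambda>v. frechet_derivative (D i) (at 0) v \<bullet> c)) (at 0)"
      by (rule has_derivative_transform_within_open[OF _ open_cube zeroQ]) (simp add: h1 D_def)
    from frechet_derivative_at[OF this, symmetric] show ?thesis by simp
  qed
  with second_derivative_symmetric[OF h open_cube zeroQ, of "axis i 1" "axis j 1"] show ?thesis by simp
qed

text \<open>For tangential \<open>i\<close>, the normal derivative of the \<open>i\<close>-th and
  the \<open>i\<close>-th derivative of the \<nu>-th component of \<open>\<theta>\<close> share a
  mixed second derivative of \<open>Z\<close>, and the latter is zero because
  \<open>\<theta>\<close> vanishes on the face. By antisymmetry of \<open>Tfield\<close> the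
  subtraction doubles the remaining term, whence the factor 2.\<close>

lemma D_T_kappa: "D i 0 \<bullet> Tfield (D \<nu> 0) = \<kappa> $ i / 2"
proof (cases "i = \<nu>")
  case False
  define S where "S = frechet_derivative (D i) (at 0) (axis \<nu> 1) \<bullet> Tfield (Z 0)"
  have 1: "\<kappa> $ i = S + D i 0 \<bullet> Tfield (D \<nu> 0)"
    by (simp add: \<kappa>_def theta_derivative S_def) (simp add: D_def)
  have "((\<lambda>t. \<theta> (0 + t *\<^sub>R axis i 1) $ \<nu>) has_vector_derivative frechet_derivative (\<lambda>y. \<theta> y $ \<nu>) (at 0) (axis i 1)) (at 0)"
    by (rule has_derivative_dirderiv(1)[OF cdiff_1_has_derivative[OF cdiff_nth[OF theta_1] zeroQ]])
  moreover have "((\<lambda>t. \<theta> (0 + t *\<^sub>R axis i 1) $ \<nu>) has_vector_derivative 0) (at 0)"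
  proof (rule has_vector_derivative_transform_within_open[where f="\<lambda>t. 0" and S="{-\<delta><..<\<delta>}"])
    show "0 = \<theta> (0 + t *\<^sub>R axis i 1) $ \<nu>" if "t \<in> {-\<delta><..<\<delta>}" for t
      using that False delta by (intro theta_boundary[symmetric]) (auto simp: cube_def axis_def)
  qed (use delta in auto)
  ultimately have "frechet_derivative (\<lambda>y. \<theta> y $ \<nu>) (at 0) (axis i 1) = 0"
    by (rule vector_derivative_unique_at)
  then have "0 = S + D \<nu> 0 \<bullet> Tfield (D i 0)"
    using mixed_symmetric[of \<nu> i "Tfield (Z 0)"] by (simp add: theta_derivative S_def) (simp add: D_def)
  with 1 show ?thesis using Tfield_inner(1)[of "D \<nu> 0" "D i 0"] by (simp add: inner_commute)
qed (simp add: kappa_nu)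

text \<open>For \<open>b = D \<nu> 0\<close> the number \<open>A1 $ \<nu>\<close> is a positive
  multiple of \<open>b \<bullet> b\<close>. By \<open>D_T_kappa\<close> the coupling term is
  \<open>\<kappa> \<bullet> J1\<close>, a nonnegative multiple of
  \<open>\<kappa> \<bullet> \<kappa>\<close>. The limit identity says that the two contributions add
  up to zero.\<close>

lemma D_nu_zero: "D \<nu> 0 = 0"
proof -
  define b where "b = D \<nu> 0"
  define A1 where "A1 = sqrt (det G1) *\<^sub>R inv ((*v) G1) (\<chi> j. b \<bullet> D j 0)"
  have A_lim: "(A b \<longlongrightarrow> A1) at0"
    unfolding A_def[abs_def] A1_def
    by (rule tendsto_sqrt_det_inv(1)[OF G_lim _ G_ev G1_posdef]) (simp, intro tendsto_intros D_lim)
  have beta: "(\<chi> j. b \<bullet> D j 0) = (b \<bullet> b) *\<^sub>R axis \<nu> 1"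
  proof -
    have "b \<bullet> D j 0 = 0" if "j \<noteq> \<nu>" for j
      using that axes[OF that] D_e[OF zeroQ that, of \<nu>] by (simp add: b_def inner_commute D_def)
    then show ?thesis by (auto simp: vec_eq_iff axis_def b_def)
  qed
  have "inv ((*v) G1) (\<chi> j. b \<bullet> D j 0) = ((b \<bullet> b) / g) *\<^sub>R axis \<nu> 1"
  proof (rule posdef_inv_eq[OF G1_posdef])
    have "G0 0 *v axis \<nu> 1 = g *\<^sub>R axis \<nu> 1" by (simp add: vec_eq_iff G0_0_mult axis_def)
    moreover have "\<kappa> \<bullet> axis \<nu> 1 = 0" by (simp add: inner_axis kappa_nu)
    ultimately show "G1 *v (((b \<bullet> b) / g) *\<^sub>R axis \<nu> 1) = (\<chi> j. b \<bullet> D j 0)"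
      using g_pos by (simp add: G1_def rank_one_mult beta matrix_vector_mult_scaleR)
  qed
  then have A1: "A1 $ \<nu> = sqrt (det G1) * ((b \<bullet> b) / g)" by (simp add: A1_def axis_def)
  have "real CARD('m) * A1 $ \<nu> + 2 * (\<Sum>i\<in>UNIV. (D i 0 \<bullet> Tfield b) * J1 $ i) = 0"
    by (rule boundary_limit_zero[OF delta A_cdiff A_div A_lim], assumption) (intro tendsto_intros A_lim J_lim D_lim)
  moreover have "2 * (\<Sum>i\<in>UNIV. (D i 0 \<bullet> Tfield b) * J1 $ i) = sqrt (det G1) / (1 + \<kappa> \<bullet> \<kappa>) * (\<kappa> \<bullet> \<kappa>)"
  proof -
    have "2 * (\<Sum>i\<in>UNIV. (D i 0 \<bullet> Tfield b) * J1 $ i) = (\<Sum>i\<in>UNIV. \<kappa> $ i * J1 $ i)"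
      by (simp add: b_def D_T_kappa sum_distrib_left)
    also have "\<dots> = \<kappa> \<bullet> J1" by (simp add: inner_vec_def)
    finally show ?thesis by (simp add: J1_eq)
  qed
  moreover have "0 \<le> sqrt (det G1) / (1 + \<kappa> \<bullet> \<kappa>) * (\<kappa> \<bullet> \<kappa>)" using det_G1 by simp
  ultimately have "real CARD('m) * A1 $ \<nu> \<le> 0" by linarith
  then have "A1 $ \<nu> \<le> 0" by (simp add: mult_le_0_iff)
  then have "b \<bullet> b \<le> 0" using det_G1 g_pos by (simp add: A1 mult_le_0_iff divide_le_0_iff)
  then show ?thesis unfolding b_def by (metis antisym inner_eq_zero_iff inner_ge_zero)
qed

text \<open>The \<nu>-component of \<open>\<kappa>\<close> is this product plus a term containing
  \<open>D \<nu> 0\<close>, and both \<open>\<kappa> $ \<nu>\<close> and \<open>D \<nu> 0\<close>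
  vanish.\<close>

lemma second_normal_derivative: "frechet_derivative (D \<nu>) (at 0) (axis \<nu> 1) \<bullet> Tfield (Z 0) = 0"
  using kappa_nu theta_derivative[of \<nu> "axis \<nu> 1"] by (simp add: \<kappa>_def D_nu_zero)

end

end

section \<open>Tangent cones and the modified compactification\<close>

lemma Cl_on_imp_cdiff: "Cl_on l f S \<Longrightarrow> enat k \<le> l \<Longrightarrow> open S \<and> cdiff k f S"
  unfolding Cl_on_def Ck_on_iff_cdiff by auto

text \<open>Tangent spaces and boundaries are defined through all charts at once; the cone of one-sided velocities
  does not refer to charts, so it transfers information from one chart to all the others.\<close>
definition tcone :: "'v::euclidean_space set \<Rightarrow> 'v \<Rightarrow> 'v set" where
  "tcone S q = {v. \<exists>\<gamma> d. \<gamma> 0 = q \<and> d > (0::real) \<and> (\<forall>t. 0 \<le> t \<and> t < d \<longrightarrow> \<gamma> t \<in> S) \<and>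
     (\<gamma> has_vector_derivative v) (at 0 within {0..})}"

lemma tconeI:
  assumes "\<gamma> 0 = q" "d > 0" "\<And>t. 0 \<le> t \<Longrightarrow> t < d \<Longrightarrow> \<gamma> t \<in> S" "(\<gamma> has_vector_derivative v) (at 0 within {0..})"
  shows "v \<in> tcone S q"
  unfolding tcone_def using assms by blast

lemma right_derivative_in_closed:
  fixes c :: "real \<Rightarrow> 'v::real_normed_vector"
  assumes c: "(c has_vector_derivative v) (at 0 within {0..})" and "closed C"
    and ev: "d > 0" "\<And>t. 0 < t \<Longrightarrow> t < d \<Longrightarrow> (1 / t) *\<^sub>R (c t - c 0) \<in> C"
  shows "v \<in> C"
proof -
  have lim: "((\<lambda>t. (1 / t) *\<^sub>R (c t - c 0)) \<longlongrightarrow> v) (at 0 within {0..})"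
  proof -
    have "((\<lambda>t. (c t - c 0 - (t - 0) *\<^sub>R v) /\<^sub>R norm (t - 0)) \<longlongrightarrow> 0) (at 0 within {0..})"
      using c by (simp add: has_vector_derivative_def has_derivative_at_within)
    then have "((\<lambda>t. (1 / t) *\<^sub>R (c t - c 0) - v) \<longlongrightarrow> 0) (at 0 within {0..})"
      by (rule Lim_transform_eventually)
        (auto simp: eventually_at_filter scaleR_diff_right divide_inverse intro!: always_eventually)
    then show ?thesis by (simp add: LIM_zero_iff)
  qed
  have in_C: "\<forall>\<^sub>F t in at 0 within {0..}. (1 / t) *\<^sub>R (c t - c 0) \<in> C"
    unfolding eventually_at using ev by (intro exI[of _ d]) (auto simp: dist_real_def)
  have "at (0::real) within {0..} \<noteq> bot" by (simp add: at_within_Ici_at_right)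
  then show ?thesis by (rule Lim_in_closed_set[OF \<open>closed C\<close> in_C _ lim])
qed

lemma adapted_chart_move: "adapted_chart l m S q U \<Phi> L e \<Longrightarrow> p \<in> U \<Longrightarrow> adapted_chart l m S p U \<Phi> L e"
  by (auto simp: adapted_chart_def)

lemma adapted_chart_mem:
  assumes "adapted_chart l m S q U \<Phi> L e" "p \<in> U"
  shows "p \<in> S \<longleftrightarrow> \<Phi> p \<in> L \<and> e \<bullet> \<Phi> p \<ge> 0"
proof -
  have inj: "inj_on \<Phi> U" and eq: "\<Phi> ` (S \<inter> U) = \<Phi> ` U \<inter> {y \<in> L. e \<bullet> y \<ge> 0}"
    using assms by (auto simp: adapted_chart_def)
  show ?thesis
  proof
    assume "p \<in> S"
    then have "\<Phi> p \<in> \<Phi> ` (S \<inter> U)" using assms(2) by auto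
    then show "\<Phi> p \<in> L \<and> e \<bullet> \<Phi> p \<ge> 0" unfolding eq by auto
  next
    assume "\<Phi> p \<in> L \<and> e \<bullet> \<Phi> p \<ge> 0"
    then have "\<Phi> p \<in> \<Phi> ` (S \<inter> U)" unfolding eq using assms(2) by auto
    then show "p \<in> S" using inj assms(2) by (auto simp: inj_on_def)
  qed
qed

lemma adapted_chart_derivatives:
  assumes A: "adapted_chart l m S q U \<Phi> L e" and l: "1 \<le> l"
  shows "(\<Phi> has_derivative frechet_derivative \<Phi> (at q)) (at q)"
    "(inv_into U \<Phi> has_derivative frechet_derivative (inv_into U \<Phi>) (at (\<Phi> q))) (at (\<Phi> q))"
    "frechet_derivative (inv_into U \<Phi>) (at (\<Phi> q)) (frechet_derivative \<Phi> (at q) v) = v"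
    "frechet_derivative \<Phi> (at q) (frechet_derivative (inv_into U \<Phi>) (at (\<Phi> q)) v) = v"
proof -
  have U: "open U" "q \<in> U" "inj_on \<Phi> U" "open (\<Phi> ` U)" using A by (auto simp: adapted_chart_def)
  have l1: "enat 1 \<le> l" using l by (simp add: one_enat_def)
  have c: "cdiff 1 \<Phi> U" "cdiff 1 (inv_into U \<Phi>) (\<Phi> ` U)"
    using A Cl_on_imp_cdiff[OF _ l1] by (auto simp: adapted_chart_def)
  show 1: "(\<Phi> has_derivative frechet_derivative \<Phi> (at q)) (at q)"
    by (rule cdiff_1_has_derivative[OF c(1) U(2)])
  show 2: "(inv_into U \<Phi> has_derivative frechet_derivative (inv_into U \<Phi>) (at (\<Phi> q))) (at (\<Phi> q))"
    by (rule cdiff_1_has_derivative[OF c(2)]) (use U in auto)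
  let ?D = "frechet_derivative \<Phi> (at q)" and ?E = "frechet_derivative (inv_into U \<Phi>) (at (\<Phi> q))"
  have "((\<lambda>x. inv_into U \<Phi> (\<Phi> x)) has_derivative (\<lambda>v. ?E (?D v))) (at q)"
    by (rule has_derivative_compose[OF 1 2])
  moreover have "((\<lambda>x. inv_into U \<Phi> (\<Phi> x)) has_derivative (\<lambda>v. v)) (at q)"
    by (rule has_derivative_transform_within_open[OF has_derivative_ident U(1,2)]) (simp add: U)
  ultimately show 3: "?E (?D v) = v" for v by (rule fun_cong[OF has_derivative_unique])
  have "linear ?D" "inj ?D" using 1 3 by (auto simp: has_derivative_linear intro: inj_on_inverseI)
  then have "surj ?D" by (simp add: linear_injective_imp_surjective)
  then obtain u where "v = ?D u" by (metis surjD)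
  then show "?D (?E v) = v" using 3 by simp
qed

text \<open>The chart maps a curve in \<open>S\<close> into the half space, whose closedness catches
  the limit of the difference quotients; conversely a straight segment is pulled back by the inverse
  chart. If \<open>e \<bullet> \<Phi> q > 0\<close>, a short segment may leave in any direction of
  \<open>L\<close>.\<close>

lemma tcone_chart:
  assumes A: "adapted_chart l m S q U \<Phi> L e" and l: "1 \<le> l" and q: "q \<in> S"
  shows "tcone S q = {v. frechet_derivative \<Phi> (at q) v \<in> L \<and> (e \<bullet> \<Phi> q = 0 \<longrightarrow> e \<bullet> frechet_derivative \<Phi> (at q) v \<ge> 0)}"
proof -
  have U: "open U" "q \<in> U" "inj_on \<Phi> U" "open (\<Phi> ` U)" and L: "subspace L" "e \<in> L"
    using A by (auto simp: adapted_chart_def)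
  note der = adapted_chart_derivatives[OF A l]
  let ?D = "frechet_derivative \<Phi> (at q)" and ?E = "frechet_derivative (inv_into U \<Phi>) (at (\<Phi> q))"
  have \<Phi>q: "\<Phi> q \<in> L" "e \<bullet> \<Phi> q \<ge> 0" using adapted_chart_mem[OF A U(2)] q by auto
  show ?thesis
  proof (intro set_eqI iffI)
    fix v assume "v \<in> tcone S q"
    then obtain \<gamma> d where g: "\<gamma> 0 = q" "d > 0" "\<And>t. 0 \<le> t \<Longrightarrow> t < d \<Longrightarrow> \<gamma> t \<in> S"
        "(\<gamma> has_vector_derivative v) (at 0 within {0..})"
      unfolding tcone_def by blast
    have "continuous (at 0 within {0..}) \<gamma>" by (rule has_vector_derivative_continuous[OF g(4)])
    then have "(\<gamma> \<longlongrightarrow> q) (at 0 within {0..})" by (simp add: continuous_within g(1))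
    then have "\<forall>\<^sub>F t in at 0 within {0..}. \<gamma> t \<in> U" using U(1,2) by (rule topological_tendstoD)
    then obtain d' where d': "d' > 0" "\<And>t. 0 \<le> t \<Longrightarrow> t \<noteq> 0 \<Longrightarrow> t < d' \<Longrightarrow> \<gamma> t \<in> U"
      unfolding eventually_at by (auto simp: dist_real_def)
    have gL: "\<Phi> (\<gamma> t) \<in> L \<and> e \<bullet> \<Phi> (\<gamma> t) \<ge> 0" if "0 < t" "t < min d d'" for t
      using adapted_chart_mem[OF A d'(2)[of t]] g(3)[of t] that by auto
    have der\<gamma>: "((\<lambda>t. \<Phi> (\<gamma> t)) has_vector_derivative ?D v) (at 0 within {0..})"
      using vector_derivative_diff_chain_within[OF g(4), of \<Phi> ?D] der(1) g(1)
      by (simp add: o_def has_derivative_at_withinI)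
    have "?D v \<in> L"
    proof (rule right_derivative_in_closed[OF der\<gamma> closed_subspace[OF L(1)]])
      show "min d d' > 0" using g d' by simp
      show "(1 / t) *\<^sub>R (\<Phi> (\<gamma> t) - \<Phi> (\<gamma> 0)) \<in> L" if "0 < t" "t < min d d'" for t
        using gL[OF that] \<Phi>q g(1) by (intro subspace_scale[OF L(1)] subspace_diff[OF L(1)]) auto
    qed
    moreover have "e \<bullet> ?D v \<ge> 0" if 0: "e \<bullet> \<Phi> q = 0"
    proof -
      have "?D v \<in> {y. e \<bullet> y \<ge> 0}"
      proof (rule right_derivative_in_closed[OF der\<gamma> closed_halfspace_ge])
        show "min d d' > 0" using g d' by simp
        show "(1 / t) *\<^sub>R (\<Phi> (\<gamma> t) - \<Phi> (\<gamma> 0)) \<in> {y. e \<bullet> y \<ge> 0}" if "0 < t" "t < min d d'" for t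
          using gL[OF that] 0 g(1) that by (simp add: inner_diff_right)
      qed
      then show ?thesis by simp
    qed
    ultimately show "v \<in> {v. ?D v \<in> L \<and> (e \<bullet> \<Phi> q = 0 \<longrightarrow> e \<bullet> ?D v \<ge> 0)}" by blast
  next
    fix v assume "v \<in> {v. ?D v \<in> L \<and> (e \<bullet> \<Phi> q = 0 \<longrightarrow> e \<bullet> ?D v \<ge> 0)}"
    then have v: "?D v \<in> L" "e \<bullet> \<Phi> q = 0 \<Longrightarrow> e \<bullet> ?D v \<ge> 0" by auto
    define w where "w = ?D v"
    have "((\<lambda>t. \<Phi> q + t *\<^sub>R w) \<longlongrightarrow> \<Phi> q + 0 *\<^sub>R w) (at 0 within {0..})" by (intro tendsto_intros)
    then have lim: "((\<lambda>t. \<Phi> q + t *\<^sub>R w) \<longlongrightarrow> \<Phi> q) (at 0 within {0..})" by simp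
    have "\<forall>\<^sub>F t in at 0 within {0..}. \<Phi> q + t *\<^sub>R w \<in> \<Phi> ` U"
      by (rule topological_tendstoD[OF lim U(4)]) (use U in auto)
    moreover have "\<forall>\<^sub>F t in at 0 within {0..}. e \<bullet> (\<Phi> q + t *\<^sub>R w) \<ge> 0"
    proof (cases "e \<bullet> \<Phi> q = 0")
      case True
      then show ?thesis using v(2) by (auto simp: eventually_at_filter inner_add_right w_def intro!: always_eventually)
    next
      case False
      then have "e \<bullet> \<Phi> q > 0" using \<Phi>q by simp
      with order_tendstoD(1)[OF tendsto_inner[OF tendsto_const lim], of 0 e] show ?thesis
        by (auto elim: eventually_mono)
    qed
    ultimately have "\<forall>\<^sub>F t in at 0 within {0..}. \<Phi> q + t *\<^sub>R w \<in> \<Phi> ` U \<and> e \<bullet> (\<Phi> q + t *\<^sub>R w) \<ge> 0"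
      by (rule eventually_conj)
    then obtain d where d: "d > 0" "\<And>t. 0 \<le> t \<Longrightarrow> t \<noteq> 0 \<Longrightarrow> t < d \<Longrightarrow> \<Phi> q + t *\<^sub>R w \<in> \<Phi> ` U \<and> e \<bullet> (\<Phi> q + t *\<^sub>R w) \<ge> 0"
      unfolding eventually_at by (auto simp: dist_real_def)
    show "v \<in> tcone S q"
    proof (rule tconeI[where \<gamma>="\<lambda>t. inv_into U \<Phi> (\<Phi> q + t *\<^sub>R w)" and d=d])
      show "inv_into U \<Phi> (\<Phi> q + 0 *\<^sub>R w) = q" using U by simp
      show "inv_into U \<Phi> (\<Phi> q + t *\<^sub>R w) \<in> S" if "0 \<le> t" "t < d" for t
      proof -
        have *: "\<Phi> q + t *\<^sub>R w \<in> \<Phi> ` U" "e \<bullet> (\<Phi> q + t *\<^sub>R w) \<ge> 0"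
          using d(2)[of t] that U \<Phi>q by (cases "t = 0"; auto)+
        have "\<Phi> q + t *\<^sub>R w \<in> L" using \<Phi>q v(1) by (intro subspace_add[OF L(1)] subspace_scale[OF L(1)]) (auto simp: w_def)
        with * show ?thesis
          using adapted_chart_mem[OF A inv_into_into[OF *(1)]] by (simp add: f_inv_into_f)
      qed
      have "((\<lambda>t. \<Phi> q + t *\<^sub>R w) has_vector_derivative w) (at 0 within {0..})"
        by (auto intro!: derivative_eq_intros)
      from vector_derivative_diff_chain_within[OF this, of "inv_into U \<Phi>" ?E]
      show "((\<lambda>t. inv_into U \<Phi> (\<Phi> q + t *\<^sub>R w)) has_vector_derivative v) (at 0 within {0..})"
        using der(2,3) by (simp add: o_def has_derivative_at_withinI w_def)
    qed (rule d(1))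
  qed
qed

text \<open>A half space of \<open>L\<close> together with its negative is all of \<open>L\<close>,
  so every chart yields the same tangent space.\<close>

lemma tspace_tcone:
  assumes A: "adapted_chart l m S q U \<Phi> L e" and l: "1 \<le> l" and q: "q \<in> S"
  shows "tspace l m S q = {v. v \<in> tcone S q \<or> - v \<in> tcone S q}"
proof -
  have *: "frechet_derivative \<Phi> (at q) v \<in> L \<longleftrightarrow> v \<in> tcone S q \<or> - v \<in> tcone S q"
    if A: "adapted_chart l m S q U \<Phi> L e" for U \<Phi> L e v
  proof -
    have L: "subspace L" using A by (auto simp: adapted_chart_def)
    have "linear (frechet_derivative \<Phi> (at q))"
      using adapted_chart_derivatives(1)[OF A l] by (rule has_derivative_linear)
    then have neg: "frechet_derivative \<Phi> (at q) (- v) = - frechet_derivative \<Phi> (at q) v" by (rule linear_neg)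
    have "- x \<in> L \<longleftrightarrow> x \<in> L" for x using subspace_neg[OF L, of x] subspace_neg[OF L, of "- x"] by auto
    then show ?thesis unfolding tcone_chart[OF A l q] by (auto simp: neg)
  qed
  show ?thesis using *[OF A] * A unfolding tspace_def by blast
qed

text \<open>In a chart showing \<open>q\<close> to be interior the cone is a linear space, while
  \<open>tcone_boundary\<close> finds a vector whose negative is missing. Together they prevent two
  charts from disagreeing on whether \<open>q\<close> is a boundary point.\<close>

lemma tcone_symmetric:
  assumes A: "adapted_chart l m S q U \<Phi> L e" and l: "1 \<le> l" and q: "q \<in> S" and "e = 0 \<or> e \<bullet> \<Phi> q \<noteq> 0" "v \<in> tcone S q"
  shows "- v \<in> tcone S q"
proof -
  have L: "subspace L" using A by (auto simp: adapted_chart_def)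
  have "linear (frechet_derivative \<Phi> (at q))"
    using adapted_chart_derivatives(1)[OF A l] by (rule has_derivative_linear)
  then show ?thesis using assms(4,5) unfolding tcone_chart[OF A l q]
    by (auto simp: linear_neg subspace_neg[OF L])
qed

text \<open>The preimage of \<open>e\<close> points inward and its negative does not belong to the
  cone. The tangent space of the boundary consists of the vectors lying in the cone with both
  signs.\<close>

lemma tcone_boundary:
  assumes A: "adapted_chart l m S q U \<Phi> L e" and l: "1 \<le> l" and q: "q \<in> S" and "e \<noteq> 0" "e \<bullet> \<Phi> q = 0"
  shows "\<exists>v\<in>tcone S q. - v \<notin> tcone S q"
    "{v. frechet_derivative \<Phi> (at q) v \<in> L \<and> e \<bullet> frechet_derivative \<Phi> (at q) v = 0} = {v. v \<in> tcone S q \<and> - v \<in> tcone S q}"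
proof -
  have L: "subspace L" "e \<in> L" using A by (auto simp: adapted_chart_def)
  have lin: "linear (frechet_derivative \<Phi> (at q))"
    using adapted_chart_derivatives(1)[OF A l] by (rule has_derivative_linear)
  note der = adapted_chart_derivatives[OF A l]
  let ?v = "frechet_derivative (inv_into U \<Phi>) (at (\<Phi> q)) e"
  have ee: "\<not> e \<bullet> e \<le> 0" using assms(4) by (metis inner_gt_zero_iff not_le)
  then have "?v \<in> tcone S q \<and> - ?v \<notin> tcone S q"
    unfolding tcone_chart[OF A l q] using assms(5) L by (simp add: linear_neg[OF lin] der(4) ee)
  then show "\<exists>v\<in>tcone S q. - v \<notin> tcone S q" by blast
  have "- x \<in> L \<longleftrightarrow> x \<in> L" for x using subspace_neg[OF L(1), of x] subspace_neg[OF L(1), of "- x"] by auto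
  then show "{v. frechet_derivative \<Phi> (at q) v \<in> L \<and> e \<bullet> frechet_derivative \<Phi> (at q) v = 0} = {v. v \<in> tcone S q \<and> - v \<in> tcone S q}"
    unfolding tcone_chart[OF A l q] using assms(5) by (auto simp: linear_neg[OF lin])
qed

lemma mbdry_tcone:
  assumes "q \<in> mbdry l m S" "1 \<le> l"
  shows "\<exists>v\<in>tcone S q. - v \<notin> tcone S q" "bdry_tspace l m S q = {v. v \<in> tcone S q \<and> - v \<in> tcone S q}"
proof -
  obtain U \<Phi> L e where A: "q \<in> S" "adapted_chart l m S q U \<Phi> L e" "e \<noteq> 0" "e \<bullet> \<Phi> q = 0"
    using assms by (auto simp: mbdry_def)
  show "\<exists>v\<in>tcone S q. - v \<notin> tcone S q" by (rule tcone_boundary(1)[OF A(2) assms(2) A(1,3,4)])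
  show "bdry_tspace l m S q = {v. v \<in> tcone S q \<and> - v \<in> tcone S q}"
    using tcone_boundary(2)[OF _ assms(2) A(1)] A unfolding bdry_tspace_def by blast
qed

section \<open>The modified compactification and its inverse\<close>

text \<open>The inverse of \<open>Smod\<close> on the closed ball. It is smooth on the whole space,
  whereas \<open>Smod\<close> has a square root singularity at the sphere; so regularity is carried
  by \<open>proj\<close>, from the modified compactification to the closure of \<Sigma>.\<close>

definition proj :: "complex^'n \<Rightarrow> complex^'n" where
  "proj w = (2 / (1 + (norm w)\<^sup>2)) *\<^sub>R w"

text \<open>Changes sign across the sphere, which makes it a smooth coordinate on both sides, unlike
  a square root.\<close>

definition rho :: "complex^'n \<Rightarrow> real" where
  "rho w = (1 - (norm w)\<^sup>2) / (1 + (norm w)\<^sup>2)"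

lemma one_plus_norm_pos: "1 + (norm (w::'a::real_normed_vector))\<^sup>2 > 0" by (simp add: add_pos_nonneg)

lemma cdiff_proj: "cdiff k proj S" and cdiff_rho: "cdiff k rho S"
  using one_plus_norm_pos[where 'a="complex^'a"] less_imp_neq[OF one_plus_norm_pos[where 'a="complex^'a"]]
  unfolding proj_def[abs_def] rho_def[abs_def]
  by (intro cdiff_scaleR cdiff_divide cdiff_const cdiff_id cdiff_add cdiff_diff cdiff_norm_power2; force)+

lemma norm_proj: "(norm (proj w))\<^sup>2 = 1 - (rho w)\<^sup>2"
  using one_plus_norm_pos[of w]
  by (simp add: proj_def rho_def power_mult_distrib power_divide field_simps) (simp add: power2_eq_square algebra_simps)

lemma rho_nonneg_iff: "rho w \<ge> 0 \<longleftrightarrow> norm w \<le> 1" and rho_eq_0_iff: "rho w = 0 \<longleftrightarrow> norm w = 1"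
  and rho_pos_iff: "rho w > 0 \<longleftrightarrow> norm w < 1"
proof -
  have "norm w \<noteq> -1" using norm_ge_zero[of w] by linarith
  then show "rho w \<ge> 0 \<longleftrightarrow> norm w \<le> 1" "rho w = 0 \<longleftrightarrow> norm w = 1" "rho w > 0 \<longleftrightarrow> norm w < 1"
    using one_plus_norm_pos[of w]
    by (simp_all add: rho_def zero_le_divide_iff zero_less_divide_iff abs_square_le_1 abs_square_less_1 power2_eq_1_iff)
qed

lemma proj_sphere: "norm w = 1 \<Longrightarrow> proj w = w" by (simp add: proj_def)

lemma Smod_norm: "norm z \<le> 1 \<Longrightarrow> (norm (Smod z))\<^sup>2 = (1 - sqrt (1 - (norm z)\<^sup>2)) / (1 + sqrt (1 - (norm z)\<^sup>2))"
proof -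
  assume z: "norm z \<le> 1"
  define c where "c = sqrt (1 - (norm z)\<^sup>2)"
  have c: "c \<ge> 0" "(norm z)\<^sup>2 = 1 - c\<^sup>2" using z by (simp_all add: c_def abs_square_le_1)
  have "(norm (Smod z))\<^sup>2 = (1 - c\<^sup>2) / (1 + c)\<^sup>2"
    using c by (simp add: Smod_def c_def[symmetric] power_divide)
  also have "1 - c\<^sup>2 = (1 - c) * (1 + c)" by (simp add: power2_eq_square algebra_simps)
  also have "(1 - c) * (1 + c) / (1 + c)\<^sup>2 = (1 - c) / (1 + c)" using c by (simp add: power2_eq_square)
  finally show ?thesis by (simp add: c_def)
qed

lemma Smod_rho: "norm z \<le> 1 \<Longrightarrow> rho (Smod z) = sqrt (1 - (norm z)\<^sup>2)"
proof -
  assume z: "norm z \<le> 1"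
  define c where "c = sqrt (1 - (norm z)\<^sup>2)"
  have c: "c \<ge> 0" using z by (simp add: c_def abs_square_le_1)
  have "1 - (norm (Smod z))\<^sup>2 = 2 * c / (1 + c)" "1 + (norm (Smod z))\<^sup>2 = 2 / (1 + c)"
    using c by (simp_all add: Smod_norm[OF z] c_def[symmetric] field_simps)
  then show ?thesis using c by (simp add: rho_def c_def[symmetric])
qed

lemma proj_Smod: "norm z \<le> 1 \<Longrightarrow> proj (Smod z) = z"
proof -
  assume z: "norm z \<le> 1"
  define c where "c = sqrt (1 - (norm z)\<^sup>2)"
  have c: "c \<ge> 0" using z by (simp add: c_def abs_square_le_1)
  have "1 + (norm (Smod z))\<^sup>2 = 2 / (1 + c)"
    using c by (simp add: Smod_norm[OF z] c_def[symmetric] field_simps)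
  then have "proj (Smod z) = (1 + c) *\<^sub>R Smod z" by (simp add: proj_def)
  then show ?thesis using c by (simp add: Smod_def c_def[symmetric])
qed

lemma Smod_proj: "norm w \<le> 1 \<Longrightarrow> Smod (proj w) = w"
proof -
  assume w: "norm w \<le> 1"
  have r: "rho w \<ge> 0" using w rho_nonneg_iff by blast
  have "1 - (norm (proj w))\<^sup>2 = (rho w)\<^sup>2" by (simp add: norm_proj)
  then have "Smod (proj w) = (1 / (1 + rho w)) *\<^sub>R proj w" using r by (simp add: Smod_def)
  also have "1 + rho w = 2 / (1 + (norm w)\<^sup>2)" using one_plus_norm_pos[of w] by (simp add: rho_def field_simps)
  also have "(1 / (2 / (1 + (norm w)\<^sup>2))) *\<^sub>R proj w = ((1 + (norm w)\<^sup>2) / (1 + (norm w)\<^sup>2)) *\<^sub>R w"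
    by (simp add: proj_def)
  finally show ?thesis using one_plus_norm_pos[of w] by simp
qed

lemma norm_proj_le: "norm (proj w) \<le> 1" and norm_proj_eq_1: "norm (proj w) = 1 \<longleftrightarrow> norm w = 1"
proof -
  have "(norm (proj w))\<^sup>2 \<le> 1" by (simp add: norm_proj)
  then show "norm (proj w) \<le> 1" by (simp add: abs_square_le_1)
  have "norm (proj w) = 1 \<longleftrightarrow> (norm (proj w))\<^sup>2 = 1"   proof -
    have "norm (proj w) \<noteq> - 1" using norm_ge_zero[of "proj w"] by linarith
    then show ?thesis by (simp add: power2_eq_1_iff)
  qed
  then show "norm (proj w) = 1 \<longleftrightarrow> norm w = 1" by (simp add: norm_proj rho_eq_0_iff)
qed

lemma Smod_norm_le: "norm z \<le> 1 \<Longrightarrow> norm (Smod z) \<le> 1"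
  and Smod_norm_less: "norm z < 1 \<Longrightarrow> norm (Smod z) < 1"
  using Smod_rho[of z] rho_nonneg_iff[of "Smod z"] rho_pos_iff[of "Smod z"]
  by (auto simp: abs_square_le_1 abs_square_less_1)

lemma Smod_sphere: "norm z = 1 \<Longrightarrow> Smod z = z" by (simp add: Smod_def)

lemma continuous_on_Smod: "continuous_on (cball 0 1) Smod"
  unfolding Smod_def[abs_def]
  by (intro continuous_intros) (auto simp: add_nonneg_eq_0_iff abs_square_le_1)

lemma cdiff_Smod: "cdiff k Smod (ball 0 1)"
proof -
  have "1 + sqrt (1 - (norm z)\<^sup>2) \<noteq> 0" if "z \<in> ball 0 1" for z :: "complex^'a"
  proof -
    have "sqrt (1 - (norm z)\<^sup>2) \<ge> 0" using norm_lt_1_nz[of z] that by simp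
    then show ?thesis by linarith
  qed
  then show ?thesis
    unfolding Smod_def[abs_def]
    by (intro cdiff_scaleR cdiff_divide cdiff_const cdiff_id cdiff_add cdiff_diff cdiff_norm_power2 cdiff_sqrt_compose)
      (use norm_lt_1_nz in auto)
qed

text \<open>On the sphere the derivative of \<open>proj\<close> is the orthogonal projection along
  \<open>q\<close>; the radial direction is seen to first order only by \<open>rho\<close>.\<close>

lemma proj_derivative_sphere:
  assumes "norm q = 1"
  shows "(proj has_derivative (\<lambda>v. v - (q \<bullet> v) *\<^sub>R q)) (at q)" "(rho has_derivative (\<lambda>v. - (q \<bullet> v))) (at q)"
proof -
  have q: "q \<bullet> q = 1" using assms by (simp add: power2_norm_eq_inner[symmetric])
  show "(proj has_derivative (\<lambda>v. v - (q \<bullet> v) *\<^sub>R q)) (at q)"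
    unfolding proj_def[abs_def] power2_norm_eq_inner
    by (auto intro!: derivative_eq_intros simp: q inner_commute fun_eq_iff field_simps)
  show "(rho has_derivative (\<lambda>v. - (q \<bullet> v))) (at q)"
    unfolding rho_def[abs_def] power2_norm_eq_inner
    by (auto intro!: derivative_eq_intros simp: q inner_commute fun_eq_iff field_simps)
qed

section \<open>Boundary parametrizations\<close>

text \<open>An orthonormal basis of \<open>T0\<close> is completed by the normalized component of
  \<open>a\<close> orthogonal to \<open>T0\<close>. Since \<open>T\<close> has dimension
  \<open>CARD('m)\<close>, the type \<open>'m\<close> can label the vectors, and
  \<open>\<nu>\<close> is the label of the last one.\<close>

lemma adapted_frame:
  fixes T T0 :: "'v::euclidean_space set"
  assumes T: "subspace T" "dim T = CARD('m::finite)" and T0: "subspace T0" "T0 \<subseteq> T"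
    and a: "a \<in> T" "a \<notin> T0" "\<And>v. v \<in> T \<Longrightarrow> \<exists>c. v - c *\<^sub>R a \<in> T0"
  obtains e :: "'m::finite \<Rightarrow> 'v" and \<nu> :: "'m::finite" where "\<And>i j. e i \<bullet> e j = (if i = j then 1 else 0)"
    "span (range e) = T" "\<And>i. i \<noteq> \<nu> \<Longrightarrow> e i \<in> T0" "e \<nu> \<notin> T0"
proof -
  obtain B where B: "B \<subseteq> T0" "pairwise orthogonal B" "\<And>x. x \<in> B \<Longrightarrow> norm x = 1" "independent B" "span B = T0"
    using orthonormal_basis_subspace[OF T0(1)] by metis
  have fB: "finite B" using B(4) by (rule independent_imp_finite)
  have Bij: "x \<bullet> y = (if x = y then 1 else 0)" if "x \<in> B" "y \<in> B" for x y
    using B(2,3) that by (auto simp: pairwise_def orthogonal_def norm_eq_1)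
  define p where "p = (\<Sum>b\<in>B. (a \<bullet> b) *\<^sub>R b)"
  define n0 where "n0 = a - p"
  have pT0: "p \<in> T0" unfolding p_def using B(1) by (intro subspace_sum[OF T0(1)] subspace_scale[OF T0(1)]) auto
  have n0B: "n0 \<bullet> b = 0" if "b \<in> B" for b
  proof -
    have "p \<bullet> b = (\<Sum>x\<in>B. if x = b then a \<bullet> b else 0)"
      unfolding p_def inner_sum_left using that by (intro sum.cong) (auto simp: Bij)
    then show ?thesis using that fB by (simp add: n0_def inner_diff_left)
  qed
  have n0_T0: "n0 \<bullet> v = 0" if "v \<in> T0" for v
  proof -
    have "v \<in> span B" using that B(5) by simp
    then have "orthogonal n0 v" by (rule orthogonal_to_span) (simp add: orthogonal_def n0B)
    then show ?thesis by (simp add: orthogonal_def)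
  qed
  have n0ne: "n0 \<noteq> 0" using a(2) pT0 by (auto simp: n0_def)
  have n0T: "n0 \<in> T" unfolding n0_def using a(1) pT0 T0(2) by (intro subspace_diff[OF T(1)]) auto
  define n where "n = (1 / norm n0) *\<^sub>R n0"
  have n1: "norm n = 1" using n0ne by (simp add: n_def)
  have nB: "n \<bullet> v = 0" if "v \<in> T0" for v using n0_T0[OF that] by (simp add: n_def)
  have nT: "n \<in> T" unfolding n_def by (rule subspace_scale[OF T(1) n0T])
  have nT0: "n \<notin> T0" using nB[of n] n1 by (auto simp: norm_eq_1)
  define E where "E = insert n B"
  have Eij: "x \<bullet> y = (if x = y then 1 else 0)" if "x \<in> E" "y \<in> E" for x y
  proof -
    have 1: "n \<bullet> b = 0" "b \<bullet> n = 0" "b \<noteq> n" if "b \<in> B" for b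
      using nB[of b] B(1) that nT0 by (auto simp: inner_commute)
    have "n \<bullet> n = 1" using n1 by (simp add: norm_eq_1)
    show ?thesis
    proof (cases "x = n")
      case True
      then show ?thesis using \<open>n \<bullet> n = 1\<close> 1[of y] that(2) by (cases "y = n") (auto simp: E_def)
    next
      case False
      then have x: "x \<in> B" using that(1) by (simp add: E_def)
      show ?thesis using 1[OF x] Bij[OF x] that(2) False by (cases "y = n") (auto simp: E_def)
    qed
  qed
  have indE: "independent E"
  proof (rule pairwise_orthogonal_independent)
    show "pairwise orthogonal E" using Eij by (auto simp: pairwise_def orthogonal_def)
    show "0 \<notin> E" using Eij[of 0 0] by auto
  qed
  have spanE: "span E = T"
  proof
    show "span E \<subseteq> T" using nT B(1) T0(2) T(1) by (intro span_minimal) (auto simp: E_def)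
    show "T \<subseteq> span E"
    proof
      fix v assume "v \<in> T"
      then obtain c where c: "v - c *\<^sub>R a \<in> T0" using a(3) by blast
      have T0E: "T0 \<subseteq> span E" unfolding B(5)[symmetric] by (rule span_mono) (auto simp: E_def)
      have "n \<in> span E" by (rule span_base) (simp add: E_def)
      then have "norm n0 *\<^sub>R n \<in> span E" by (rule span_scale)
      then have "n0 + p \<in> span E" using T0E pT0 n0ne by (intro span_add) (auto simp: n_def)
      then have "c *\<^sub>R a \<in> span E" by (intro span_scale) (simp add: n0_def)
      then have "(v - c *\<^sub>R a) + c *\<^sub>R a \<in> span E" using T0E c by (intro span_add) auto
      then show "v \<in> span E" by simp
    qed
  qed
  have "card E = CARD('m)" using dim_span_eq_card_independent[OF indE] spanE T(2) by simp
  moreover have "finite E" using fB by (simp add: E_def)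
  ultimately obtain f :: "'m \<Rightarrow> 'v" where f: "bij_betw f UNIV E"
    by (metis finite_same_card_bij finite_class.finite_UNIV)
  obtain \<nu> where \<nu>: "f \<nu> = n" using f by (metis E_def bij_betw_imp_surj_on insertI1 rangeE)
  have inj: "inj f" and rg: "range f = E" using f by (auto simp: bij_betw_def)
  show ?thesis
  proof (rule that[of f \<nu>])
    show "f i \<bullet> f j = (if i = j then 1 else 0)" for i j
      using Eij[of "f i" "f j"] rg inj by (auto simp: inj_def)
    show "span (range f) = T" using rg spanE by simp
    show "f i \<in> T0" if "i \<noteq> \<nu>" for i
    proof -
      have "f i \<in> E" "f i \<noteq> n" using rg inj that \<nu> by (auto simp: inj_def)
      then show ?thesis using B(1) by (auto simp: E_def)
    qed
    show "f \<nu> \<notin> T0" using nT0 \<nu> by simp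
  qed
qed

lemma orthonormal_expansion:
  fixes e :: "'m::finite \<Rightarrow> 'v::euclidean_space"
  assumes e: "\<And>i j. e i \<bullet> e j = (if i = j then 1 else 0)" and v: "v \<in> span (range e)"
  shows "v = (\<Sum>i\<in>UNIV. (v \<bullet> e i) *\<^sub>R e i)"
  using v
proof (induction rule: span_induct_alt)
  case (step c x y)
  then obtain j where j: "x = e j" by auto
  have "(\<Sum>i\<in>UNIV. (e j \<bullet> e i) *\<^sub>R e i) = e j"
    by (simp add: e if_distrib[of "\<lambda>x. x *\<^sub>R _"] cong: if_cong)
  then show ?case
    using step.IH unfolding j inner_add_left scaleR_add_left sum.distrib
    by (simp add: scaleR_sum_right[symmetric] scaleR_scaleR[symmetric] del: scaleR_scaleR)
qed simp

text \<open>The intended left inverse of the boundary parametrization, on the whole ambient space;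
  prescribing it is what makes \<open>proj \<circ> F\<close> normalized.\<close>

definition coords :: "'m \<Rightarrow> ('m \<Rightarrow> complex^'n) \<Rightarrow> complex^'n \<Rightarrow> real^'m" where
  "coords \<nu> e w = (\<chi> i. if i = \<nu> then rho w else e i \<bullet> proj w)"

lemma cdiff_coords: "cdiff k (coords \<nu> e) S"
proof (rule cdiff_vec_lambda)
  show "cdiff k (\<lambda>w. coords \<nu> e w $ i) S" for i
    by (cases "i = \<nu>") (auto simp: coords_def intro: cdiff_rho cdiff_inner cdiff_proj)
qed

text \<open>\<open>F\<close> lives on the full cube but parametrizes a piece of \<open>S\<close>
  only for \<open>0 \<le> y $ \<nu>\<close>; for negative values it is a C^2 continuation outside
  the closed ball. \<open>cover\<close> says that within the open set \<open>U\<close> nothing of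
  \<open>S\<close> is missed.\<close>

locale bparam =
  fixes S :: "(complex^'n) set" and F :: "real^'m \<Rightarrow> complex^'n" and \<nu> :: 'm and e :: "'m \<Rightarrow> complex^'n"
    and \<delta> :: real and U :: "(complex^'n) set"
  assumes delta: "\<delta> > 0" and F2: "cdiff 2 F (cube \<delta>)"
    and left: "\<And>y. y \<in> cube \<delta> \<Longrightarrow> coords \<nu> e (F y) = y"
    and mem: "\<And>y. y \<in> cube \<delta> \<Longrightarrow> F y \<in> S \<longleftrightarrow> 0 \<le> y $ \<nu>"
    and U: "open U" "F ` cube \<delta> \<subseteq> U"
    and cover: "\<And>z. z \<in> S \<Longrightarrow> z \<in> U \<Longrightarrow> coords \<nu> e z \<in> cube \<delta> \<and> F (coords \<nu> e z) = z"
    and ortho: "\<And>i j. i \<noteq> \<nu> \<Longrightarrow> j \<noteq> \<nu> \<Longrightarrow> e i \<bullet> e j = (if i = j then 1 else 0)"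
    and e_q: "\<And>i. i \<noteq> \<nu> \<Longrightarrow> e i \<bullet> F 0 = 0"
    and axes: "\<And>i. i \<noteq> \<nu> \<Longrightarrow> frechet_derivative F (at 0) (axis i 1) = e i"
begin

lemma F1: "cdiff 1 F (cube \<delta>)" using cdiff_mono[OF F2, of 1] by simp

lemma Fd: "y \<in> cube \<delta> \<Longrightarrow> (F has_derivative frechet_derivative F (at y)) (at y)"
  by (rule cdiff_1_has_derivative[OF F1])

lemma rho_F: "y \<in> cube \<delta> \<Longrightarrow> rho (F y) = y $ \<nu>"
  using arg_cong[OF left, of y "\<lambda>v. v $ \<nu>"] by (simp add: coords_def)

lemma sphere_F: "y \<in> cube \<delta> \<Longrightarrow> F y \<in> sphere 0 1 \<longleftrightarrow> y $ \<nu> = 0"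
  using rho_F[of y] rho_eq_0_iff[of "F y"] by auto

lemma curve_in_cube:
  assumes "y \<in> cube \<delta>"
  shows "\<exists>d>0. \<forall>t. 0 \<le> t \<and> t < d \<longrightarrow> y + t *\<^sub>R u \<in> cube \<delta>"
proof -
  have "((\<lambda>t. y + t *\<^sub>R u) \<longlongrightarrow> y + 0 *\<^sub>R u) (at 0)" by (intro tendsto_intros)
  then have "((\<lambda>t. y + t *\<^sub>R u) \<longlongrightarrow> y) (at 0)" by simp
  then have "\<forall>\<^sub>F t in at 0. y + t *\<^sub>R u \<in> cube \<delta>" using open_cube assms by (rule topological_tendstoD)
  then obtain d where d: "d > 0" "\<And>t. t \<noteq> 0 \<Longrightarrow> \<bar>t\<bar> < d \<Longrightarrow> y + t *\<^sub>R u \<in> cube \<delta>"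
    unfolding eventually_at by (auto simp: dist_real_def)
  have "y + t *\<^sub>R u \<in> cube \<delta>" if "0 \<le> t" "t < d" for t
    using d(2)[of t] that assms by (cases "t = 0") auto
  with d(1) show ?thesis by blast
qed

lemma F_curve:
  assumes "y \<in> cube \<delta>"
  shows "((\<lambda>t. F (y + t *\<^sub>R u)) has_vector_derivative frechet_derivative F (at y) u) (at 0 within {0..})"
  by (rule has_vector_derivative_at_within[OF has_derivative_dirderiv(1)[OF Fd[OF assms]]])

text \<open>\<open>coords\<close> turns a curve in \<open>S'\<close> into a parameter curve that
  \<open>F\<close> maps back to it, so the velocity of the parameter curve is a preimage of
  \<open>v\<close>; the closed set \<open>C\<close> carries constraints on its difference quotients
  to the limit.\<close>

lemma cone_lift:
  assumes y: "y \<in> cube \<delta>" and v: "v \<in> tcone S' (F y)" "S' \<subseteq> S"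
    and C: "closed C" "\<And>t x z. t > 0 \<Longrightarrow> z \<in> S' \<Longrightarrow> z \<in> U \<Longrightarrow> (1 / t) *\<^sub>R (coords \<nu> e z - y) \<in> C"
  shows "\<exists>u\<in>C. v = frechet_derivative F (at y) u"
proof -
  obtain \<gamma> d where g: "\<gamma> 0 = F y" "d > 0" "\<And>t. 0 \<le> t \<Longrightarrow> t < d \<Longrightarrow> \<gamma> t \<in> S'"
      "(\<gamma> has_vector_derivative v) (at 0 within {0..})"
    using v(1) unfolding tcone_def by blast
  have FU: "F y \<in> U" using U y by auto
  have "continuous (at 0 within {0..}) \<gamma>" by (rule has_vector_derivative_continuous[OF g(4)])
  then have "(\<gamma> \<longlongrightarrow> F y) (at 0 within {0..})" by (simp add: continuous_within g(1))
  then have "\<forall>\<^sub>F t in at 0 within {0..}. \<gamma> t \<in> U" using U(1) FU by (rule topological_tendstoD)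
  then obtain d' where d': "d' > 0" "\<And>t. 0 \<le> t \<Longrightarrow> t \<noteq> 0 \<Longrightarrow> t < d' \<Longrightarrow> \<gamma> t \<in> U"
    unfolding eventually_at by (auto simp: dist_real_def)
  define r where "r = min d d'"
  have r: "r > 0" using g d' by (simp add: r_def)
  have gU: "\<gamma> t \<in> U" if "0 \<le> t" "t < r" for t
    using d'(2)[of t] that FU g(1) by (cases "t = 0") (auto simp: r_def)
  have gS: "\<gamma> t \<in> S'" if "0 \<le> t" "t < r" for t using g(3)[of t] that by (auto simp: r_def)
  let ?P = "frechet_derivative (coords \<nu> e) (at (F y))"
  have dP: "(coords \<nu> e has_derivative ?P) (at (F y))"
    by (rule cdiff_1_has_derivative[OF cdiff_coords[where S=UNIV]]) simp
  have der: "((\<lambda>t. coords \<nu> e (\<gamma> t)) has_vector_derivative ?P v) (at 0 within {0..})"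
    using vector_derivative_diff_chain_within[OF g(4), of "coords \<nu> e" ?P] dP g(1)
    by (simp add: o_def has_derivative_at_withinI)
  define u where "u = ?P v"
  have "u \<in> C" unfolding u_def
  proof (rule right_derivative_in_closed[OF der C(1) r])
    fix t assume t: "0 < t" "t < r"
    show "(1 / t) *\<^sub>R (coords \<nu> e (\<gamma> t) - coords \<nu> e (\<gamma> 0)) \<in> C"
      unfolding g(1) left[OF y] using t gS gU by (intro C(2)) auto
  qed
  moreover have "v = frechet_derivative F (at y) u"
  proof -
    have "((\<lambda>t. F (coords \<nu> e (\<gamma> t))) has_vector_derivative frechet_derivative F (at y) u) (at 0 within {0..})"
      using vector_derivative_diff_chain_within[OF der, of F "frechet_derivative F (at y)"] Fd[OF y] g(1) left[OF y]
      by (simp add: o_def has_derivative_at_withinI u_def)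
    moreover have "((\<lambda>t. F (coords \<nu> e (\<gamma> t))) has_vector_derivative v) (at 0 within {0..})"
    proof (rule has_vector_derivative_transform_within[OF g(4) r])
      show "\<gamma> t = F (coords \<nu> e (\<gamma> t))" if "t \<in> {0..}" "dist t 0 < r" for t
        using cover[of "\<gamma> t"] gS[of t] gU[of t] v(2) that by (auto simp: dist_real_def)
    qed simp
    moreover have "at (0::real) within {0..} \<noteq> bot" by (simp add: at_within_Ici_at_right)
    ultimately show ?thesis using vector_derivative_unique_within by blast
  qed
  ultimately show ?thesis by blast
qed

lemma tcone_F:
  assumes y: "y \<in> cube \<delta>" "y $ \<nu> = 0"
  shows "tcone S (F y) = {frechet_derivative F (at y) u |u. u $ \<nu> \<ge> 0}" (is "?L = ?R")
proof
  show "?L \<subseteq> ?R"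
  proof
    fix v assume "v \<in> ?L"
    have "\<exists>u\<in>{u. 0 \<le> u $ \<nu>}. v = frechet_derivative F (at y) u"
    proof (rule cone_lift[OF y(1) \<open>v \<in> ?L\<close> order_refl])
      show "closed {u::real^'m. 0 \<le> u $ \<nu>}" by (intro closed_Collect_le continuous_intros)
      fix t :: real and z assume t: "t > 0" "z \<in> S" "z \<in> U"
      have "coords \<nu> e z \<in> cube \<delta>" "F (coords \<nu> e z) \<in> S" using cover[OF t(2,3)] t(2) by auto
      then have "0 \<le> coords \<nu> e z $ \<nu>" using mem by blast
      then show "(1 / t) *\<^sub>R (coords \<nu> e z - y) \<in> {u. 0 \<le> u $ \<nu>}" using t y by simp
    qed
    then show "v \<in> ?R" by blast
  qed
  show "?R \<subseteq> ?L"
  proof clarify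
    fix u :: "real^'m" assume u: "0 \<le> u $ \<nu>"
    obtain d where d: "d > 0" "\<And>t. 0 \<le> t \<and> t < d \<Longrightarrow> y + t *\<^sub>R u \<in> cube \<delta>" using curve_in_cube[OF y(1)] by blast
    show "frechet_derivative F (at y) u \<in> tcone S (F y)"
      by (rule tconeI[OF _ d(1) _ F_curve[OF y(1)]]) (use d mem u y in auto)
  qed
qed

text \<open>The boundary directions expressed through the set \<open>S \<inter> sphere 0 1\<close>
  alone, hence comparable between two parametrizations through the same point.\<close>

lemma tcone_sphere_F:
  assumes y: "y \<in> cube \<delta>" "y $ \<nu> = 0"
  shows "tcone (S \<inter> sphere 0 1) (F y) = {frechet_derivative F (at y) u |u. u $ \<nu> = 0}" (is "?L = ?R")
proof
  show "?L \<subseteq> ?R"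
  proof
    fix v assume "v \<in> ?L"
    have "\<exists>u\<in>{u. u $ \<nu> = 0}. v = frechet_derivative F (at y) u"
    proof (rule cone_lift[OF y(1) \<open>v \<in> ?L\<close> Int_lower1])
      show "closed {u::real^'m. u $ \<nu> = 0}" by (intro closed_Collect_eq continuous_intros)
      fix t :: real and z assume t: "t > 0" "z \<in> S \<inter> sphere 0 1" "z \<in> U"
      have "coords \<nu> e z \<in> cube \<delta>" "F (coords \<nu> e z) \<in> sphere 0 1" using cover[of z] t by auto
      then have "coords \<nu> e z $ \<nu> = 0" using sphere_F by blast
      then show "(1 / t) *\<^sub>R (coords \<nu> e z - y) \<in> {u. u $ \<nu> = 0}" using y by simp
    qed
    then show "v \<in> ?R" by blast
  qed
  show "?R \<subseteq> ?L"
  proof clarify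
    fix u :: "real^'m" assume u: "u $ \<nu> = 0"
    obtain d where d: "d > 0" "\<And>t. 0 \<le> t \<and> t < d \<Longrightarrow> y + t *\<^sub>R u \<in> cube \<delta>" using curve_in_cube[OF y(1)] by blast
    have "F (y + t *\<^sub>R u) \<in> S \<inter> sphere 0 1" if "0 \<le> t" "t < d" for t
      using d(2)[of t] mem[of "y + t *\<^sub>R u"] sphere_F[of "y + t *\<^sub>R u"] u y that by auto
    then show "frechet_derivative F (at y) u \<in> tcone (S \<inter> sphere 0 1) (F y)"
      by (intro tconeI[OF _ d(1) _ F_curve[OF y(1)]]) auto
  qed
qed

definition "Z y = proj (F y)"

lemma Z2: "cdiff 2 Z (cube \<delta>)"
  unfolding Z_def[abs_def] by (rule cdiff_compose[OF F2 cdiff_proj[where S=UNIV]]) auto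

lemma Z_normalized: "normalized \<nu> e Z (cube \<delta>)"
  unfolding normalized_def
proof (intro ballI conjI allI impI)
  fix y :: "real^'m" assume y: "y \<in> cube \<delta>"
  show "(norm (Z y))\<^sup>2 = 1 - (y $ \<nu>)\<^sup>2" by (simp add: Z_def norm_proj rho_F[OF y])
  show "e i \<bullet> Z y = y $ i" if "i \<noteq> \<nu>" for i
    using arg_cong[OF left[OF y], of "\<lambda>v. v $ i"] that by (simp add: coords_def Z_def)
qed

lemma Z_boundary:
  assumes y: "y \<in> cube \<delta>" "y $ \<nu> = 0"
  shows "Z y = F y" "norm (F y) = 1"
    "frechet_derivative Z (at y) u = frechet_derivative F (at y) u - (F y \<bullet> frechet_derivative F (at y) u) *\<^sub>R F y"
proof -
  show n: "norm (F y) = 1" using sphere_F[OF y(1)] y(2) by simp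
  then show "Z y = F y" by (simp add: Z_def proj_sphere)
  have "(Z has_derivative (\<lambda>u. frechet_derivative F (at y) u - (F y \<bullet> frechet_derivative F (at y) u) *\<^sub>R F y)) (at y)"
    unfolding Z_def[abs_def] by (rule has_derivative_compose[OF Fd[OF y(1)] proj_derivative_sphere(1)[OF n]])
  then show "frechet_derivative Z (at y) u = frechet_derivative F (at y) u - (F y \<bullet> frechet_derivative F (at y) u) *\<^sub>R F y"
    by (rule fun_cong[OF frechet_derivative_at[symmetric]])
qed

lemma zero_cube: "0 \<in> cube \<delta>" using delta by (simp add: cube_def)

lemma Z_axes: "i \<noteq> \<nu> \<Longrightarrow> frechet_derivative Z (at 0) (axis i 1) = e i"
proof -
  assume i: "i \<noteq> \<nu>"
  have "frechet_derivative Z (at 0) (axis i 1)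
      = frechet_derivative F (at 0) (axis i 1) - (F 0 \<bullet> frechet_derivative F (at 0) (axis i 1)) *\<^sub>R F 0"
    by (rule Z_boundary(3)[OF zero_cube]) simp
  also have "\<dots> = e i" using e_q[OF i] by (simp add: axes[OF i] inner_commute[of "F 0"])
  finally show ?thesis .
qed

end

text \<open>The given chart is arbitrary, but \<open>coords\<close> has to be a left inverse of
  \<open>F\<close>. The local diffeomorphism \<open>\<Theta>\<close> takes \<open>coords\<close>
  along the tangent space \<open>T\<close> and the given chart transversally to it; \<open>F\<close>
  is its inverse restricted to \<open>T\<close>. Transversality makes \<open>rho\<close> a
  coordinate of \<open>S\<close>, and horizontality makes the boundary frame orthogonal to
  \<open>q\<close>.\<close>

lemma boundary_parametrization:
  fixes S :: "(complex^'n) set"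
  assumes reg: "regular_in_ball 2 CARD('m::finite) S" and hor: "horizontal_bdry 2 CARD('m) S"
    and q: "q \<in> S" "norm q = 1"
  obtains F :: "real^'m \<Rightarrow> complex^'n" and \<nu> e \<delta> U where "bparam S F \<nu> e \<delta> U" "F 0 = q"
proof -
  let ?m = "CARD('m)"
  have ball: "S \<subseteq> cball 0 1" and mb: "mbdry 2 ?m S = S \<inter> sphere 0 1"
    and trans: "\<exists>v \<in> tspace 2 ?m S q. v \<bullet> q \<noteq> 0"
    using reg q by (auto simp: regular_in_ball_def)
  have qm: "q \<in> mbdry 2 ?m S" using mb q by auto
  then obtain U \<Phi> L c where A: "adapted_chart 2 ?m S q U \<Phi> L c" "c \<noteq> 0" "c \<bullet> \<Phi> q = 0"
    by (auto simp: mbdry_def)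
  have l: "(1::enat) \<le> 2" by simp
  have U: "open U" "q \<in> U" "inj_on \<Phi> U" "open (\<Phi> ` U)" and L: "subspace L" "dim L = ?m" "c \<in> L"
    and \<Phi>2: "Cl_on 2 \<Phi> U" using A by (auto simp: adapted_chart_def)
  have \<Phi>c: "cdiff 2 \<Phi> U" using \<Phi>2 by (simp add: Cl_on_numeral_iff)
  define D where "D = frechet_derivative \<Phi> (at q)"
  define E where "E = frechet_derivative (inv_into U \<Phi>) (at (\<Phi> q))"
  note der = adapted_chart_derivatives[OF A(1) l, folded D_def E_def]
  have linD: "linear D" and linE: "linear E" using has_derivative_linear[OF der(1)] has_derivative_linear[OF der(2)] by auto
  define T where "T = E ` L"
  have T_iff: "v \<in> T \<longleftrightarrow> D v \<in> L" for v unfolding T_def using der(3,4) by (metis imageE imageI)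
  have subT: "subspace T" unfolding T_def by (rule linear_subspace_image[OF linE L(1)])
  have "inj_on E (span L)" by (rule inj_on_inverseI[where g=D]) (rule der(4))
  then have dimT: "dim T = ?m" unfolding T_def using dim_image_eq[OF linE] L(2) by simp
  define T0 where "T0 = {v \<in> T. c \<bullet> D v = 0}"
  have subT0: "subspace T0" "T0 \<subseteq> T" unfolding T0_def using subT
    by (auto simp: subspace_def linear_add[OF linD] linear_scale[OF linD] linear_0[OF linD] inner_add_right)
  have cc: "c \<bullet> c > 0" using A(2) by simp
  have a: "E c \<in> T" "E c \<notin> T0" using L(3) cc by (auto simp: T_def T0_def der(4))
  have aT: "\<exists>k. v - k *\<^sub>R E c \<in> T0" if "v \<in> T" for v
  proof (intro exI[of _ "c \<bullet> D v / (c \<bullet> c)"])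
    show "v - (c \<bullet> D v / (c \<bullet> c)) *\<^sub>R E c \<in> T0"
      unfolding T0_def using that a(1) cc
      by (simp add: subspace_diff[OF subT] subspace_scale[OF subT] linear_diff[OF linD] linear_scale[OF linD] der(4) inner_diff_right)
  qed
  obtain e :: "'m \<Rightarrow> complex^'n" and \<nu> where e: "\<And>i j. e i \<bullet> e j = (if i = j then 1 else 0)"
    "span (range e) = T" "\<And>i. i \<noteq> \<nu> \<Longrightarrow> e i \<in> T0" "e \<nu> \<notin> T0"
    using adapted_frame[OF subT dimT subT0 a aT] by metis
  have "T0 \<subseteq> bdry_tspace 2 ?m S q"
    unfolding bdry_tspace_def T0_def using A by (auto simp: T_iff D_def)
  then have T0H: "T0 \<subseteq> Hdist q" using hor qm by (auto simp: horizontal_bdry_def)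
  have eq0: "e i \<bullet> q = 0" if "i \<noteq> \<nu>" for i using e(3)[OF that] T0H by (auto simp: Hdist_def)
  have expand: "v = (\<Sum>i\<in>UNIV. (v \<bullet> e i) *\<^sub>R e i)" if "v \<in> T" for v
    using orthonormal_expansion[OF e(1)] that e(2) by blast
  have eT: "e i \<in> T" for i using span_base[of "e i" "range e"] e(2) by simp
  \<comment> \<open>Otherwise all of \<open>T\<close> would be orthogonal to \<open>q\<close>,
    against transversality.\<close>
  have nq: "e \<nu> \<bullet> q \<noteq> 0"
  proof
    assume 0: "e \<nu> \<bullet> q = 0"
    obtain v where v: "v \<in> tspace 2 ?m S q" "v \<bullet> q \<noteq> 0" using trans by blast
    have "v \<in> tcone S q \<or> - v \<in> tcone S q" using v(1) tspace_tcone[OF A(1) l q(1)] by blast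
    then have "v \<in> T \<or> - v \<in> T" unfolding tcone_chart[OF A(1) l q(1)] T_iff D_def by blast
    then have "v \<in> T" using subspace_neg[OF subT, of "- v"] by auto
    then have "v \<bullet> q = (\<Sum>i\<in>UNIV. (v \<bullet> e i) *\<^sub>R e i) \<bullet> q" using expand by metis
    also have "\<dots> = 0" unfolding inner_sum_left using eq0 0 by (intro sum.neutral) (metis inner_scaleR_left mult_zero_right)
    finally show False using v by simp
  qed
  define pr where "pr = (\<lambda>v. \<Sum>i\<in>UNIV. (v \<bullet> e i) *\<^sub>R e i)"
  have linpr: "linear pr" unfolding pr_def by (intro linearI) (simp_all add: inner_add_left scaleR_add_left sum.distrib scaleR_sum_right)
  have pre: "pr v \<bullet> e j = v \<bullet> e j" for v j
    by (simp add: pr_def inner_sum_left e(1) if_distrib[of "(*) _"] cong: if_cong)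
  have prT: "pr v \<in> T" for v unfolding pr_def by (intro subspace_sum[OF subT] subspace_scale[OF subT] eT)
  have pr_iff: "v - pr v = 0 \<longleftrightarrow> v \<in> T" for v using expand prT by (metis eq_iff_diff_eq_0 pr_def)
  define \<iota> where "\<iota> = (\<lambda>y::real^'m. \<Sum>i\<in>UNIV. y $ i *\<^sub>R e i)"
  have lin\<iota>: "linear \<iota>" unfolding \<iota>_def by (intro linearI) (simp_all add: scaleR_add_left sum.distrib scaleR_sum_right)
  have \<iota>e: "\<iota> y \<bullet> e j = y $ j" for y j
    by (simp add: \<iota>_def inner_sum_left e(1) if_distrib[of "(*) _"] cong: if_cong)
  \<comment> \<open>The given chart followed by the inverse of its linearization: its derivative at
    \<open>q\<close> is the identity, and the condition \<open>\<Phi> z \<in> L\<close> becomes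
    \<open>w z \<in> T\<close>.\<close>
  define w where "w = (\<lambda>z. E (\<Phi> z - \<Phi> q))"
  define \<Theta> where "\<Theta> = (\<lambda>z. \<iota> (coords \<nu> e z) + (w z - pr (w z)))"
  have bl: "bounded_linear E" "bounded_linear pr" "bounded_linear \<iota>"
    using linE linpr lin\<iota> linear_conv_bounded_linear by blast+
  have w2: "cdiff 2 w U" unfolding w_def by (intro cdiff_compose_linear[OF bl(1)] cdiff_diff \<Phi>c cdiff_const)
  have \<Theta>2: "cdiff 2 \<Theta> U" unfolding \<Theta>_def
    by (intro cdiff_add cdiff_diff cdiff_compose_linear[OF bl(3)] cdiff_compose_linear[OF bl(2)] w2 cdiff_coords)
  have \<Theta>1: "cdiff 1 \<Theta> U" using cdiff_mono[OF \<Theta>2, of 1] by simp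
  have \<Theta>e: "\<Theta> z \<bullet> e j = coords \<nu> e z $ j" for z j
    by (simp add: \<Theta>_def inner_add_left inner_diff_left \<iota>e pre)
  have coords_q: "coords \<nu> e q = 0" using q eq0 by (simp add: vec_eq_iff coords_def rho_def proj_sphere)
  have \<Theta>q: "\<Theta> q = 0"
    by (simp add: \<Theta>_def coords_q w_def linear_0[OF linE] linear_0[OF linpr] linear_0[OF lin\<iota>])
  define Dc where "Dc = (\<lambda>v. (\<chi> i. if i = \<nu> then - (q \<bullet> v) else e i \<bullet> (v - (q \<bullet> v) *\<^sub>R q)) :: real^'m)"
  have dcoords: "(coords \<nu> e has_derivative Dc) (at q)"
  proof (rule has_derivative_componentwise_within[THEN iffD2], rule ballI)
    fix b :: "real^'m" assume "b \<in> Basis"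
    then obtain i where b: "b = axis i 1" by (auto simp: Basis_vec_def)
    show "((\<lambda>x. coords \<nu> e x \<bullet> b) has_derivative (\<lambda>x. Dc x \<bullet> b)) (at q)"
      using proj_derivative_sphere[OF q(2)] has_derivative_inner_right[OF proj_derivative_sphere(1)[OF q(2)], of "e i"]
      by (cases "i = \<nu>") (simp_all add: b inner_axis coords_def Dc_def)
  qed
  have dw: "(w has_derivative (\<lambda>v. v)) (at q)"
  proof -
    have "((\<lambda>z. E (\<Phi> z - \<Phi> q)) has_derivative (\<lambda>v. E (D v - 0))) (at q)"
      by (intro bounded_linear.has_derivative[OF bl(1)] has_derivative_diff der(1) has_derivative_const)
    then show ?thesis by (simp add: w_def der(3))
  qed
  define D\<Theta> where "D\<Theta> = (\<lambda>v. \<iota> (Dc v) + (v - pr v))"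
  have d\<Theta>: "(\<Theta> has_derivative D\<Theta>) (at q)"
    unfolding \<Theta>_def D\<Theta>_def
    by (intro has_derivative_add has_derivative_diff bounded_linear.has_derivative[OF bl(3)]
        bounded_linear.has_derivative[OF bl(2)] dw dcoords)
  \<comment> \<open>The transversal part puts \<open>v\<close> into \<open>T\<close>, the tangential
    coordinates leave a multiple of \<open>e \<nu>\<close>, and the radial one kills it because
    \<open>e \<nu>\<close> is not orthogonal to \<open>q\<close>.\<close>
  have inj\<Theta>: "v = 0" if "D\<Theta> v = 0" for v
  proof -
    have Dc0: "Dc v $ j = 0" for j
      using arg_cong[OF that, of "\<lambda>x. x \<bullet> e j"] by (simp add: D\<Theta>_def inner_add_left inner_diff_left \<iota>e pre)
    then have "Dc v = 0" by (simp add: vec_eq_iff)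
    then have vT: "v \<in> T" using that pr_iff linear_0[OF lin\<iota>] by (simp add: D\<Theta>_def)
    have qv: "q \<bullet> v = 0" using Dc0[of \<nu>] by (simp add: Dc_def)
    have vj: "v \<bullet> e j = 0" if "j \<noteq> \<nu>" for j using Dc0[of j] that qv by (simp add: Dc_def inner_commute)
    have "v = (\<Sum>i\<in>UNIV. (v \<bullet> e i) *\<^sub>R e i)" by (rule expand[OF vT])
    also have "\<dots> = (\<Sum>i\<in>UNIV. if i = \<nu> then (v \<bullet> e \<nu>) *\<^sub>R e \<nu> else 0)"
      by (rule sum.cong) (auto simp: vj)
    finally have "v = (\<Sum>i\<in>UNIV. if i = \<nu> then (v \<bullet> e \<nu>) *\<^sub>R e \<nu> else 0)" .
    then have v: "v = (v \<bullet> e \<nu>) *\<^sub>R e \<nu>" by simp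
    then have "q \<bullet> v = (v \<bullet> e \<nu>) * (q \<bullet> e \<nu>)" by (metis inner_scaleR_right)
    then have "v \<bullet> e \<nu> = 0" using qv nq by (simp add: inner_commute)
    then show "v = 0" using v by simp
  qed
  have fd\<Theta>: "frechet_derivative \<Theta> (at q) = D\<Theta>" using frechet_derivative_at[OF d\<Theta>] by simp
  have "inj (frechet_derivative \<Theta> (at q))"
    unfolding fd\<Theta> using linear_injective_0[OF has_derivative_linear[OF d\<Theta>]] inj\<Theta> by blast
  from cdiff_inverse_function[OF U(1,2) \<Theta>1 this]
  obtain U1 V1 g where U1: "open U1" "q \<in> U1" "U1 \<subseteq> U" "open V1" "\<Theta> q \<in> V1" "homeomorphism U1 V1 \<Theta> g"
    and gk: "\<And>k. cdiff (Suc k) \<Theta> U \<Longrightarrow> cdiff (Suc k) g V1" by metis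
  have g2: "cdiff 2 g V1" using gk[of 1] \<Theta>2 by (simp add: numeral_2_eq_2)
  have gV: "g x \<in> U1" "\<Theta> (g x) = x" if "x \<in> V1" for x using U1(6) that by (auto simp: homeomorphism_def)
  have g\<Theta>: "g (\<Theta> z) = z" "\<Theta> z \<in> V1" if "z \<in> U1" for z using U1(6) that by (auto simp: homeomorphism_def)
  have "open (\<iota> -` V1)" by (rule continuous_open_vimage[OF U1(4)]) (simp add: linear_continuous_at[OF bl(3)])
  moreover have "0 \<in> \<iota> -` V1" using U1(5) \<Theta>q by (simp add: linear_0[OF lin\<iota>])
  ultimately obtain \<delta> where \<delta>: "\<delta> > 0" "cbox (0 - (\<chi> i. \<delta>)) (0 + (\<chi> i. \<delta>)) \<subseteq> \<iota> -` V1"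
    by (rule cbox_cart_shrink)
  have cubeV: "\<iota> y \<in> V1" if "y \<in> cube \<delta>" for y
  proof -
    have "y \<in> cbox (0 - (\<chi> i. \<delta>)) (0 + (\<chi> i. \<delta>))"
      unfolding mem_box_cart
    proof
      fix i
      have "\<bar>y $ i\<bar> < \<delta>" using that by (simp add: cube_def)
      then show "(0 - (\<chi> i. \<delta>)) $ i \<le> y $ i \<and> y $ i \<le> (0 + (\<chi> i. \<delta>)) $ i" by auto
    qed
    then show ?thesis using \<delta>(2) by auto
  qed
  define F where "F = (\<lambda>y. g (\<iota> y))"
  have F2: "cdiff 2 F (cube \<delta>)"
    unfolding F_def by (rule cdiff_compose[OF cdiff_linear[OF bl(3)] g2]) (use cubeV in auto)
  have FU: "F y \<in> U1" "\<Theta> (F y) = \<iota> y" if "y \<in> cube \<delta>" for y using gV[OF cubeV[OF that]] by (auto simp: F_def)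
  have left: "coords \<nu> e (F y) = y" if "y \<in> cube \<delta>" for y
    using \<Theta>e[of "F y"] FU(2)[OF that] \<iota>e by (simp add: vec_eq_iff)
  have wT: "w (F y) \<in> T" if "y \<in> cube \<delta>" for y
    using FU(2)[OF that] left[OF that] pr_iff by (simp add: \<Theta>_def)
  have \<Phi>q: "\<Phi> q \<in> L" using adapted_chart_mem[OF A(1) U(2)] q by blast
  have wL: "w z \<in> T \<longleftrightarrow> \<Phi> z \<in> L" for z
  proof -
    have "w z \<in> T \<longleftrightarrow> \<Phi> z - \<Phi> q \<in> L" by (simp add: T_iff w_def der(4))
    also have "\<dots> \<longleftrightarrow> \<Phi> z \<in> L" using subspace_diff[OF L(1) _ \<Phi>q, of "\<Phi> z"] subspace_add[OF L(1) _ \<Phi>q, of "\<Phi> z - \<Phi> q"] by auto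
    finally show ?thesis .
  qed
  have rhoF: "rho (F y) = y $ \<nu>" if "y \<in> cube \<delta>" for y
    using arg_cong[OF left[OF that], of "\<lambda>v. v $ \<nu>"] by (simp add: coords_def)
  \<comment> \<open>The side function of the original chart read along \<open>F\<close>. It remains
    to see that \<open>h y \<ge> 0\<close> holds exactly where
    \<open>0 \<le> y $ \<nu>\<close>.\<close>
  define h where "h = (\<lambda>y. c \<bullet> \<Phi> (F y))"
  have FS: "F y \<in> S \<longleftrightarrow> h y \<ge> 0" if "y \<in> cube \<delta>" for y
    using adapted_chart_mem[OF A(1), of "F y"] FU(1)[OF that] U1(3) wT[OF that] wL unfolding h_def by blast
  have S_rho: "y $ \<nu> \<ge> 0" if "y \<in> cube \<delta>" "F y \<in> S" for y
    using rhoF[OF that(1)] rho_nonneg_iff[of "F y"] that(2) ball by auto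
  have zero: "0 \<in> cube \<delta>" using \<delta>(1) by (simp add: cube_def)
  have F0: "F 0 = q" using g\<Theta>(1)[OF U1(2)] \<Theta>q by (simp add: F_def linear_0[OF lin\<iota>])
  have F1: "cdiff 1 F (cube \<delta>)" using cdiff_mono[OF F2, of 1] by simp
  have dF0: "(F has_derivative frechet_derivative F (at 0)) (at 0)" by (rule cdiff_1_has_derivative[OF F1 zero])
  have D\<Theta>F: "D\<Theta> (frechet_derivative F (at 0) u) = \<iota> u" for u
  proof -
    have "((\<lambda>y. \<Theta> (F y)) has_derivative (\<lambda>u. D\<Theta> (frechet_derivative F (at 0) u))) (at 0)"
      by (rule has_derivative_compose[OF dF0]) (simp add: F0 d\<Theta>)
    moreover have "((\<lambda>y. \<Theta> (F y)) has_derivative \<iota>) (at 0)"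
      by (rule has_derivative_transform_within_open[OF bounded_linear_imp_has_derivative[OF bl(3)] open_cube zero]) (simp add: FU)
    ultimately show ?thesis by (rule fun_cong[OF has_derivative_unique])
  qed
  have linD\<Theta>: "linear D\<Theta>" by (rule has_derivative_linear[OF d\<Theta>])
  have D\<Theta>inj: "a = b" if "D\<Theta> a = D\<Theta> b" for a b using inj\<Theta>[of "a - b"] that by (simp add: linear_diff[OF linD\<Theta>])
  have prfix: "v - pr v = 0" if "v \<in> T" for v using that pr_iff by blast
  have axesF: "frechet_derivative F (at 0) (axis i 1) = e i" if "i \<noteq> \<nu>" for i
  proof (rule D\<Theta>inj)
    have "Dc (e i) = axis i 1"
      using that eq0[OF that] e(1) by (simp add: Dc_def vec_eq_iff axis_def inner_commute)
    then show "D\<Theta> (frechet_derivative F (at 0) (axis i 1)) = D\<Theta> (e i)"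
      unfolding D\<Theta>F by (simp add: D\<Theta>_def prfix[OF eT])
  qed
  \<comment> \<open>Makes \<open>rho\<close> grow at unit rate, its derivative at \<open>q\<close>
    being \<open>- (q \<bullet> v)\<close>.\<close>
  define k where "k = - (1 / (q \<bullet> e \<nu>))"
  have axesF\<nu>: "frechet_derivative F (at 0) (axis \<nu> 1) = k *\<^sub>R e \<nu>"
  proof (rule D\<Theta>inj)
    have "Dc (k *\<^sub>R e \<nu>) = axis \<nu> 1"
      using nq eq0 e(1) by (simp add: Dc_def vec_eq_iff axis_def k_def inner_commute inner_diff_right)
    then show "D\<Theta> (frechet_derivative F (at 0) (axis \<nu> 1)) = D\<Theta> (k *\<^sub>R e \<nu>)"
      unfolding D\<Theta>F by (simp add: D\<Theta>_def prfix subspace_scale[OF subT eT])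
  qed
  have conth: "continuous_on (cube \<delta>) h"
    unfolding h_def using FU(1) U1(3)
    by (intro continuous_intros continuous_on_compose2[OF cdiff_continuous[OF \<Phi>c] cdiff_continuous[OF F2]]) auto
  define s where "s = k * (c \<bullet> D (e \<nu>))"
  have s0: "s \<noteq> 0" using e(4) eT nq by (auto simp: s_def k_def T0_def inner_commute)
  have dh: "((\<lambda>t. h (t *\<^sub>R axis \<nu> 1)) has_real_derivative s) (at 0)"
  proof -
    have "((\<lambda>y. \<Phi> (F y)) has_derivative (\<lambda>u. D (frechet_derivative F (at 0) u))) (at 0)"
      by (rule has_derivative_compose[OF dF0]) (simp add: F0 der(1))
    then have "(h has_derivative (\<lambda>u. c \<bullet> D (frechet_derivative F (at 0) u))) (at 0)"
      unfolding h_def by (rule has_derivative_inner_right)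
    from has_derivative_dirderiv(1)[OF this, of "axis \<nu> 1"]
    show ?thesis by (simp add: axesF\<nu> linear_scale[OF linD] s_def has_real_derivative_iff_has_vector_derivative)
  qed
  have h0: "h 0 = 0" by (simp add: h_def F0 A(3))
  have small: "t *\<^sub>R axis \<nu> 1 \<in> cube \<delta>" if "\<bar>t\<bar> < \<delta>" for t
    using that \<delta>(1) by (auto simp: cube_def axis_def)
  \<comment> \<open>A negative slope would put points with \<open>y $ \<nu> < 0\<close>, which lie
    outside the closed ball, into \<open>S\<close>.\<close>
  have s_pos: "s > 0"
  proof (rule ccontr)
    assume "\<not> s > 0"
    then have "s < 0" using s0 by simp
    from DERIV_neg_dec_left[OF dh this]
    obtain d where d: "d > 0" "\<And>t. t > 0 \<Longrightarrow> t < d \<Longrightarrow> h (0 *\<^sub>R axis \<nu> 1) < h ((0 - t) *\<^sub>R axis \<nu> 1)" by blast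
    define t where "t = min d \<delta> / 2"
    have t: "t > 0" "t < d" "t < \<delta>" using d \<delta>(1) by (auto simp: t_def)
    have "h ((- t) *\<^sub>R axis \<nu> 1) > 0" using d(2)[OF t(1,2)] h0 by simp
    then have "F ((- t) *\<^sub>R axis \<nu> 1) \<in> S" using FS[OF small[of "- t"]] t by auto
    from S_rho[OF small[of "- t"] this] t show False by (simp add: axis_def)
  qed
  have "\<exists>y\<in>hcube \<nu> \<delta>. h y > 0"
  proof -
    from DERIV_pos_inc_right[OF dh s_pos]
    obtain d where d: "d > 0" "\<And>t. t > 0 \<Longrightarrow> t < d \<Longrightarrow> h (0 *\<^sub>R axis \<nu> 1) < h ((0 + t) *\<^sub>R axis \<nu> 1)" by blast
    define t where "t = min d \<delta> / 2"
    have t: "t > 0" "t < d" "t < \<delta>" using d \<delta>(1) by (auto simp: t_def)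
    have "h (t *\<^sub>R axis \<nu> 1) > 0" using d(2)[OF t(1,2)] h0 by simp
    moreover have "t *\<^sub>R axis \<nu> 1 \<in> hcube \<nu> \<delta>" using small[of t] t by (simp add: hcube_def axis_def)
    ultimately show ?thesis by blast
  qed
  then obtain y1 where y1: "y1 \<in> hcube \<nu> \<delta>" "h y1 > 0" by blast
  \<comment> \<open>A zero of \<open>h\<close> in the open half cube would be a boundary point of
    \<open>S\<close> off the sphere.\<close>
  have hne: "h y \<noteq> 0" if y: "y \<in> hcube \<nu> \<delta>" for y
  proof
    assume "h y = 0"
    have yc: "y \<in> cube \<delta>" "y $ \<nu> > 0" using y by (auto simp: hcube_def)
    have FyS: "F y \<in> S" using FS[OF yc(1)] \<open>h y = 0\<close> by simp
    have "adapted_chart 2 ?m S (F y) U \<Phi> L c" using adapted_chart_move[OF A(1)] FU(1)[OF yc(1)] U1(3) by blast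
    then have "F y \<in> mbdry 2 ?m S" using FyS A(2) \<open>h y = 0\<close> by (auto simp: mbdry_def h_def)
    then have "norm (F y) = 1" using mb by auto
    then have "rho (F y) = 0" by (simp add: rho_eq_0_iff)
    then show False using rhoF[OF yc(1)] yc(2) by simp
  qed
  have hconv: "convex (hcube \<nu> \<delta>)"
  proof -
    have "hcube \<nu> \<delta> = cube \<delta> \<inter> {y. axis \<nu> 1 \<bullet> y > 0}" by (auto simp: hcube_def inner_axis' )
    then show ?thesis by (simp add: convex_Int convex_cube convex_halfspace_gt)
  qed
  \<comment> \<open>The half cube is connected, \<open>h\<close> has no zero on it and is positive
    at \<open>y1\<close>.\<close>
  have hpos: "h y > 0" if y: "y \<in> hcube \<nu> \<delta>" for y
  proof (rule ccontr)
    assume "\<not> h y > 0"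
    then have neg: "h y \<le> 0" by simp
    have "continuous_on (hcube \<nu> \<delta>) h" by (rule continuous_on_subset[OF conth]) (auto simp: hcube_def)
    then have "connected (h ` hcube \<nu> \<delta>)" by (rule connected_continuous_image[OF _ convex_connected[OF hconv]])
    then have "{h y..h y1} \<subseteq> h ` hcube \<nu> \<delta>" using connected_contains_Icc y y1(1) by blast
    then have "0 \<in> h ` hcube \<nu> \<delta>" using neg y1(2) by auto
    then show False using hne by auto
  qed
  have mem: "F y \<in> S \<longleftrightarrow> 0 \<le> y $ \<nu>" if y: "y \<in> cube \<delta>" for y
  proof
    assume "0 \<le> y $ \<nu>"
    show "F y \<in> S"
    proof (cases "y $ \<nu> = 0")
      case False
      then have "y \<in> hcube \<nu> \<delta>" using y \<open>0 \<le> y $ \<nu>\<close> by (simp add: hcube_def)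
      then show ?thesis using FS[OF y] hpos by force
    next
      \<comment> \<open>Points of the face are limits of points of the open half cube, so
        \<open>h\<close> is nonnegative there by continuity.\<close>
      case True
      have "isCont h y" using conth y by (simp add: continuous_on_eq_continuous_at[OF open_cube])
      then have hl: "(h \<longlongrightarrow> h y) (at y)" by (simp add: continuous_at)
      have c0: "((\<lambda>t. y + t *\<^sub>R axis \<nu> 1) \<longlongrightarrow> y + 0 *\<^sub>R axis \<nu> 1) (at_right 0)" by (intro tendsto_intros)
      then have c1: "((\<lambda>t. y + t *\<^sub>R axis \<nu> 1) \<longlongrightarrow> y) (at_right 0)" by simp
      have "((\<lambda>t. h (y + t *\<^sub>R axis \<nu> 1)) \<longlongrightarrow> h y) (at_right 0)"
        by (rule isCont_tendsto_compose[OF \<open>isCont h y\<close> c1])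
      moreover have "\<forall>\<^sub>F t in at_right 0. 0 \<le> h (y + t *\<^sub>R axis \<nu> 1)"
      proof -
        have "\<forall>\<^sub>F t in at_right 0. y + t *\<^sub>R axis \<nu> 1 \<in> cube \<delta>" using c1 open_cube y by (rule topological_tendstoD)
        moreover have "\<forall>\<^sub>F t in at_right (0::real). 0 < t" by (simp add: eventually_at_right_less)
        ultimately show ?thesis
        proof eventually_elim
          case (elim t)
          then have "y + t *\<^sub>R axis \<nu> 1 \<in> hcube \<nu> \<delta>" using True by (simp add: hcube_def axis_def)
          then show ?case using hpos by (simp add: less_imp_le)
        qed
      qed
      ultimately have "0 \<le> h y" by (rule tendsto_lowerbound) simp
      then show ?thesis using FS[OF y] by simp
    qed
  qed (use S_rho y in blast)
  define U2 where "U2 = U1 \<inter> coords \<nu> e -` cube \<delta>"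
  have "open U2" unfolding U2_def
    by (rule continuous_open_preimage[OF cdiff_continuous[OF cdiff_coords] U1(1) open_cube])
  have "bparam S F \<nu> e \<delta> U2"
  proof
    show "F ` cube \<delta> \<subseteq> U2" using FU(1) left by (auto simp: U2_def)
    show "coords \<nu> e z \<in> cube \<delta> \<and> F (coords \<nu> e z) = z" if z: "z \<in> S" "z \<in> U2" for z
    proof
      show zc: "coords \<nu> e z \<in> cube \<delta>" using z by (simp add: U2_def)
      have "\<Phi> z \<in> L" using adapted_chart_mem[OF A(1), of z] z U1(3) by (auto simp: U2_def)
      then have "w z - pr (w z) = 0" using wL pr_iff by blast
      then have "\<Theta> z = \<iota> (coords \<nu> e z)" by (simp add: \<Theta>_def)
      then show "F (coords \<nu> e z) = z" using g\<Theta>(1)[of z] z by (simp add: F_def U2_def)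
    qed
    show "e i \<bullet> F 0 = 0" if "i \<noteq> \<nu>" for i using eq0[OF that] F0 by simp
  qed (use \<delta>(1) F2 left mem \<open>open U2\<close> e axesF in auto)
  then show ?thesis using F0 by (rule that)
qed

section \<open>The normal derivatives at all boundary points\<close>

locale weak_minimal =
  fixes \<Sigma> :: "(complex^'n) set" and mt :: "'m::finite itself"
  assumes ball: "\<Sigma> \<subseteq> ball 0 1" and sub: "submfd \<infinity> CARD('m) \<Sigma>"
    and min: "bergman_minimal TYPE('m) \<Sigma>"
    and reg: "regular_in_ball 2 CARD('m) (Smod ` closure \<Sigma>)"
    and hor: "horizontal_bdry 2 CARD('m) (Smod ` closure \<Sigma>)"
begin

definition "K = closure \<Sigma>"
definition "S = Smod ` K"

lemma K_cball: "K \<subseteq> cball 0 1"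
  unfolding K_def using closure_mono[OF ball] by simp

lemma K_norm: "z \<in> K \<Longrightarrow> norm z \<le> 1" using K_cball by auto

lemma S_norm: "w \<in> S \<Longrightarrow> norm w \<le> 1" unfolding S_def using K_norm Smod_norm_le by auto

lemma Smod_mem_iff: "norm z \<le> 1 \<Longrightarrow> Smod z \<in> S \<longleftrightarrow> z \<in> K"
proof
  assume z: "norm z \<le> 1" "Smod z \<in> S"
  then obtain z' where "z' \<in> K" "Smod z = Smod z'" by (auto simp: S_def)
  then show "z \<in> K" using proj_Smod[OF z(1)] proj_Smod[OF K_norm, of z'] by metis
qed (simp add: S_def)

lemma proj_mem: "w \<in> S \<Longrightarrow> proj w \<in> K"
  using Smod_mem_iff[OF norm_proj_le, of w] Smod_proj[OF S_norm, of w] by simp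

lemma sphere_mem: "norm q = 1 \<Longrightarrow> q \<in> S \<longleftrightarrow> q \<in> K"
  using Smod_mem_iff[of q] by (simp add: Smod_sphere)

lemma regS: "regular_in_ball 2 CARD('m) S" and horS: "horizontal_bdry 2 CARD('m) S"
  using reg hor by (simp_all add: S_def K_def)

text \<open>Every open set in the half cube contains parameters of points of \<Sigma>. A smooth
  chart of \<Sigma> at such a point gives a smooth \<open>G\<close> into \<Sigma>, and reading
  \<open>G\<close> in the coordinates of \<open>F\<close> a smooth \<open>H\<close> with
  \<open>Z \<circ> H = G\<close>. \<open>H\<close> is immersive because \<open>G\<close> is, hence
  locally invertible as the dimensions agree, and \<open>Z = G \<circ> h\<close> is smooth on the
  image.\<close>

lemma smooth_dense:
  fixes F :: "real^'m \<Rightarrow> complex^'n"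
  assumes B: "bparam S F \<nu> e \<delta> U" and y: "y \<in> hcube \<nu> \<delta>" and X: "open X" "y \<in> X"
  shows "\<exists>W. open W \<and> W \<noteq> {} \<and> W \<subseteq> X \<inter> hcube \<nu> \<delta> \<and> (\<forall>k. cdiff k (\<lambda>y. proj (F y)) W) \<and> (\<lambda>y. proj (F y)) ` W \<subseteq> \<Sigma>"
proof -
  interpret bparam S F \<nu> e \<delta> U by (rule B)
  have yc: "y \<in> cube \<delta>" "y $ \<nu> > 0" using y by (auto simp: hcube_def)
  define N0 where "N0 = U \<inter> coords \<nu> e -` (X \<inter> hcube \<nu> \<delta>)"
  have "open N0" unfolding N0_def
    by (rule continuous_open_preimage[OF cdiff_continuous[OF cdiff_coords] U(1)]) (intro open_Int X open_hcube)
  \<comment> \<open>The open ball keeps away from the singularity of \<open>Smod\<close>.\<close>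
  define N where "N = ball 0 1 \<inter> Smod -` N0"
  have oN: "open N" unfolding N_def
    by (rule continuous_open_preimage[OF cdiff_continuous[OF cdiff_Smod] open_ball \<open>open N0\<close>])
  have FyS: "F y \<in> S" using mem[OF yc(1)] yc(2) by simp
  have "Z y \<in> N"
  proof -
    have "norm (Z y) < 1" using normalized_norm_less[OF Z_normalized yc(1)] yc(2) by simp
    moreover have "Smod (Z y) = F y" unfolding Z_def by (rule Smod_proj[OF S_norm[OF FyS]])
    ultimately show ?thesis using U(2) yc(1) left[OF yc(1)] X y by (auto simp: N_def N0_def)
  qed
  moreover have "Z y \<in> closure \<Sigma>" using proj_mem[OF FyS] by (simp add: Z_def K_def)
  ultimately obtain p where p: "p \<in> \<Sigma>" "p \<in> N" using oN by (metis closure_iff_nhds_not_empty disjoint_iff order_refl)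
  obtain U1 \<Phi> L where A: "adapted_chart \<infinity> CARD('m) \<Sigma> p U1 \<Phi> L 0" using sub p(1) by (auto simp: submfd_def)
  have U1: "open U1" "p \<in> U1" "inj_on \<Phi> U1" "open (\<Phi> ` U1)" and L: "subspace L" "dim L = CARD('m)"
    and inv_sm: "\<And>k. cdiff k (inv_into U1 \<Phi>) (\<Phi> ` U1)"
    using A by (auto simp: adapted_chart_def Cl_on_infty_iff)
  have "subspace (UNIV :: (real^'m) set)" "dim (UNIV :: (real^'m) set) = dim L" using L by auto
  then obtain \<iota> :: "real^'m \<Rightarrow> complex^'n" where \<iota>: "linear \<iota>" "\<iota> ` UNIV = L" "inj \<iota>"
    using subspace_isomorphism[of "UNIV :: (real^'m) set" L] L(1) by auto
  have bl: "bounded_linear \<iota>" using \<iota>(1) linear_conv_bounded_linear by blast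
  have \<Phi>p: "\<Phi> p \<in> L" using adapted_chart_mem[OF A U1(2)] p(1) by blast
  define a where "a = (\<lambda>w. \<Phi> p + \<iota> w)"
  have ak: "cdiff k a T" for k T unfolding a_def by (intro cdiff_add cdiff_const cdiff_linear[OF bl])
  define W1 where "W1 = UNIV \<inter> a -` (\<Phi> ` U1)"
  have oW1: "open W1" unfolding W1_def
    by (rule continuous_open_preimage[OF cdiff_continuous[OF ak] open_UNIV U1(4)])
  define G where "G = (\<lambda>w. inv_into U1 \<Phi> (a w))"
  have Gk: "cdiff k G W1" for k unfolding G_def by (rule cdiff_compose[OF ak inv_sm]) (auto simp: W1_def)
  have \<Phi>G: "\<Phi> (G w) = a w" "G w \<in> U1" if "w \<in> W1" for w
    using that by (auto simp: W1_def G_def f_inv_into_f inv_into_into)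
  have aL: "a w \<in> L" for w unfolding a_def using \<Phi>p \<iota>(2) by (intro subspace_add[OF L(1)]) auto
  have G\<Sigma>: "G w \<in> \<Sigma>" if "w \<in> W1" for w
    using adapted_chart_mem[OF A \<Phi>G(2)[OF that]] \<Phi>G(1)[OF that] aL by simp
  have a0: "a 0 = \<Phi> p" using linear_0[OF \<iota>(1)] by (simp add: a_def)
  have G0: "G 0 = p" using U1 by (simp add: G_def a0)
  define W2 where "W2 = W1 \<inter> G -` N"
  have oW2: "open W2" unfolding W2_def by (rule continuous_open_preimage[OF cdiff_continuous[OF Gk] oW1 oN])
  have zW1: "0 \<in> W1" using U1(2) by (simp add: W1_def a0)
  have zW2: "0 \<in> W2" using zW1 G0 p(2) by (simp add: W2_def)
  define H where "H = (\<lambda>w. coords \<nu> e (Smod (G w)))"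
  have Hk: "cdiff k H W2" for k
    unfolding H_def
    by (rule cdiff_compose[OF cdiff_compose[OF cdiff_subset[OF Gk] cdiff_Smod] cdiff_coords[where S=UNIV]])
      (auto simp: W2_def N_def)
  have HX: "H w \<in> X \<inter> hcube \<nu> \<delta>" if "w \<in> W2" for w using that by (auto simp: W2_def N_def N0_def H_def)
  have ZH: "proj (F (H w)) = G w" if w: "w \<in> W2" for w
  proof -
    have gK: "G w \<in> K" using G\<Sigma>[of w] w closure_subset by (auto simp: W2_def K_def)
    have "F (H w) = Smod (G w)"
      unfolding H_def using cover[of "Smod (G w)"] gK w by (auto simp: S_def W2_def N_def N0_def)
    then show ?thesis using proj_Smod[OF K_norm[OF gK]] by simp
  qed
  have H1: "cdiff 1 H W2" by (rule Hk)
  have inj: "inj (frechet_derivative H (at 0))"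
  proof -
    have dH: "(H has_derivative frechet_derivative H (at 0)) (at 0)" by (rule cdiff_1_has_derivative[OF H1 zW2])
    have dG: "(G has_derivative frechet_derivative G (at 0)) (at 0)" by (rule cdiff_1_has_derivative[OF Gk zW1])
    have hq: "H 0 \<in> cube \<delta>" using HX[OF zW2] by (auto simp: hcube_def)
    have dZ: "(Z has_derivative frechet_derivative Z (at (H 0))) (at (H 0))"
      by (rule cdiff_1_has_derivative[OF cdiff_mono[OF Z2] hq]) simp
    have "((\<lambda>w. Z (H w)) has_derivative (\<lambda>v. frechet_derivative Z (at (H 0)) (frechet_derivative H (at 0) v))) (at 0)"
      by (rule has_derivative_compose[OF dH dZ])
    then have "(G has_derivative (\<lambda>v. frechet_derivative Z (at (H 0)) (frechet_derivative H (at 0) v))) (at 0)"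
      by (rule has_derivative_transform_within_open[OF _ oW2 zW2]) (simp add: Z_def ZH)
    then have 1: "frechet_derivative G (at 0) v = frechet_derivative Z (at (H 0)) (frechet_derivative H (at 0) v)" for v
      by (rule fun_cong[OF has_derivative_unique[OF dG]])
    have d\<Phi>: "(\<Phi> has_derivative frechet_derivative \<Phi> (at p)) (at p)"
      by (rule adapted_chart_derivatives(1)[OF A]) simp
    have "((\<lambda>w. \<Phi> (G w)) has_derivative (\<lambda>v. frechet_derivative \<Phi> (at p) (frechet_derivative G (at 0) v))) (at 0)"
      by (rule has_derivative_compose[OF dG]) (simp add: G0 d\<Phi>)
    moreover have "(a has_derivative \<iota>) (at 0)"
      unfolding a_def using has_derivative_add[OF has_derivative_const bounded_linear_imp_has_derivative[OF bl]] by simp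
    then have "((\<lambda>w. \<Phi> (G w)) has_derivative \<iota>) (at 0)"
      by (rule has_derivative_transform_within_open[OF _ oW1 zW1]) (simp add: \<Phi>G)
    ultimately have 2: "frechet_derivative \<Phi> (at p) (frechet_derivative G (at 0) v) = \<iota> v" for v
      by (rule fun_cong[OF has_derivative_unique])
    have "v = 0" if "frechet_derivative H (at 0) v = 0" for v
    proof -
      have "frechet_derivative G (at 0) v = 0" using 1[of v] that linear_0[OF has_derivative_linear[OF dZ]] by simp
      then have "\<iota> v = 0" using 2[of v] linear_0[OF has_derivative_linear[OF d\<Phi>]] by simp
      then show ?thesis using \<iota>(3) linear_0[OF \<iota>(1)] by (metis injD)
    qed
    then show ?thesis using linear_injective_0[OF has_derivative_linear[OF dH]] by blast
  qed
  from cdiff_inverse_function[OF oW2 zW2 H1 inj]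
  obtain U' V h where V: "open U'" "0 \<in> U'" "U' \<subseteq> W2" "open V" "H 0 \<in> V" "homeomorphism U' V H h"
    and hk: "\<And>k. cdiff (Suc k) H W2 \<Longrightarrow> cdiff (Suc k) h V" by metis
  have hV: "h y' \<in> U'" "H (h y') = y'" if "y' \<in> V" for y' using V(6) that by (auto simp: homeomorphism_def)
  have Zh: "proj (F y') = G (h y')" if "y' \<in> V" for y'
    using ZH[of "h y'"] hV[OF that] V(3) by auto
  have hW1: "h ` V \<subseteq> W1" using hV(1) V(3) by (auto simp: W2_def)
  show ?thesis
  proof (intro exI[of _ V] conjI allI)
    show "V \<noteq> {}" using V(5) by blast
    show "V \<subseteq> X \<inter> hcube \<nu> \<delta>" using HX hV V(3) by (metis subsetD subsetI)
    show "cdiff k (\<lambda>y. proj (F y)) V" for k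
    proof (rule cdiff_cong[OF V(4)])
      show "cdiff k (\<lambda>y. G (h y)) V"
        by (rule cdiff_compose[OF cdiff_lower[OF hk[OF Hk]] Gk hW1])
    qed (simp add: Zh)
    show "(\<lambda>y. proj (F y)) ` V \<subseteq> \<Sigma>" using Zh G\<Sigma> hW1 by auto
  qed (rule V(4))
qed

lemma tcone_horizontal:
  assumes "q \<in> S" "norm q = 1" "v \<in> tcone S q" "- v \<in> tcone S q"
  shows "v \<bullet> q = 0" "v \<bullet> Tfield q = 0"
proof -
  have q: "q \<in> mbdry 2 CARD('m) S" using regS assms(1,2) by (auto simp: regular_in_ball_def)
  have "bdry_tspace 2 CARD('m) S q = {v. v \<in> tcone S q \<and> - v \<in> tcone S q}" by (rule mbdry_tcone(2)[OF q]) simp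
  moreover have "bdry_tspace 2 CARD('m) S q \<subseteq> Hdist q" using horS q by (auto simp: horizontal_bdry_def)
  ultimately have "v \<in> Hdist q" using assms(3,4) by auto
  then show "v \<bullet> q = 0" "v \<bullet> Tfield q = 0" by (auto simp: Hdist_def)
qed

text \<open>Directions along the face occur in the cone with both signs, so they are tangent to the
  boundary and horizontal; being orthogonal to \<open>F y\<close> they are not altered by
  \<open>proj\<close>.\<close>

lemma boundary_tangent:
  fixes F :: "real^'m \<Rightarrow> complex^'n"
  assumes B: "bparam S F \<nu> e \<delta> U" and y: "y \<in> cube \<delta>" "y $ \<nu> = 0" and u: "u $ \<nu> = 0"
  shows "frechet_derivative F (at y) u \<bullet> F y = 0" "frechet_derivative F (at y) u \<bullet> Tfield (F y) = 0"
    "frechet_derivative (\<lambda>y. proj (F y)) (at y) u = frechet_derivative F (at y) u"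
proof -
  interpret bparam S F \<nu> e \<delta> U by (rule B)
  have FS: "F y \<in> S" using mem[OF y(1)] y(2) by simp
  have "linear (frechet_derivative F (at y))" by (rule has_derivative_linear[OF Fd[OF y(1)]])
  then have neg: "- frechet_derivative F (at y) u = frechet_derivative F (at y) (- u)" by (simp add: linear_neg)
  have "frechet_derivative F (at y) u \<in> tcone S (F y)" "- frechet_derivative F (at y) u \<in> tcone S (F y)"
    unfolding tcone_F[OF y] neg mem_Collect_eq using u by (metis order_refl, metis neg_equal_zero order_refl uminus_vec_def vector_uminus_component)
  from tcone_horizontal[OF FS Z_boundary(2)[OF y] this]
  show 1: "frechet_derivative F (at y) u \<bullet> F y = 0" "frechet_derivative F (at y) u \<bullet> Tfield (F y) = 0" .
  show "frechet_derivative (\<lambda>y. proj (F y)) (at y) u = frechet_derivative F (at y) u"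
    using Z_boundary(3)[OF y, of u] 1(1) by (simp add: Z_def[abs_def] inner_commute[of "F y"])
qed

lemma boundary_chart_bparam:
  fixes F :: "real^'m \<Rightarrow> complex^'n"
  assumes B: "bparam S F \<nu> e \<delta> U"
  shows "boundary_chart \<Sigma> (\<lambda>y. proj (F y)) \<nu> e \<delta>"
proof -
  interpret bparam S F \<nu> e \<delta> U by (rule B)
  have ZZ: "Z = (\<lambda>y. proj (F y))" by (simp add: Z_def[abs_def])
  show ?thesis
  proof (unfold ZZ[symmetric], standard)
    show "frechet_derivative Z (at y) (axis i 1) \<bullet> Tfield (Z y) = 0"
      if "y \<in> cube \<delta>" "y $ \<nu> = 0" "i \<noteq> \<nu>" for y i
      using boundary_tangent[OF B that(1,2), of "axis i 1"] that(3)
      by (simp add: ZZ[symmetric] Z_boundary(1)[OF that(1,2)] axis_def)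
    show "\<exists>W. open W \<and> W \<noteq> {} \<and> W \<subseteq> X \<inter> hcube \<nu> \<delta> \<and> (\<forall>k. cdiff k Z W) \<and> Z ` W \<subseteq> \<Sigma>"
      if "y \<in> hcube \<nu> \<delta>" "open X" "y \<in> X" for y X
      unfolding ZZ by (rule smooth_dense[OF B that])
  qed (use delta Z2 Z_normalized min ball Z_axes ortho in auto)
qed

text \<open>\<open>conormal_vanishes\<close> concerns the centre of a parametrization. Every
  boundary point is the centre of one, and the tangent cone makes the result independent of
  which.\<close>

lemma conormal:
  assumes q: "q \<in> K" "norm q = 1" and v: "v \<in> tcone S q"
  shows "v \<bullet> Tfield q = 0"
proof -
  have qS: "q \<in> S" using q sphere_mem by blast
  obtain F :: "real^'m \<Rightarrow> complex^'n" and \<nu> e \<delta> U where B: "bparam S F \<nu> e \<delta> U" and F0: "F 0 = q"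
    using boundary_parametrization[OF regS horS qS q(2)] by blast
  interpret bparam S F \<nu> e \<delta> U by (rule B)
  have ZZ: "Z = (\<lambda>y. proj (F y))" by (simp add: Z_def[abs_def])
  interpret C: boundary_chart \<Sigma> Z \<nu> e \<delta> unfolding ZZ by (rule boundary_chart_bparam[OF B])
  have z: "0 \<in> cube \<delta>" "(0::real^'m) $ \<nu> = 0" using zero_cube by auto
  obtain u where u: "v = frechet_derivative F (at 0) u" using v unfolding F0[symmetric] tcone_F[OF z] by blast
  have Zq: "Z 0 = q" using Z_boundary(1)[OF z] F0 by simp
  have lin: "linear (frechet_derivative Z (at 0))" by (rule has_derivative_linear[OF C.Zd[OF z(1)]])
  have "frechet_derivative Z (at 0) u = v - (q \<bullet> v) *\<^sub>R q" using Z_boundary(3)[OF z, of u] by (simp add: u F0)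
  then have "v \<bullet> Tfield q = frechet_derivative Z (at 0) u \<bullet> Tfield q" by (simp add: inner_diff_left)
  also have "\<dots> = (\<Sum>i\<in>UNIV. u $ i * (frechet_derivative Z (at 0) (axis i 1) \<bullet> Tfield q))"
    by (subst linear_axis_sum[OF lin]) (simp add: inner_sum_left)
  also have "\<dots> = 0"
  proof (rule sum.neutral, rule ballI)
    fix i
    have "frechet_derivative Z (at 0) (axis i 1) \<bullet> Tfield q = 0"
      using C.conormal_vanishes C.hor[OF z(1,2), of i] Zq by (cases "i = \<nu>") (auto simp: C.D_def)
    then show "u $ i * (frechet_derivative Z (at 0) (axis i 1) \<bullet> Tfield q) = 0" by simp
  qed
  finally show ?thesis .
qed

lemma normal_derivative_origin:
  fixes F :: "real^'m \<Rightarrow> complex^'n"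
  assumes B: "bparam S F \<nu> e \<delta> U"
  defines "Z \<equiv> \<lambda>y. proj (F y)"
  shows "frechet_derivative Z (at 0) (axis \<nu> 1) = 0"
    "frechet_derivative (\<lambda>y. frechet_derivative Z (at y) (axis \<nu> 1)) (at 0) (axis \<nu> 1) \<bullet> Tfield (F 0) = 0"
proof -
  interpret P: bparam S F \<nu> e \<delta> U by (rule B)
  have ZZ: "P.Z = Z" by (simp add: P.Z_def[abs_def] Z_def)
  interpret C: boundary_chart \<Sigma> Z \<nu> e \<delta> unfolding Z_def by (rule boundary_chart_bparam[OF B])
  have con: "C.D \<nu> y \<bullet> Tfield (Z y) = 0" if y: "y \<in> cube \<delta>" "y $ \<nu> = 0" for y
  proof -
    have "F y \<in> S" using P.mem[OF y(1)] y(2) by simp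
    then have FK: "F y \<in> K" using sphere_mem[OF P.Z_boundary(2)[OF y]] by simp
    have "frechet_derivative F (at y) (axis \<nu> 1) \<in> tcone S (F y)"
      unfolding P.tcone_F[OF y] by (auto simp: axis_def intro!: exI[of _ "axis \<nu> 1"])
    from conormal[OF FK P.Z_boundary(2)[OF y] this] show ?thesis
      using P.Z_boundary(1)[OF y] P.Z_boundary(3)[OF y, of "axis \<nu> 1"]
      by (simp add: ZZ C.D_def inner_diff_left)
  qed
  show "frechet_derivative Z (at 0) (axis \<nu> 1) = 0" using C.D_nu_zero[OF con] by (simp add: C.D_def)
  have "Z 0 = F 0" using P.Z_boundary(1)[OF P.zero_cube] by (simp add: ZZ)
  then show "frechet_derivative (\<lambda>y. frechet_derivative Z (at y) (axis \<nu> 1)) (at 0) (axis \<nu> 1) \<bullet> Tfield (F 0) = 0"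
    using C.second_normal_derivative[OF con] by (simp add: C.D_def[abs_def])
qed

text \<open>The vanishing is known for a parametrization centred at \<open>F y\<close>. It shares
  the tangent cones of \<open>S\<close> and of its boundary with the given one; so the normal
  derivative equals the derivative of \<open>Z\<close> in a direction \<open>x\<close> with
  \<open>x $ \<nu> = 0\<close>. Pairing with \<open>e j\<close> then shows \<open>x $ j = 0\<close>
  for the other \<open>j\<close>.\<close>

lemma normal_derivative_zero:
  fixes F :: "real^'m \<Rightarrow> complex^'n"
  assumes B: "bparam S F \<nu> e \<delta> U" and y: "y \<in> cube \<delta>" "y $ \<nu> = 0"
  shows "frechet_derivative (\<lambda>y. proj (F y)) (at y) (axis \<nu> 1) = 0"
proof -
  interpret P: bparam S F \<nu> e \<delta> U by (rule B)
  have ZZ: "P.Z = (\<lambda>y. proj (F y))" by (simp add: P.Z_def[abs_def])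
  define q where "q = F y"
  have q1: "norm q = 1" unfolding q_def by (rule P.Z_boundary(2)[OF y])
  have qS: "q \<in> S" using P.mem[OF y(1)] y(2) by (simp add: q_def)
  obtain F' :: "real^'m \<Rightarrow> complex^'n" and \<nu>' e' \<delta>' U' where B': "bparam S F' \<nu>' e' \<delta>' U'" and F'0: "F' 0 = q"
    using boundary_parametrization[OF regS horS qS q1] by blast
  interpret P': bparam S F' \<nu>' e' \<delta>' U' by (rule B')
  have z: "0 \<in> cube \<delta>'" "(0::real^'m) $ \<nu>' = 0" using P'.zero_cube by auto
  have ZZ': "P'.Z = (\<lambda>y. proj (F' y))" by (simp add: P'.Z_def[abs_def])
  have Z1: "cdiff 1 P.Z (cube \<delta>)" using cdiff_mono[OF P.Z2, of 1] by simp
  have dZ: "(P.Z has_derivative frechet_derivative P.Z (at y)) (at y)" by (rule cdiff_1_has_derivative[OF Z1 y(1)])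
  have linZ: "linear (frechet_derivative P.Z (at y))" by (rule has_derivative_linear[OF dZ])
  have Z1': "cdiff 1 P'.Z (cube \<delta>')" using cdiff_mono[OF P'.Z2, of 1] by simp
  have linZ': "linear (frechet_derivative P'.Z (at 0))"
    by (rule has_derivative_linear[OF cdiff_1_has_derivative[OF Z1' z(1)]])
  define v where "v = frechet_derivative F (at y) (axis \<nu> 1)"
  have "v \<in> tcone S q" unfolding q_def P.tcone_F[OF y] v_def by (auto simp: axis_def intro!: exI[of _ "axis \<nu> 1"])
  then obtain u' where u': "v = frechet_derivative F' (at 0) u'" unfolding F'0[symmetric] P'.tcone_F[OF z] by blast
  have "frechet_derivative P.Z (at y) (axis \<nu> 1) = v - (q \<bullet> v) *\<^sub>R q"
    using P.Z_boundary(3)[OF y] by (simp add: v_def q_def)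
  also have "\<dots> = frechet_derivative P'.Z (at 0) u'"
    using P'.Z_boundary(3)[OF z, of u'] by (simp add: u' F'0)
  also have "\<dots> = (\<Sum>i\<in>UNIV. u' $ i *\<^sub>R frechet_derivative P'.Z (at 0) (axis i 1))"
    by (rule linear_axis_sum[OF linZ'])
  finally have vsum: "frechet_derivative P.Z (at y) (axis \<nu> 1) = (\<Sum>i\<in>UNIV. u' $ i *\<^sub>R frechet_derivative P'.Z (at 0) (axis i 1))" .
  have "\<exists>u. u $ \<nu> = 0 \<and> frechet_derivative P'.Z (at 0) (axis i 1) = frechet_derivative P.Z (at y) u" for i
  proof (cases "i = \<nu>'")
    case True
    then have "frechet_derivative P'.Z (at 0) (axis i 1) = 0"
      using normal_derivative_origin(1)[OF B'] by (simp add: ZZ')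
    then show ?thesis by (intro exI[of _ 0]) (simp add: linear_0[OF linZ])
  next
    case False
    then have i0: "(axis i 1 :: real^'m) $ \<nu>' = 0" by (simp add: axis_def)
    have "frechet_derivative F' (at 0) (axis i 1) \<in> tcone (S \<inter> sphere 0 1) q"
      unfolding F'0[symmetric] P'.tcone_sphere_F[OF z] using i0 by blast
    then obtain u where u: "u $ \<nu> = 0" "frechet_derivative F' (at 0) (axis i 1) = frechet_derivative F (at y) u"
      unfolding q_def P.tcone_sphere_F[OF y] by blast
    have "frechet_derivative P'.Z (at 0) (axis i 1) = frechet_derivative F' (at 0) (axis i 1)"
      using boundary_tangent(3)[OF B' z i0] by (simp add: ZZ')
    also have "\<dots> = frechet_derivative P.Z (at y) u"
      using boundary_tangent(3)[OF B y u(1)] u(2) by (simp add: ZZ)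
    finally show ?thesis using u(1) by blast
  qed
  then obtain w where w: "\<And>i. w i $ \<nu> = 0" "\<And>i. frechet_derivative P'.Z (at 0) (axis i 1) = frechet_derivative P.Z (at y) (w i)"
    by metis
  define x where "x = (\<Sum>i\<in>UNIV. u' $ i *\<^sub>R w i)"
  have x0: "x $ \<nu> = 0" by (simp add: x_def w(1))
  have "frechet_derivative P.Z (at y) (axis \<nu> 1) = frechet_derivative P.Z (at y) x"
    unfolding vsum w(2) x_def by (simp add: linear_sum[OF linZ] linear_scale[OF linZ])
  moreover have "x = 0"
  proof -
    have "x $ j = 0" if j: "j \<noteq> \<nu>" for j
    proof -
      have "x $ j = e j \<bullet> frechet_derivative P.Z (at y) x"
        by (rule normalized_derivative(2)[OF P.Z_normalized open_cube y(1) dZ j, symmetric])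
      also have "\<dots> = e j \<bullet> frechet_derivative P.Z (at y) (axis \<nu> 1)"
        using \<open>frechet_derivative P.Z (at y) (axis \<nu> 1) = frechet_derivative P.Z (at y) x\<close> by simp
      also have "\<dots> = axis \<nu> 1 $ j" by (rule normalized_derivative(2)[OF P.Z_normalized open_cube y(1) dZ j])
      finally show ?thesis using j by (simp add: axis_def)
    qed
    then show ?thesis using x0 by (metis vec_eq_iff zero_index)
  qed
  ultimately show ?thesis using linear_0[OF linZ] by (simp add: ZZ)
qed

end

section \<open>Charts in the squared boundary coordinate\<close>

text \<open>Approaching a face point off the face, the limit is
  \<open>quotient_tendsto_derivative\<close>; within the face it is continuity of the
  derivative.\<close>

lemma quotient_continuous:
  fixes h :: "real^'m \<Rightarrow> 'b::real_normed_vector"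
  assumes h: "cdiff 1 h (cube d)" and zero: "\<And>y. y \<in> cube d \<Longrightarrow> y $ \<nu> = 0 \<Longrightarrow> h y = 0"
  shows "continuous_on (cube d) (\<lambda>y. if y $ \<nu> = 0 then frechet_derivative h (at y) (axis \<nu> 1) else h y /\<^sub>R y $ \<nu>)"
proof (intro continuous_at_imp_continuous_on ballI)
  fix c :: "real^'m" assume c: "c \<in> cube d"
  let ?k = "\<lambda>y. if y $ \<nu> = 0 then frechet_derivative h (at y) (axis \<nu> 1) else h y /\<^sub>R y $ \<nu>"
  have h1: "cdiff (Suc 0) h (cube d)" using h by simp
  have ch: "isCont h c" using cdiff_continuous[OF h] c by (simp add: continuous_on_eq_continuous_at[OF open_cube])
  have cD: "isCont (\<lambda>y. frechet_derivative h (at y) (axis \<nu> 1)) c"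
    using cdiff_continuous[OF cdiff_frechet[OF h1 open_cube]] c by (simp add: continuous_on_eq_continuous_at[OF open_cube])
  show "isCont ?k c"
  proof (cases "c $ \<nu> = 0")
    case False
    have "isCont (\<lambda>y. h y /\<^sub>R y $ \<nu>) c" using ch False by (intro continuous_intros) auto
    moreover have "\<forall>\<^sub>F y in nhds c. h y /\<^sub>R y $ \<nu> = ?k y"
    proof (rule eventually_mono)
      show "\<forall>\<^sub>F y in nhds c. y \<in> {y. y $ \<nu> \<noteq> 0}"
        by (rule eventually_nhds_in_open) (use False in \<open>auto intro!: open_Collect_neq continuous_intros\<close>)
    qed auto
    ultimately show ?thesis using isCont_cong[of "\<lambda>y. h y /\<^sub>R y $ \<nu>" ?k c] by simp
  next
    case True
    have 1: "(?k \<longlongrightarrow> frechet_derivative h (at c) (axis \<nu> 1)) (at c within {y. y $ \<nu> \<noteq> 0})"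
      by (rule Lim_transform_eventually[OF quotient_tendsto_derivative[OF h zero c True]])
        (auto simp: eventually_at_filter)
    have "((\<lambda>y. frechet_derivative h (at y) (axis \<nu> 1)) \<longlongrightarrow> frechet_derivative h (at c) (axis \<nu> 1)) (at c)"
      using cD by (simp add: continuous_at)
    then have "((\<lambda>y. frechet_derivative h (at y) (axis \<nu> 1)) \<longlongrightarrow> frechet_derivative h (at c) (axis \<nu> 1)) (at c within {y. y $ \<nu> = 0})"
      by (rule tendsto_within_subset[OF _ subset_UNIV])
    then have 2: "(?k \<longlongrightarrow> frechet_derivative h (at c) (axis \<nu> 1)) (at c within {y. y $ \<nu> = 0})"
      by (rule Lim_transform_eventually) (auto simp: eventually_at_filter)
    have "(?k \<longlongrightarrow> frechet_derivative h (at c) (axis \<nu> 1)) (at c within ({y. y $ \<nu> \<noteq> 0} \<union> {y. y $ \<nu> = 0}))"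
      using 1 2 by (simp only: Lim_within_Un)
    moreover have "{y::real^'m. y $ \<nu> \<noteq> 0} \<union> {y. y $ \<nu> = 0} = UNIV" by auto
    ultimately show ?thesis using True by (simp add: continuous_at)
  qed
qed

lemma continuous_sgn_times:
  fixes R :: "real^'m \<Rightarrow> 'b::real_normed_vector"
  assumes S: "open S" and R: "continuous_on S R" and zero: "\<And>y. y \<in> S \<Longrightarrow> y $ \<nu> = 0 \<Longrightarrow> R y = 0"
  shows "continuous_on S (\<lambda>y. sgn (y $ \<nu>) *\<^sub>R R y)"
proof (intro continuous_at_imp_continuous_on ballI)
  fix c assume c: "c \<in> S"
  have cR: "isCont R c" using R c by (simp add: continuous_on_eq_continuous_at[OF S])
  show "isCont (\<lambda>y. sgn (y $ \<nu>) *\<^sub>R R y) c"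
  proof (cases "c $ \<nu> = 0")
    case False
    then show ?thesis
      unfolding continuous_at
    proof (intro tendsto_scaleR tendsto_sgn)
      show "((\<lambda>y. y $ \<nu>) \<longlongrightarrow> c $ \<nu>) (at c)" by (intro tendsto_intros)
      show "(R \<longlongrightarrow> R c) (at c)" using cR by (simp add: continuous_at)
    qed
  next
    case True
    have "(R \<longlongrightarrow> 0) (at c)" using cR zero[OF c True] by (simp add: continuous_at)
    then have "((\<lambda>y. norm (R y)) \<longlongrightarrow> 0) (at c)" by (rule tendsto_norm_zero)
    then have "((\<lambda>y. sgn (y $ \<nu>) *\<^sub>R R y) \<longlongrightarrow> 0) (at c)"
      by (rule Lim_null_comparison[rotated]) (auto intro!: always_eventually simp: abs_sgn_eq)
    then show ?thesis using True by (simp add: continuous_at)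
  qed
qed

text \<open>The mean value inequality for \<open>f\<close> minus the linear function of slope
  \<open>l\<close>, on either side of zero.\<close>

lemma derivative_from_limit:
  fixes f :: "real \<Rightarrow> 'b::real_normed_vector"
  assumes d: "d > 0" and f: "continuous_on {-d<..<d} f"
    and der: "\<And>t. t \<noteq> 0 \<Longrightarrow> \<bar>t\<bar> < d \<Longrightarrow> (f has_vector_derivative g t) (at t)"
    and lim: "(g \<longlongrightarrow> l) (at 0)"
  shows "(f has_vector_derivative l) (at 0)"
  unfolding has_vector_derivative_def
proof (rule has_derivativeI)
  show "bounded_linear (\<lambda>h. h *\<^sub>R l)" by (rule bounded_linear_scaleR_left)
  show "((\<lambda>y. (f y - f 0 - (y - 0) *\<^sub>R l) /\<^sub>R norm (y - 0)) \<longlongrightarrow> 0) (at 0)"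
  proof (rule tendstoI)
    fix e :: real assume e: "e > 0"
    have "\<forall>\<^sub>F t in at 0. dist (g t) l < e / 2" using lim e by (intro tendstoD) auto
    then obtain r where r: "r > 0" "\<And>t. t \<noteq> 0 \<Longrightarrow> \<bar>t\<bar> < r \<Longrightarrow> dist (g t) l < e / 2"
      unfolding eventually_at by (auto simp: dist_real_def)
    have main: "norm (f b - f a - (b - a) *\<^sub>R l) \<le> e / 2 * (b - a)"
      if ab: "a < b" "a = 0 \<or> b = 0" "\<bar>a\<bar> < min d r" "\<bar>b\<bar> < min d r" for a b
    proof -
      have "norm ((\<lambda>t. f t - t *\<^sub>R l) b - (\<lambda>t. f t - t *\<^sub>R l) a) \<le> (\<lambda>t. e / 2 * t) b - (\<lambda>t. e / 2 * t) a"
      proof (rule differentiable_bound_general[OF ab(1)])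
        show "continuous_on {a..b} (\<lambda>t. f t - t *\<^sub>R l)"
          by (intro continuous_intros continuous_on_subset[OF f]) (use ab in auto)
        show "continuous_on {a..b} (\<lambda>t. e / 2 * t)" by (intro continuous_intros)
        fix t assume t: "a < t" "t < b"
        then have t': "t \<noteq> 0" "\<bar>t\<bar> < d" "\<bar>t\<bar> < r" using ab by auto
        show "((\<lambda>t. f t - t *\<^sub>R l) has_vector_derivative (g t - l)) (at t)"
          using der[OF t'(1,2)] by (auto intro!: derivative_eq_intros)
        show "((\<lambda>t. e / 2 * t) has_vector_derivative e / 2) (at t)"
          by (auto intro!: derivative_eq_intros simp: has_real_derivative_iff_has_vector_derivative[symmetric])
        show "norm (g t - l) \<le> e / 2" using r(2)[OF t'(1,3)] by (simp add: dist_norm)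
      qed
      then show ?thesis by (simp add: algebra_simps)
    qed
    have "dist ((f y - f 0 - (y - 0) *\<^sub>R l) /\<^sub>R norm (y - 0)) 0 < e" if y: "y \<noteq> 0" "\<bar>y\<bar> < min d r" for y
    proof -
      have "norm (f y - f 0 - y *\<^sub>R l) \<le> e / 2 * \<bar>y\<bar>"
      proof (cases "y > 0")
        case True
        with main[of 0 y] y d r show ?thesis by simp
      next
        case False
        then have "y < 0" using y by simp
        with main[of y 0] y d r have "norm (f 0 - f y - (0 - y) *\<^sub>R l) \<le> e / 2 * (0 - y)" by simp
        moreover have "f 0 - f y - (0 - y) *\<^sub>R l = - (f y - f 0 - y *\<^sub>R l)" by simp
        ultimately have "norm (f y - f 0 - y *\<^sub>R l) \<le> e / 2 * (0 - y)" by (metis norm_minus_cancel)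
        with \<open>y < 0\<close> show ?thesis by simp
      qed
      also have "\<dots> < e * \<bar>y\<bar>" using y e by simp
      finally show ?thesis using y by (simp add: divide_less_eq inverse_eq_divide)
    qed
    then show "\<forall>\<^sub>F y in at 0. dist ((f y - f 0 - (y - 0) *\<^sub>R l) /\<^sub>R norm (y - 0)) 0 < e"
      unfolding eventually_at using d r by (intro exI[of _ "min d r"]) (auto simp: dist_real_def)
  qed
qed

definition setc :: "'m \<Rightarrow> real^'m \<Rightarrow> real \<Rightarrow> real^'m" where
  "setc \<nu> y s = y + (s - y $ \<nu>) *\<^sub>R axis \<nu> 1"

lemma setc_nth [simp]: "setc \<nu> y s $ i = (if i = \<nu> then s else y $ i)"
  by (simp add: setc_def axis_def)

lemma setc_same [simp]: "setc \<nu> y (y $ \<nu>) = y"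
  by (simp add: setc_def)

lemma continuous_on_setc: "continuous_on S f \<Longrightarrow> continuous_on S (\<lambda>y. setc \<nu> y (f y))"
  unfolding setc_def by (intro continuous_intros)

lemma has_vector_derivative_setc:
  assumes Z: "(Z has_derivative Z') (at (setc \<nu> y s))"
  shows "((\<lambda>r. Z (setc \<nu> y r)) has_vector_derivative Z' (axis \<nu> 1)) (at s)"
proof -
  have "((\<lambda>r. setc \<nu> y r) has_derivative (\<lambda>h. h *\<^sub>R axis \<nu> 1)) (at s)"
    unfolding setc_def by (auto intro!: derivative_eq_intros)
  from has_derivative_compose[OF this Z] show ?thesis
    by (simp add: has_vector_derivative_def linear_scale[OF has_derivative_linear[OF Z]])
qed

text \<open>The squared boundary coordinate: a function whose normal derivative vanishes on the boundary
  becomes differentiable in \<open>\<tau> = y\<^sup>2\<close>; odd reflection extends it across the boundary.\<close>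
definition unfold :: "'m \<Rightarrow> (real^'m \<Rightarrow> 'b::real_normed_vector) \<Rightarrow> real^'m \<Rightarrow> 'b" where
  "unfold \<nu> Z y = Z (setc \<nu> y 0) + sgn (y $ \<nu>) *\<^sub>R (Z (setc \<nu> y (sqrt \<bar>y $ \<nu>\<bar>)) - Z (setc \<nu> y 0))"

lemma unfold_nonneg: "y $ \<nu> \<ge> 0 \<Longrightarrow> unfold \<nu> Z y = Z (setc \<nu> y (sqrt (y $ \<nu>)))"
  by (cases "y $ \<nu> = 0") (simp_all add: unfold_def)

text \<open>In direction \<nu> the chain rule gives half the quotient of the normal derivative by
  its own coordinate, evaluated at the square root; as the normal derivative vanishes on the face,
  this extends continuously by half the second normal derivative. In the other directions the jump
  of the sign is harmless, its factor being zero on the face.\<close>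

lemma unfold_C1:
  fixes Z :: "real^'m \<Rightarrow> 'b::real_normed_vector"
  assumes d: "d > 0" and Z2: "cdiff 2 Z (cube d)"
    and zero: "\<And>y. y \<in> cube d \<Longrightarrow> y $ \<nu> = 0 \<Longrightarrow> frechet_derivative Z (at y) (axis \<nu> 1) = 0"
  defines "d' \<equiv> min d (d\<^sup>2)"
  shows "cdiff 1 (unfold \<nu> Z) (cube d')"
    "frechet_derivative (unfold \<nu> Z) (at 0) u = (\<Sum>i\<in>UNIV. u $ i *\<^sub>R (if i = \<nu>
       then (1/2) *\<^sub>R frechet_derivative (\<lambda>y. frechet_derivative Z (at y) (axis \<nu> 1)) (at 0) (axis \<nu> 1)
       else frechet_derivative Z (at 0) (axis i 1)))"
proof -
  have Z2': "cdiff (Suc 1) Z (cube d)" using Z2 by (simp add: numeral_2_eq_2)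
  have Z1: "cdiff 1 Z (cube d)" by (rule cdiff_lower[OF Z2'])
  have Zd: "(Z has_derivative frechet_derivative Z (at y)) (at y)" if "y \<in> cube d" for y
    by (rule cdiff_1_has_derivative[OF Z1 that])
  define D where "D = (\<lambda>i y. frechet_derivative Z (at y) (axis i 1))"
  have D1: "cdiff 1 (D i) (cube d)" for i unfolding D_def by (rule cdiff_frechet[OF Z2' open_cube])
  define up where "up = (\<lambda>y::real^'m. setc \<nu> y (sqrt \<bar>y $ \<nu>\<bar>))"
  define bs where "bs = (\<lambda>y::real^'m. setc \<nu> y 0)"
  \<comment> \<open>The bound by the square of \<open>d\<close> keeps the square root of the
    \<nu>-coordinate below \<open>d\<close>; the bound by \<open>d\<close> serves the other
    coordinates.\<close>
  have d': "d' > 0" "d' \<le> d" using d by (auto simp: d'_def)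
  have sq: "sqrt \<bar>t\<bar> < d" if "\<bar>t\<bar> < d'" for t
    using that d real_sqrt_less_mono[of "\<bar>t\<bar>" "d\<^sup>2"] by (simp add: d'_def)
  have up: "up y \<in> cube d" and bs: "bs y \<in> cube d" if "y \<in> cube d'" for y
    using that sq d d' by (auto simp: up_def bs_def cube_def intro: less_le_trans)
  have cup: "continuous_on T up" and cbs: "continuous_on T bs" for T
    unfolding up_def bs_def by (intro continuous_on_setc continuous_intros)+
  have cDup: "continuous_on (cube d') (\<lambda>y. D i (up y))" and cDbs: "continuous_on (cube d') (\<lambda>y. D i (bs y))" for i
    by (rule continuous_on_compose2[OF cdiff_continuous[OF D1]]; use cup cbs up bs in auto)+
  have cZup: "continuous_on (cube d') (\<lambda>y. Z (up y))" and cZbs: "continuous_on (cube d') (\<lambda>y. Z (bs y))"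
    by (rule continuous_on_compose2[OF cdiff_continuous[OF Z1]]; use cup cbs up bs in auto)+
  have updef: "up y = bs y" if "y $ \<nu> = 0" for y using that by (simp add: up_def bs_def)
  define k where "k = (\<lambda>y. if y $ \<nu> = 0 then frechet_derivative (D \<nu>) (at y) (axis \<nu> 1) else D \<nu> y /\<^sub>R y $ \<nu>)"
  have ck: "continuous_on (cube d) k"
    unfolding k_def by (rule quotient_continuous[OF D1]) (use zero in \<open>auto simp: D_def\<close>)
  define P where "P = (\<lambda>i y. if i = \<nu> then (1/2) *\<^sub>R k (up y) else D i (bs y) + sgn (y $ \<nu>) *\<^sub>R (D i (up y) - D i (bs y)))"
  have cP: "continuous_on (cube d') (P i)" for i
  proof (cases "i = \<nu>")
    case True
    have "continuous_on (cube d') (\<lambda>y. k (up y))"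
      by (rule continuous_on_compose2[OF ck cup]) (use up in auto)
    then show ?thesis using True by (auto simp: P_def intro!: continuous_intros)
  next
    case False
    have "continuous_on (cube d') (\<lambda>y. sgn (y $ \<nu>) *\<^sub>R (D i (up y) - D i (bs y)))"
      by (rule continuous_sgn_times[OF open_cube]) (auto intro!: continuous_on_diff cDup cDbs simp: updef)
    then show ?thesis using False by (auto simp: P_def intro!: continuous_on_add cDbs)
  qed
  have cY: "continuous_on (cube d') (unfold \<nu> Z)"
  proof -
    have "continuous_on (cube d') (\<lambda>y. sgn (y $ \<nu>) *\<^sub>R (Z (up y) - Z (bs y)))"
      by (rule continuous_sgn_times[OF open_cube]) (auto intro!: continuous_on_diff cZup cZbs simp: updef)
    then show ?thesis unfolding unfold_def[abs_def] using cZbs by (auto simp: up_def bs_def intro!: continuous_on_add)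
  qed
  have partial: "((\<lambda>t. unfold \<nu> Z (y + t *\<^sub>R axis i 1)) has_vector_derivative P i y) (at 0)" if y: "y \<in> cube d'" for i y
  proof (cases "i = \<nu>")
    case False
    have eq: "unfold \<nu> Z (y + t *\<^sub>R axis i 1) = Z (bs y + t *\<^sub>R axis i 1) + sgn (y $ \<nu>) *\<^sub>R (Z (up y + t *\<^sub>R axis i 1) - Z (bs y + t *\<^sub>R axis i 1))" for t
    proof -
      have 1: "setc \<nu> (y + t *\<^sub>R axis i 1) s = setc \<nu> y s + t *\<^sub>R axis i 1" for s
        using False by (simp add: vec_eq_iff axis_def)
      have 2: "(y + t *\<^sub>R axis i 1) $ \<nu> = y $ \<nu>" using False by (simp add: axis_def)
      show ?thesis by (simp only: unfold_def up_def bs_def 1 2)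
    qed
    show ?thesis unfolding eq
      using False has_derivative_dirderiv(1)[OF Zd[OF up[OF y]], of "axis i 1"] has_derivative_dirderiv(1)[OF Zd[OF bs[OF y]], of "axis i 1"]
      by (auto simp: P_def D_def intro!: derivative_eq_intros)
  next
    case i: True
    define f where "f = (\<lambda>s. unfold \<nu> Z (setc \<nu> y s))"
    have bsy: "bs (setc \<nu> y s) = bs y" for s by (simp add: bs_def vec_eq_iff)
    have upy: "up (setc \<nu> y s) = setc \<nu> y (sqrt \<bar>s\<bar>)" for s by (simp add: up_def vec_eq_iff)
    have f: "f s = Z (bs y) + sgn s *\<^sub>R (Z (setc \<nu> y (sqrt \<bar>s\<bar>)) - Z (bs y))" for s
      unfolding f_def unfold_def using bsy[of s] upy[of s] by (simp add: up_def bs_def)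
    have sc: "setc \<nu> y s \<in> cube d'" if "\<bar>s\<bar> < d'" for s using that y by (auto simp: cube_def)
    have fder: "(f has_vector_derivative P \<nu> (setc \<nu> y s)) (at s)" if s: "s \<noteq> 0" "\<bar>s\<bar> < d'" for s
    proof -
      have zs: "(Z has_derivative frechet_derivative Z (at (setc \<nu> y (sqrt \<bar>s\<bar>)))) (at (setc \<nu> y (sqrt \<bar>s\<bar>)))"
        using Zd up[OF sc[OF s(2)]] upy by metis
      have c: "((\<lambda>r. Z (setc \<nu> y r)) has_vector_derivative D \<nu> (setc \<nu> y (sqrt \<bar>s\<bar>))) (at (sqrt \<bar>s\<bar>))"
        unfolding D_def by (rule has_vector_derivative_setc[OF zs])
      have aux: "(1/2) *\<^sub>R (inverse r *\<^sub>R X) = (1 / (2 * r)) *\<^sub>R X" for X :: 'b and r :: real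
        unfolding scaleR_scaleR by (simp only: divide_inverse inverse_mult_distrib mult_1_left mult.commute)
      have nz: "setc \<nu> y (sqrt \<bar>s\<bar>) $ \<nu> = sqrt \<bar>s\<bar>" "sqrt \<bar>s\<bar> \<noteq> 0" using s(1) by simp_all
      have kx: "k (setc \<nu> y (sqrt \<bar>s\<bar>)) = D \<nu> (setc \<nu> y (sqrt \<bar>s\<bar>)) /\<^sub>R sqrt \<bar>s\<bar>"
        unfolding k_def nz(1) by (rule if_not_P[OF nz(2)])
      have Pv: "P \<nu> (setc \<nu> y s) = (1 / (2 * sqrt \<bar>s\<bar>)) *\<^sub>R D \<nu> (setc \<nu> y (sqrt \<bar>s\<bar>))"
        unfolding P_def upy kx if_P[OF refl] by (rule aux)
      have aux2: "a * (a * (inverse r / 2)) = 1 / (2 * r)" if "a * a = 1" for a r :: real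
      proof -
        have "a * (a * (inverse r / 2)) = (a * a) * (inverse r / 2)" by (rule mult.assoc[symmetric])
        also have "\<dots> = 1 / (2 * r)" unfolding that by (simp only: divide_inverse inverse_mult_distrib mult_1_left mult.commute)
        finally show ?thesis .
      qed
      have "sgn s * sgn s = 1" using s(1) by (simp add: sgn_if)
      then have sg: "sgn s * (sgn s * (inverse (sqrt \<bar>s\<bar>) / 2)) = 1 / (2 * sqrt \<bar>s\<bar>)"
        by (rule aux2)
      have sd: "((\<lambda>s. sqrt \<bar>s\<bar>) has_vector_derivative sgn s * (inverse (sqrt \<bar>s\<bar>) / 2)) (at s)"
      proof -
        have 1: "(sqrt has_real_derivative inverse (sqrt \<bar>s\<bar>) / 2) (at \<bar>s\<bar>)" using s(1) by (intro DERIV_real_sqrt) simp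
        have "((\<lambda>t. sgn s * t) has_real_derivative sgn s) (at s)" by (auto intro!: derivative_eq_intros)
        then have 2: "(abs has_real_derivative sgn s) (at s)"
        proof (rule has_field_derivative_transform_within_open)
          show "open {t. t * s > 0}" by (intro open_Collect_less continuous_intros)
          show "s \<in> {t. t * s > 0}" using s(1) by (auto simp: zero_less_mult_iff)
          show "sgn s * t = \<bar>t\<bar>" if "t \<in> {t. t * s > 0}" for t
            using that by (auto simp: zero_less_mult_iff sgn_if abs_if split: if_splits)
        qed
        have "((\<lambda>s. sqrt \<bar>s\<bar>) has_real_derivative (inverse (sqrt \<bar>s\<bar>) / 2) * sgn s) (at s)" by (rule DERIV_chain2[OF 1 2])
        then show ?thesis
          by (simp only: has_real_derivative_iff_has_vector_derivative mult.commute[of "sgn s"])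
      qed
      have "((\<lambda>s. Z (setc \<nu> y (sqrt \<bar>s\<bar>))) has_vector_derivative (sgn s * (inverse (sqrt \<bar>s\<bar>) / 2)) *\<^sub>R D \<nu> (setc \<nu> y (sqrt \<bar>s\<bar>))) (at s)"
        using vector_diff_chain_at[OF sd c] by (simp add: o_def)
      then have "((\<lambda>t. Z (bs y) + sgn s *\<^sub>R (Z (setc \<nu> y (sqrt \<bar>t\<bar>)) - Z (bs y))) has_vector_derivative
          sgn s *\<^sub>R ((sgn s * (inverse (sqrt \<bar>s\<bar>) / 2)) *\<^sub>R D \<nu> (setc \<nu> y (sqrt \<bar>s\<bar>)))) (at s)"
        by (auto intro!: derivative_eq_intros)
      then have "((\<lambda>t. Z (bs y) + sgn s *\<^sub>R (Z (setc \<nu> y (sqrt \<bar>t\<bar>)) - Z (bs y))) has_vector_derivative P \<nu> (setc \<nu> y s)) (at s)"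
        unfolding scaleR_scaleR sg Pv .
      then show ?thesis
      proof (rule has_vector_derivative_transform_within_open[where S="{t. t * s > 0}"])
        show "open {t. t * s > 0}" by (intro open_Collect_less continuous_intros)
        show "s \<in> {t. t * s > 0}" using s(1) by (auto simp: zero_less_mult_iff)
        show "Z (bs y) + sgn s *\<^sub>R (Z (setc \<nu> y (sqrt \<bar>t\<bar>)) - Z (bs y)) = f t" if "t \<in> {t. t * s > 0}" for t
          using that unfolding f by (auto simp: zero_less_mult_iff sgn_if split: if_splits)
      qed
    qed
    have f': "(f has_vector_derivative P \<nu> y) (at (y $ \<nu>))"
    proof (cases "y $ \<nu> = 0")
      case False
      then show ?thesis using fder[of "y $ \<nu>"] y by (simp add: cube_def)
    next
      \<comment> \<open>On the face the square root is not differentiable, so the derivative is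
        obtained as a limit of derivatives at nearby points.\<close>
      case True
      have y0: "setc \<nu> y 0 = y" using True by (simp add: vec_eq_iff)
      have "continuous_on {-d'<..<d'} f" unfolding f_def
      proof (rule continuous_on_compose2[OF cY])
        show "continuous_on {-d'<..<d'} (setc \<nu> y)" unfolding setc_def by (intro continuous_intros)
        show "setc \<nu> y ` {-d'<..<d'} \<subseteq> cube d'" using sc by auto
      qed
      moreover have "((\<lambda>s. P \<nu> (setc \<nu> y s)) \<longlongrightarrow> P \<nu> y) (at 0)"
      proof -
        have "isCont (P \<nu>) (setc \<nu> y 0)" using cP y y0 by (simp add: continuous_on_eq_continuous_at[OF open_cube])
        moreover have "isCont (setc \<nu> y) 0" unfolding setc_def by (intro continuous_intros)
        ultimately have "isCont (\<lambda>s. P \<nu> (setc \<nu> y s)) 0" by (rule isCont_o2[rotated])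
        then show ?thesis by (simp add: continuous_at y0)
      qed
      ultimately have "(f has_vector_derivative P \<nu> y) (at 0)"
        using derivative_from_limit[OF d'(1) _ fder] by blast
      then show ?thesis using True by simp
    qed
    have "((\<lambda>t. y $ \<nu> + t) has_vector_derivative 1) (at 0)" by (auto intro!: derivative_eq_intros)
    from vector_diff_chain_at[OF this, of f] f'
    have "((\<lambda>t. f (y $ \<nu> + t)) has_vector_derivative P \<nu> y) (at 0)" by (simp add: o_def)
    moreover have "f (y $ \<nu> + t) = unfold \<nu> Z (y + t *\<^sub>R axis i 1)" for t
      by (simp add: f_def setc_def i)
    ultimately show ?thesis by (simp add: i)
  qed
  \<comment> \<open>The criterion by partials is indexed by \<open>Basis\<close>;
    \<open>SOME\<close> recovers the label of a basis vector.\<close>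
  define Y' where "Y' = (\<lambda>y u. \<Sum>b\<in>(Basis :: (real^'m) set). (u \<bullet> b) *\<^sub>R (P (SOME i. b = axis i 1) y))"
  have someax: "(SOME i. axis j (1::real) = axis i 1) = j" for j :: 'm
    by (rule some_equality) (auto simp: axis_eq_axis)
  have dY: "(unfold \<nu> Z has_derivative Y' y) (at y)" if y: "y \<in> cube d'" for y
    unfolding Y'_def
  proof (rule has_derivative_partials[OF open_cube y])
    fix x b :: "real^'m" assume x: "x \<in> cube d'" and b: "b \<in> Basis"
    then obtain j where j: "b = axis j 1" by (auto simp: Basis_vec_def)
    show "((\<lambda>t. unfold \<nu> Z (x + t *\<^sub>R b)) has_vector_derivative P (SOME i. b = axis i 1) x) (at 0)"
      unfolding j someax by (rule partial[OF x])
  qed (rule cP)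
  have Yax: "Y' y (axis i 1) = P i y" for y i
  proof -
    have "Y' y (axis i 1) = (\<Sum>b\<in>(Basis :: (real^'m) set). if b = axis i 1 then P i y else 0)"
      unfolding Y'_def by (intro sum.cong) (auto simp: inner_Basis someax axis_in_Basis_iff)
    then show ?thesis by (simp add: axis_in_Basis_iff)
  qed
  have Y': "Y' y u = (\<Sum>i\<in>UNIV. u $ i *\<^sub>R P i y)" for y u
  proof -
    have "Y' y u = Y' y (\<Sum>i\<in>UNIV. u $ i *\<^sub>R axis i 1)"
      by (simp add: vec_eq_iff axis_def if_distrib[of "(*) _"] cong: if_cong arg_cong[where f="Y' y"])
        (rule arg_cong[where f="Y' y"], simp add: vec_eq_iff axis_def if_distrib[of "(*) _"] cong: if_cong)
    also have "\<dots> = (\<Sum>i\<in>UNIV. u $ i *\<^sub>R Y' y (axis i 1))"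
    proof -
      have l: "linear (Y' y)" unfolding Y'_def
        by (intro linearI) (simp_all add: inner_add_left scaleR_add_left sum.distrib scaleR_sum_right)
      show ?thesis by (simp add: linear_sum[OF l] linear_scale[OF l])
    qed
    also have "\<dots> = (\<Sum>i\<in>UNIV. u $ i *\<^sub>R P i y)" by (simp add: Yax)
    finally show ?thesis .
  qed
  have "cdiff (Suc 0) (unfold \<nu> Z) (cube d')"
  proof (rule cdiff_SucI[OF dY])
    show "cdiff 0 (\<lambda>x. Y' x v) (cube d')" for v
      unfolding Y' by (auto intro!: continuous_intros cP)
  qed
  then show "cdiff 1 (unfold \<nu> Z) (cube d')" by simp
  have z: "0 \<in> cube d'" using d' by (simp add: cube_def)
  have uz: "up 0 = 0" "bs 0 = 0" by (simp_all add: up_def bs_def vec_eq_iff)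
  have "frechet_derivative (unfold \<nu> Z) (at 0) u = Y' 0 u" using frechet_derivative_at[OF dY[OF z]] by simp
  then show "frechet_derivative (unfold \<nu> Z) (at 0) u = (\<Sum>i\<in>UNIV. u $ i *\<^sub>R (if i = \<nu>
       then (1/2) *\<^sub>R frechet_derivative (\<lambda>y. frechet_derivative Z (at y) (axis \<nu> 1)) (at 0) (axis \<nu> 1)
       else frechet_derivative Z (at 0) (axis i 1)))"
    unfolding Y' by (simp add: P_def k_def uz D_def cong: if_cong)
qed

text \<open>\<open>Y\<close> has only \<open>'m\<close> as parameters; adding the component
  orthogonal to the frame gives a map of the ambient space whose derivative is diagonal on the frame
  and the identity on its complement, hence invertible.\<close>

lemma slice_chart:
  fixes Y :: "real^'m \<Rightarrow> 'v::euclidean_space" and e :: "'m \<Rightarrow> 'v" and c :: "'m \<Rightarrow> real"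
  assumes d: "d > 0" and Y1: "cdiff 1 Y (cube d)"
    and e: "\<And>i j. e i \<bullet> e j = (if i = j then 1 else 0)"
    and dY: "\<And>u. frechet_derivative Y (at 0) u = (\<Sum>i\<in>UNIV. u $ i *\<^sub>R c i *\<^sub>R e i)" and c: "\<And>i. c i \<noteq> 0"
  defines "\<kappa> \<equiv> \<lambda>x. \<chi> i. x \<bullet> e i"
  defines "\<Xi> \<equiv> \<lambda>x. Y (\<kappa> x) + (x - (\<Sum>i\<in>UNIV. (x \<bullet> e i) *\<^sub>R e i))"
  obtains U V g where "open U" "0 \<in> U" "U \<subseteq> \<kappa> -` cube d" "cdiff 1 \<Xi> U" "open V" "Y 0 \<in> V"
    "homeomorphism U V \<Xi> g" "cdiff 1 g V"
    "(\<Xi> has_derivative (\<lambda>x. (\<Sum>i\<in>UNIV. (x \<bullet> e i) *\<^sub>R c i *\<^sub>R e i) + (x - (\<Sum>i\<in>UNIV. (x \<bullet> e i) *\<^sub>R e i)))) (at 0)"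
proof -
  have bl: "bounded_linear \<kappa>"
    unfolding \<kappa>_def linear_conv_bounded_linear[symmetric]
    by (intro linearI) (simp_all add: vec_eq_iff inner_add_left)
  define B where "B = \<kappa> -` cube d"
  have k0: "\<kappa> 0 = 0" by (rule linear_0[OF bounded_linear.linear[OF bl]])
  have oB: "open B" unfolding B_def
    by (rule open_vimage[OF open_cube linear_continuous_on[OF bl]])
  have zB: "0 \<in> B" using d k0 by (simp add: B_def cube_def)
  have kB: "\<kappa> ` B \<subseteq> cube d" by (auto simp: B_def)
  have X1: "cdiff 1 \<Xi> B" unfolding \<Xi>_def
    by (intro cdiff_add cdiff_diff cdiff_id cdiff_sum cdiff_scaleR cdiff_inner cdiff_const
        cdiff_compose[OF cdiff_linear[OF bl] Y1 kB])
  define D where "D = (\<lambda>x. (\<Sum>i\<in>UNIV. (x \<bullet> e i) *\<^sub>R c i *\<^sub>R e i) + (x - (\<Sum>i\<in>UNIV. (x \<bullet> e i) *\<^sub>R e i)))"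
  have "(Y has_derivative (\<lambda>u. \<Sum>i\<in>UNIV. u $ i *\<^sub>R c i *\<^sub>R e i)) (at (\<kappa> 0))"
    using cdiff_1_has_derivative[OF Y1, of 0] d unfolding k0 ext[of "frechet_derivative Y (at 0)", OF dY]
    by (simp add: cube_def)
  from has_derivative_compose[OF bounded_linear_imp_has_derivative[OF bl] this]
  have dYk: "((\<lambda>x. Y (\<kappa> x)) has_derivative (\<lambda>x. \<Sum>i\<in>UNIV. (x \<bullet> e i) *\<^sub>R c i *\<^sub>R e i)) (at 0)"
    by (simp add: \<kappa>_def)
  have dX: "(\<Xi> has_derivative D) (at 0)"
    unfolding \<Xi>_def D_def by (intro has_derivative_add[OF dYk] derivative_eq_intros) (auto simp: fun_eq_iff)
  have De: "D x \<bullet> e j = (x \<bullet> e j) * c j" for x j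
    by (simp add: D_def inner_add_left inner_diff_left inner_sum_left e if_distrib[of "(*) _"] cong: if_cong)
  have "inj D"
  proof (rule iffD2[OF linear_injective_0[OF has_derivative_linear[OF dX]]], intro allI impI)
    fix x assume x: "D x = 0"
    then have "x \<bullet> e j = 0" for j using De[of x j] c by simp
    then show "x = 0" using x by (simp add: D_def)
  qed
  then have inj: "inj (frechet_derivative \<Xi> (at 0))" unfolding frechet_derivative_at[OF dX, symmetric] .
  have X0: "\<Xi> 0 = Y 0" by (simp add: \<Xi>_def k0)
  from cdiff_inverse_function[OF oB zB X1 inj]
  obtain U V g where UV: "open U" "0 \<in> U" "U \<subseteq> B" "open V" "\<Xi> 0 \<in> V" "homeomorphism U V \<Xi> g"
    and gk: "\<And>k. cdiff (Suc k) \<Xi> B \<Longrightarrow> cdiff (Suc k) g V" by metis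
  have "cdiff 1 g V" using gk[of 0] X1 by simp
  then show thesis
    using that[OF UV(1,2) _ cdiff_subset[OF X1 UV(3)] UV(4) _ UV(6)] UV(3,5) dX
    by (auto simp: B_def X0 D_def)
qed

lemma adapted_chartI:
  assumes "open U" "q \<in> U" "cdiff 1 \<Phi> U" "open W" "\<Phi> ` U = W" "cdiff 1 g W" "\<And>x. x \<in> U \<Longrightarrow> g (\<Phi> x) = x"
    "subspace L" "dim L = m" "e \<in> L" "\<And>z. z \<in> U \<Longrightarrow> z \<in> S \<longleftrightarrow> \<Phi> z \<in> L \<and> e \<bullet> \<Phi> z \<ge> 0"
  shows "adapted_chart 1 m S q U \<Phi> L e"
proof -
  have inj: "inj_on \<Phi> U" using assms(7) by (rule inj_on_inverseI)
  have "cdiff 1 (inv_into U \<Phi>) W"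
    by (rule cdiff_cong[OF assms(4) _ assms(6)]) (use assms(5,7) inj in auto)
  then show ?thesis
    using assms inj unfolding adapted_chart_def Cl_on_1_iff by (auto 4 3)
qed

section \<open>C^1 charts of the closure\<close>

context weak_minimal
begin

text \<open>Inside the open ball \<open>Smod\<close> is a diffeomorphism, so charts of
  \<open>S\<close> pull back to \<open>K\<close>. The edge of the half space avoids \<open>q\<close>
  because the boundary of \<open>S\<close> lies on the sphere.\<close>

lemma interior_chart:
  assumes q: "q \<in> K" "norm q < 1"
  obtains U \<Phi> L e where "adapted_chart 1 CARD('m) K q U \<Phi> L e" "e = 0 \<or> e \<bullet> \<Phi> q \<noteq> 0"
proof -
  define p where "p = Smod q"
  have pS: "p \<in> S" using q by (simp add: p_def S_def)
  have p1: "norm p < 1" unfolding p_def by (rule Smod_norm_less[OF q(2)])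
  obtain U \<Phi> L e where A: "adapted_chart 2 CARD('m) S p U \<Phi> L e"
    using regS pS unfolding regular_in_ball_def submfd_wb_def by blast
  have U: "open U" "p \<in> U" "inj_on \<Phi> U" "open (\<Phi> ` U)" and L: "subspace L" "dim L = CARD('m)" "e \<in> L"
    and c2: "cdiff 2 \<Phi> U" "cdiff 2 (inv_into U \<Phi>) (\<Phi> ` U)"
    using A by (auto simp: adapted_chart_def Cl_on_numeral_iff)
  have e: "e = 0 \<or> e \<bullet> \<Phi> p \<noteq> 0"
  proof (rule ccontr)
    assume "\<not> (e = 0 \<or> e \<bullet> \<Phi> p \<noteq> 0)"
    then have "p \<in> mbdry 2 CARD('m) S" using A pS unfolding mbdry_def by blast
    then have "p \<in> sphere 0 1" using regS by (auto simp: regular_in_ball_def)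
    then show False using p1 by simp
  qed
  have c1: "cdiff 1 \<Phi> U" "cdiff 1 (inv_into U \<Phi>) (\<Phi> ` U)" using c2 cdiff_mono[of 2 _ _ 1] by auto
  define U' where "U' = ball 0 1 \<inter> Smod -` U"
  define W where "W = \<Phi> ` U \<inter> inv_into U \<Phi> -` ball 0 1"
  have oU': "open U'" unfolding U'_def
    by (rule continuous_open_preimage[OF cdiff_continuous[OF cdiff_Smod] open_ball U(1)])
  have oW: "open W" unfolding W_def
    by (rule continuous_open_preimage[OF cdiff_continuous[OF c1(2)] U(4) open_ball])
  have im: "(\<lambda>z. \<Phi> (Smod z)) ` U' = W"
  proof
    show "(\<lambda>z. \<Phi> (Smod z)) ` U' \<subseteq> W" using U(3) Smod_norm_less by (auto simp: U'_def W_def)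
    show "W \<subseteq> (\<lambda>z. \<Phi> (Smod z)) ` U'"
    proof
      fix y assume y: "y \<in> W"
      then obtain w where w: "w \<in> U" "y = \<Phi> w" "norm w < 1" using U(3) by (auto simp: W_def)
      have "norm (proj w) < 1" using norm_proj_le[of w] norm_proj_eq_1[of w] w(3) by linarith
      moreover have "Smod (proj w) = w" using w(3) by (simp add: Smod_proj)
      ultimately show "y \<in> (\<lambda>z. \<Phi> (Smod z)) ` U'" using w by (intro image_eqI[of _ _ "proj w"]) (auto simp: U'_def)
    qed
  qed
  have "adapted_chart 1 CARD('m) K q U' (\<lambda>z. \<Phi> (Smod z)) L e"
  proof (rule adapted_chartI[OF oU' _ _ oW im _ _ L])
    show "q \<in> U'" using q U(2) by (simp add: U'_def p_def)
    show "cdiff 1 (\<lambda>z. \<Phi> (Smod z)) U'"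
      by (rule cdiff_compose[OF cdiff_subset[OF cdiff_Smod] c1(1)]) (auto simp: U'_def)
    show "cdiff 1 (\<lambda>y. proj (inv_into U \<Phi> y)) W"
      by (rule cdiff_compose[OF cdiff_subset[OF c1(2)] cdiff_proj[where S=UNIV]]) (auto simp: W_def)
    fix z assume z: "z \<in> U'"
    then have z1: "norm z \<le> 1" "Smod z \<in> U" by (auto simp: U'_def)
    show "proj (inv_into U \<Phi> (\<Phi> (Smod z))) = z" using z1 U(3) by (simp add: proj_Smod)
    show "z \<in> K \<longleftrightarrow> \<Phi> (Smod z) \<in> L \<and> e \<bullet> \<Phi> (Smod z) \<ge> 0"
      using adapted_chart_mem[OF A z1(2)] Smod_mem_iff[OF z1(1)] by simp
  qed
  then show thesis using that e by (simp add: p_def)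
qed

text \<open>The derivative of \<open>Y = unfold \<nu> Z\<close> at the origin sends the axes to the
  \<open>e i\<close> and to half the second normal derivative \<open>\<zeta>\<close>. These are
  orthogonal and nonzero, so the extension \<open>\<Xi>\<close> is locally invertible and its
  inverse \<open>g\<close> is the chart. The final clauses are read off from these spanning
  vectors.\<close>

lemma boundary_chart_C1:
  assumes q: "q \<in> K" "norm q = 1"
  obtains U \<Phi> L c where "adapted_chart 1 CARD('m) K q U \<Phi> L c" "c \<noteq> 0" "c \<bullet> \<Phi> q = 0"
    "\<And>v. frechet_derivative \<Phi> (at q) v \<in> L \<Longrightarrow> v \<bullet> Tfield q = 0"
    "\<And>v. frechet_derivative \<Phi> (at q) v \<in> L \<Longrightarrow> c \<bullet> frechet_derivative \<Phi> (at q) v = 0 \<Longrightarrow> v \<bullet> q = 0"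
    "\<exists>v. frechet_derivative \<Phi> (at q) v \<in> L \<and> v \<bullet> q \<noteq> 0"
proof -
  have qS: "q \<in> S" using q sphere_mem by blast
  obtain F :: "real^'m \<Rightarrow> complex^'n" and \<nu> e \<delta> Ub where B: "bparam S F \<nu> e \<delta> Ub" and F0: "F 0 = q"
    using boundary_parametrization[OF regS horS qS q(2)] by blast
  interpret P: bparam S F \<nu> e \<delta> Ub by (rule B)
  define Z where "Z = P.Z"
  have ZF: "Z = (\<lambda>y. proj (F y))" by (simp add: Z_def P.Z_def[abs_def])
  note Z2 = P.Z2[folded Z_def]
  have Z2': "cdiff (Suc 1) Z (cube \<delta>)" using Z2 by (simp add: numeral_2_eq_2)
  have Z1: "cdiff 1 Z (cube \<delta>)" by (rule cdiff_lower[OF Z2'])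
  note norm = P.Z_normalized[folded Z_def]
  have z: "0 \<in> cube \<delta>" "(0::real^'m) $ \<nu> = 0" using P.zero_cube by auto
  have Z0: "Z 0 = q" using P.Z_boundary(1)[OF z] F0 by (simp add: Z_def)
  define D where "D = (\<lambda>y. frechet_derivative Z (at y) (axis \<nu> 1))"
  define \<zeta> where "\<zeta> = frechet_derivative D (at 0) (axis \<nu> 1)"
  have D1: "cdiff 1 D (cube \<delta>)" unfolding D_def by (rule cdiff_frechet[OF Z2' open_cube])
  have dD: "(D has_derivative frechet_derivative D (at 0)) (at 0)" by (rule cdiff_1_has_derivative[OF D1 z(1)])
  have Zd: "(Z has_derivative frechet_derivative Z (at y)) (at y)" if "y \<in> cube \<delta>" for y
    by (rule cdiff_1_has_derivative[OF Z1 that])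
  have D0: "D 0 = 0" using normal_derivative_zero[OF B z] by (simp add: D_def ZF)
  \<comment> \<open>The relation \<open>Z \<bullet> D = - y $ \<nu>\<close> differentiated at the
    origin, where \<open>D\<close> vanishes. Thus \<open>\<zeta>\<close> is nonzero and transversal
    to the sphere.\<close>
  have zq: "\<zeta> \<bullet> q = - 1"
  proof -
    have "((\<lambda>y. Z y \<bullet> D y) has_derivative (\<lambda>h. Z 0 \<bullet> frechet_derivative D (at 0) h + frechet_derivative Z (at 0) h \<bullet> D 0)) (at 0)"
      by (rule has_derivative_inner[OF Zd[OF z(1)] dD])
    then have 1: "((\<lambda>y. - y $ \<nu>) has_derivative (\<lambda>h. Z 0 \<bullet> frechet_derivative D (at 0) h + frechet_derivative Z (at 0) h \<bullet> D 0)) (at 0)"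
    proof (rule has_derivative_transform_within_open[OF _ open_cube z(1)])
      show "Z y \<bullet> D y = - y $ \<nu>" if "y \<in> cube \<delta>" for y
        unfolding D_def using normalized_derivative(1)[OF norm open_cube that Zd[OF that], of "axis \<nu> 1"] by simp
    qed
    have "((\<lambda>y. - y $ \<nu>) has_derivative (\<lambda>h. - h $ \<nu>)) (at (0::real^'m))"
      by (intro has_derivative_minus bounded_linear_imp_has_derivative bounded_linear_vec_nth)
    from fun_cong[OF has_derivative_unique[OF 1 this], of "axis \<nu> 1"] show ?thesis
      by (simp add: Z0 D0 \<zeta>_def inner_commute)
  qed
  have ez: "e i \<bullet> \<zeta> = 0" if i: "i \<noteq> \<nu>" for i
  proof -
    have "((\<lambda>y. e i \<bullet> D y) has_derivative (\<lambda>h. e i \<bullet> frechet_derivative D (at 0) h)) (at 0)"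
      by (rule has_derivative_inner_right[OF dD])
    then have 1: "((\<lambda>y. 0) has_derivative (\<lambda>h. e i \<bullet> frechet_derivative D (at 0) h)) (at 0)"
    proof (rule has_derivative_transform_within_open[OF _ open_cube z(1)])
      show "e i \<bullet> D y = 0" if "y \<in> cube \<delta>" for y
        unfolding D_def using normalized_derivative(2)[OF norm open_cube that Zd[OF that] i, of "axis \<nu> 1"] i
        by (simp add: axis_def)
    qed
    from fun_cong[OF has_derivative_unique[OF 1 has_derivative_const], of "axis \<nu> 1"] show ?thesis by (simp add: \<zeta>_def)
  qed
  have z0: "\<zeta> \<noteq> 0" using zq by auto
  define \<eta> where "\<eta> = \<zeta> /\<^sub>R norm \<zeta>"
  have \<eta>: "\<eta> \<bullet> \<eta> = 1" unfolding norm_eq_1[symmetric] \<eta>_def using z0 by simp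
  have e\<eta>: "e i \<bullet> \<eta> = 0" "\<eta> \<bullet> e i = 0" if "i \<noteq> \<nu>" for i
    using ez[OF that] by (simp_all add: \<eta>_def inner_commute[of \<zeta>])
  \<comment> \<open>With \<open>\<zeta>\<close> normalized the frame is orthonormal; its length and
    the factor 1/2 are moved into the scales \<open>c\<close>.\<close>
  define e' where "e' = (\<lambda>i. if i = \<nu> then \<eta> else e i)"
  define c where "c = (\<lambda>i. if i = \<nu> then norm \<zeta> / 2 else 1)"
  have c0: "c i \<noteq> 0" for i using z0 by (simp add: c_def)
  have orth: "e' i \<bullet> e' j = (if i = j then 1 else 0)" for i j
    by (cases "i = \<nu>"; cases "j = \<nu>") (simp_all add: e'_def \<eta> e\<eta> P.ortho)
  have ce: "c \<nu> *\<^sub>R e' \<nu> = (1/2) *\<^sub>R \<zeta>" using z0 by (simp add: c_def e'_def \<eta>_def)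
  have cei: "c i *\<^sub>R e' i = e i" if "i \<noteq> \<nu>" for i using that by (simp add: c_def e'_def)
  define \<delta>' where "\<delta>' = min \<delta> (\<delta>\<^sup>2)"
  have \<delta>': "\<delta>' > 0" using P.delta by (simp add: \<delta>'_def)
  define Y where "Y = unfold \<nu> Z"
  have zero: "frechet_derivative Z (at y) (axis \<nu> 1) = 0" if "y \<in> cube \<delta>" "y $ \<nu> = 0" for y
    unfolding ZF by (rule normal_derivative_zero[OF B that])
  have Y1: "cdiff 1 Y (cube \<delta>')"
    unfolding Y_def \<delta>'_def by (rule unfold_C1(1)[OF P.delta Z2]) (rule zero)
  have dY: "frechet_derivative Y (at 0) u = (\<Sum>i\<in>UNIV. u $ i *\<^sub>R c i *\<^sub>R e' i)" for u
  proof -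
    have "(if i = \<nu> then (1 / 2) *\<^sub>R \<zeta> else frechet_derivative Z (at 0) (axis i 1)) = c i *\<^sub>R e' i" for i
      using ce cei[of i] P.Z_axes[of i, folded Z_def] by (cases "i = \<nu>") simp_all
    moreover have "frechet_derivative Y (at 0) u
        = (\<Sum>i\<in>UNIV. u $ i *\<^sub>R (if i = \<nu> then (1 / 2) *\<^sub>R \<zeta> else frechet_derivative Z (at 0) (axis i 1)))"
      unfolding Y_def \<zeta>_def D_def by (rule unfold_C1(2)[OF P.delta Z2]) (rule zero)
    ultimately show ?thesis by simp
  qed
  have Y0: "Y 0 = q"
    unfolding Y_def by (subst unfold_nonneg) (simp_all add: setc_def Z0)
  define \<kappa> where "\<kappa> = (\<lambda>x::complex^'n. \<chi> i. x \<bullet> e' i)"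
  define \<Xi> where "\<Xi> = (\<lambda>x. Y (\<kappa> x) + (x - (\<Sum>i\<in>UNIV. (x \<bullet> e' i) *\<^sub>R e' i)))"
  obtain U1 V1 g where UV: "open U1" "0 \<in> U1" "U1 \<subseteq> \<kappa> -` cube \<delta>'" "cdiff 1 \<Xi> U1" "open V1" "Y 0 \<in> V1"
    "homeomorphism U1 V1 \<Xi> g" "cdiff 1 g V1"
    and dX: "(\<Xi> has_derivative (\<lambda>x. (\<Sum>i\<in>UNIV. (x \<bullet> e' i) *\<^sub>R c i *\<^sub>R e' i) + (x - (\<Sum>i\<in>UNIV. (x \<bullet> e' i) *\<^sub>R e' i)))) (at 0)"
    by (rule slice_chart[OF \<delta>' Y1 orth dY c0, folded \<Xi>_def[unfolded \<kappa>_def], folded \<kappa>_def], rule that)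
  have hom: "\<Xi> (g z) = z" "g z \<in> U1" if "z \<in> V1" for z using UV(7) that by (auto simp: homeomorphism_def)
  have hom': "g (\<Xi> x) = x" "\<Xi> x \<in> V1" if "x \<in> U1" for x using UV(7) that by (auto simp: homeomorphism_def)
  define L where "L = span (range e')"
  have L: "subspace L" by (simp add: L_def)
  have exp: "(\<Sum>i\<in>UNIV. (x \<bullet> e' i) *\<^sub>R e' i) = x" if "x \<in> L" for x
    using orthonormal_expansion[OF orth, of x] that by (simp add: L_def)
  have injc: "inj e'"
  proof (rule injI)
    fix i j assume "e' i = e' j"
    then show "i = j" using orth[of i j] orth[of j j] by (auto split: if_splits)
  qed
  have dimL: "dim L = CARD('m)"
  proof -
    have "independent (range e')"
    proof (rule pairwise_orthogonal_independent)
      show "pairwise orthogonal (range e')" by (auto simp: pairwise_def orthogonal_def orth)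
      show "0 \<notin> range e'"
      proof
        assume "0 \<in> range e'"
        then obtain i where "e' i = 0" by (metis imageE)
        then show False using orth[of i i] by simp
      qed
    qed
    then show ?thesis unfolding L_def using injc by (simp add: dim_eq_card_independent card_image)
  qed
  have eL: "e' i \<in> L" for i by (simp add: L_def span_base)
  define \<iota> where "\<iota> = (\<lambda>y::real^'m. \<Sum>i\<in>UNIV. y $ i *\<^sub>R e' i)"
  have \<iota>L: "\<iota> y \<in> L" for y unfolding \<iota>_def by (intro subspace_sum[OF L] subspace_scale[OF L] eL)
  have \<iota>e: "\<iota> y \<bullet> e' j = y $ j" for y j
    by (simp add: \<iota>_def inner_sum_left orth if_distrib[of "(*) _"] cong: if_cong)
  have \<kappa>\<iota>: "\<kappa> (\<iota> y) = y" for y by (simp add: \<kappa>_def \<iota>e vec_eq_iff)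
  have XL: "\<Xi> x = Y (\<kappa> x)" if "x \<in> L" for x using exp[OF that] by (simp add: \<Xi>_def)
  \<comment> \<open>The value the chart must take at points of \<open>K\<close>: the coordinates of
    the modified compactification with the \<nu>-coordinate squared.\<close>
  define T where "T = (\<lambda>z. \<iota> (setc \<nu> (coords \<nu> e (Smod z)) ((coords \<nu> e (Smod z) $ \<nu>)\<^sup>2)))"
  have cc: "continuous_on (cball 0 1) (\<lambda>z::complex^'n. coords \<nu> e (Smod z))"
    by (rule continuous_on_compose2[OF cdiff_continuous[OF cdiff_coords[where S=UNIV]] continuous_on_Smod]) auto
  have cT: "continuous_on (cball 0 1) T"
    unfolding T_def \<iota>_def setc_def by (intro continuous_intros cc)
  \<comment> \<open>\<open>Smod\<close> and \<open>T\<close> are known to be continuous on the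
    closed ball only, so their preimages are relatively open and are replaced by ambient open sets
    with the same trace.\<close>
  obtain N1 where N1: "open N1" "N1 \<inter> cball 0 1 = Smod -` Ub \<inter> cball (0::complex^'n) 1"
    using continuous_on_open_invariant[THEN iffD1, OF continuous_on_Smod] P.U(1) by metis
  obtain N2 where N2: "open N2" "N2 \<inter> cball 0 1 = T -` U1 \<inter> cball 0 1"
    using continuous_on_open_invariant[THEN iffD1, OF cT] UV(1) by metis
  have qU: "q \<in> Ub" using P.U(2) z(1) F0 by blast
  have "coords \<nu> e q = 0" using P.left[OF z(1)] F0 by simp
  then have "T q = 0" using q by (simp add: T_def Smod_sphere setc_def \<iota>_def)
  then have qN: "q \<in> N1" "q \<in> N2" using N1(2) N2(2) qU UV(2) q by (auto simp: set_eq_iff Smod_sphere)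
  define Uc where "Uc = V1 \<inter> (N1 \<inter> N2)"
  define W where "W = U1 \<inter> \<Xi> -` Uc"
  have oU: "open Uc" unfolding Uc_def by (intro open_Int UV N1 N2)
  have oW: "open W" unfolding W_def by (rule continuous_open_preimage[OF cdiff_continuous[OF UV(4)] UV(1) oU])
  have qUc: "q \<in> Uc" using qN UV(6) by (simp add: Uc_def Y0)
  have im: "g ` Uc = W"
  proof
    show "g ` Uc \<subseteq> W" using hom by (auto simp: W_def Uc_def)
    show "W \<subseteq> g ` Uc" using hom' by (force simp: W_def)
  qed
  have sqd: "setc \<nu> t (sqrt (t $ \<nu>)) \<in> cube \<delta>" if "t \<in> cube \<delta>'" "t $ \<nu> \<ge> 0" for t
  proof -
    have "\<bar>t $ i\<bar> < \<delta>'" for i using that(1) by (simp add: cube_def)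
    then have 1: "\<bar>t $ i\<bar> < \<delta>" "\<bar>t $ i\<bar> < \<delta>\<^sup>2" for i by (simp_all add: \<delta>'_def)
    have "sqrt (t $ \<nu>) < \<delta>" using real_sqrt_less_mono[of "t $ \<nu>" "\<delta>\<^sup>2"] 1(2)[of \<nu>] that(2) P.delta by simp
    then show ?thesis using 1(1) that(2) by (simp add: cube_def)
  qed
  \<comment> \<open>For \<open>z\<close> in \<open>K\<close>, \<open>T z\<close> lies in
    \<open>U1\<close> and is mapped to \<open>z\<close> by \<open>\<Xi>\<close>, so it is
    \<open>g z\<close>. Conversely a nonnegative \<nu>-coordinate has a square root, which exhibits
    \<open>z\<close> as a value of \<open>proj\<close> on \<open>S\<close>.\<close>
  have mem: "z \<in> K \<longleftrightarrow> g z \<in> L \<and> e' \<nu> \<bullet> g z \<ge> 0" if z: "z \<in> Uc" for z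
  proof
    assume zK: "z \<in> K"
    have n1: "norm z \<le> 1" by (rule K_norm[OF zK])
    have w: "Smod z \<in> S" "Smod z \<in> Ub" and Tz: "T z \<in> U1"
      using zK N1(2) N2(2) z n1 by (auto simp: S_def Uc_def set_eq_iff)
    define y where "y = coords \<nu> e (Smod z)"
    have y: "y \<in> cube \<delta>" "F y = Smod z" using P.cover[OF w] by (auto simp: y_def)
    have yn: "y $ \<nu> \<ge> 0" using P.mem[OF y(1)] y(2) w(1) by simp
    have "Z y = z" using y(2) proj_Smod[OF n1] by (simp add: ZF)
    have Tz': "T z = \<iota> (setc \<nu> y ((y $ \<nu>)\<^sup>2))" by (simp add: T_def y_def)
    have "\<Xi> (T z) = Y (setc \<nu> y ((y $ \<nu>)\<^sup>2))" unfolding Tz' XL[OF \<iota>L] \<kappa>\<iota> ..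
    also have "\<dots> = Z (setc \<nu> (setc \<nu> y ((y $ \<nu>)\<^sup>2)) (y $ \<nu>))"
      unfolding Y_def using yn by (subst unfold_nonneg) simp_all
    also have "setc \<nu> (setc \<nu> y ((y $ \<nu>)\<^sup>2)) (y $ \<nu>) = y" by (simp add: vec_eq_iff)
    finally have "g z = T z" using hom'(1)[OF Tz] \<open>Z y = z\<close> by simp
    then show "g z \<in> L \<and> e' \<nu> \<bullet> g z \<ge> 0" unfolding Tz' using \<iota>L \<iota>e by (simp add: inner_commute[of "e' \<nu>"])
  next
    assume a: "g z \<in> L \<and> e' \<nu> \<bullet> g z \<ge> 0"
    have zV: "z \<in> V1" using z by (simp add: Uc_def)
    define t where "t = \<kappa> (g z)"
    have t: "t \<in> cube \<delta>'" "t $ \<nu> \<ge> 0" using UV(3) hom(2)[OF zV] a by (auto simp: t_def \<kappa>_def inner_commute)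
    have "z = Y t" using hom(1)[OF zV] XL a by (simp add: t_def)
    also have "\<dots> = Z (setc \<nu> t (sqrt (t $ \<nu>)))" unfolding Y_def by (rule unfold_nonneg[OF t(2)])
    finally have "z = proj (F (setc \<nu> t (sqrt (t $ \<nu>))))" by (simp add: ZF)
    moreover have "F (setc \<nu> t (sqrt (t $ \<nu>))) \<in> S" using P.mem[OF sqd[OF t]] t(2) by simp
    ultimately show "z \<in> K" using proj_mem by simp
  qed
  have A: "adapted_chart 1 CARD('m) K q Uc g L (e' \<nu>)"
  proof (rule adapted_chartI[OF oU qUc _ oW im _ _ L dimL eL mem])
    show "cdiff 1 g Uc" by (rule cdiff_subset[OF UV(8)]) (auto simp: Uc_def)
    show "cdiff 1 \<Xi> W" by (rule cdiff_subset[OF UV(4)]) (auto simp: W_def)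
  qed (use hom in \<open>auto simp: Uc_def\<close>)
  have "g (\<Xi> 0) = 0" by (rule hom'(1)[OF UV(2)])
  moreover have "\<kappa> 0 = 0" by (simp add: \<kappa>_def vec_eq_iff)
  then have "\<Xi> 0 = q" using Y0 by (simp add: \<Xi>_def)
  ultimately have gq: "g q = 0" by simp
  let ?G = "frechet_derivative g (at q)"
  \<comment> \<open>The derivative of \<open>\<Xi>\<close> at the origin, inverse to that of
    \<open>g\<close> at \<open>q\<close>; so vectors that \<open>g\<close> sends into
    \<open>L\<close> are combinations of the \<open>e' i\<close> scaled by
    \<open>c i\<close>.\<close>
  define E where "E = (\<lambda>x. (\<Sum>i\<in>UNIV. (x \<bullet> e' i) *\<^sub>R c i *\<^sub>R e' i) + (x - (\<Sum>i\<in>UNIV. (x \<bullet> e' i) *\<^sub>R e' i)))"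
  have qV: "q \<in> V1" using qUc by (simp add: Uc_def)
  have dg: "(g has_derivative ?G) (at q)" by (rule cdiff_1_has_derivative[OF UV(8) qV])
  have EG: "E (?G v) = v" for v
  proof -
    have "((\<lambda>z. \<Xi> (g z)) has_derivative (\<lambda>v. E (?G v))) (at q)"
      by (rule has_derivative_compose[OF dg]) (use dX in \<open>simp only: gq E_def\<close>)
    then have 1: "((\<lambda>z. z) has_derivative (\<lambda>v. E (?G v))) (at q)"
      by (rule has_derivative_transform_within_open[OF _ UV(5) qV]) (simp add: hom)
    show ?thesis by (rule fun_cong[OF has_derivative_unique[OF 1 has_derivative_ident]])
  qed
  have GE: "?G (E x) = x" for x
  proof -
    have "((\<lambda>x. g (\<Xi> x)) has_derivative (\<lambda>x. ?G (E x))) (at 0)"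
      by (rule has_derivative_compose[OF dX[folded E_def]]) (simp add: \<open>\<Xi> 0 = q\<close> dg)
    then have 1: "((\<lambda>x. x) has_derivative (\<lambda>x. ?G (E x))) (at 0)"
      by (rule has_derivative_transform_within_open[OF _ UV(1,2)]) (simp add: hom')
    show ?thesis by (rule fun_cong[OF has_derivative_unique[OF 1 has_derivative_ident]])
  qed
  have vE: "v = (\<Sum>i\<in>UNIV. (?G v \<bullet> e' i) *\<^sub>R c i *\<^sub>R e' i)" if "?G v \<in> L" for v
    using EG[of v] exp[OF that] by (simp add: E_def)
  \<comment> \<open>For \<open>\<zeta>\<close> this is the statement on the second normal
    derivative; the other vectors are boundary directions.\<close>
  have hT: "(c i *\<^sub>R e' i) \<bullet> Tfield q = 0" for i
  proof (cases "i = \<nu>")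
    case True
    have "\<zeta> \<bullet> Tfield q = 0"
      using normal_derivative_origin(2)[OF B] by (simp add: \<zeta>_def D_def[abs_def] ZF F0)
    then show ?thesis using True ce by simp
  next
    case False
    have "(axis i 1 :: real^'m) $ \<nu> = 0" using False by (simp add: axis_def)
    from boundary_tangent(2)[OF B z this] show ?thesis unfolding cei[OF False] F0 P.axes[OF False] .
  qed
  have hq: "(c i *\<^sub>R e' i) \<bullet> q = 0" if "i \<noteq> \<nu>" for i
    unfolding cei[OF that] using P.e_q[OF that] F0 by simp
  show thesis
  proof (rule that[OF A])
    show "e' \<nu> \<noteq> 0" using orth[of \<nu> \<nu>] by auto
    show "e' \<nu> \<bullet> g q = 0" by (simp add: gq)
    show "v \<bullet> Tfield q = 0" if "?G v \<in> L" for v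
      by (subst vE[OF that]) (simp only: inner_sum_left inner_scaleR_left[of "_ \<bullet> _"] hT mult_zero_right sum.neutral_const)
    show "v \<bullet> q = 0" if "?G v \<in> L" "e' \<nu> \<bullet> ?G v = 0" for v
    proof -
      have "v \<bullet> q = (\<Sum>i\<in>UNIV. (?G v \<bullet> e' i) * ((c i *\<^sub>R e' i) \<bullet> q))"
        by (subst vE[OF that(1)]) (simp only: inner_sum_left inner_scaleR_left[of "_ \<bullet> _"])
      also have "\<dots> = 0"
      proof (rule sum.neutral, rule ballI)
        show "(?G v \<bullet> e' i) * ((c i *\<^sub>R e' i) \<bullet> q) = 0" for i
          using hq[of i] that(2) by (cases "i = \<nu>") (simp_all add: inner_commute)
      qed
      finally show ?thesis .
    qed
    show "\<exists>v. ?G v \<in> L \<and> v \<bullet> q \<noteq> 0"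
    proof (intro exI[of _ "E (e' \<nu>)"] conjI)
      show "?G (E (e' \<nu>)) \<in> L" by (simp add: GE eL)
      have "E (e' \<nu>) = c \<nu> *\<^sub>R e' \<nu>"
      proof -
        have "(\<Sum>i\<in>UNIV. (e' \<nu> \<bullet> e' i) *\<^sub>R c i *\<^sub>R e' i) = (\<Sum>i\<in>UNIV. if i = \<nu> then c \<nu> *\<^sub>R e' \<nu> else 0)"
          by (rule sum.cong) (auto simp: orth)
        then show ?thesis unfolding E_def exp[OF eL] by simp
      qed
      then show "E (e' \<nu>) \<bullet> q \<noteq> 0" using zq by (simp add: ce)
    qed
  qed
qed

lemma boundary_chart_C1_exists:
  assumes "q \<in> K" "norm q = 1"
  shows "\<exists>U \<Phi> L c. adapted_chart 1 CARD('m) K q U \<Phi> L c \<and> c \<noteq> 0 \<and> c \<bullet> \<Phi> q = 0 \<and>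
    (\<exists>v. frechet_derivative \<Phi> (at q) v \<in> L \<and> v \<bullet> q \<noteq> 0)"
  by (rule boundary_chart_C1[OF assms], rule exI, rule exI, rule exI, rule exI, intro conjI)

text \<open>For points inside the ball one chart of interior type does not by itself exclude an edge
  chart; the symmetry of the tangent cone does.\<close>

lemma boundary_K: "mbdry 1 CARD('m) K = K \<inter> sphere 0 1"
proof
  show "mbdry 1 CARD('m) K \<subseteq> K \<inter> sphere 0 1"
  proof
    fix q assume q: "q \<in> mbdry 1 CARD('m) K"
    then have qK: "q \<in> K" by (auto simp: mbdry_def)
    have "\<not> norm q < 1"
    proof
      assume "norm q < 1"
      then obtain U \<Phi> L e where "adapted_chart 1 CARD('m) K q U \<Phi> L e" "e = 0 \<or> e \<bullet> \<Phi> q \<noteq> 0"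
        using interior_chart[OF qK] by blast
      then show False using tcone_symmetric[OF _ order_refl qK] mbdry_tcone(1)[OF q order_refl] by blast
    qed
    then show "q \<in> K \<inter> sphere 0 1" using K_norm[OF qK] qK by simp
  qed
  show "K \<inter> sphere 0 1 \<subseteq> mbdry 1 CARD('m) K"
  proof
    fix q assume "q \<in> K \<inter> sphere 0 1"
    then have q: "q \<in> K" "norm q = 1" by auto
    from boundary_chart_C1_exists[OF this] show "q \<in> mbdry 1 CARD('m) K" using q unfolding mbdry_def by blast
  qed
qed

lemma regular_K: "regular_in_ball 1 CARD('m) K"
  unfolding regular_in_ball_def
proof (intro conjI K_cball boundary_K ballI)
  show "submfd_wb 1 CARD('m) K"
    unfolding submfd_wb_def
  proof
    fix q assume q: "q \<in> K"
    then consider "norm q < 1" | "norm q = 1" using K_norm by fastforce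
    then show "\<exists>U \<Phi> L e. adapted_chart 1 CARD('m) K q U \<Phi> L e"
    proof cases
      case 1
      show ?thesis by (rule interior_chart[OF q 1], intro exI)
    next
      case 2
      then show ?thesis using boundary_chart_C1_exists[OF q] by blast
    qed
  qed
  fix q assume "q \<in> K \<inter> sphere 0 1"
  then have "q \<in> K" "norm q = 1" by auto
  from boundary_chart_C1_exists[OF this] show "\<exists>v\<in>tspace 1 CARD('m) K q. v \<bullet> q \<noteq> 0"
    unfolding tspace_def by blast
qed

text \<open>Both tangent spaces admit arbitrary charts; they are rewritten through the tangent cone
  and then evaluated in the one chart of \<open>boundary_chart_C1\<close>.\<close>

lemma horizontal_K: "horizontal_bdry 1 CARD('m) K"
  and strongly_horizontal_K: "q \<in> mbdry 1 CARD('m) K \<Longrightarrow> v \<in> tspace 1 CARD('m) K q \<Longrightarrow> v \<bullet> Tfield q = 0"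
proof -
  have *: "(v \<in> bdry_tspace 1 CARD('m) K q \<longrightarrow> v \<in> Hdist q) \<and> (v \<in> tspace 1 CARD('m) K q \<longrightarrow> v \<bullet> Tfield q = 0)"
    if qm: "q \<in> mbdry 1 CARD('m) K" for q v
  proof -
    have q: "q \<in> K" "norm q = 1" using qm unfolding boundary_K by auto
    obtain U \<Phi> L c where A: "adapted_chart 1 CARD('m) K q U \<Phi> L c" "c \<noteq> 0" "c \<bullet> \<Phi> q = 0"
      and h: "\<And>v. frechet_derivative \<Phi> (at q) v \<in> L \<Longrightarrow> v \<bullet> Tfield q = 0"
        "\<And>v. frechet_derivative \<Phi> (at q) v \<in> L \<Longrightarrow> c \<bullet> frechet_derivative \<Phi> (at q) v = 0 \<Longrightarrow> v \<bullet> q = 0"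
        "\<exists>v. frechet_derivative \<Phi> (at q) v \<in> L \<and> v \<bullet> q \<noteq> 0"
      by (rule boundary_chart_C1[OF q], rule that)
    have lin: "linear (frechet_derivative \<Phi> (at q))"
      using adapted_chart_derivatives(1)[OF A(1) order_refl] by (rule has_derivative_linear)
    have cone: "w \<bullet> Tfield q = 0" if "w \<in> tcone K q" for w
      using that h(1) unfolding tcone_chart[OF A(1) order_refl q(1)] by blast
    have "v \<bullet> Tfield q = 0" if "v \<in> tspace 1 CARD('m) K q"
      using that cone[of v] cone[of "- v"] unfolding tspace_tcone[OF A(1) order_refl q(1)] by auto
    moreover have "v \<in> Hdist q" if "v \<in> bdry_tspace 1 CARD('m) K q"
      using that h unfolding mbdry_tcone(2)[OF qm order_refl] tcone_boundary(2)[OF A(1) order_refl q(1) A(2,3), symmetric]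
      by (auto simp: Hdist_def)
    ultimately show ?thesis by blast
  qed
  show "horizontal_bdry 1 CARD('m) K" using * unfolding horizontal_bdry_def by blast
  show "q \<in> mbdry 1 CARD('m) K \<Longrightarrow> v \<in> tspace 1 CARD('m) K q \<Longrightarrow> v \<bullet> Tfield q = 0" using * by blast
qed

end

theorem theorem1p1:
  fixes \<Sigma> :: "(complex^'n) set"
  assumes "\<Sigma> \<subseteq> ball 0 1"
    and "submfd \<infinity> CARD('m::finite) \<Sigma>"
    and "bergman_minimal TYPE('m) \<Sigma>"
    and "weakly_asym_regular 2 CARD('m) \<Sigma>"
    and "weakly_asym_horizontal 2 CARD('m) \<Sigma>"
  shows "asym_regular 1 CARD('m) \<Sigma> \<and> strongly_asym_horizontal 1 CARD('m) \<Sigma>"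
proof -
  interpret weak_minimal \<Sigma> "TYPE('m)"
    by standard (use assms in \<open>auto simp: weakly_asym_regular_def weakly_asym_horizontal_def\<close>)
  show ?thesis
    using regular_K horizontal_K strongly_horizontal_K
    unfolding strongly_asym_horizontal_def asym_regular_def K_def by blast
qed

end
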